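(* Let $k$, $\varphi:{\mathscr D}_t^\pm\to{\mathscr D}_s^\pm$, $b$, $a_1,\dots,a_d$, $u_{a_i}(s)$, $\mathbf V_{\mathfrak r}(s)$, $(M,D_t)$ and its direct image $(M_\varphi,D_s)$ be as in the context. For each $i=1,\dots,d$ let $\vec Y_{a_i,1}(t),\dots,\vec Y_{a_i,\mathfrak r}(t)$ be an optimal basis of horizontal elements of $(M,D_t)$ at $a_i$, ordered so that $\mathcal R_{a_i}(\vec Y_{a_i,1})\le\dots\le\mathcal R_{a_i}(\vec Y_{a_i,\mathfrak r})$, and suppose these bases are linked. Let $\mathscr P$ be the resulting set of fundamental pairs and, for each $\mathcal P\in\mathscr P$, let $\mathscr U_{\mathcal P}$ be a set of discs chosen as in the context. Then: (1) for every $\mathcal P\in\mathscr P$ and every $\mathcal U\in\mathscr U_{\mathcal P}$, the vector $\mathbf V_{\mathfrak r}(s)\,v_{\mathcal P,\mathcal U,s}$ is (the coordinate vector of) a horizontal element of $(M_\varphi,D_s)$ at $b$, and its radius of convergence $\mathcal R_b\big(\mathbf V_{\mathfrak r}(s)\,v_{\mathcal P,\mathcal U,s}\big)$ equals the radius $\rho$ of the open disc $\varphi(\mathcal U)={\mathscr D}_s(b,\rho^-)$; (2) the family $\{\mathbf V_{\mathfrak r}(s)\,v_{\mathcal P,\mathcal U,s}:\ \mathcal U\in\mathscr U_{\mathcal P},\ \mathcal P\in\mathscr P\}$ is an optimal basis of the space of horizontal elements of $(M_\varphi,D_s)$ at $b$.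
   Context: $k$ is an algebraically closed field complete for a non-archimedean absolute value $|\cdot|$ extending the $p$-adic absolute value of $\mathbb Q_p$. ${\mathscr D}_t(a,r^-)$, ${\mathscr D}_t(a,r)$ are the open and closed Berkovich discs of centre $a\in k$ and radius $r$ in coordinate $t$; $\mathcal O_t(a,r^-)$ is the ring of $\sum c_n(t-a)^n\in k[[t-a]]$ converging on $|t-a|<r$. ${\mathscr D}_t^\pm$ denotes the unit disc, either open ${\mathscr D}_t(0,1^-)$ or closed ${\mathscr D}_t(0,1)$, with ring of analytic functions $\mathcal O_t^\pm$; similarly in coordinate $s$. For $a\in k$ and $f\in k[[t-a]]$, $\mathcal R_a(f)=\sup\{r\in[0,1): f\in\mathcal O_t(a,r^-)\}$; for a vector of power series, $\mathcal R_a$ is the minimum over its components. $\eta_{a,r}$ denotes the maximal (Shilov) point of ${\mathscr D}_t(a,r)$, $\eta_{a,0}=a$. $\varphi:{\mathscr D}_t^\pm\to{\mathscr D}_s^\pm$ is a finite étale morphism of degree $d$ of unit discs (both open or both closed), written $s=f(t)$ with $f\in\mathcal O_t^\pm$ ($f'$ invertible). $P(s,X)\in\mathcal O_s^\pm[X]$ is the unique monic polynomial of degree $d$ with $P(f(t),t)=0$. Fix $b\in{\mathscr D}_s^\pm(k)$ and let $\varphi^{-1}(b)=\{a_1,\dots,a_d\}$ (distinct). For each $i$, $u_{a_i}(s)\in k[[s-b]]$ is the power series with constant term $a_i$ and $P(s,u_{a_i}(s))=0$ (it has positive radius of convergence). $\mathbf U(s)$ is the $d\times d$ matrix with $(i,j)$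 entry $u_{a_i}(s)^{j-1}$, $\mathbf V(s)=\mathbf U(s)^{-1}$, and $\mathbf V_{\mathfrak r}(s)$ is the $\mathfrak r d\times\mathfrak r d$ block diagonal matrix with $\mathfrak r$ diagonal blocks equal to $\mathbf V(s)$. A differential module $(M,D_t)$ of rank $\mathfrak r$ is a free $\mathcal O_t^\pm$-module $M$ of rank $\mathfrak r$ with a $k$-linear $D_t:M\to M$ satisfying $D_t(gm)=\frac{dg}{dt}m+gD_t(m)$. Fix a basis $e_1,\dots,e_{\mathfrak r}$. For $a\in{\mathscr D}_t^\pm(k)$, a horizontal element at $a$ is an element of the kernel of $D_t$ on $M\otimes\mathcal O_t(a,r^-)$ for some $r>0$, identified with its coordinate vector in $k[[t-a]]^{\mathfrak r}$; its radius of convergence is $\mathcal R_a$ of that vector. These form a $k$-space of dimension $\mathfrak r$. The multiradius at $a$ is $(\mathcal R_1,\dots,\mathcal R_{\mathfrak r})$ with $\mathcal R_i=\sup\{r\in(0,1]:\dim_k\ker(D_t|M\otimes\mathcal O_t(a,r^-))\ge\mathfrak r-i+1\}$; a basis of horizontal elements at $a$ is optimal if its radii of convergence can be rearranged to give the multiradius. The direct image $(M_\varphi,D_s)$ is $M$ viewed as an $\mathcal O_s^\pm$-module via $s=f(t)$, with $D_s(m)=\frac1{f'(t)}D_t(m)$; it is a differential module of rank $\mathfrak rd$ with basis $e_1,te_1,\dots,t^{d-1}e_1,e_2,\dots,t^{d-1}e_{\mathfrak r}$ (so position $(j-1)d+l+1$ corresponds to $t^le_j$). Horizontal elements of $M_\varphi$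 at $b$ and their radii are defined likewise, identified with coordinate vectors in $k[[s-b]]^{\mathfrak rd}$. Tree and branches: for $a\in{\mathscr D}_t^\pm(k)$, $l_{t,a}=\{\eta_{a,r}\}$ with $r\in[0,1)$ (open case) or $r\in[0,1]$ (closed case); $\mathbb T_{\varphi,b}=\bigcup_i l_{t,a_i}$. A point $\eta\in\mathbb T_{\varphi,b}$ is branching if $\mathbb T_{\varphi,b}\setminus\{\eta\}$ has more than two connected components; $\mathcal B_{\varphi,b}$ is the set of branching points. A branch at $\eta\in\mathcal B_{\varphi,b}$ is an open disc which is a connected component of ${\mathscr D}_t^\pm\setminus\{\eta\}$ meeting $\mathbb T_{\varphi,b}$; $\delta(\eta)$ is the number of branches at $\eta$. Linked bases: optimal bases $\vec Y_{a_i,1},\dots,\vec Y_{a_i,\mathfrak r}$ ($i=1,\dots,d$) are linked if whenever $|a_j-a_i|<\mathcal R_{a_i}(\vec Y_{a_i,l})$, the element $\vec Y_{a_i,l}$ (which is then also a horizontal element at $a_j$) equals one of $\vec Y_{a_j,1},\dots,\vec Y_{a_j,\mathfrak r}$. Fundamental pairs: for each $i,j$, with $r_{i,j}=\mathcal R_{a_i}(\vec Y_{a_i,j})$, the pair $(\vec Y_{a_i,j},{\mathscr D}_t(a_i,r_{i,j}^-))$; $\mathscr P$ is the set of distinct such pairs. For $\mathcal P=(\vec Y,U)\in\mathscr P$, $\mathcal B_{\varphi,b}(\mathcal P)=U\cap\mathcal B_{\varphi,b}$; for each $\eta\in\mathcal B_{\varphi,b}(\mathcal P)$ choose any set $\mathscr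 U_\eta$ of $\delta(\eta)-1$ branches at $\eta$, and let $\mathscr U_{\mathcal P}$ consist of $U$ together with all these chosen branches. For $\mathcal U\in\mathscr U_{\mathcal P}$, $v_{\mathcal P,\mathcal U,s}\in k[[s-b]]^{\mathfrak rd}$ is the vector whose entry in position $(l-1)d+i$ ($1\le l\le\mathfrak r$, $1\le i\le d$) is the $l$-th component of $\vec Y(u_{a_i}(s))$ if $a_i\in\mathcal U$, and $0$ otherwise. *)

theory Defs
  imports "HOL-Computational_Algebra.Computational_Algebra" "HOL-Library.Multiset"
begin

definition klim :: "('k::field \<Rightarrow> real) \<Rightarrow> (nat \<Rightarrow> 'k) \<Rightarrow> 'k \<Rightarrow> bool" where
  "klim absv s L \<longleftrightarrow> (\<lambda>N. absv (s N - L)) \<longlonglongrightarrow> 0"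

definition ksums :: "('k::field \<Rightarrow> real) \<Rightarrow> (nat \<Rightarrow> 'k) \<Rightarrow> 'k \<Rightarrow> bool" where
  "ksums absv c L \<longleftrightarrow> klim absv (\<lambda>N. \<Sum>n<N. c n) L"

definition ksummable :: "('k::field \<Rightarrow> real) \<Rightarrow> (nat \<Rightarrow> 'k) \<Rightarrow> bool" where
  "ksummable absv c \<longleftrightarrow> (\<exists>L. ksums absv c L)"

definition ksum :: "('k::field \<Rightarrow> real) \<Rightarrow> (nat \<Rightarrow> 'k) \<Rightarrow> 'k" where
  "ksum absv c = (THE L. ksums absv c L)"

definition nonarch_padic_field :: "('k::field_char_0 \<Rightarrow> real) \<Rightarrow> bool" where
  "nonarch_padic_field absv \<longleftrightarrow>
     (\<forall>x. 0 \<le> absv x \<and> (absv x = 0 \<longleftrightarrow> x = 0)) \<and>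
     (\<forall>x y. absv (x * y) = absv x * absv y) \<and>
     (\<forall>x y. absv (x + y) \<le> max (absv x) (absv y)) \<and>
     (\<forall>s. (\<forall>e>0. \<exists>N. \<forall>m\<ge>N. \<forall>n\<ge>N. absv (s m - s n) < e) \<longrightarrow> (\<exists>L. klim absv s L)) \<and>
     (\<forall>p::'k poly. 0 < degree p \<longrightarrow> (\<exists>x. poly p x = 0)) \<and>
     (\<exists>p::nat. prime p \<and>
        (\<forall>n::int. n \<noteq> 0 \<longrightarrow> absv (of_int n) = (1 / real p) ^ multiplicity (int p) n))"

definition udisc :: "('k \<Rightarrow> real) \<Rightarrow> bool \<Rightarrow> 'k set" where
  "udisc absv cl = {x. if cl then absv x \<le> 1 else absv x < 1}"

definition odisc :: "('k::field \<Rightarrow> real) \<Rightarrow> 'k \<Rightarrow> real \<Rightarrow> 'k set" where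
  "odisc absv c r = {x. absv (x - c) < r}"

definition cdisc :: "('k::field \<Rightarrow> real) \<Rightarrow> 'k \<Rightarrow> real \<Rightarrow> 'k set" where
  "cdisc absv c r = {x. absv (x - c) \<le> r}"

text \<open>A power series in (t - a) is represented by an fps in the variable X = t - a.\<close>
definition conv_open :: "('k::field \<Rightarrow> real) \<Rightarrow> 'k fps \<Rightarrow> real \<Rightarrow> bool" where
  "conv_open absv f r \<longleftrightarrow> (\<forall>x. absv x < r \<longrightarrow> ksummable absv (\<lambda>n. fps_nth f n * x ^ n))"

definition Rad :: "('k::field \<Rightarrow> real) \<Rightarrow> 'k fps \<Rightarrow> real" where
  "Rad absv f = Sup {r. 0 \<le> r \<and> r < 1 \<and> conv_open absv f r}"

definition Radv :: "('k::field \<Rightarrow> real) \<Rightarrow> nat \<Rightarrow> (nat \<Rightarrow> 'k fps) \<Rightarrow> real" where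
  "Radv absv n Z = (if n = 0 then 1 else Min ((\<lambda>p. Rad absv (Z p)) ` {..<n}))"

definition Oring :: "('k::field \<Rightarrow> real) \<Rightarrow> bool \<Rightarrow> 'k fps set" where
  "Oring absv cl = {f. \<forall>x\<in>udisc absv cl. ksummable absv (\<lambda>n. fps_nth f n * x ^ n)}"

definition evalk :: "('k::field \<Rightarrow> real) \<Rightarrow> 'k fps \<Rightarrow> 'k \<Rightarrow> 'k" where
  "evalk absv f x = ksum absv (\<lambda>n. fps_nth f n * x ^ n)"

text \<open>Analytic composition h(g), g possibly with non-zero constant term.\<close>
definition acomp :: "('k::field \<Rightarrow> real) \<Rightarrow> 'k fps \<Rightarrow> 'k fps \<Rightarrow> 'k fps" where
  "acomp absv h g = Abs_fps (\<lambda>m. ksum absv (\<lambda>n. fps_nth h n * fps_nth (g ^ n) m))"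

definition expand :: "('k::field \<Rightarrow> real) \<Rightarrow> 'k fps \<Rightarrow> 'k \<Rightarrow> 'k fps" where
  "expand absv h c = acomp absv h (fps_X + fps_const c)"

definition reexp :: "('k::field \<Rightarrow> real) \<Rightarrow> nat \<Rightarrow> (nat \<Rightarrow> 'k fps) \<Rightarrow> 'k \<Rightarrow> (nat \<Rightarrow> 'k fps)" where
  "reexp absv n Z c = (\<lambda>l. if l < n then expand absv (Z l) c else 0)"

text \<open>Free module of rank n with basis e_1..e_n and D(e_q) = sum_p A p q e_p
  (0-based indices). Horizontal elements at c converging on D(c,r^-).\<close>
definition hor_on :: "('k::field \<Rightarrow> real) \<Rightarrow> nat \<Rightarrow> (nat \<Rightarrow> nat \<Rightarrow> 'k fps) \<Rightarrow> 'k \<Rightarrow> real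
    \<Rightarrow> (nat \<Rightarrow> 'k fps) \<Rightarrow> bool" where
  "hor_on absv n A c r Z \<longleftrightarrow> (\<forall>p\<ge>n. Z p = 0) \<and> (\<forall>p<n. conv_open absv (Z p) r) \<and>
     (\<forall>p<n. fps_deriv (Z p) + (\<Sum>q<n. expand absv (A p q) c * Z q) = 0)"

definition horizontal :: "('k::field \<Rightarrow> real) \<Rightarrow> nat \<Rightarrow> (nat \<Rightarrow> nat \<Rightarrow> 'k fps) \<Rightarrow> 'k
    \<Rightarrow> (nat \<Rightarrow> 'k fps) \<Rightarrow> bool" where
  "horizontal absv n A c Z \<longleftrightarrow> (\<exists>r>0. hor_on absv n A c r Z)"

definition klin_indep :: "nat \<Rightarrow> 'j set \<Rightarrow> ('j \<Rightarrow> nat \<Rightarrow> 'k::field fps) \<Rightarrow> bool" where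
  "klin_indep n J F \<longleftrightarrow> (\<forall>cf::'j \<Rightarrow> 'k. (\<forall>p<n. (\<Sum>j\<in>J. fps_const (cf j) * F j p) = 0)
       \<longrightarrow> (\<forall>j\<in>J. cf j = 0))"

text \<open>i-th entry (1 \<le> i \<le> n) of the multiradius at c.\<close>
definition multiradius :: "('k::field \<Rightarrow> real) \<Rightarrow> nat \<Rightarrow> (nat \<Rightarrow> nat \<Rightarrow> 'k fps) \<Rightarrow> 'k
    \<Rightarrow> nat \<Rightarrow> real" where
  "multiradius absv n A c i = Sup {r. 0 < r \<and> r \<le> 1 \<and>
      (\<exists>F. (\<forall>j<n - i + 1. hor_on absv n A c r (F j)) \<and> klin_indep n {..<n - i + 1} F)}"

definition opt_basis :: "('k::field \<Rightarrow> real) \<Rightarrow> nat \<Rightarrow> (nat \<Rightarrow> nat \<Rightarrow> 'k fps) \<Rightarrow> 'k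
    \<Rightarrow> 'j set \<Rightarrow> ('j \<Rightarrow> nat \<Rightarrow> 'k fps) \<Rightarrow> bool" where
  "opt_basis absv n A c J F \<longleftrightarrow> finite J \<and>
     (\<forall>j\<in>J. horizontal absv n A c (F j)) \<and> klin_indep n J F \<and>
     (\<forall>Z. horizontal absv n A c Z \<longrightarrow>
        (\<exists>cf::'j \<Rightarrow> 'k. \<forall>p<n. Z p = (\<Sum>j\<in>J. fps_const (cf j) * F j p))) \<and>
     image_mset (\<lambda>j. Radv absv n (F j)) (mset_set J)
       = image_mset (multiradius absv n A c) (mset_set {1..n})"

text \<open>s = f(t) defines a finite etale morphism of degree d of unit discs:
  f is analytic, maps the disc into the disc, f' is invertible, and O_t is a free
  O_s-module of rank d (via s = f(t)).\<close>
definition fin_etale :: "('k::field \<Rightarrow> real) \<Rightarrow> bool \<Rightarrow> nat \<Rightarrow> 'k fps \<Rightarrow> bool" where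
  "fin_etale absv cl d f \<longleftrightarrow> f \<in> Oring absv cl \<and>
     (\<forall>x\<in>udisc absv cl. evalk absv f x \<in> udisc absv cl) \<and>
     (\<exists>g\<in>Oring absv cl. fps_deriv f * g = 1) \<and>
     (\<exists>w. (\<forall>l<d. w l \<in> Oring absv cl) \<and>
        (\<forall>g\<in>Oring absv cl. \<exists>!h. (\<forall>l<d. h l \<in> Oring absv cl) \<and> (\<forall>l\<ge>d. h l = 0) \<and>
            g = (\<Sum>l<d. acomp absv (h l) f * w l)))"

definition coordO :: "('k::field \<Rightarrow> real) \<Rightarrow> bool \<Rightarrow> nat \<Rightarrow> 'k fps \<Rightarrow> 'k fps \<Rightarrow> nat \<Rightarrow> 'k fps" where
  "coordO absv cl d f g = (THE h. (\<forall>l<d. h l \<in> Oring absv cl) \<and> (\<forall>l\<ge>d. h l = 0) \<and>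
            g = (\<Sum>l<d. acomp absv (h l) f * fps_X ^ l))"

text \<open>Connection matrix of the direct image (M_phi, D_s) in the basis
  t^l e_j, at 0-based position j*d + l.\<close>
definition dimg_mat :: "('k::field \<Rightarrow> real) \<Rightarrow> bool \<Rightarrow> nat \<Rightarrow> 'k fps \<Rightarrow> (nat \<Rightarrow> nat \<Rightarrow> 'k fps)
    \<Rightarrow> nat \<Rightarrow> nat \<Rightarrow> 'k fps" where
  "dimg_mat absv cl d f G p q =
     (let i = p div d; m = p mod d; j = q div d; l = q mod d;
          g = inverse (fps_deriv f) *
                ((if i = j then of_nat l * fps_X ^ (l - 1) else 0) + fps_X ^ l * G i j)
      in coordO absv cl d f g m)"

text \<open>A point eta_{c,rho} (rho>0) is represented by (k-points of D(c,rho), rho).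
  Branches at it: the open discs D(a_i,rho^-) with a_i in D(c,rho).\<close>
definition brs :: "('k::field \<Rightarrow> real) \<Rightarrow> nat \<Rightarrow> (nat \<Rightarrow> 'k) \<Rightarrow> 'k set \<Rightarrow> real \<Rightarrow> 'k set set" where
  "brs absv d a S \<rho> = {odisc absv (a i) \<rho> | i. i < d \<and> a i \<in> S}"

definition branching_pts :: "('k::field \<Rightarrow> real) \<Rightarrow> bool \<Rightarrow> nat \<Rightarrow> (nat \<Rightarrow> 'k) \<Rightarrow> ('k set \<times> real) set" where
  "branching_pts absv cl d a = {(cdisc absv c \<rho>, \<rho>) | c \<rho>. 0 < \<rho> \<and> (\<rho> < 1 \<or> (cl \<and> \<rho> = 1)) \<and>
      (\<exists>i<d. absv (a i - c) \<le> \<rho>) \<and>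
      2 < card (brs absv d a (cdisc absv c \<rho>) \<rho>) + (if \<rho> < 1 then 1 else 0)}"

text \<open>A fundamental pair (Y, D(a_i,r^-)) is represented canonically by
  (k-points of the disc, r, E) where E k is the expansion of Y at a_k for a_k in the
  disc (and 0 otherwise). Y is a family Y i j of horizontal vectors at a_i.\<close>
definition fund_pairs :: "('k::field \<Rightarrow> real) \<Rightarrow> nat \<Rightarrow> nat \<Rightarrow> (nat \<Rightarrow> 'k)
    \<Rightarrow> (nat \<Rightarrow> nat \<Rightarrow> nat \<Rightarrow> 'k fps) \<Rightarrow> ('k set \<times> real \<times> (nat \<Rightarrow> nat \<Rightarrow> 'k fps)) set" where
  "fund_pairs absv d rk a Y =
     {(odisc absv (a i) (Radv absv rk (Y i j)), Radv absv rk (Y i j),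
       \<lambda>k. if k < d \<and> a k \<in> odisc absv (a i) (Radv absv rk (Y i j))
           then reexp absv rk (Y i j) (a k - a i) else (\<lambda>l. 0)) | i j. i < d \<and> j < rk}"

definition BP :: "('k::field \<Rightarrow> real) \<Rightarrow> bool \<Rightarrow> nat \<Rightarrow> (nat \<Rightarrow> 'k)
    \<Rightarrow> ('k set \<times> real \<times> (nat \<Rightarrow> nat \<Rightarrow> 'k fps)) \<Rightarrow> ('k set \<times> real) set" where
  "BP absv cl d a P = {\<eta> \<in> branching_pts absv cl d a. snd \<eta> < fst (snd P) \<and> fst \<eta> \<subseteq> fst P}"

definition UP :: "('k::field \<Rightarrow> real) \<Rightarrow> bool \<Rightarrow> nat \<Rightarrow> (nat \<Rightarrow> 'k)
    \<Rightarrow> (('k set \<times> real \<times> (nat \<Rightarrow> nat \<Rightarrow> 'k fps)) \<Rightarrow> ('k set \<times> real) \<Rightarrow> 'k set set)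
    \<Rightarrow> ('k set \<times> real \<times> (nat \<Rightarrow> nat \<Rightarrow> 'k fps)) \<Rightarrow> 'k set set" where
  "UP absv cl d a Ch P = insert (fst P) (\<Union>\<eta>\<in>BP absv cl d a P. Ch P \<eta>)"

definition vvec :: "nat \<Rightarrow> nat \<Rightarrow> (nat \<Rightarrow> 'k::field) \<Rightarrow> (nat \<Rightarrow> 'k fps)
    \<Rightarrow> ('k set \<times> real \<times> (nat \<Rightarrow> nat \<Rightarrow> 'k fps)) \<Rightarrow> 'k set \<Rightarrow> nat \<Rightarrow> 'k fps" where
  "vvec d rk a u P U = (\<lambda>p. if p < rk * d \<and> a (p mod d) \<in> U
      then fps_compose (snd (snd P) (p mod d) (p div d)) (u (p mod d) - fps_const (a (p mod d)))
      else 0)"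

definition Vr :: "nat \<Rightarrow> nat \<Rightarrow> (nat \<Rightarrow> nat \<Rightarrow> 'k::comm_ring_1 fps) \<Rightarrow> (nat \<Rightarrow> 'k fps) \<Rightarrow> nat \<Rightarrow> 'k fps" where
  "Vr d rk V v = (\<lambda>p. if p < rk * d then (\<Sum>i'<d. V (p mod d) i' * v ((p div d) * d + i')) else 0)"

end

theory Submission
  imports Defs
begin

text \<open>
If \<open>a\<^sub>1, \<dots>, a\<^sub>d\<close> is the fibre over \<open>b\<close>, freeness of rank \<open>d\<close> forces
\<open>f - b = (t - a\<^sub>1) \<cdots> (t - a\<^sub>d) h\<close> with \<open>h\<close> a unit of norm one. Hence the disc of radius \<open>r\<close>
around \<open>a\<^sub>i\<close> is mapped onto the disc of radius \<open>\<Prod>\<^sub>j max(r, |a\<^sub>i - a\<^sub>j|)\<close> around \<open>b\<close>, and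
Weierstrass division by \<open>f - b\<close> expresses analytic functions on such discs, and by gluing on the
whole preimage of a disc around \<open>b\<close>, as polynomials in \<open>t\<close> of degree less than \<open>d\<close> whose
coefficients are analytic functions of \<open>s\<close>. Multiplication by the inverse Vandermonde matrix
computes these coefficients, so horizontal elements at \<open>b\<close> on a disc correspond to families of
horizontal elements on the components of its preimage.

Fix a fundamental pair \<open>(Y, U)\<close>. The indicator functions of the chosen discs form a basis of the
functions on the fibre points in \<open>U\<close>: following unchosen branches downwards from a disc leads to a
fibre point contained in no smaller chosen disc. The coefficient of a chosen branch \<open>B\<close> at a vertex
\<open>\<eta>\<close> in a linear combination is the difference of its values at the fibre points reached from \<open>B\<close>
and from the unchosen branch at \<open>\<eta>\<close>. If the combination converges beyond \<open>\<phi>(B)\<close>, analytic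
continuation from one point to the other makes the two values equal, so that the coefficient
vanishes. This yields the radii of convergence and the optimality of the basis.
\<close>

text \<open>The hypothesis on \<open>f\<close> provides some basis of the source ring over the
  target ring, not the powers of \<open>t\<close> in which the direct image is written; that the
  powers work is obtained by Weierstrass division, which relies on the unit factor having norm one.
  Norm one combines two inputs: \<open>f\<close> maps the disc into the disc, and no
  \<open>f - s\<close> with \<open>s\<close> in the disc is a unit, because freeness would make
  \<open>X - s\<close> a unit.

  The main obstacle is gluing. A disc around \<open>b\<close> has several components upstairs, and a
  horizontal element on one of them has to be extended by zero to the others. For each other
  component a polynomial in \<open>t\<close> with coefficients analytic in \<open>s\<close> is built
  that vanishes there and is invertible on the given one.

  Optimality is handled as the absence of cancellation: if a combination of basis elements converges
  on a disc, so does every member with a nonzero coefficient. This property is extracted from the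
  bases at the points \<open>a i\<close>, transported to \<open>b\<close>, and turned back into the
  statement on the multiradius.\<close>

lemma tendsto_null_le:
  fixes f g :: "nat \<Rightarrow> real"
  assumes "g \<longlonglongrightarrow> 0" "\<And>n. 0 \<le> f n" "\<And>n. f n \<le> g n"
  shows "f \<longlonglongrightarrow> 0"
  using assms by (intro tendsto_sandwich[OF _ _ tendsto_const assms(1)]) auto

locale nonarch =
  fixes absv :: "'k::field_char_0 \<Rightarrow> real"
  assumes padic: "nonarch_padic_field absv"
begin

lemma absv_nonneg [simp]: "0 \<le> absv x"
  and absv_eq_0_iff [simp]: "absv x = 0 \<longleftrightarrow> x = 0"
  and absv_mult: "absv (x * y) = absv x * absv y"
  and absv_add_le: "absv (x + y) \<le> max (absv x) (absv y)"
  using padic unfolding nonarch_padic_field_def by auto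

lemma absv_complete:
  assumes "\<And>e. e > 0 \<Longrightarrow> \<exists>N. \<forall>m\<ge>N. \<forall>n\<ge>N. absv (s m - s n) < e"
  shows "\<exists>L. klim absv s L"
  using padic assms unfolding nonarch_padic_field_def by blast

lemma absv_0 [simp]: "absv 0 = 0"
  by simp

lemma absv_1 [simp]: "absv 1 = 1"
proof -
  have "absv 1 * absv 1 = absv 1"
    by (metis absv_mult mult_1)
  then show ?thesis
    using absv_eq_0_iff[of 1] by auto
qed

lemma absv_minus [simp]: "absv (- x) = absv x"
proof -
  have "absv (-1) * absv (-1) = 1"
    by (metis absv_1 absv_mult mult_minus1 minus_minus)
  then have "absv (-1) = 1"
    using absv_nonneg[of "-1"] by (smt (verit, best) mult_cancel_left2 square_eq_1_iff)
  then show ?thesis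
    by (metis absv_mult mult_1 mult_minus1)
qed

lemma absv_minus_commute: "absv (x - y) = absv (y - x)"
  by (metis absv_minus minus_diff_eq)

lemma absv_diff_le: "absv (x - y) \<le> max (absv x) (absv y)"
  using absv_add_le[of x "-y"] by simp

lemma absv_pos_iff [simp]: "0 < absv x \<longleftrightarrow> x \<noteq> 0"
  by (simp add: less_le)

lemma absv_add_eq: "absv x < absv y \<Longrightarrow> absv (x + y) = absv y"
  using absv_add_le[of x y] absv_diff_le[of "x + y" x] by auto

lemma absv_power: "absv (x ^ n) = absv x ^ n"
  by (induction n) (auto simp: absv_mult)

lemma absv_inverse: "absv (inverse x) = inverse (absv x)"
proof (cases "x = 0")
  case False
  have "absv x * absv (inverse x) = 1"
    using False by (simp flip: absv_mult)
  then show ?thesis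
    by (simp add: inverse_unique)
qed auto

lemma absv_prod: "absv (\<Prod>i\<in>A. f i) = (\<Prod>i\<in>A. absv (f i))"
  by (induction A rule: infinite_finite_induct) (auto simp: absv_mult)

lemma absv_sum_le:
  assumes "\<And>i. i \<in> A \<Longrightarrow> absv (f i) \<le> B" "0 \<le> B"
  shows "absv (\<Sum>i\<in>A. f i) \<le> B"
  using assms
proof (induction A rule: infinite_finite_induct)
  case (insert x F)
  have "max (absv (f x)) (absv (sum f F)) \<le> B"
    using insert by auto
  then show ?case
    using insert(1,2) absv_add_le[of "f x" "sum f F"] by auto
qed auto

lemma absv_of_nat_le: "absv (of_nat n) \<le> 1"
proof (induction n)
  case (Suc n)
  then show ?case
    using absv_add_le[of 1 "of_nat n"] by simp
qed auto

lemma absv_ultra: "absv (x - z) \<le> max (absv (x - y)) (absv (y - z))"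
  using absv_add_le[of "x - y" "y - z"] by simp

lemma absv_ultra_eq: "absv (x - y) < absv (y - z) \<Longrightarrow> absv (x - z) = absv (y - z)"
  using absv_add_eq[of "x - y" "y - z"] by simp

subsection \<open>Density of the value group\<close>

lemma ex_root: "n > 0 \<Longrightarrow> \<exists>y. y ^ n = (c::'k)"
proof -
  assume n: "n > 0"
  let ?p = "monom 1 n - [:c:]"
  have "coeff ?p n = 1"
    using n by (cases n) auto
  then have "degree ?p \<ge> n"
    by (intro le_degree) auto
  then have "0 < degree ?p" using n by simp
  then obtain x where "poly ?p x = 0"
    using padic unfolding nonarch_padic_field_def by blast
  then show ?thesis by (auto simp: poly_monom)
qed

text \<open>Density comes from roots of \<open>p\<close>: their absolute values approach 1 from
  below, so their powers leave only small gaps. This allows radii, which range over all reals, to be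
  tested at points of the field.\<close>

lemma ex_absv_between:
  assumes "0 < r1" "r1 < r2" "r2 \<le> 1"
  obtains x where "r1 < absv x" "absv x < r2"
proof -
  obtain p :: nat where p: "prime p" "\<And>n::int. n \<noteq> 0 \<Longrightarrow> absv (of_int n) = (1 / real p) ^ multiplicity (int p) n"
    using padic unfolding nonarch_padic_field_def by blast
  define q where "q = 1 / real p"
  have q: "0 < q" "q < 1"
    using prime_gt_1_nat[OF p(1)] by (auto simp: q_def)
  have "multiplicity (int p) (int p) = 1"
    using p(1) by simp
  then have absp: "absv (of_nat p) = q"
    using p(2)[of "int p"] p(1) by (simp add: q_def)
  have "(\<lambda>n. root n q) \<longlonglongrightarrow> 1"
    using q by (intro LIMSEQ_root_const) auto
  then have "eventually (\<lambda>n. root n q > r1 / r2) sequentially"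
    using assms by (intro order_tendstoD) auto
  then obtain n where n: "n > 0" "root n q > r1 / r2"
    by (metis (mono_tags, lifting) eventually_sequentially le_eq_less_or_eq less_Suc_eq_le zero_less_Suc)
  obtain y where y: "y ^ n = (of_nat p :: 'k)"
    using ex_root n(1) by blast
  define g where "g = absv y"
  have gn: "g ^ n = q"
    using y absp by (simp add: g_def flip: absv_power)
  have g: "g = root n q"
    using gn n(1) by (metis absv_nonneg g_def real_root_power_cancel)
  have g01: "0 < g" "g < 1"
    using g q n(1) by auto
  have "\<exists>m. g ^ m < r2"
    using g01 assms by (intro real_arch_pow_inv) auto
  define m where "m = (LEAST m. g ^ m < r2)"
  have m: "g ^ m < r2"
    unfolding m_def by (rule LeastI_ex) fact
  have "m \<noteq> 0"
    using m assms by (intro notI) auto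
  then obtain m' where m': "m = Suc m'"
    by (cases m) auto
  have "\<not> g ^ m' < r2"
    using not_less_Least[of m' "\<lambda>m. g ^ m < r2"] m' by (auto simp: m_def)
  then have "g ^ m \<ge> g * r2"
    using m' g01 by simp
  moreover have "g * r2 > r1"
    using n(2) assms by (simp add: g field_simps)
  ultimately have "r1 < absv (y ^ m)" "absv (y ^ m) < r2"
    using m by (auto simp: absv_power g_def)
  then show ?thesis using that by blast
qed

subsection \<open>Sums\<close>

lemma klim_unique: "klim absv s L \<Longrightarrow> klim absv s L' \<Longrightarrow> L = L'"
proof -
  assume "klim absv s L" "klim absv s L'"
  then have "(\<lambda>N. max (absv (s N - L)) (absv (s N - L'))) \<longlonglongrightarrow> max 0 0"
    unfolding klim_def by (intro tendsto_max)
  moreover have "absv (L - L') \<le> max (absv (s N - L)) (absv (s N - L'))" for N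
    using absv_ultra[of L L' "s N"] absv_minus_commute[of L] by simp
  ultimately have "absv (L - L') \<le> max 0 0"
    by (intro LIMSEQ_le_const) auto
  then show ?thesis
    by (simp add: order_antisym_conv)
qed

lemma klim_add: "klim absv s L \<Longrightarrow> klim absv t M \<Longrightarrow> klim absv (\<lambda>n. s n + t n) (L + M)"
proof -
  assume "klim absv s L" "klim absv t M"
  then have "(\<lambda>N. max (absv (s N - L)) (absv (t N - M))) \<longlonglongrightarrow> max 0 0"
    unfolding klim_def by (intro tendsto_max)
  then have lim: "(\<lambda>N. max (absv (s N - L)) (absv (t N - M))) \<longlonglongrightarrow> 0"
    by simp
  have le: "absv (s N + t N - (L + M)) \<le> max (absv (s N - L)) (absv (t N - M))" for N
    using absv_add_le[of "s N - L" "t N - M"] by (simp add: algebra_simps)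
  show ?thesis
    unfolding klim_def by (rule tendsto_null_le[OF lim absv_nonneg le])
qed

lemma klim_cmult: "klim absv s L \<Longrightarrow> klim absv (\<lambda>n. c * s n) (c * L)"
proof -
  assume "klim absv s L"
  then have "(\<lambda>n. absv c * absv (s n - L)) \<longlonglongrightarrow> absv c * 0"
    unfolding klim_def by (intro tendsto_mult tendsto_const)
  then show ?thesis
    by (simp add: klim_def flip: absv_mult right_diff_distrib)
qed

lemma klim_le:
  assumes "klim absv s L" "\<And>n. absv (s n) \<le> B"
  shows "absv L \<le> B"
proof -
  have B: "0 \<le> B"
    using assms(2)[of 0] absv_nonneg order_trans by blast
  have "(\<lambda>N. max (absv (s N - L)) B) \<longlonglongrightarrow> max 0 B"
    using assms(1) unfolding klim_def by (intro tendsto_max tendsto_const)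
  moreover have "absv L \<le> max (absv (s N - L)) B" for N
    using absv_diff_le[of "s N" "s N - L"] assms(2)[of N] by auto
  ultimately have "absv L \<le> max 0 B"
    by (intro LIMSEQ_le_const) auto
  then show ?thesis using B by simp
qed

lemma ksums_unique: "ksums absv c L \<Longrightarrow> ksums absv c M \<Longrightarrow> L = M"
  unfolding ksums_def by (rule klim_unique)

lemma ksum_eqI: "ksums absv c L \<Longrightarrow> ksum absv c = L"
  unfolding ksum_def using ksums_unique by blast

lemma ksums_add: "ksums absv c L \<Longrightarrow> ksums absv c' M \<Longrightarrow> ksums absv (\<lambda>n. c n + c' n) (L + M)"
  unfolding ksums_def sum.distrib by (rule klim_add)

lemma ksums_cmult: "ksums absv c L \<Longrightarrow> ksums absv (\<lambda>n. x * c n) (x * L)"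
  unfolding ksums_def sum_distrib_left[symmetric] by (rule klim_cmult)

lemma ksums_finite:
  assumes "\<And>n. n \<ge> N \<Longrightarrow> c n = 0"
  shows "ksums absv c (\<Sum>n<N. c n)"
proof -
  have "absv ((\<Sum>n<M. c n) - (\<Sum>n<N. c n)) = 0" if "M \<ge> N" for M
  proof -
    have "(\<Sum>n<M. c n) = (\<Sum>n<N. c n)"
      using that assms by (intro sum.mono_neutral_right) auto
    then show ?thesis by simp
  qed
  then have "eventually (\<lambda>M. absv ((\<Sum>n<M. c n) - (\<Sum>n<N. c n)) = 0) sequentially"
    by (rule eventually_sequentiallyI[of N])
  then show ?thesis
    unfolding ksums_def klim_def by (rule tendsto_eventually)
qed

lemma ksums_le: "ksums absv c L \<Longrightarrow> (\<And>n. absv (c n) \<le> B) \<Longrightarrow> absv L \<le> B"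
  unfolding ksums_def by (erule klim_le, rule absv_sum_le)
    (auto intro: order_trans[OF absv_nonneg])

lemma ksums_zero: "ksums absv c L \<Longrightarrow> (\<lambda>n. absv (c n)) \<longlonglongrightarrow> 0"
proof -
  assume "ksums absv c L"
  then have *: "(\<lambda>N. absv ((\<Sum>n<N. c n) - L)) \<longlonglongrightarrow> 0"
    unfolding ksums_def klim_def .
  then have "(\<lambda>N. max (absv ((\<Sum>n<Suc N. c n) - L)) (absv ((\<Sum>n<N. c n) - L))) \<longlonglongrightarrow> max 0 0"
    by (intro tendsto_max * LIMSEQ_Suc)
  then have lim: "(\<lambda>N. max (absv ((\<Sum>n<Suc N. c n) - L)) (absv ((\<Sum>n<N. c n) - L))) \<longlonglongrightarrow> 0"
    by simp
  have le: "absv (c N) \<le> max (absv ((\<Sum>n<Suc N. c n) - L)) (absv ((\<Sum>n<N. c n) - L))" for N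
    using absv_diff_le[of "(\<Sum>n<Suc N. c n) - L" "(\<Sum>n<N. c n) - L"] by simp
  show ?thesis
    by (rule tendsto_null_le[OF lim absv_nonneg le])
qed

text \<open>A block of consecutive terms is bounded by its largest term, so null sequences have
  Cauchy partial sums and completeness applies.\<close>

lemma ksummable_if_zero:
  assumes "(\<lambda>n. absv (c n)) \<longlonglongrightarrow> 0"
  shows "ksummable absv c"
  unfolding ksummable_def ksums_def
proof (rule absv_complete)
  fix e :: real assume e: "e > 0"
  then have "eventually (\<lambda>n. absv (c n) < e / 2) sequentially"
    using assms order_tendstoD(2)[of _ 0 sequentially "e/2"] by simp
  then obtain N where N: "\<And>n. n \<ge> N \<Longrightarrow> absv (c n) < e / 2"
    unfolding eventually_sequentially by blast
  have *: "absv ((\<Sum>n<m. c n) - (\<Sum>n<n. c n)) \<le> e / 2" if "N \<le> n" "n \<le> m" for m n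
  proof -
    have "(\<Sum>n<m. c n) - (\<Sum>n<n. c n) = (\<Sum>k\<in>{n..<m}. c k)"
      using that by (simp add: sum_diff_nat_ivl lessThan_atLeast0)
    then show ?thesis
      using that e by (simp only:) (intro absv_sum_le less_imp_le[OF N], auto)
  qed
  have "absv ((\<Sum>n<m. c n) - (\<Sum>n<n. c n)) < e" if "N \<le> n" "N \<le> m" for m n
    using *[of n m] *[of m n] that e absv_minus_commute[of "\<Sum>n<m. c n"]
    by (smt (verit) field_sum_of_halves nat_le_linear)
  then show "\<exists>N. \<forall>m\<ge>N. \<forall>n\<ge>N. absv ((\<Sum>n<m. c n) - (\<Sum>n<n. c n)) < e"
    by blast
qed

lemma ksummable_iff: "ksummable absv c \<longleftrightarrow> (\<lambda>n. absv (c n)) \<longlonglongrightarrow> 0"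
proof
  assume "ksummable absv c"
  then show "(\<lambda>n. absv (c n)) \<longlonglongrightarrow> 0"
    unfolding ksummable_def using ksums_zero by (elim exE)
qed (rule ksummable_if_zero)

lemma ksums_ksum: "(\<lambda>n. absv (c n)) \<longlonglongrightarrow> 0 \<Longrightarrow> ksums absv c (ksum absv c)"
proof -
  assume "(\<lambda>n. absv (c n)) \<longlonglongrightarrow> 0"
  then obtain L where "ksums absv c L"
    using ksummable_if_zero unfolding ksummable_def by blast
  then show ?thesis
    using ksum_eqI by simp
qed

subsection \<open>Gauss norms and Tate algebras\<close>

text \<open>The Gauss norm on the disc of radius \<open>r\<close> appears only through its upper
  bounds, so that no supremum has to exist.\<close>

definition gauss_le :: "real \<Rightarrow> 'k fps \<Rightarrow> real \<Rightarrow> bool" where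
  "gauss_le r f B \<longleftrightarrow> (\<forall>n. absv (f $ n) * r ^ n \<le> B)"

text \<open>The Tate algebra of the closed disc of radius \<open>r\<close>. Since \<open>r\<close>
  may lie outside the value group, the condition is on coefficients and not on points.\<close>

definition tate :: "real \<Rightarrow> 'k fps \<Rightarrow> bool" where
  "tate r f \<longleftrightarrow> (\<lambda>n. absv (f $ n) * r ^ n) \<longlonglongrightarrow> 0"

lemma gauss_leD: "gauss_le r f B \<Longrightarrow> absv (f $ n) * r ^ n \<le> B"
  by (simp add: gauss_le_def)

lemma gauss_le_nonneg: "gauss_le r f B \<Longrightarrow> 0 \<le> B"
  by (metis absv_nonneg gauss_leD mult_1_right order_trans power_0)

lemma gauss_le_mono: "gauss_le r f B \<Longrightarrow> B \<le> C \<Longrightarrow> gauss_le r f C"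
  by (meson gauss_le_def order_trans)

lemma gauss_le_radius: "gauss_le r f B \<Longrightarrow> 0 \<le> r' \<Longrightarrow> r' \<le> r \<Longrightarrow> gauss_le r' f B"
  unfolding gauss_le_def by (meson absv_nonneg mult_left_mono order_trans power_mono)

lemma gauss_le_0: "0 \<le> B \<Longrightarrow> gauss_le r 0 B"
  by (simp add: gauss_le_def)

lemma gauss_le_minus [simp]: "gauss_le r (- f) B \<longleftrightarrow> gauss_le r f B"
  by (simp add: gauss_le_def)

lemma gauss_le_add:
  assumes "gauss_le r f B" "gauss_le r g C" "0 \<le> r"
  shows "gauss_le r (f + g) (max B C)"
  unfolding gauss_le_def
proof
  fix n
  have "absv ((f + g) $ n) * r ^ n \<le> max (absv (f $ n)) (absv (g $ n)) * r ^ n"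
    using assms(3) by (intro mult_right_mono) (auto simp: absv_add_le)
  also have "\<dots> = max (absv (f $ n) * r ^ n) (absv (g $ n) * r ^ n)"
    using assms(3) by (simp add: max_mult_distrib_right)
  also have "\<dots> \<le> max B C"
    using assms unfolding gauss_le_def by (intro max.mono) auto
  finally show "absv ((f + g) $ n) * r ^ n \<le> max B C" .
qed

lemma gauss_le_add': "gauss_le r f B \<Longrightarrow> gauss_le r g B \<Longrightarrow> 0 \<le> r \<Longrightarrow> gauss_le r (f + g) B"
  using gauss_le_add[of r f B g B] by simp

lemma gauss_le_diff': "gauss_le r f B \<Longrightarrow> gauss_le r g B \<Longrightarrow> 0 \<le> r \<Longrightarrow> gauss_le r (f - g) B"
  using gauss_le_add'[of r f B "-g"] by simp

lemma gauss_le_sum: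
  assumes "\<And>i. i \<in> I \<Longrightarrow> gauss_le r (f i) B" "0 \<le> B" "0 \<le> r"
  shows "gauss_le r (\<Sum>i\<in>I. f i) B"
  using assms
  by (induction I rule: infinite_finite_induct) (auto intro: gauss_le_add' gauss_le_0)

lemma gauss_le_mult:
  assumes "gauss_le r f B" "gauss_le r g C" "0 \<le> r"
  shows "gauss_le r (f * g) (B * C)"
  unfolding gauss_le_def
proof
  fix n
  have B: "0 \<le> B" "0 \<le> C" using assms gauss_le_nonneg by blast+
  show "absv ((f * g) $ n) * r ^ n \<le> B * C"
  proof (cases "r = 0 \<and> n \<noteq> 0")
    case True
    then show ?thesis using B by (simp add: power_0_left)
  next
    case False
    then have rn: "r ^ n > 0" using assms(3) by (cases "n = 0") auto
    have "absv ((f * g) $ n) \<le> B * C / r ^ n"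
      unfolding fps_mult_nth
    proof (rule absv_sum_le)
      fix i assume "i \<in> {0..n}"
      then have "r ^ n = r ^ i * r ^ (n - i)"
        by (simp flip: power_add)
      moreover have "(absv (f $ i) * r ^ i) * (absv (g $ (n - i)) * r ^ (n - i)) \<le> B * C"
        using assms B by (intro mult_mono gauss_leD) auto
      ultimately show "absv (f $ i * g $ (n - i)) \<le> B * C / r ^ n"
        using rn by (simp add: absv_mult field_simps)
    qed (use B rn in auto)
    then show ?thesis
      using rn by (simp add: field_simps)
  qed
qed

lemma gauss_le_const: "absv c \<le> B \<Longrightarrow> gauss_le r (fps_const c) B"
proof -
  assume "absv c \<le> B"
  moreover from this have "0 \<le> B"
    using absv_nonneg[of c] by linarith
  ultimately show ?thesis
    by (simp add: gauss_le_def)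
qed

lemma gauss_le_1: "gauss_le r 1 1"
  using gauss_le_const[of 1 1] by simp

lemma gauss_le_cmult: "gauss_le r f B \<Longrightarrow> gauss_le r (fps_const c * f) (absv c * B)"
  by (simp add: gauss_le_def absv_mult mult.assoc mult_left_mono)

lemma gauss_le_power: "gauss_le r f B \<Longrightarrow> 0 \<le> r \<Longrightarrow> gauss_le r (f ^ n) (B ^ n)"
  by (induction n) (simp_all add: gauss_le_mult gauss_le_1)

lemma gauss_le_X: "0 \<le> r \<Longrightarrow> gauss_le r fps_X r"
  by (simp add: gauss_le_def fps_X_def)

lemma gauss_le_X_plus: "0 \<le> r \<Longrightarrow> gauss_le r (fps_X + fps_const c) (max r (absv c))"
  by (intro gauss_le_add gauss_le_X gauss_le_const) auto

lemma gauss_le_prod: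
  "(\<And>i. i \<in> I \<Longrightarrow> gauss_le r (f i) (B i)) \<Longrightarrow> 0 \<le> r \<Longrightarrow> gauss_le r (\<Prod>i\<in>I. f i) (\<Prod>i\<in>I. B i)"
  by (induction I rule: infinite_finite_induct) (simp_all add: gauss_le_mult gauss_le_1)

lemma gauss_le_eq_0:
  assumes "\<And>e. e > 0 \<Longrightarrow> gauss_le r f e" "0 < r"
  shows "f = 0"
proof (rule fps_ext)
  fix n
  have "absv (f $ n) * r ^ n \<le> 0 + e" if "e > 0" for e
    using gauss_leD[OF assms(1)[OF that], of n] by simp
  then have "absv (f $ n) * r ^ n \<le> 0"
    by (rule field_le_epsilon)
  then have "absv (f $ n) \<le> 0"
    using zero_less_power[OF assms(2), of n] by (auto simp: mult_le_0_iff)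
  then show "f $ n = 0 $ n"
    by (simp add: order_antisym_conv)
qed

lemma tate_bound: "tate r f \<Longrightarrow> \<exists>B. gauss_le r f B"
proof -
  assume "tate r f"
  then have "Bseq (\<lambda>n. absv (f $ n) * r ^ n)"
    unfolding tate_def using convergentI convergent_imp_Bseq by blast
  then obtain K where "\<And>n. norm (absv (f $ n) * r ^ n) \<le> K"
    by (auto simp: Bseq_def)
  then show ?thesis
    unfolding gauss_le_def by (intro exI[of _ K]) (auto dest: abs_le_D1)
qed

lemma tate_0 [simp]: "tate r 0"
  by (simp add: tate_def)

lemma tate_finite: "(\<And>n. n \<ge> N \<Longrightarrow> f $ n = 0) \<Longrightarrow> tate r f"
  unfolding tate_def
  by (rule tendsto_eventually, rule eventually_sequentiallyI[of N]) simp

lemma tate_const [simp]: "tate r (fps_const c)"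
  by (rule tate_finite[of 1]) auto

lemma tate_1 [simp]: "tate r 1"
  using tate_const[of r 1] by simp

lemma tate_X [simp]: "tate r fps_X"
  by (rule tate_finite[of 2]) (simp add: fps_X_def)

lemma tate_add: "tate r f \<Longrightarrow> tate r g \<Longrightarrow> 0 \<le> r \<Longrightarrow> tate r (f + g)"
proof -
  assume *: "tate r f" "tate r g" "0 \<le> r"
  have "(\<lambda>n. absv (f $ n) * r ^ n + absv (g $ n) * r ^ n) \<longlonglongrightarrow> 0 + 0"
    using * unfolding tate_def by (intro tendsto_add)
  then have lim: "(\<lambda>n. absv (f $ n) * r ^ n + absv (g $ n) * r ^ n) \<longlonglongrightarrow> 0"
    by simp
  have le: "absv ((f + g) $ n) * r ^ n \<le> absv (f $ n) * r ^ n + absv (g $ n) * r ^ n" for n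
  proof -
    have "absv (f $ n + g $ n) \<le> absv (f $ n) + absv (g $ n)"
      by (smt (verit) absv_add_le absv_nonneg)
    then show ?thesis
      using *(3) by (simp flip: distrib_right add: mult_right_mono)
  qed
  show "tate r (f + g)"
    unfolding tate_def by (rule tendsto_null_le[OF lim _ le]) (use *(3) in auto)
qed

lemma tate_cmult: "tate r f \<Longrightarrow> tate r (fps_const c * f)"
proof -
  assume "tate r f"
  then have "(\<lambda>n. absv c * (absv (f $ n) * r ^ n)) \<longlonglongrightarrow> absv c * 0"
    unfolding tate_def by (intro tendsto_intros)
  then show ?thesis
    by (simp add: tate_def absv_mult mult.assoc)
qed

lemma tate_minus [simp]: "tate r (- f) \<longleftrightarrow> tate r f"
  by (simp add: tate_def)

lemma tate_diff: "tate r f \<Longrightarrow> tate r g \<Longrightarrow> 0 \<le> r \<Longrightarrow> tate r (f - g)"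
  using tate_add[of r f "-g"] by simp

lemma tate_sum: "(\<And>i. i \<in> I \<Longrightarrow> tate r (f i)) \<Longrightarrow> 0 \<le> r \<Longrightarrow> tate r (\<Sum>i\<in>I. f i)"
  by (induction I rule: infinite_finite_induct) (auto intro: tate_add)

lemma tate_X_mult: "tate r f \<Longrightarrow> tate r (fps_X * f)"
proof -
  assume "tate r f"
  then have "(\<lambda>n. r * (absv (f $ n) * r ^ n)) \<longlonglongrightarrow> r * 0"
    unfolding tate_def by (intro tendsto_intros)
  then have "(\<lambda>n. absv ((fps_X * f) $ Suc n) * r ^ Suc n) \<longlonglongrightarrow> 0"
    by (simp add: mult_ac)
  then show ?thesis
    unfolding tate_def by (rule LIMSEQ_imp_Suc)
qed

lemma tate_X_power_mult: "tate r f \<Longrightarrow> tate r (fps_X ^ n * f)"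
  by (induction n) (auto simp: mult.assoc intro: tate_X_mult)

lemma tate_radius: "tate r f \<Longrightarrow> 0 \<le> r' \<Longrightarrow> r' \<le> r \<Longrightarrow> tate r' f"
  unfolding tate_def
  by (rule tendsto_null_le[of "\<lambda>n. absv (f $ n) * r ^ n"])
     (auto intro!: mult_left_mono power_mono)

lemma tate_if_gauss_le:
  assumes "gauss_le r f B" "0 \<le> r'" "r' < r"
  shows "tate r' f"
proof -
  have "(\<lambda>n. B * (r' / r) ^ n) \<longlonglongrightarrow> B * 0"
    using assms by (intro tendsto_intros LIMSEQ_realpow_zero) auto
  then have lim: "(\<lambda>n. B * (r' / r) ^ n) \<longlonglongrightarrow> 0" by simp
  have "absv (f $ n) * r' ^ n \<le> B * (r' / r) ^ n" for n
  proof -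
    have "absv (f $ n) * r' ^ n = (absv (f $ n) * r ^ n) * (r' / r) ^ n"
      using assms by (simp add: power_divide)
    also have "\<dots> \<le> B * (r' / r) ^ n"
      using assms by (intro mult_right_mono gauss_leD) auto
    finally show ?thesis .
  qed
  then show ?thesis
    unfolding tate_def using assms by (intro tendsto_null_le[OF lim]) auto
qed

lemma tate_limit:
  assumes "\<And>e. e > 0 \<Longrightarrow> \<exists>g. tate r g \<and> gauss_le r (f - g) e" "0 \<le> r"
  shows "tate r f"
  unfolding tate_def
proof (rule LIMSEQ_I)
  fix e :: real assume e: "e > 0"
  obtain g where g: "tate r g" "gauss_le r (f - g) (e / 2)"
    using assms(1)[of "e/2"] e by auto
  have "eventually (\<lambda>n. absv (g $ n) * r ^ n < e / 2) sequentially"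
    using g(1) e order_tendstoD(2)[of _ 0 sequentially "e/2"] unfolding tate_def by simp
  then obtain N where N: "\<And>n. n \<ge> N \<Longrightarrow> absv (g $ n) * r ^ n < e / 2"
    unfolding eventually_sequentially by blast
  have "absv (f $ n) * r ^ n < e" if "n \<ge> N" for n
  proof -
    have "absv (f $ n) * r ^ n \<le> max (absv ((f - g) $ n)) (absv (g $ n)) * r ^ n"
      using absv_add_le[of "(f - g) $ n" "g $ n"] assms(2) by (intro mult_right_mono) auto
    also have "\<dots> = max (absv ((f - g) $ n) * r ^ n) (absv (g $ n) * r ^ n)"
      using assms(2) by (simp add: max_mult_distrib_right)
    also have "\<dots> < e"
      using N[OF that] gauss_leD[OF g(2), of n] e by auto
    finally show ?thesis .
  qed
  then show "\<exists>N. \<forall>n\<ge>N. norm (absv (f $ n) * r ^ n - 0) < e"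
    using assms(2) by (intro exI[of _ N]) (auto simp: abs_mult)
qed

text \<open>Written as a sum of monomials, so that additive maps can be evaluated on it term by
  term.\<close>

definition trunc :: "nat \<Rightarrow> 'k fps \<Rightarrow> 'k fps" where
  "trunc N f = (\<Sum>n<N. fps_const (f $ n) * fps_X ^ n)"

lemma trunc_nth: "trunc N f $ n = (if n < N then f $ n else 0)"
proof -
  have "trunc N f $ n = (\<Sum>m<N. if m = n then f $ n else 0)"
    unfolding trunc_def fps_sum_nth by (intro sum.cong) (auto simp: fps_X_power_nth)
  then show ?thesis by (simp add: sum.delta)
qed

lemma tate_trunc [simp]: "tate r (trunc N f)"
  by (rule tate_finite[of N]) (auto simp: trunc_nth)

lemma gauss_le_trunc: "gauss_le r f B \<Longrightarrow> gauss_le r (trunc N f) B"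
  using gauss_le_nonneg[of r f B] by (auto simp: gauss_le_def trunc_nth)

lemma trunc_approx:
  assumes "tate r f" "e > 0"
  obtains N where "gauss_le r (f - trunc N f) e"
proof -
  have "eventually (\<lambda>n. absv (f $ n) * r ^ n < e) sequentially"
    using assms order_tendstoD(2)[of _ 0 sequentially e] unfolding tate_def by simp
  then obtain N where "\<And>n. n \<ge> N \<Longrightarrow> absv (f $ n) * r ^ n < e"
    unfolding eventually_sequentially by blast
  then have "gauss_le r (f - trunc N f) e"
    using assms by (auto simp: gauss_le_def trunc_nth less_imp_le)
  then show ?thesis using that by blast
qed

text \<open>Multiplication by a polynomial preserves the Tate algebra by shifting, and
  \<open>f\<close> is a limit of its truncations in Gauss norm. The denominator \<open>B + 1\<close>
  stays positive for \<open>B = 0\<close>.\<close>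

lemma tate_mult:
  assumes "tate r f" "tate r g" "0 \<le> r"
  shows "tate r (f * g)"
proof (rule tate_limit)
  fix e :: real assume e: "e > 0"
  obtain B where B: "gauss_le r g B" using tate_bound assms(2) by blast
  then have B0: "B \<ge> 0" using gauss_le_nonneg by blast
  obtain N where N: "gauss_le r (f - trunc N f) (e / (B + 1))"
    using trunc_approx[OF assms(1)] e B0 by (metis add_nonneg_pos divide_pos_pos zero_less_one)
  have "gauss_le r ((f - trunc N f) * g) (e / (B + 1) * B)"
    using gauss_le_mult[OF N B assms(3)] .
  moreover have "e / (B + 1) * B \<le> e"
    using e B0 by (simp add: field_simps)
  ultimately have "gauss_le r (f * g - trunc N f * g) e"
    by (auto simp: algebra_simps intro: gauss_le_mono)
  moreover have "tate r (trunc N f * g)"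
    unfolding trunc_def sum_distrib_right mult.assoc
    by (intro tate_sum tate_cmult tate_X_power_mult assms)
  ultimately show "\<exists>h. tate r h \<and> gauss_le r (f * g - h) e" by blast
qed fact

lemma tate_power: "tate r f \<Longrightarrow> 0 \<le> r \<Longrightarrow> tate r (f ^ n)"
  by (induction n) (auto intro: tate_mult)

lemma tate_prod: "(\<And>i. i \<in> I \<Longrightarrow> tate r (f i)) \<Longrightarrow> 0 \<le> r \<Longrightarrow> tate r (\<Prod>i\<in>I. f i)"
  by (induction I rule: infinite_finite_induct) (auto intro: tate_mult)

text \<open>Completeness for the Gauss norm, restricted to geometric decay: this is the form
  produced by geometric series and by iterated division, and the rate bounds every tail.\<close>

lemma tate_complete:
  assumes s: "\<And>k. tate r (s k)" "\<And>k. gauss_le r (s k) (C * \<delta> ^ k)" and \<delta>: "0 \<le> \<delta>" "\<delta> < 1" and r: "0 < r"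
  obtains S where "tate r S" "\<And>K. gauss_le r (S - (\<Sum>k<K. s k)) (C * \<delta> ^ K)"
proof -
  have C: "0 \<le> C"
    using gauss_le_nonneg[OF s(2)[of 0]] by simp
  define S where "S = Abs_fps (\<lambda>n. ksum absv (\<lambda>k. s k $ n))"
  have sums: "ksums absv (\<lambda>k. s k $ n) (S $ n)" for n
  proof -
    have "(\<lambda>k. C / r ^ n * \<delta> ^ k) \<longlonglongrightarrow> C / r ^ n * 0"
      using \<delta> by (intro tendsto_intros LIMSEQ_realpow_zero) auto
    then have lim: "(\<lambda>k. C / r ^ n * \<delta> ^ k) \<longlonglongrightarrow> 0"
      by simp
    have le: "absv (s k $ n) \<le> C / r ^ n * \<delta> ^ k" for k
      using gauss_leD[OF s(2)[of k], of n] r by (simp add: field_simps)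
    have "(\<lambda>k. absv (s k $ n)) \<longlonglongrightarrow> 0"
      by (rule tendsto_null_le[OF lim absv_nonneg le])
    then show ?thesis
      unfolding S_def using ksums_ksum by simp
  qed
  have appr: "gauss_le r (S - (\<Sum>k<K. s k)) (C * \<delta> ^ K)" for K
    unfolding gauss_le_def
  proof
    fix n
    have "ksums absv (\<lambda>k. if k < K then 0 else s k $ n) (S $ n + (- 1) * (\<Sum>k<K. s k $ n))"
    proof -
      have "ksums absv (\<lambda>k. if k < K then s k $ n else 0) (\<Sum>k<K. s k $ n)"
        using ksums_finite[of K "\<lambda>k. if k < K then s k $ n else 0"] by simp
      from ksums_add[OF sums[of n] ksums_cmult[OF this, of "-1"]]
      show ?thesis
        by (rule back_subst[of "\<lambda>g. ksums absv g _"]) auto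
    qed
    then have "absv (S $ n + (- 1) * (\<Sum>k<K. s k $ n)) \<le> C * \<delta> ^ K / r ^ n"
    proof (rule ksums_le)
      fix k
      show "absv (if k < K then 0 else s k $ n) \<le> C * \<delta> ^ K / r ^ n"
      proof (cases "k < K")
        case False
        have "absv (s k $ n) \<le> C * \<delta> ^ k / r ^ n"
          using gauss_leD[OF s(2)[of k], of n] r by (simp add: field_simps)
        also have "\<dots> \<le> C * \<delta> ^ K / r ^ n"
          using False \<delta> C r by (intro divide_right_mono mult_left_mono power_decreasing) auto
        finally show ?thesis using False by simp
      qed (use C \<delta> r in auto)
    qed
    then show "absv ((S - (\<Sum>k<K. s k)) $ n) * r ^ n \<le> C * \<delta> ^ K"
      using r by (simp add: fps_sum_nth field_simps)
  qed
  have "tate r S"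
  proof (rule tate_limit)
    fix e :: real assume e: "e > 0"
    have "(\<lambda>K. C * \<delta> ^ K) \<longlonglongrightarrow> C * 0"
      using \<delta> by (intro tendsto_intros LIMSEQ_realpow_zero) auto
    then have "eventually (\<lambda>K. C * \<delta> ^ K < e) sequentially"
      using e order_tendstoD(2)[of _ 0 sequentially e] by simp
    then obtain K where "C * \<delta> ^ K < e"
      unfolding eventually_sequentially by blast
    then show "\<exists>g. tate r g \<and> gauss_le r (S - g) e"
      using appr[of K] s(1) r
      by (intro exI[of _ "\<Sum>k<K. s k"]) (auto intro: gauss_le_mono tate_sum)
  qed (use r in auto)
  then show ?thesis using that appr by blast
qed

subsection \<open>Analytic composition\<close>

lemma acomp_nth_bound:
  assumes "gauss_le \<rho> h B" "gauss_le r g \<rho>" "0 < r"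
  shows "absv (h $ n * (g ^ n) $ m) \<le> B / r ^ m"
    and "absv (h $ n * (g ^ n) $ m) \<le> absv (h $ n) * \<rho> ^ n / r ^ m"
proof -
  have "absv ((g ^ n) $ m) * r ^ m \<le> \<rho> ^ n"
    using gauss_leD gauss_le_power assms by (meson less_imp_le)
  then have "absv ((g ^ n) $ m) \<le> \<rho> ^ n / r ^ m"
    using assms(3) by (simp add: field_simps)
  then show *: "absv (h $ n * (g ^ n) $ m) \<le> absv (h $ n) * \<rho> ^ n / r ^ m"
    using mult_left_mono[OF _ absv_nonneg] by (fastforce simp: absv_mult)
  have "absv (h $ n) * \<rho> ^ n / r ^ m \<le> B / r ^ m"
    using gauss_leD[OF assms(1), of n] assms(3) by (simp add: divide_right_mono)
  with * show "absv (h $ n * (g ^ n) $ m) \<le> B / r ^ m"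
    by linarith
qed

text \<open>A Gauss norm of \<open>g\<close> bounded by \<rho> takes the place of a vanishing
  constant term: it bounds the coefficients of \<open>g ^ n\<close> and makes each coefficient of
  the composite a convergent series.\<close>

lemma acomp_sums:
  assumes "tate \<rho> h" "gauss_le r g \<rho>" "0 < r"
  shows "ksums absv (\<lambda>n. h $ n * (g ^ n) $ m) (acomp absv h g $ m)"
proof -
  obtain B where B: "gauss_le \<rho> h B"
    using tate_bound assms(1) by blast
  have "(\<lambda>n. absv (h $ n) * \<rho> ^ n / r ^ m) \<longlonglongrightarrow> 0 / r ^ m"
    using assms(1) unfolding tate_def by (rule tendsto_divide[OF _ tendsto_const]) (use assms(3) in auto)
  then have lim: "(\<lambda>n. absv (h $ n) * \<rho> ^ n / r ^ m) \<longlonglongrightarrow> 0"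
    by simp
  show ?thesis
    unfolding acomp_def fps_nth_Abs_fps
    by (intro ksums_ksum tendsto_null_le[OF lim] absv_nonneg acomp_nth_bound(2)[OF B assms(2,3)])
qed

lemma acomp_gauss:
  assumes "tate \<rho> h" "gauss_le \<rho> h B" "gauss_le r g \<rho>" "0 < r"
  shows "gauss_le r (acomp absv h g) B"
  unfolding gauss_le_def
proof
  fix m
  have "absv (acomp absv h g $ m) \<le> B / r ^ m"
    using acomp_sums[OF assms(1,3,4)] by (rule ksums_le) (rule acomp_nth_bound[OF assms(2-4)])
  then show "absv (acomp absv h g $ m) * r ^ m \<le> B"
    using assms(4) by (simp add: field_simps)
qed

lemma acomp_add:
  assumes "tate \<rho> h" "tate \<rho> h'" "gauss_le r g \<rho>" "0 < r"
  shows "acomp absv (h + h') g = acomp absv h g + acomp absv h' g"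
proof (rule fps_ext)
  fix m
  have "0 \<le> \<rho>" using assms(3) by (rule gauss_le_nonneg)
  then have "tate \<rho> (h + h')"
    using assms by (intro tate_add)
  from acomp_sums[OF this assms(3,4), of m]
    ksums_add[OF acomp_sums[OF assms(1,3,4), of m] acomp_sums[OF assms(2,3,4), of m]]
  show "acomp absv (h + h') g $ m = (acomp absv h g + acomp absv h' g) $ m"
    by (simp add: distrib_right ksums_unique)
qed

lemma acomp_cmult:
  assumes "tate \<rho> h" "gauss_le r g \<rho>" "0 < r"
  shows "acomp absv (fps_const c * h) g = fps_const c * acomp absv h g"
proof (rule fps_ext)
  fix m
  from acomp_sums[OF tate_cmult[OF assms(1), of c] assms(2,3), of m]
    ksums_cmult[OF acomp_sums[OF assms, of m], of c]
  show "acomp absv (fps_const c * h) g $ m = (fps_const c * acomp absv h g) $ m"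
    by (simp add: mult.assoc ksums_unique)
qed

lemma acomp_diff:
  assumes "tate \<rho> h" "tate \<rho> h'" "gauss_le r g \<rho>" "0 < r"
  shows "acomp absv (h - h') g = acomp absv h g - acomp absv h' g"
proof -
  have *: "- f = fps_const (-1) * f" for f :: "'k fps"
    by (simp flip: fps_const_neg)
  have "acomp absv (h + (- h')) g = acomp absv h g + acomp absv (- h') g"
    using assms by (intro acomp_add) auto
  also have "acomp absv (- h') g = - acomp absv h' g"
    unfolding * using assms by (intro acomp_cmult)
  finally show ?thesis by simp
qed

lemma acomp_monom [simp]: "acomp absv (fps_const c * fps_X ^ n) g = fps_const c * g ^ n"
proof (rule fps_ext)
  fix m
  have "ksums absv (\<lambda>k. (fps_const c * fps_X ^ n) $ k * (g ^ k) $ m)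
     (\<Sum>k<Suc n. (fps_const c * fps_X ^ n) $ k * (g ^ k) $ m)"
    by (rule ksums_finite) (simp add: fps_X_power_nth)
  also have "(\<Sum>k<Suc n. (fps_const c * fps_X ^ n) $ k * (g ^ k) $ m) = c * (g ^ n) $ m"
    by (simp add: fps_X_power_nth if_distrib[of "\<lambda>x. x * _"] if_distrib[of "\<lambda>x. _ * x"] cong: if_cong)
  finally show "acomp absv (fps_const c * fps_X ^ n) g $ m = (fps_const c * g ^ n) $ m"
    unfolding acomp_def fps_nth_Abs_fps by (simp add: ksum_eqI)
qed

lemma acomp_power_X [simp]: "acomp absv (fps_X ^ n) g = g ^ n"
  using acomp_monom[of 1 n g] by simp

lemma acomp_X [simp]: "acomp absv fps_X g = g"
  using acomp_power_X[of 1 g] by simp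

lemma acomp_const [simp]: "acomp absv (fps_const c) g = fps_const c"
  using acomp_monom[of c 0 g] by simp

lemma acomp_1 [simp]: "acomp absv 1 g = 1"
  using acomp_const[of 1 g] by simp

lemma acomp_0 [simp]: "acomp absv 0 g = 0"
  using acomp_const[of 0 g] by simp

lemma acomp_sum:
  assumes "\<And>i. i \<in> I \<Longrightarrow> tate \<rho> (h i)" "gauss_le r g \<rho>" "0 < r"
  shows "acomp absv (\<Sum>i\<in>I. h i) g = (\<Sum>i\<in>I. acomp absv (h i) g)"
  using assms(1)
proof (induction I rule: infinite_finite_induct)
  case (insert x F)
  have "0 \<le> \<rho>" using assms(2) by (rule gauss_le_nonneg)
  then have "acomp absv (h x + (\<Sum>i\<in>F. h i)) g = acomp absv (h x) g + acomp absv (\<Sum>i\<in>F. h i) g"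
    using insert assms by (intro acomp_add tate_sum) auto
  then show ?case using insert by simp
qed auto

text \<open>Polynomials are dense in a Tate algebra.\<close>

lemma tate_ext:
  assumes h: "tate \<rho> h" and pos: "0 < r" "0 \<le> \<rho>" "0 \<le> C"
    and \<Phi>: "\<And>h1 h2. tate \<rho> h1 \<Longrightarrow> tate \<rho> h2 \<Longrightarrow> \<Phi> (h1 + h2) = \<Phi> h1 + \<Phi> h2"
    and \<Psi>: "\<And>h1 h2. tate \<rho> h1 \<Longrightarrow> tate \<rho> h2 \<Longrightarrow> \<Psi> (h1 + h2) = \<Psi> h1 + \<Psi> h2"
    and b\<Phi>: "\<And>h B. tate \<rho> h \<Longrightarrow> gauss_le \<rho> h B \<Longrightarrow> gauss_le r (\<Phi> h) (C * B)"
    and b\<Psi>: "\<And>h B. tate \<rho> h \<Longrightarrow> gauss_le \<rho> h B \<Longrightarrow> gauss_le r (\<Psi> h) (C * B)"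
    and eq: "\<And>c n. \<Phi> (fps_const c * fps_X ^ n) = \<Psi> (fps_const c * fps_X ^ n)"
  shows "\<Phi> h = \<Psi> h"
proof -
  have trunc: "\<Phi> (trunc N h) = \<Psi> (trunc N h)" for N
  proof (induction N)
    case 0
    then show ?case using eq[of 0 0] by (simp add: trunc_def)
  next
    case (Suc N)
    have mon: "tate \<rho> (fps_const (h $ N) * fps_X ^ N)"
      using tate_X_power_mult[of \<rho> "fps_const (h $ N)" N] by (simp add: mult.commute)
    have "trunc (Suc N) h = trunc N h + fps_const (h $ N) * fps_X ^ N"
      by (simp add: trunc_def)
    then show ?case
      using mon Suc eq by (simp add: \<Phi> \<Psi>)
  qed
  have "\<Phi> h - \<Psi> h = 0"
  proof (rule gauss_le_eq_0)
    fix e :: real assume e: "e > 0"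
    obtain N where N: "gauss_le \<rho> (h - trunc N h) (e / (C + 1))"
      using trunc_approx[OF h] e pos by (metis add_nonneg_pos divide_pos_pos zero_less_one)
    have t: "tate \<rho> (h - trunc N h)"
      using h pos by (intro tate_diff) auto
    have "C * (e / (C + 1)) \<le> e"
      using e pos by (simp add: field_simps)
    then have "gauss_le r (\<Phi> (h - trunc N h)) e" "gauss_le r (\<Psi> (h - trunc N h)) e"
      using b\<Phi>[OF t N] b\<Psi>[OF t N] gauss_le_mono by blast+
    moreover have "\<Phi> h = \<Phi> (h - trunc N h) + \<Phi> (trunc N h)" "\<Psi> h = \<Psi> (h - trunc N h) + \<Psi> (trunc N h)"
      using \<Phi>[OF t, of "trunc N h"] \<Psi>[OF t, of "trunc N h"] by simp_all
    ultimately show "gauss_le r (\<Phi> h - \<Psi> h) e"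
      using gauss_le_diff' trunc pos by simp
  qed (use pos in auto)
  then show ?thesis by simp
qed

text \<open>Density of polynomials is used twice: with \<open>h1\<close> a monomial the identity
  extends from monomials to every \<open>h2\<close>, and then, with \<open>h2\<close> fixed, from
  monomials to every \<open>h1\<close>.\<close>

lemma acomp_mult:
  assumes h: "tate \<rho> h1" "tate \<rho> h2" and g: "gauss_le r g \<rho>" "0 < r"
  shows "acomp absv (h1 * h2) g = acomp absv h1 g * acomp absv h2 g"
proof -
  have \<rho>: "0 \<le> \<rho>" using g(1) by (rule gauss_le_nonneg)
  have mon: "tate \<rho> (fps_const c * fps_X ^ n)" for c n
    using tate_X_power_mult[of \<rho> "fps_const c" n] by (simp add: mult.commute)
  have *: "acomp absv (fps_const c * fps_X ^ n * h2) g = fps_const c * g ^ n * acomp absv h2 g" for c n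
    using h(2) g(2) \<rho>
  proof (rule tate_ext[where C = "absv c * \<rho> ^ n"])
    fix h B assume hB: "tate \<rho> h" "gauss_le \<rho> h B"
    have "gauss_le \<rho> (fps_const c * fps_X ^ n * h) (absv c * \<rho> ^ n * B)"
      using \<rho> hB by (intro gauss_le_mult gauss_le_cmult gauss_le_power gauss_le_X)
    then show "gauss_le r (acomp absv (fps_const c * fps_X ^ n * h) g) (absv c * \<rho> ^ n * B)"
      using hB g \<rho> by (intro acomp_gauss[of \<rho>] tate_mult tate_power tate_const tate_X)
    show "gauss_le r (fps_const c * g ^ n * acomp absv h g) (absv c * \<rho> ^ n * B)"
      using g hB by (intro gauss_le_mult gauss_le_cmult gauss_le_power acomp_gauss[of \<rho>]) auto
  next
    fix c' m
    have "fps_const c * fps_X ^ n * (fps_const c' * fps_X ^ m) = fps_const (c * c') * (fps_X :: 'k fps) ^ (n + m)"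
      by (simp add: power_add mult_ac flip: fps_const_mult)
    then show "acomp absv (fps_const c * fps_X ^ n * (fps_const c' * fps_X ^ m)) g =
       fps_const c * g ^ n * acomp absv (fps_const c' * fps_X ^ m) g"
      by (simp only: acomp_monom) (simp add: power_add mult_ac flip: fps_const_mult)
  next
    fix h1 h2 :: "'k fps" assume unit_part: "tate \<rho> h1" "tate \<rho> h2"
    show "acomp absv (fps_const c * fps_X ^ n * (h1 + h2)) g =
       acomp absv (fps_const c * fps_X ^ n * h1) g + acomp absv (fps_const c * fps_X ^ n * h2) g"
      unfolding distrib_left using unit_part g \<rho> by (intro acomp_add tate_mult tate_power tate_const tate_X)
    show "fps_const c * g ^ n * acomp absv (h1 + h2) g =
       fps_const c * g ^ n * acomp absv h1 g + fps_const c * g ^ n * acomp absv h2 g"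
      by (simp add: acomp_add[OF unit_part g] distrib_left)
  qed (use \<rho> in auto)
  obtain B2 where B2: "gauss_le \<rho> h2 B2" using tate_bound h(2) by blast
  show ?thesis
    using h(1) g(2) \<rho>
  proof (rule tate_ext[where C = B2])
    show "0 \<le> B2" using B2 by (rule gauss_le_nonneg)
  next
    fix h B assume hB: "tate \<rho> h" "gauss_le \<rho> h B"
    have "gauss_le \<rho> (h * h2) (B2 * B)"
      using gauss_le_mult[OF hB(2) B2 \<rho>] by (simp add: mult.commute)
    then show "gauss_le r (acomp absv (h * h2) g) (B2 * B)"
      using hB g \<rho> h by (intro acomp_gauss[of \<rho>] tate_mult)
    show "gauss_le r (acomp absv h g * acomp absv h2 g) (B2 * B)"
      using gauss_le_mult[OF acomp_gauss[OF hB g] acomp_gauss[OF h(2) B2 g]] g(2)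
      by (simp add: mult.commute)
  next
    fix k1 k2 :: "'k fps" assume kk: "tate \<rho> k1" "tate \<rho> k2"
    show "acomp absv ((k1 + k2) * h2) g = acomp absv (k1 * h2) g + acomp absv (k2 * h2) g"
      unfolding distrib_right using kk h g \<rho> by (intro acomp_add tate_mult)
    show "acomp absv (k1 + k2) g * acomp absv h2 g =
       acomp absv k1 g * acomp absv h2 g + acomp absv k2 g * acomp absv h2 g"
      by (simp add: acomp_add[OF kk g] distrib_right)
  qed (use * in simp)
qed

lemma acomp_power:
  assumes "tate \<rho> h" "gauss_le r g \<rho>" "0 < r"
  shows "acomp absv (h ^ n) g = acomp absv h g ^ n"
  using assms gauss_le_nonneg[OF assms(2)]
  by (induction n) (simp_all add: acomp_mult[of \<rho> _ _ r] tate_power)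

lemma acomp_prod:
  assumes "\<And>i. i \<in> I \<Longrightarrow> tate \<rho> (h i)" "gauss_le r g \<rho>" "0 < r"
  shows "acomp absv (\<Prod>i\<in>I. h i) g = (\<Prod>i\<in>I. acomp absv (h i) g)"
  using assms(1)
proof (induction I rule: infinite_finite_induct)
  case (insert x F)
  have "0 \<le> \<rho>" using assms(2) by (rule gauss_le_nonneg)
  then have "acomp absv (h x * (\<Prod>i\<in>F. h i)) g = acomp absv (h x) g * acomp absv (\<Prod>i\<in>F. h i) g"
    using insert assms by (intro acomp_mult[of \<rho> _ _ r] tate_prod) auto
  then show ?case using insert by simp
qed auto

lemma acomp_tate:
  assumes "tate \<rho> h" "gauss_le r g \<rho>" "0 < r" "tate r g"
  shows "tate r (acomp absv h g)"
proof (rule tate_limit)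
  have \<rho>: "0 \<le> \<rho>" using assms(2) by (rule gauss_le_nonneg)
  fix e :: real assume e: "e > 0"
  obtain N where N: "gauss_le \<rho> (h - trunc N h) e"
    using trunc_approx[OF assms(1) e] .
  have mon: "tate \<rho> (fps_const c * fps_X ^ n)" for c n
    using tate_X_power_mult[of \<rho> "fps_const c" n] by (simp add: mult.commute)
  have "acomp absv (trunc N h) g = (\<Sum>n<N. fps_const (h $ n) * g ^ n)"
    unfolding trunc_def by (subst acomp_sum[of _ \<rho> _ r]) (use mon assms in auto)
  then have "tate r (acomp absv (trunc N h) g)"
    using assms by (auto intro!: tate_sum tate_cmult tate_power)
  moreover have "gauss_le r (acomp absv (h - trunc N h) g) e"
    using N assms \<rho> by (intro acomp_gauss[of \<rho>] tate_diff) auto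
  then have "gauss_le r (acomp absv h g - acomp absv (trunc N h) g) e"
    using acomp_diff[of \<rho> h "trunc N h" r g] assms by simp
  ultimately show "\<exists>k. tate r k \<and> gauss_le r (acomp absv h g - k) e"
    by blast
qed (use assms in auto)

text \<open>With zero constant term only finitely many terms reach a given coefficient. This links
  local expansions to formal composition and formal inverses.\<close>

lemma acomp_eq_compose:
  assumes "g $ 0 = 0"
  shows "acomp absv h g = fps_compose h g"
proof (rule fps_ext)
  fix m
  have "ksums absv (\<lambda>n. h $ n * (g ^ n) $ m) (\<Sum>n<Suc m. h $ n * (g ^ n) $ m)"
    using startsby_zero_power_prefix[OF assms] by (intro ksums_finite) simp
  then show "acomp absv h g $ m = fps_compose h g $ m"
    unfolding acomp_def fps_nth_Abs_fps
    by (simp add: ksum_eqI fps_compose_nth lessThan_Suc_atMost atMost_atLeast0)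
qed

subsection \<open>Re-expansion at another centre\<close>

lemma gauss_le_shift: "absv c \<le> r \<Longrightarrow> gauss_le r (fps_X + fps_const c) r"
  using gauss_le_X_plus[of r c] order_trans[OF absv_nonneg, of c r] by (simp add: max_def split: if_splits)

lemma tate_shift [simp]: "tate r (fps_X + fps_const c)"
  by (rule tate_finite[of 2]) (auto simp: fps_X_def)

lemma expand_X [simp]: "expand absv fps_X c = fps_X + fps_const c"
  by (simp add: expand_def)

lemma expand_const [simp]: "expand absv (fps_const x) c = fps_const x"
  by (simp add: expand_def)

lemma expand_simple [simp]: "expand absv 0 c = 0" "expand absv 1 c = 1"
  "expand absv (fps_X ^ n) c = (fps_X + fps_const c) ^ n"
  by (simp_all add: expand_def)

lemma expand_zero [simp]: "expand absv h 0 = h"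
  by (simp add: expand_def acomp_eq_compose)

lemma evalk_eq_expand: "evalk absv h x = expand absv h x $ 0"
  by (simp add: evalk_def expand_def acomp_def fps_nth_power_0)

context
  fixes r c assumes r: "0 < r" and c: "absv c \<le> r"
begin

lemma expand_add: "tate r f \<Longrightarrow> tate r g \<Longrightarrow> expand absv (f + g) c = expand absv f c + expand absv g c"
  unfolding expand_def by (rule acomp_add[OF _ _ gauss_le_shift[OF c] r])

lemma expand_diff: "tate r f \<Longrightarrow> tate r g \<Longrightarrow> expand absv (f - g) c = expand absv f c - expand absv g c"
  unfolding expand_def by (rule acomp_diff[OF _ _ gauss_le_shift[OF c] r])

lemma expand_mult: "tate r f \<Longrightarrow> tate r g \<Longrightarrow> expand absv (f * g) c = expand absv f c * expand absv g c"
  unfolding expand_def by (rule acomp_mult[OF _ _ gauss_le_shift[OF c] r])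

lemma expand_cmult: "tate r f \<Longrightarrow> expand absv (fps_const x * f) c = fps_const x * expand absv f c"
  unfolding expand_def by (rule acomp_cmult[OF _ gauss_le_shift[OF c] r])

lemma expand_power: "tate r f \<Longrightarrow> expand absv (f ^ n) c = expand absv f c ^ n"
  unfolding expand_def by (rule acomp_power[OF _ gauss_le_shift[OF c] r])

lemma expand_sum: "(\<And>i. i \<in> I \<Longrightarrow> tate r (f i)) \<Longrightarrow> expand absv (\<Sum>i\<in>I. f i) c = (\<Sum>i\<in>I. expand absv (f i) c)"
  unfolding expand_def by (rule acomp_sum[OF _ gauss_le_shift[OF c] r])

lemma expand_prod: "(\<And>i. i \<in> I \<Longrightarrow> tate r (f i)) \<Longrightarrow> expand absv (\<Prod>i\<in>I. f i) c = (\<Prod>i\<in>I. expand absv (f i) c)"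
  unfolding expand_def by (rule acomp_prod[OF _ gauss_le_shift[OF c] r])

lemma expand_gauss: "tate r f \<Longrightarrow> gauss_le r f B \<Longrightarrow> gauss_le r (expand absv f c) B"
  unfolding expand_def by (rule acomp_gauss[OF _ _ gauss_le_shift[OF c] r])

lemma expand_tate: "tate r f \<Longrightarrow> tate r (expand absv f c)"
  unfolding expand_def by (rule acomp_tate[OF _ gauss_le_shift[OF c] r]) auto

text \<open>Both sides are additive and norm-bounded in \<open>h\<close>, and on monomials the claim
  is that \<open>expand\<close> respects scalars and powers.\<close>

lemma expand_acomp:
  assumes "tate \<rho> h" "gauss_le r f \<rho>" "tate r f"
  shows "expand absv (acomp absv h f) c = acomp absv h (expand absv f c)"
  using assms(1) r gauss_le_nonneg[OF assms(2)]
proof (rule tate_ext[where C = 1])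
  fix h1 h2 :: "'k fps" assume h: "tate \<rho> h1" "tate \<rho> h2"
  show "expand absv (acomp absv (h1 + h2) f) c = expand absv (acomp absv h1 f) c + expand absv (acomp absv h2 f) c"
    using h assms r by (simp add: acomp_add[of \<rho> _ _ r] expand_add acomp_tate)
  show "acomp absv (h1 + h2) (expand absv f c) = acomp absv h1 (expand absv f c) + acomp absv h2 (expand absv f c)"
    using h assms r by (intro acomp_add[of \<rho> _ _ r] expand_gauss)
next
  fix h B assume h: "tate \<rho> h" "gauss_le \<rho> h B"
  have "gauss_le r (expand absv (acomp absv h f) c) B"
    using h assms r by (intro expand_gauss acomp_tate acomp_gauss[of \<rho>])
  moreover have "gauss_le r (acomp absv h (expand absv f c)) B"
    using h assms r by (intro acomp_gauss[of \<rho>] expand_gauss)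
  ultimately show "gauss_le r (expand absv (acomp absv h f) c) (1 * B)"
    "gauss_le r (acomp absv h (expand absv f c)) (1 * B)" by simp_all
next
  fix x n
  show "expand absv (acomp absv (fps_const x * fps_X ^ n) f) c = acomp absv (fps_const x * fps_X ^ n) (expand absv f c)"
    using assms r by (simp add: expand_cmult expand_power tate_power)
qed auto

lemma acomp_expand:
  assumes "tate r h" "gauss_le r' g r" "0 < r'"
  shows "acomp absv (expand absv h c) g = acomp absv h (g + fps_const c)"
  using assms(1) assms(3) less_imp_le[OF r]
proof (rule tate_ext[where C = 1])
  have g: "gauss_le r' (g + fps_const c) r"
    using assms c by (intro gauss_le_add' gauss_le_const) auto
  {
    fix h1 h2 :: "'k fps" assume h: "tate r h1" "tate r h2"
    show "acomp absv (expand absv (h1 + h2) c) g = acomp absv (expand absv h1 c) g + acomp absv (expand absv h2 c) g"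
      using h assms by (simp add: expand_add acomp_add[of r _ _ r'] expand_tate)
    show "acomp absv (h1 + h2) (g + fps_const c) = acomp absv h1 (g + fps_const c) + acomp absv h2 (g + fps_const c)"
      using h assms g by (intro acomp_add[of r _ _ r'])
  }
  {
    fix h B assume h: "tate r h" "gauss_le r h B"
    have "gauss_le r' (acomp absv (expand absv h c) g) B"
      using h assms by (intro acomp_gauss[of r] expand_tate expand_gauss)
    moreover have "gauss_le r' (acomp absv h (g + fps_const c)) B"
      using h assms g by (intro acomp_gauss[of r])
    ultimately show "gauss_le r' (acomp absv (expand absv h c) g) (1 * B)"
      "gauss_le r' (acomp absv h (g + fps_const c)) (1 * B)" by simp_all
  }
  fix x n
  have "tate r ((fps_X + fps_const c) ^ n)"
    using r by (intro tate_power) auto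
  then have "acomp absv (expand absv (fps_const x * fps_X ^ n) c) g
     = fps_const x * acomp absv ((fps_X + fps_const c) ^ n) g"
    using tate_X_power_mult[of r 1 n] assms
    by (simp add: expand_cmult acomp_cmult[of r _ r'])
  also have "\<dots> = fps_const x * (g + fps_const c) ^ n"
    using assms by (simp add: acomp_power[of r _ r'] acomp_add[of r _ _ r'])
  finally show "acomp absv (expand absv (fps_const x * fps_X ^ n) c) g
     = acomp absv (fps_const x * fps_X ^ n) (g + fps_const c)"
    by simp
qed auto

end

lemma expand_expand:
  assumes "tate r h" "0 < r" "absv c \<le> r" "absv c' \<le> r"
  shows "expand absv (expand absv h c) c' = expand absv h (c + c')"
  using acomp_expand[OF assms(2,3,1) gauss_le_shift[OF assms(4)] assms(2)]
  by (simp add: expand_def add_ac fps_const_add[symmetric] del: fps_const_add)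

lemma expand_inverse:
  assumes "tate r h" "0 < r" "absv c \<le> r"
  shows "expand absv (expand absv h c) (- c) = h"
  using expand_expand[OF assms, of "- c"] assms by simp

lemma tate_deriv:
  assumes "tate r f" "0 < r"
  shows "tate r (fps_deriv f)"
proof -
  have "(\<lambda>n. absv (f $ Suc n) * r ^ Suc n / r) \<longlonglongrightarrow> 0 / r"
    using assms by (intro tendsto_divide tendsto_const LIMSEQ_Suc[of "\<lambda>n. absv (f $ n) * r ^ n"]) (auto simp: tate_def)
  then have lim: "(\<lambda>n. absv (f $ Suc n) * r ^ Suc n / r) \<longlonglongrightarrow> 0"
    by simp
  have le: "absv (fps_deriv f $ n) * r ^ n \<le> absv (f $ Suc n) * r ^ Suc n / r" for n
  proof -
    have "absv (of_nat (n + 1)) * absv (f $ (n + 1)) \<le> 1 * absv (f $ (n + 1))"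
      by (intro mult_right_mono absv_of_nat_le) auto
    then show ?thesis
      using assms(2) by (simp only: fps_deriv_nth absv_mult) (simp add: mult_right_mono)
  qed
  show ?thesis
    unfolding tate_def by (rule tendsto_null_le[OF lim _ le]) (use assms in auto)
qed

lemma gauss_le_deriv:
  assumes "gauss_le r f B" "0 < r"
  shows "gauss_le r (fps_deriv f) (1 / r * B)"
  unfolding gauss_le_def
proof
  fix n
  have "absv (of_nat (n + 1)) * absv (f $ (n + 1)) \<le> 1 * absv (f $ (n + 1))"
    by (intro mult_right_mono absv_of_nat_le) auto
  then have "absv (fps_deriv f $ n) * r ^ n \<le> absv (f $ Suc n) * r ^ n"
    using assms(2) by (simp only: fps_deriv_nth absv_mult) (simp add: mult_right_mono)
  also have "\<dots> \<le> 1 / r * B"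
    using gauss_leD[OF assms(1), of "Suc n"] assms(2) by (simp add: field_simps)
  finally show "absv (fps_deriv f $ n) * r ^ n \<le> 1 / r * B" .
qed

lemma expand_deriv:
  assumes "tate r f" "0 < r" "absv c \<le> r"
  shows "fps_deriv (expand absv f c) = expand absv (fps_deriv f) c"
  using assms(1,2) less_imp_le[OF assms(2)]
proof (rule tate_ext[where C = "1 / r"])
  fix h1 h2 :: "'k fps" assume "tate r h1" "tate r h2"
  then show "fps_deriv (expand absv (h1 + h2) c) = fps_deriv (expand absv h1 c) + fps_deriv (expand absv h2 c)"
    "expand absv (fps_deriv (h1 + h2)) c = expand absv (fps_deriv h1) c + expand absv (fps_deriv h2) c"
    using assms by (simp_all add: expand_add[of r] tate_deriv)
next
  fix h B assume "tate r h" "gauss_le r h B"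
  then show "gauss_le r (fps_deriv (expand absv h c)) (1 / r * B)"
    "gauss_le r (expand absv (fps_deriv h) c) (1 / r * B)"
    using assms by (auto intro!: gauss_le_deriv expand_gauss tate_deriv simp del: mult_1 times_divide_eq_left)
next
  fix x n
  have *: "fps_deriv (fps_const x * (fps_X + fps_const c) ^ n) = fps_const (x * of_nat n) * (fps_X + fps_const c) ^ (n - 1)" for c :: 'k
    by (simp add: fps_deriv_power mult_ac flip: fps_const_mult)
  have "fps_deriv (fps_const x * fps_X ^ n) = fps_const (x * of_nat n) * (fps_X :: 'k fps) ^ (n - 1)"
    using *[of 0] by simp
  moreover have "expand absv (fps_const x * fps_X ^ n) c = fps_const x * (fps_X + fps_const c) ^ n" for x n
    using assms tate_X_power_mult[of r 1 n] by (simp add: expand_cmult)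
  ultimately show "fps_deriv (expand absv (fps_const x * fps_X ^ n) c) = expand absv (fps_deriv (fps_const x * fps_X ^ n)) c"
    by (simp only: *)
qed (use assms in auto)

subsection \<open>Radii of convergence\<close>

text \<open>The radii of closed discs that exhaust the unit disc: all below 1 in the open case, 1
  included in the closed case. Statements about the analytic ring are thereby reduced to Tate
  algebras.\<close>

definition good :: "bool \<Rightarrow> real \<Rightarrow> bool" where
  "good cl r \<longleftrightarrow> 0 < r \<and> (if cl then r \<le> 1 else r < 1)"

text \<open>A radius \<open>r' < r\<close> need not be the absolute value of a point; density of the
  value group supplies a point between the two, where convergence gives the coefficient
  condition.\<close>

lemma conv_open_iff:
  assumes "0 < r" "r \<le> 1"
  shows "conv_open absv f r \<longleftrightarrow> (\<forall>r'. 0 < r' \<and> r' < r \<longrightarrow> tate r' f)"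
proof (intro iffI allI impI)
  fix r' assume *: "conv_open absv f r" "0 < r' \<and> r' < r"
  obtain x where x: "r' < absv x" "absv x < r"
    using ex_absv_between[of r' r] * assms by blast
  then have "ksummable absv (\<lambda>n. f $ n * x ^ n)"
    using * by (simp add: conv_open_def)
  then have "tate (absv x) f"
    by (simp add: ksummable_iff tate_def absv_mult absv_power)
  then show "tate r' f"
    using tate_radius x * by (meson less_imp_le)
next
  assume *: "\<forall>r'. 0 < r' \<and> r' < r \<longrightarrow> tate r' f"
  show "conv_open absv f r"
    unfolding conv_open_def
  proof (intro allI impI)
    fix x assume x: "absv x < r"
    have "0 < (absv x + r) / 2" "(absv x + r) / 2 < r"
      using assms(1) x add_nonneg_pos[OF absv_nonneg[of x] assms(1)] by simp_all
    then have "tate ((absv x + r) / 2) f"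
      using * by simp
    moreover have "absv x \<le> (absv x + r) / 2"
      using x by simp
    ultimately have "tate (absv x) f"
      using tate_radius by (meson absv_nonneg)
    then show "ksummable absv (\<lambda>n. f $ n * x ^ n)"
      by (simp add: ksummable_iff tate_def absv_mult absv_power)
  qed
qed

lemma conv_open_mono: "conv_open absv f r \<Longrightarrow> r' \<le> r \<Longrightarrow> conv_open absv f r'"
  by (auto simp: conv_open_def)

lemma Oring_iff: "f \<in> Oring absv cl \<longleftrightarrow> (\<forall>r. good cl r \<longrightarrow> tate r f)"
proof (cases cl)
  case True
  have "f \<in> Oring absv cl \<longleftrightarrow> tate 1 f"
  proof
    assume "f \<in> Oring absv cl"
    moreover have "1 \<in> udisc absv cl"
      using True by (simp add: udisc_def)
    ultimately have "ksummable absv (\<lambda>n. f $ n * 1 ^ n)"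
      unfolding Oring_def by blast
    then show "tate 1 f"
      by (simp add: ksummable_iff tate_def)
  next
    assume t: "tate 1 f"
    have "ksummable absv (\<lambda>n. f $ n * x ^ n)" if "absv x \<le> 1" for x
    proof -
      have "tate (absv x) f" using tate_radius[OF t _ that] by simp
      then show ?thesis
        by (simp add: ksummable_iff tate_def absv_mult absv_power)
    qed
    then show "f \<in> Oring absv cl"
      using True by (auto simp: Oring_def udisc_def)
  qed
  also have "\<dots> \<longleftrightarrow> (\<forall>r. good cl r \<longrightarrow> tate r f)"
    using True tate_radius[of 1 f] by (auto simp: good_def)
  finally show ?thesis .
next
  case False
  then have "f \<in> Oring absv cl \<longleftrightarrow> conv_open absv f 1"
    by (auto simp: Oring_def udisc_def conv_open_def)
  then show ?thesis
    using False conv_open_iff[of 1 f] by (auto simp: good_def)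
qed

lemma Rad_bounds: "0 \<le> Rad absv f" "Rad absv f \<le> 1"
proof -
  let ?S = "{r. 0 \<le> r \<and> r < 1 \<and> conv_open absv f r}"
  have 0: "0 \<in> ?S" by (auto simp: conv_open_def dest: order.strict_trans2[OF _ absv_nonneg])
  have "bdd_above ?S" by (auto intro: bdd_aboveI[of _ 1])
  then show "0 \<le> Rad absv f"
    unfolding Rad_def using 0 by (rule cSup_upper[rotated])
  show "Rad absv f \<le> 1"
    unfolding Rad_def using 0 by (intro cSup_least) (blast, simp)
qed

text \<open>Convergence on all smaller open discs gives convergence on their union, so the supremum
  is attained, even at 1, although the set defining \<open>Rad\<close> stops before it.\<close>

lemma Rad_ge_iff:
  assumes "0 < r" "r \<le> 1"
  shows "r \<le> Rad absv f \<longleftrightarrow> conv_open absv f r"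
proof
  let ?S = "{r. 0 \<le> r \<and> r < 1 \<and> conv_open absv f r}"
  have 0: "0 \<in> ?S" by (auto simp: conv_open_def dest: order.strict_trans2[OF _ absv_nonneg])
  have bdd: "bdd_above ?S" by (auto intro: bdd_aboveI[of _ 1])
  {
    assume *: "r \<le> Rad absv f"
    show "conv_open absv f r"
      unfolding conv_open_def
    proof (intro allI impI)
      fix x assume "absv x < r"
      then have "absv x < Sup ?S" using * by (simp add: Rad_def)
      then obtain r' where "r' \<in> ?S" "absv x < r'"
        using less_cSup_iff[OF _ bdd] 0 by blast
      then show "ksummable absv (\<lambda>n. f $ n * x ^ n)"
        by (simp add: conv_open_def)
    qed
  }
  {
    assume *: "conv_open absv f r"
    show "r \<le> Rad absv f"
    proof (rule dense_le_bounded[OF assms(1)])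
      fix w assume "0 < w" "w < r"
      then have "w \<in> ?S" using * assms conv_open_mono[of f r w] by simp
      then show "w \<le> Rad absv f"
        unfolding Rad_def using bdd by (rule cSup_upper)
    qed
  }
qed

text \<open>Later arguments on radii use this criterion. For \<open>n = 0\<close> it holds because
  the default value of \<open>Radv\<close> is 1.\<close>

lemma Radv_ge_iff:
  assumes "0 < r" "r \<le> 1"
  shows "r \<le> Radv absv n Z \<longleftrightarrow> (\<forall>p<n. conv_open absv (Z p) r)"
  using assms by (auto simp: Radv_def Rad_ge_iff Min_ge_iff lessThan_empty_iff)

lemma Radv_bounds: "0 \<le> Radv absv n Z" "Radv absv n Z \<le> 1"
proof -
  show "0 \<le> Radv absv n Z"
    by (auto simp: Radv_def Rad_bounds Min_ge_iff lessThan_empty_iff)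
  have "Min ((\<lambda>p. Rad absv (Z p)) ` {..<n}) \<le> Rad absv (Z 0)" if "n > 0"
    using that by (intro Min_le) auto
  moreover have "Rad absv (Z 0) \<le> 1"
    by (rule Rad_bounds)
  ultimately have "Min ((\<lambda>p. Rad absv (Z p)) ` {..<n}) \<le> 1" if "n > 0"
    using that order_trans by blast
  then show "Radv absv n Z \<le> 1"
    unfolding Radv_def by simp
qed

subsection \<open>Series dominated by their constant coefficient\<close>

text \<open>The constant term exceeds the rest by a uniform factor. Such series are invertible in
  the Tate algebra, and \<open>unit_imp_dom\<close> shows that there are no other units.\<close>

definition dominated :: "real \<Rightarrow> 'k fps \<Rightarrow> bool" where
  "dominated r K \<longleftrightarrow> tate r K \<and> K $ 0 \<noteq> 0 \<and>
     (\<exists>\<delta>. 0 < \<delta> \<and> \<delta> < 1 \<and> gauss_le r (K - fps_const (K $ 0)) (\<delta> * absv (K $ 0)))"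

lemma dominatedI:
  assumes "tate r K" "K $ 0 \<noteq> 0" "gauss_le r (K - fps_const (K $ 0)) (\<delta> * absv (K $ 0))" "\<delta> < 1"
  shows "dominated r K"
proof -
  have "gauss_le r (K - fps_const (K $ 0)) (max \<delta> (1 / 2) * absv (K $ 0))"
    by (rule gauss_le_mono[OF assms(3)]) (intro mult_right_mono, auto)
  then show ?thesis
    unfolding dominated_def using assms by (intro conjI exI[of _ "max \<delta> (1 / 2)"]) auto
qed

text \<open>The weights tend to zero, so beyond some index they stay below half the constant term;
  the finitely many remaining strict inequalities leave a uniform gap.\<close>

lemma dominated_strictI:
  assumes "tate r K" "0 < r" "K $ 0 \<noteq> 0" "\<And>n. n \<ge> 1 \<Longrightarrow> absv (K $ n) * r ^ n < absv (K $ 0)"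
  shows "dominated r K"
proof -
  define k where "k = absv (K $ 0)"
  have k: "k > 0" using assms by (simp add: k_def)
  have "eventually (\<lambda>n. absv (K $ n) * r ^ n < k / 2) sequentially"
    using assms k order_tendstoD(2)[of _ 0 sequentially "k/2"] unfolding tate_def by simp
  then obtain N where N: "\<And>n. n \<ge> N \<Longrightarrow> absv (K $ n) * r ^ n < k / 2"
    unfolding eventually_sequentially by blast
  define S where "S = insert (k / 2) ((\<lambda>n. absv (K $ n) * r ^ n) ` {1..<N})"
  have S: "finite S" "S \<noteq> {}" by (auto simp: S_def)
  have "\<And>n. n \<ge> 1 \<Longrightarrow> absv (K $ n) * r ^ n < k"
    using assms(4) by (simp add: k_def)
  then have "\<And>x. x \<in> S \<Longrightarrow> x < k"
    using k by (auto simp: S_def)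
  then have Mk: "Max S < k" using S by simp
  have "gauss_le r (K - fps_const (K $ 0)) (Max S)"
    unfolding gauss_le_def
  proof
    fix n
    consider "n = 0" | "n \<in> {1..<N}" | "n \<ge> N" "n \<ge> 1" by force
    then show "absv ((K - fps_const (K $ 0)) $ n) * r ^ n \<le> Max S"
    proof cases
      case 1
      have "k / 2 \<le> Max S" using S by (intro Max_ge) (auto simp: S_def)
      then show ?thesis using 1 k by simp
    next
      case 2
      then have "absv (K $ n) * r ^ n \<le> Max S" using S by (intro Max_ge) (auto simp: S_def)
      then show ?thesis using 2 by simp
    next
      case 3
      have "k / 2 \<le> Max S" using S by (intro Max_ge) (auto simp: S_def)
      then have "absv (K $ n) * r ^ n \<le> Max S" using N[OF 3(1)] by simp
      then show ?thesis using 3 by simp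
    qed
  qed
  then have "gauss_le r (K - fps_const (K $ 0)) (Max S / k * absv (K $ 0))"
    using k by (simp add: k_def)
  then show ?thesis
    using assms k Mk by (intro dominatedI[where \<delta> = "Max S / k"]) auto
qed

lemma dominated_tate: "dominated r K \<Longrightarrow> tate r K"
  and dominated_nz: "dominated r K \<Longrightarrow> K $ 0 \<noteq> 0"
  by (auto simp: dominated_def)

lemma dominated_gauss:
  assumes "dominated r K" "0 \<le> r"
  shows "gauss_le r K (absv (K $ 0))"
proof -
  obtain \<delta> where \<delta>: "\<delta> < 1" "gauss_le r (K - fps_const (K $ 0)) (\<delta> * absv (K $ 0))"
    using assms by (auto simp: dominated_def)
  have "\<delta> * absv (K $ 0) \<le> 1 * absv (K $ 0)"
    using \<delta>(1) by (intro mult_right_mono) auto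
  then have "gauss_le r (K - fps_const (K $ 0)) (absv (K $ 0))"
    using gauss_le_mono[OF \<delta>(2)] by simp
  from gauss_le_add'[OF this gauss_le_const[OF order_refl] assms(2)] show ?thesis by simp
qed

lemma dominated_const: "c \<noteq> 0 \<Longrightarrow> dominated r (fps_const c)"
  by (intro dominatedI[where \<delta> = "0"]) (auto simp: gauss_le_0)

lemma dominated_mult:
  assumes "dominated r K" "dominated r L" "0 \<le> r"
  shows "dominated r (K * L)"
proof -
  obtain \<delta> where \<delta>: "0 < \<delta>" "\<delta> < 1" "gauss_le r (K - fps_const (K $ 0)) (\<delta> * absv (K $ 0))"
    using assms by (auto simp: dominated_def)
  obtain \<epsilon> where \<epsilon>: "0 < \<epsilon>" "\<epsilon> < 1" "gauss_le r (L - fps_const (L $ 0)) (\<epsilon> * absv (L $ 0))"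
    using assms by (auto simp: dominated_def)
  have "K * L - fps_const ((K * L) $ 0)
     = (K - fps_const (K $ 0)) * L + fps_const (K $ 0) * (L - fps_const (L $ 0))"
    by (simp add: algebra_simps flip: fps_const_mult)
  moreover have "gauss_le r ((K - fps_const (K $ 0)) * L) (max \<delta> \<epsilon> * absv ((K * L) $ 0))"
    by (rule gauss_le_mono[OF gauss_le_mult[OF \<delta>(3) dominated_gauss[OF assms(2,3)] assms(3)]])
       (simp add: absv_mult mult.assoc mult_right_mono)
  moreover have "gauss_le r (fps_const (K $ 0) * (L - fps_const (L $ 0))) (max \<delta> \<epsilon> * absv ((K * L) $ 0))"
    by (rule gauss_le_mono[OF gauss_le_cmult[OF \<epsilon>(3)]])
       (simp add: absv_mult mult.left_commute mult_right_mono)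
  ultimately have "gauss_le r (K * L - fps_const ((K * L) $ 0)) (max \<delta> \<epsilon> * absv ((K * L) $ 0))"
    using gauss_le_add' assms(3) by simp
  then show ?thesis
    using \<delta> \<epsilon> assms by (intro dominatedI[where \<delta> = "max \<delta> \<epsilon>"]) (auto simp: tate_mult dominated_tate dominated_nz)
qed

lemma dominated_prod: "(\<And>i. i \<in> I \<Longrightarrow> dominated r (f i)) \<Longrightarrow> 0 \<le> r \<Longrightarrow> dominated r (\<Prod>i\<in>I. f i)"
  using dominated_const[of 1 r]
  by (induction I rule: infinite_finite_induct) (auto simp: dominated_mult)

lemma dominated_add:
  assumes "dominated r K" "tate r \<eta>" "gauss_le r \<eta> (\<epsilon> * absv (K $ 0))" "\<epsilon> < 1" "0 \<le> r"
  shows "dominated r (K + \<eta>)" "absv ((K + \<eta>) $ 0) = absv (K $ 0)"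
proof -
  obtain \<delta> where \<delta>: "0 < \<delta>" "\<delta> < 1" "gauss_le r (K - fps_const (K $ 0)) (\<delta> * absv (K $ 0))"
    using assms by (auto simp: dominated_def)
  have nz: "absv (K $ 0) > 0"
    using dominated_nz[OF assms(1)] by simp
  have "absv (\<eta> $ 0) \<le> \<epsilon> * absv (K $ 0)"
    using gauss_leD[OF assms(3), of 0] by simp
  also have "\<dots> < absv (K $ 0)"
    using nz assms(4) by simp
  finally have "absv (\<eta> $ 0 + K $ 0) = absv (K $ 0)"
    by (rule absv_add_eq)
  then show eq: "absv ((K + \<eta>) $ 0) = absv (K $ 0)"
    by (simp add: add.commute)
  have "gauss_le r (\<eta> - fps_const (\<eta> $ 0)) (\<epsilon> * absv (K $ 0))"
    using assms \<open>absv (\<eta> $ 0) \<le> _\<close> by (intro gauss_le_diff' gauss_le_const)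
  then have "gauss_le r (\<eta> - fps_const (\<eta> $ 0)) (max \<delta> \<epsilon> * absv (K $ 0))"
    by (rule gauss_le_mono) (simp add: mult_right_mono)
  moreover have "gauss_le r (K - fps_const (K $ 0)) (max \<delta> \<epsilon> * absv (K $ 0))"
    by (rule gauss_le_mono[OF \<delta>(3)]) (simp add: mult_right_mono)
  moreover have "K + \<eta> - fps_const ((K + \<eta>) $ 0) = (K - fps_const (K $ 0)) + (\<eta> - fps_const (\<eta> $ 0))"
    by (simp flip: fps_const_add)
  ultimately have "gauss_le r (K + \<eta> - fps_const ((K + \<eta>) $ 0)) (max \<delta> \<epsilon> * absv ((K + \<eta>) $ 0))"
    unfolding eq by (simp only: gauss_le_add'[OF _ _ assms(5)])
  moreover have "(K + \<eta>) $ 0 \<noteq> 0"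
    using eq nz by (metis absv_pos_iff)
  ultimately show "dominated r (K + \<eta>)"
    using assms \<delta> by (intro dominatedI[where \<delta> = "max \<delta> \<epsilon>"] tate_add) (auto simp: dominated_tate)
qed

lemma dominated_linear: "r < absv c \<Longrightarrow> 0 < r \<Longrightarrow> dominated r (fps_X + fps_const c)"
  by (rule dominatedI[where \<delta> = "r / absv c"]) (auto simp: gauss_le_X divide_less_eq)

text \<open>After scaling, \<open>K\<close> becomes \<open>1 + \<eta>\<close> with \<eta> of norm
  below 1, and the geometric series in \<open>- \<eta>\<close> converges in the Tate algebra. Its
  limit must be the formal inverse, and the bound on its tail after the first term gives
  dominance.\<close>

lemma dominated_inverse:
  assumes "dominated r K" "0 < r"
  shows "K * inverse K = 1" "dominated r (inverse K)"
proof -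
  show KI: "K * inverse K = 1"
    using inverse_mult_eq_1[OF dominated_nz[OF assms(1)]] by (simp add: mult.commute)
  obtain \<delta> where \<delta>: "0 < \<delta>" "\<delta> < 1" "gauss_le r (K - fps_const (K $ 0)) (\<delta> * absv (K $ 0))"
    using assms by (auto simp: dominated_def)
  have nz: "K $ 0 \<noteq> 0" "absv (K $ 0) > 0"
    using dominated_nz[OF assms(1)] by simp_all
  define \<eta> where "\<eta> = fps_const (inverse (K $ 0)) * (K - fps_const (K $ 0))"
  have K: "K = fps_const (K $ 0) * (1 + \<eta>)"
    using nz by (simp add: \<eta>_def algebra_simps flip: mult.assoc)
  have unit: "absv (inverse (K $ 0)) * (\<delta> * absv (K $ 0)) = \<delta>"
    using nz by (simp add: absv_inverse)
  have \<eta>: "gauss_le r \<eta> \<delta>" "tate r \<eta>"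
    using gauss_le_cmult[OF \<delta>(3), of "inverse (K $ 0)", unfolded unit] assms dominated_tate[OF assms(1)]
    by (auto simp: \<eta>_def intro!: tate_cmult tate_diff)
  have "gauss_le r ((- \<eta>) ^ k) (1 * \<delta> ^ k)" "tate r ((- \<eta>) ^ k)" for k
    using gauss_le_power[of r "- \<eta>" \<delta> k] tate_power[of r "-\<eta>" k] \<eta> assms by simp_all
  then obtain S where S: "tate r S" "\<And>K. gauss_le r (S - (\<Sum>k<K. (- \<eta>) ^ k)) (1 * \<delta> ^ K)"
    using tate_complete[of r "\<lambda>k. (- \<eta>) ^ k" 1 \<delta>] \<delta> assms by (metis less_imp_le)
  have "(1 + \<eta>) * S - 1 = 0"
  proof (rule gauss_le_eq_0)
    fix e :: real assume e: "e > 0"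
    obtain k where k: "\<delta> ^ k < e"
      using real_arch_pow_inv e \<delta> by blast
    have geo: "(1 + \<eta>) * (\<Sum>k<k. (- \<eta>) ^ k) = 1 - (- \<eta>) ^ k"
      using one_diff_power_eq[of "- \<eta>" k] by simp
    have "(1 + \<eta>) * S - 1 = (1 + \<eta>) * (S - (\<Sum>k<k. (- \<eta>) ^ k)) - (- \<eta>) ^ k"
      unfolding right_diff_distrib geo by simp
    moreover have "gauss_le r (1 + \<eta>) 1"
      using \<eta>(1) \<delta> assms by (intro gauss_le_add' gauss_le_1) (auto intro: gauss_le_mono)
    then have "gauss_le r ((1 + \<eta>) * (S - (\<Sum>k<k. (- \<eta>) ^ k))) (1 * (1 * \<delta> ^ k))"
      using S(2) assms by (intro gauss_le_mult) auto
    moreover have "gauss_le r ((- \<eta>) ^ k) (1 * (1 * \<delta> ^ k))"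
      using gauss_le_power[of r "- \<eta>" \<delta> k] \<eta> assms by simp
    ultimately have "gauss_le r ((1 + \<eta>) * S - 1) (1 * (1 * \<delta> ^ k))"
      using gauss_le_diff' assms by simp
    then show "gauss_le r ((1 + \<eta>) * S - 1) e"
      by (rule gauss_le_mono) (use k in simp)
  qed (use assms in auto)
  then have 1: "(1 + \<eta>) * S = 1" by simp
  have "\<eta> $ 0 = 0" by (simp add: \<eta>_def)
  then have S0: "S $ 0 = 1"
    using arg_cong[OF 1, of "\<lambda>f. f $ 0"] by simp
  have "K * (fps_const (inverse (K $ 0)) * S) = (fps_const (K $ 0) * fps_const (inverse (K $ 0))) * ((1 + \<eta>) * S)"
    by (subst K) (simp only: mult_ac)
  also have "\<dots> = 1"
    using nz by (simp add: 1)
  finally have "K * (fps_const (inverse (K $ 0)) * S) = K * inverse K"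
    using KI by simp
  then have inv: "inverse K = fps_const (inverse (K $ 0)) * S"
    using nz by auto
  have "gauss_le r (S - 1) \<delta>"
    using S(2)[of 1] by simp
  from gauss_le_cmult[OF this, of "inverse (K $ 0)"]
  have "gauss_le r (inverse K - fps_const (inverse K $ 0)) (\<delta> * absv (inverse K $ 0))"
    unfolding inv using S0 by (simp add: algebra_simps)
  then show "dominated r (inverse K)"
    using \<delta> nz S(1) inv S0 by (intro dominatedI[where \<delta> = \<delta>]) (auto simp: tate_cmult)
qed

text \<open>The weights tend to zero while one of them is positive, so the maximum is attained, and
  only finitely often; taking the last place makes the later inequalities strict.\<close>

lemma last_max_index:
  assumes "tate r f" "0 < r" "f \<noteq> 0"
  obtains N where "f $ N \<noteq> 0" "\<And>n. absv (f $ n) * r ^ n \<le> absv (f $ N) * r ^ N"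
    "\<And>n. n > N \<Longrightarrow> absv (f $ n) * r ^ n < absv (f $ N) * r ^ N"
proof -
  obtain m where m: "f $ m \<noteq> 0" using assms(3) by (auto simp: fps_eq_iff)
  define w where "w n = absv (f $ n) * r ^ n" for n
  have wm: "w m > 0" using m assms by (simp add: w_def)
  have "eventually (\<lambda>n. w n < w m) sequentially"
    using assms(1) wm order_tendstoD(2)[of w 0 sequentially "w m"] unfolding tate_def w_def by simp
  then obtain K where K: "\<And>n. n \<ge> K \<Longrightarrow> w n < w m"
    unfolding eventually_sequentially by blast
  have mK: "m < K" using K[of m] by (meson less_irrefl not_le)
  define M where "M = Max (w ` {..<K})"
  have M: "w n \<le> M" if "n < K" for n unfolding M_def using that by (intro Max_ge) auto
  have "M \<in> w ` {..<K}" unfolding M_def using mK by (intro Max_in) auto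
  then have ex: "\<exists>n<K. w n = M" by auto
  define S where "S = {n. n < K \<and> w n = M}"
  have S: "finite S" "S \<noteq> {}" using ex by (auto simp: S_def)
  define N where "N = Max S"
  have N: "N < K" "w N = M" using Max_in[OF S] by (auto simp: S_def N_def)
  have le: "w n \<le> w N" for n
    using M[of n] M[OF mK] K[of n] N by (cases "n < K") auto
  have lt: "w n < w N" if "n > N" for n
  proof (cases "n < K")
    case True
    have "w n \<noteq> M"
    proof
      assume "w n = M"
      then have "n \<in> S" using True by (simp add: S_def)
      then have "n \<le> N" unfolding N_def using S by (intro Max_ge)
      then show False using that by simp
    qed
    then show ?thesis using M[OF True] N by simp
  next
    case False
    then show ?thesis using K[of n] M[OF mK] N by simp
  qed
  have "f $ N \<noteq> 0"
    using le[of m] wm by (auto simp: w_def)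
  then show ?thesis
    using that[of N] le lt by (simp add: w_def)
qed

text \<open>The product of the last coefficients of maximal weight cannot cancel.\<close>

lemma unit_imp_dom:
  assumes "tate r h" "tate r q" "h * q = 1" "0 < r"
  shows "dominated r h"
proof -
  have "h \<noteq> 0" "q \<noteq> 0" using assms(3) by auto
  obtain N where N: "h $ N \<noteq> 0" "\<And>n. absv (h $ n) * r ^ n \<le> absv (h $ N) * r ^ N"
    "\<And>n. n > N \<Longrightarrow> absv (h $ n) * r ^ n < absv (h $ N) * r ^ N"
    using last_max_index[OF assms(1,4) \<open>h \<noteq> 0\<close>] by blast
  obtain M where M: "q $ M \<noteq> 0" "\<And>n. absv (q $ n) * r ^ n \<le> absv (q $ M) * r ^ M"
    "\<And>n. n > M \<Longrightarrow> absv (q $ n) * r ^ n < absv (q $ M) * r ^ M"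
    using last_max_index[OF assms(2,4) \<open>q \<noteq> 0\<close>] by blast
  \<comment> \<open>If \<open>i\<close> differs from \<open>N\<close>, then either
    \<open>i > N\<close> or the complementary index exceeds \<open>M\<close>, so one factor is
    strictly below its maximum.\<close>
  have lt: "absv (h $ i * q $ (N + M - i)) < absv (h $ N * q $ M)" if "i \<le> N + M" "i \<noteq> N" for i
  proof -
    define j where "j = N + M - i"
    have ij: "r ^ i * r ^ j = r ^ N * r ^ M" "i > N \<or> j > M"
      using that by (auto simp: j_def simp flip: power_add)
    have pos: "absv (h $ N) * r ^ N > 0" "absv (q $ M) * r ^ M > 0"
      using N M assms by simp_all
    have "(absv (h $ i) * r ^ i) * (absv (q $ j) * r ^ j) < (absv (h $ N) * r ^ N) * (absv (q $ M) * r ^ M)"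
      using ij(2)
    proof
      assume "i > N"
      then have "(absv (h $ i) * r ^ i) * (absv (q $ j) * r ^ j) \<le> (absv (h $ i) * r ^ i) * (absv (q $ M) * r ^ M)"
        using M(2)[of j] assms(4) by (intro mult_left_mono) auto
      also have "\<dots> < (absv (h $ N) * r ^ N) * (absv (q $ M) * r ^ M)"
        using N(3)[OF \<open>i > N\<close>] pos by (intro mult_strict_right_mono)
      finally show ?thesis .
    next
      assume "j > M"
      then have "(absv (h $ i) * r ^ i) * (absv (q $ j) * r ^ j) \<le> (absv (h $ N) * r ^ N) * (absv (q $ j) * r ^ j)"
        using N(2)[of i] assms(4) by (intro mult_right_mono) auto
      also have "\<dots> < (absv (h $ N) * r ^ N) * (absv (q $ M) * r ^ M)"
        using M(3)[OF \<open>j > M\<close>] pos by (intro mult_strict_left_mono)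
      finally show ?thesis .
    qed
    then have "(absv (h $ i) * absv (q $ j)) * (r ^ i * r ^ j) < (absv (h $ N) * absv (q $ M)) * (r ^ N * r ^ M)"
      by (simp add: mult_ac)
    then have "(absv (h $ i) * absv (q $ j)) * (r ^ N * r ^ M) < (absv (h $ N) * absv (q $ M)) * (r ^ N * r ^ M)"
      unfolding ij(1) .
    then show ?thesis
      using assms(4) by (simp add: absv_mult j_def)
  qed
  have "(h * q) $ (N + M) \<noteq> 0"
  proof -
    have fin: "finite {0..N + M}" by simp
    have NI: "N \<in> {0..N + M}" by simp
    have "(h * q) $ (N + M) = h $ N * q $ M + (\<Sum>i\<in>{0..N+M} - {N}. h $ i * q $ (N + M - i))"
      unfolding fps_mult_nth by (subst sum.remove[OF fin NI]) simp
    moreover have "absv (\<Sum>i\<in>{0..N+M} - {N}. h $ i * q $ (N + M - i)) < absv (h $ N * q $ M)"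
    proof (cases "{0..N+M} - {N} = {}")
      case True
      then show ?thesis using N(1) M(1) by (simp only: True sum.empty) simp
    next
      case False
      let ?A = "(\<lambda>i. absv (h $ i * q $ (N + M - i))) ` ({0..N+M} - {N})"
      have "absv (\<Sum>i\<in>{0..N+M} - {N}. h $ i * q $ (N + M - i)) \<le> Max ?A"
        by (rule absv_sum_le) (use False in \<open>auto intro!: Max_ge simp: Max_ge_iff\<close>)
      also have "Max ?A < absv (h $ N * q $ M)"
        using False lt by (subst Max_less_iff) auto
      finally show ?thesis .
    qed
    ultimately have "absv ((h * q) $ (N + M)) = absv (h $ N * q $ M)"
      using absv_add_eq[of "\<Sum>i\<in>{0..N+M} - {N}. h $ i * q $ (N + M - i)" "h $ N * q $ M"]
      by (simp only: add.commute[of "h $ N * q $ M"])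
    then show ?thesis using N(1) M(1) by (metis absv_eq_0_iff mult_eq_0_iff)
  qed
  \<comment> \<open>The product is 1 and has a nonzero coefficient at \<open>N + M\<close>. With
    \<open>N = 0\<close> the constant term of \<open>h\<close> is strictly the largest.\<close>
  then have "N + M = 0" using assms(3) by (auto simp: fps_one_nth split: if_splits)
  then show ?thesis
    using N assms by (intro dominated_strictI) auto
qed

subsection \<open>Weierstrass division\<close>

lemma expand_degree:
  assumes "\<And>n. n \<ge> D \<Longrightarrow> h $ n = 0" "m \<ge> D"
  shows "expand absv h c $ m = 0"
proof -
  have pow: "((fps_X + fps_const c) ^ n) $ m = 0" if "m > n" for n m
    using that
  proof (induction n arbitrary: m)
    case (Suc n)
    then obtain m' where "m = Suc m'" by (cases m) auto
    with Suc show ?case by (simp add: distrib_right)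
  qed auto
  have "h $ n * ((fps_X + fps_const c) ^ n) $ m = 0" for n
    using assms pow[of n m] by (cases "n \<ge> D") auto
  then have "(\<lambda>n. h $ n * ((fps_X + fps_const c) ^ n) $ m) = (\<lambda>n. 0)"
    by auto
  then show ?thesis
    using ksum_eqI[OF ksums_finite[of 0 "\<lambda>n. 0"]]
    by (simp add: expand_def acomp_def)
qed

text \<open>Newton basis polynomials with nodes \<alpha>. Nodes inside the disc bound the Gauss norm
  by \<open>r ^ l\<close>, and division proceeds one linear factor at a time.\<close>

definition newton :: "(nat \<Rightarrow> 'k) \<Rightarrow> nat \<Rightarrow> 'k fps" where
  "newton \<alpha> l = (\<Prod>m<l. fps_X - fps_const (\<alpha> m))"

lemma gauss_le_shift': "absv c \<le> r \<Longrightarrow> gauss_le r (fps_X - fps_const c) r"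
  using gauss_le_shift[of "- c" r] by (simp flip: fps_const_neg)

lemma tate_shift' [simp]: "tate r (fps_X - fps_const c)"
  using tate_shift[of r "- c"] by (simp flip: fps_const_neg)

lemma newton_tate: "0 \<le> r \<Longrightarrow> tate r (newton \<alpha> l)"
  unfolding newton_def by (intro tate_prod) auto

lemma newton_gauss: "0 \<le> r \<Longrightarrow> (\<And>m. m < l \<Longrightarrow> absv (\<alpha> m) \<le> r) \<Longrightarrow> gauss_le r (newton \<alpha> l) (r ^ l)"
  unfolding newton_def using gauss_le_prod[of "{..<l}" r "\<lambda>m. fps_X - fps_const (\<alpha> m)" "\<lambda>_. r"]
  by (simp add: gauss_le_shift')

text \<open>Moving \<alpha> to the origin turns division into a shift of coefficients, at the cost
  of a factor \<open>1 / r\<close>. The last clause records that the degree bound of a polynomial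
  drops, which drives the induction in \<open>weierstrass_polynomial\<close>.\<close>

lemma linear_division:
  assumes "tate r y" "gauss_le r y B" "absv \<alpha> \<le> r" "0 < r"
  obtains c y1 where "y = fps_const c + (fps_X - fps_const \<alpha>) * y1" "tate r y1" "gauss_le r y1 (B / r)"
    "absv c \<le> B" "\<And>D n. (\<And>n. n \<ge> D \<Longrightarrow> y $ n = 0) \<Longrightarrow> n \<ge> D - 1 \<Longrightarrow> y1 $ n = 0"
proof -
  define z where "z = expand absv y \<alpha>"
  define s where "s = fps_shift 1 z"
  have z: "tate r z" "gauss_le r z B"
    unfolding z_def using assms by (auto intro: expand_tate expand_gauss)
  have zs: "z = fps_const (z $ 0) + fps_X * s"
    by (rule fps_ext) (auto simp: s_def fps_X_mult_nth)
  have s: "gauss_le r s (B / r)" "tate r s"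
  proof -
    have "absv (s $ n) * r ^ n \<le> B / r" for n
      using gauss_leD[OF z(2), of "Suc n"] assms(4) by (simp add: s_def field_simps)
    then show "gauss_le r s (B / r)" by (simp add: gauss_le_def)
    have "(\<lambda>n. absv (z $ Suc n) * r ^ Suc n / r) \<longlonglongrightarrow> 0 / r"
      using z assms by (intro tendsto_divide tendsto_const LIMSEQ_Suc[of "\<lambda>n. absv (z $ n) * r ^ n"]) (auto simp: tate_def)
    then show "tate r s"
      using assms(4) by (simp add: tate_def s_def mult_ac)
  qed
  define y1 where "y1 = expand absv s (- \<alpha>)"
  have "y = expand absv z (- \<alpha>)"
    unfolding z_def using expand_inverse assms by simp
  also have "\<dots> = fps_const (z $ 0) + (fps_X - fps_const \<alpha>) * y1"
    using assms s by (subst zs)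
      (simp add: expand_add[of r] expand_mult[of r] tate_X_mult y1_def flip: fps_const_neg)
  finally have "y = fps_const (z $ 0) + (fps_X - fps_const \<alpha>) * y1" .
  moreover have "tate r y1" "gauss_le r y1 (B / r)"
    unfolding y1_def using s assms by (auto intro: expand_tate expand_gauss)
  moreover have "absv (z $ 0) \<le> B"
    using gauss_leD[OF z(2), of 0] by simp
  moreover have "y1 $ n = 0" if D: "\<And>n. n \<ge> D \<Longrightarrow> y $ n = 0" and n: "n \<ge> D - 1" for D n
  proof -
    have "z $ n = 0" if "n \<ge> D" for n
      unfolding z_def by (rule expand_degree[OF D that])
    then have "s $ n = 0" if "n \<ge> D - 1" for n
      using that by (simp add: s_def)
    then show ?thesis
      unfolding y1_def by (rule expand_degree[OF _ n])
  qed
  ultimately show ?thesis using that by blast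
qed

lemma newton_division:
  assumes "tate r y" "gauss_le r y B" "\<And>m. m < e \<Longrightarrow> absv (\<alpha> m) \<le> r" "0 < r"
  shows "\<exists>c y1. y = (\<Sum>l<e. fps_const (c l) * newton \<alpha> l) + newton \<alpha> e * y1 \<and> tate r y1 \<and>
     gauss_le r y1 (B / r ^ e) \<and> (\<forall>l<e. absv (c l) \<le> B / r ^ l) \<and>
     (\<forall>D. (\<forall>n\<ge>D. y $ n = 0) \<longrightarrow> (\<forall>n\<ge>D - e. y1 $ n = 0))"
  using assms(3)
proof (induction e)
  case 0
  then show ?case
    using assms(1,2) by (intro exI[of _ "\<lambda>_. 0"] exI[of _ y]) (simp add: newton_def)
next
  case (Suc e)
  then obtain c y1 where y1: "y = (\<Sum>l<e. fps_const (c l) * newton \<alpha> l) + newton \<alpha> e * y1" "tate r y1"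
     "gauss_le r y1 (B / r ^ e)" "\<forall>l<e. absv (c l) \<le> B / r ^ l"
     "\<And>D. \<forall>n\<ge>D. y $ n = 0 \<Longrightarrow> \<forall>n\<ge>D - e. y1 $ n = 0"
    using Suc.IH[OF Suc.prems[OF less_SucI]] by blast
  obtain c' y2 where y2: "y1 = fps_const c' + (fps_X - fps_const (\<alpha> e)) * y2" "tate r y2"
    "gauss_le r y2 (B / r ^ e / r)" "absv c' \<le> B / r ^ e"
    "\<And>D n. (\<And>n. n \<ge> D \<Longrightarrow> y1 $ n = 0) \<Longrightarrow> n \<ge> D - 1 \<Longrightarrow> y2 $ n = 0"
    using linear_division[OF y1(2,3), of "\<alpha> e"] Suc.prems assms(4) by blast
  define c2 where "c2 = c(e := c')"
  have c2: "c2 l = c l" if "l < e" for l using that by (simp add: c2_def)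
  have nw: "newton \<alpha> (Suc e) = newton \<alpha> e * (fps_X - fps_const (\<alpha> e))"
    by (simp add: newton_def)
  have "y = (\<Sum>l<e. fps_const (c l) * newton \<alpha> l) + newton \<alpha> e * (fps_const c' + (fps_X - fps_const (\<alpha> e)) * y2)"
    using y1(1) y2(1) by simp
  also have "\<dots> = (\<Sum>l<Suc e. fps_const (c2 l) * newton \<alpha> l) + newton \<alpha> (Suc e) * y2"
    by (simp add: c2 nw algebra_simps) (simp add: c2_def)
  finally have "y = (\<Sum>l<Suc e. fps_const (c2 l) * newton \<alpha> l) + newton \<alpha> (Suc e) * y2" .
  moreover have "\<forall>l<Suc e. absv (c2 l) \<le> B / r ^ l"
    using y1(4) y2(4) by (auto simp: c2_def less_Suc_eq)
  moreover have "gauss_le r y2 (B / r ^ Suc e)"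
    using y2(3) by (simp add: mult.commute)
  moreover have "\<forall>n\<ge>D - Suc e. y2 $ n = 0" if "\<forall>n\<ge>D. y $ n = 0" for D
    using y2(5)[of "D - e"] y1(5)[OF that] by simp
  ultimately show ?case
    using y2(2) by (intro exI[of _ c2] exI[of _ y2]) simp
qed

context
  fixes r :: real and e :: nat and \<alpha> :: "nat \<Rightarrow> 'k" and K :: "'k fps" and g :: "'k fps" and \<kappa> \<phi> :: real
  assumes r: "0 < r" and e: "0 < e" and \<alpha>: "\<And>m. m < e \<Longrightarrow> absv (\<alpha> m) \<le> r" and K: "dominated r K"
  defines "g \<equiv> newton \<alpha> e * K" and "\<kappa> \<equiv> absv (K $ 0)" and "\<phi> \<equiv> r ^ e * \<kappa>"
begin

lemma weierstrass_pos: "\<kappa> > 0" "\<phi> > 0"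
  using dominated_nz[OF K] r by (auto simp: \<kappa>_def \<phi>_def)

text \<open>The divisor \<open>g\<close> is in prepared form: a Newton polynomial with
  \<open>e\<close> roots in the disc times a unit \<open>K\<close>. Thus \<phi> is the radius
  downstairs: substituting \<open>g\<close> sends series converging on \<phi> to series converging
  on \<open>r\<close>.\<close>

lemma weierstrass_gauss: "gauss_le r g \<phi>"
  unfolding g_def \<phi>_def \<kappa>_def using r \<alpha> K
  by (intro gauss_le_mult newton_gauss dominated_gauss) auto

lemma weierstrass_tate: "tate r g"
  unfolding g_def using r K by (intro tate_mult newton_tate dominated_tate) auto

text \<open>Divide by the Newton polynomial; the quotient has smaller degree, so induction
  represents it. The Newton polynomial equals \<open>g * inverse K\<close>, and replacing
  \<open>inverse K\<close> by its constant term costs a factor \<delta>. Errors combine by a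
  maximum, so they do not accumulate.\<close>

lemma weierstrass_polynomial:
  assumes \<delta>: "gauss_le r (inverse K - fps_const (inverse (K $ 0))) (\<delta> / \<kappa>)"
    and y: "tate r y" "gauss_le r y B" "\<And>n. n \<ge> D \<Longrightarrow> y $ n = 0"
  shows "\<exists>z y'. (\<forall>l<e. tate \<phi> (z l) \<and> gauss_le \<phi> (z l) (B / r ^ l)) \<and>
     tate r y' \<and> gauss_le r y' (\<delta> * B) \<and> y = (\<Sum>l<e. acomp absv (z l) g * newton \<alpha> l) + y'"
  using y
proof (induction D arbitrary: y B rule: less_induct)
  case (less D y B)
  have B0: "0 \<le> B" using less.prems(2) by (rule gauss_le_nonneg)
  have \<delta>0: "0 \<le> \<delta>"
    using gauss_le_nonneg[OF \<delta>] weierstrass_pos by (simp add: zero_le_divide_iff)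
  note gg = weierstrass_gauss r
  show ?case
  proof (cases "D = 0")
    case True
    then have "y = 0" using less.prems(3) by (intro fps_ext) auto
    then show ?thesis
      using B0 \<delta>0 r by (intro exI[of _ "\<lambda>_. 0"] exI[of _ 0]) (auto simp: gauss_le_0)
  next
    case False
    obtain c y1 where y1: "y = (\<Sum>l<e. fps_const (c l) * newton \<alpha> l) + newton \<alpha> e * y1" "tate r y1"
     "gauss_le r y1 (B / r ^ e)" "\<forall>l<e. absv (c l) \<le> B / r ^ l"
     "\<And>D. \<forall>n\<ge>D. y $ n = 0 \<Longrightarrow> \<forall>n\<ge>D - e. y1 $ n = 0"
      using newton_division[where \<alpha> = \<alpha> and e = e, OF less.prems(1,2) \<alpha> r] by blast
    have "D - e < D" using False e by simp
    from less.IH[OF this y1(2,3)] y1(5) less.prems(3)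
    obtain z1 y1' where z1: "\<And>l. l < e \<Longrightarrow> tate \<phi> (z1 l)" "\<And>l. l < e \<Longrightarrow> gauss_le \<phi> (z1 l) (B / r ^ e / r ^ l)"
       "tate r y1'" "gauss_le r y1' (\<delta> * (B / r ^ e))" "y1 = (\<Sum>l<e. acomp absv (z1 l) g * newton \<alpha> l) + y1'"
      by blast
    define i where "i = inverse (K $ 0)"
    \<comment> \<open>Multiplication by \<open>i * g\<close> upstairs is multiplication by
      \<open>i * X\<close> on the coefficients.\<close>
    define z where "z l = fps_const (c l) + fps_const i * (fps_X * z1 l)" for l
    define y' where "y' = fps_const i * (g * y1') + g * (inverse K - fps_const i) * y1"
    have ai: "absv i = 1 / \<kappa>" by (simp add: i_def absv_inverse \<kappa>_def divide_inverse)
    have "newton \<alpha> e = g * inverse K"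
      using dominated_inverse(1)[OF K r] by (simp add: g_def mult.assoc)
    then have eq: "newton \<alpha> e * y1 = fps_const i * (g * y1) + g * (inverse K - fps_const i) * y1"
      by (simp add: algebra_simps)
    have az: "acomp absv (z l) g = fps_const (c l) + fps_const i * (g * acomp absv (z1 l) g)" if "l < e" for l
      unfolding z_def using z1(1)[OF that] gg
      by (simp add: acomp_add[of \<phi> _ _ r] acomp_cmult[of \<phi> _ r] acomp_mult[of \<phi> _ _ r] tate_X_mult tate_cmult)
    have "y = (\<Sum>l<e. fps_const (c l) * newton \<alpha> l) + (fps_const i * (g * y1) + g * (inverse K - fps_const i) * y1)"
      using y1(1) eq by simp
    also have "fps_const i * (g * y1) = (\<Sum>l<e. fps_const i * (g * acomp absv (z1 l) g) * newton \<alpha> l) + fps_const i * (g * y1')"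
      by (subst z1(5)) (simp add: distrib_left sum_distrib_left mult.assoc)
    finally have "y = (\<Sum>l<e. (fps_const (c l) + fps_const i * (g * acomp absv (z1 l) g)) * newton \<alpha> l) + y'"
      by (simp add: y'_def distrib_right sum.distrib)
    then have "y = (\<Sum>l<e. acomp absv (z l) g * newton \<alpha> l) + y'"
      by (simp add: az)
    moreover have "tate \<phi> (z l)" "gauss_le \<phi> (z l) (B / r ^ l)" if "l < e" for l
    proof -
      show "tate \<phi> (z l)"
        unfolding z_def using z1(1)[OF that] weierstrass_pos
        by (intro tate_add tate_cmult tate_X_mult tate_const) auto
      have "gauss_le \<phi> (fps_const i * (fps_X * z1 l)) (absv i * (\<phi> * (B / r ^ e / r ^ l)))"
        using weierstrass_pos z1(2)[OF that] by (intro gauss_le_cmult gauss_le_mult gauss_le_X) auto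
      also have "absv i * (\<phi> * (B / r ^ e / r ^ l)) = B / r ^ l"
        using weierstrass_pos r by (simp add: ai \<phi>_def)
      finally show "gauss_le \<phi> (z l) (B / r ^ l)"
        unfolding z_def using weierstrass_pos y1(4) that by (intro gauss_le_add' gauss_le_const) auto
    qed
    moreover have "tate r y'"
      unfolding y'_def using z1(3) y1(2) weierstrass_tate r dominated_tate[OF dominated_inverse(2)[OF K r]]
      by (intro tate_add tate_cmult tate_mult tate_diff tate_const) auto
    moreover have "gauss_le r y' (\<delta> * B)"
    proof -
      have "gauss_le r (fps_const i * (g * y1')) (absv i * (\<phi> * (\<delta> * (B / r ^ e))))"
        using gg z1(4) by (intro gauss_le_cmult gauss_le_mult) auto
      also have "absv i * (\<phi> * (\<delta> * (B / r ^ e))) = \<delta> * B"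
        using weierstrass_pos r by (simp add: ai \<phi>_def)
      finally have 1: "gauss_le r (fps_const i * (g * y1')) (\<delta> * B)" .
      have "gauss_le r (g * (inverse K - fps_const i) * y1) (\<phi> * (\<delta> / \<kappa>) * (B / r ^ e))"
        using gg \<delta> y1(3) by (intro gauss_le_mult) (auto simp: i_def)
      also have "\<phi> * (\<delta> / \<kappa>) * (B / r ^ e) = \<delta> * B"
        using weierstrass_pos r by (simp add: \<phi>_def)
      finally show ?thesis
        unfolding y'_def using 1 r by (intro gauss_le_add') auto
    qed
    ultimately show ?thesis by blast
  qed
qed

text \<open>A general \<open>y\<close> is truncated with error \<open>\<delta> * B\<close>, and the
  truncation is represented with an error of the same size. Iterating on the remainder contracts it
  by \<delta> each time, and the coefficients sum geometrically.\<close>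

theorem weierstrass_basis:
  assumes y: "tate r y" "gauss_le r y B" "0 < B"
  obtains z where "\<And>l. l < e \<Longrightarrow> tate \<phi> (z l)" "\<And>l. l < e \<Longrightarrow> gauss_le \<phi> (z l) (B / r ^ l)"
    "y = (\<Sum>l<e. acomp absv (z l) g * newton \<alpha> l)"
proof -
  obtain \<delta> where \<delta>: "0 < \<delta>" "\<delta> < 1" "gauss_le r (inverse K - fps_const (inverse K $ 0)) (\<delta> * absv (inverse K $ 0))"
    using dominated_inverse(2)[OF K r] by (auto simp: dominated_def)
  then have \<delta>': "gauss_le r (inverse K - fps_const (inverse (K $ 0))) (\<delta> / \<kappa>)"
    by (simp add: absv_inverse \<kappa>_def divide_inverse)
  note gg = weierstrass_gauss r
  have step: "\<exists>z y'. (\<forall>l<e. tate \<phi> (z l) \<and> gauss_le \<phi> (z l) (B / r ^ l)) \<and>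
     tate r y' \<and> gauss_le r y' (\<delta> * B) \<and> y = (\<Sum>l<e. acomp absv (z l) g * newton \<alpha> l) + y'"
    if y: "tate r y" "gauss_le r y B" "0 < B" for y B
  proof -
    obtain N where N: "gauss_le r (y - trunc N y) (\<delta> * B)"
      using trunc_approx[OF y(1), of "\<delta> * B"] \<delta> y by auto
    obtain z y' where z: "\<forall>l<e. tate \<phi> (z l) \<and> gauss_le \<phi> (z l) (B / r ^ l)"
       "tate r y'" "gauss_le r y' (\<delta> * B)" "trunc N y = (\<Sum>l<e. acomp absv (z l) g * newton \<alpha> l) + y'"
      using weierstrass_polynomial[OF \<delta>' tate_trunc gauss_le_trunc[OF y(2)], of N N]
      by (auto simp: trunc_nth)
    have "y = (\<Sum>l<e. acomp absv (z l) g * newton \<alpha> l) + (y' + (y - trunc N y))"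
      using z(4) by simp
    moreover have "tate r (y' + (y - trunc N y))" "gauss_le r (y' + (y - trunc N y)) (\<delta> * B)"
      using z(2,3) N y(1) r by (intro tate_add tate_diff gauss_le_add' tate_trunc; simp)+
    ultimately show ?thesis using z(1) by blast
  qed
  define good_step where "good_step y B z y' \<longleftrightarrow> (\<forall>l<e. tate \<phi> (z l) \<and> gauss_le \<phi> (z l) (B / r ^ l)) \<and>
     tate r y' \<and> gauss_le r y' (\<delta> * B) \<and> y = (\<Sum>l<e. acomp absv (z l) g * newton \<alpha> l) + y'" for y B z y'
  obtain Zf Yf where ZY: "\<And>y B. tate r y \<Longrightarrow> gauss_le r y B \<Longrightarrow> 0 < B \<Longrightarrow> good_step y B (Zf y B) (Yf y B)"
    using step unfolding good_step_def[symmetric] by metis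
  \<comment> \<open>\<open>ys k\<close> is the remainder after \<open>k\<close> rounds, of norm at
    most \<open>\<delta> ^ k * B\<close>, and \<open>zs k\<close> collects the coefficients
    extracted from it.\<close>
  define ys where "ys = rec_nat y (\<lambda>k y. Yf y (\<delta> ^ k * B))"
  define zs where "zs k = Zf (ys k) (\<delta> ^ k * B)" for k
  have ys: "tate r (ys k) \<and> gauss_le r (ys k) (\<delta> ^ k * B)" for k
  proof (induction k)
    case 0
    then show ?case using y by (simp add: ys_def)
  next
    case (Suc k)
    then have "good_step (ys k) (\<delta> ^ k * B) (zs k) (ys (Suc k))"
      using ZY[of "ys k" "\<delta> ^ k * B"] \<delta> y(3) by (simp add: zs_def ys_def)
    then show ?case by (simp add: good_step_def mult.assoc)
  qed
  have st: "good_step (ys k) (\<delta> ^ k * B) (zs k) (ys (Suc k))" for k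
    using ZY[of "ys k" "\<delta> ^ k * B"] \<delta> y(3) ys[of k] by (simp add: zs_def ys_def)
  have zs: "tate \<phi> (zs k l)" "gauss_le \<phi> (zs k l) (B / r ^ l * \<delta> ^ k)" if "l < e" for k l
    using st[of k] that by (auto simp: good_step_def mult_ac)
  have "\<exists>S. tate \<phi> S \<and> (\<forall>K. gauss_le \<phi> (S - (\<Sum>k<K. zs k l)) (B / r ^ l * \<delta> ^ K))" if "l < e" for l
    using tate_complete[of \<phi> "\<lambda>k. zs k l" "B / r ^ l" \<delta>] zs[OF that] \<delta> weierstrass_pos
    by (metis less_imp_le)
  then obtain S where S: "\<And>l. l < e \<Longrightarrow> tate \<phi> (S l)"
      "\<And>l K. l < e \<Longrightarrow> gauss_le \<phi> (S l - (\<Sum>k<K. zs k l)) (B / r ^ l * \<delta> ^ K)"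
    by metis
  have partial: "y = (\<Sum>l<e. acomp absv (\<Sum>k<K. zs k l) g * newton \<alpha> l) + ys K" for K
  proof (induction K)
    case 0
    then show ?case by (simp add: ys_def)
  next
    case (Suc K)
    have "(\<Sum>l<e. acomp absv (\<Sum>k<Suc K. zs k l) g * newton \<alpha> l)
       = (\<Sum>l<e. acomp absv (\<Sum>k<K. zs k l) g * newton \<alpha> l + acomp absv (zs K l) g * newton \<alpha> l)"
    proof (intro sum.cong refl)
      fix l assume "l \<in> {..<e}"
      then have "acomp absv (\<Sum>k<Suc K. zs k l) g = acomp absv (\<Sum>k<K. zs k l) g + acomp absv (zs K l) g"
        using zs gg weierstrass_pos by (simp add: acomp_add[of \<phi> _ _ r] tate_sum)
      then show "acomp absv (\<Sum>k<Suc K. zs k l) g * newton \<alpha> l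
        = acomp absv (\<Sum>k<K. zs k l) g * newton \<alpha> l + acomp absv (zs K l) g * newton \<alpha> l"
        by (simp only: distrib_right)
    qed
    moreover have "ys K = (\<Sum>l<e. acomp absv (zs K l) g * newton \<alpha> l) + ys (Suc K)"
      using st[of K] by (simp add: good_step_def)
    ultimately show ?case
      using Suc by (simp add: sum.distrib add.assoc)
  qed
  have "y - (\<Sum>l<e. acomp absv (S l) g * newton \<alpha> l) = 0"
  proof (rule gauss_le_eq_0)
    fix \<epsilon> :: real assume \<epsilon>: "\<epsilon> > 0"
    obtain K where "\<delta> ^ K < \<epsilon> / B"
      using real_arch_pow_inv[of "\<epsilon> / B" \<delta>] \<epsilon> \<delta> y(3) by auto
    then have K: "B * \<delta> ^ K \<le> \<epsilon>" using y(3) by (simp add: field_simps)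
    have "gauss_le r (acomp absv (S l - (\<Sum>k<K. zs k l)) g * newton \<alpha> l) (B * \<delta> ^ K)" if l: "l < e" for l
    proof -
      have "gauss_le r (acomp absv (S l - (\<Sum>k<K. zs k l)) g * newton \<alpha> l) ((B / r ^ l * \<delta> ^ K) * r ^ l)"
        using l S zs[OF l] gg weierstrass_pos \<alpha>
        by (intro gauss_le_mult acomp_gauss[of \<phi>] tate_diff tate_sum newton_gauss) auto
      then show ?thesis using r by simp
    qed
    then have "gauss_le r (ys K - (\<Sum>l<e. acomp absv (S l - (\<Sum>k<K. zs k l)) g * newton \<alpha> l)) (B * \<delta> ^ K)"
      using ys[of K] r y(3) \<delta> by (intro gauss_le_diff' gauss_le_sum) (auto simp: mult.commute)
    moreover have "acomp absv (S l - (\<Sum>k<K. zs k l)) g = acomp absv (S l) g - acomp absv (\<Sum>k<K. zs k l) g" if l: "l < e" for l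
      using l S(1) zs[OF l] gg weierstrass_pos by (intro acomp_diff[of \<phi> _ _ r] tate_sum) auto
    then have "(\<Sum>l<e. acomp absv (S l - (\<Sum>k<K. zs k l)) g * newton \<alpha> l)
        = (\<Sum>l<e. acomp absv (S l) g * newton \<alpha> l) - (\<Sum>l<e. acomp absv (\<Sum>k<K. zs k l) g * newton \<alpha> l)"
      unfolding sum_subtractf[symmetric] by (intro sum.cong refl) (simp add: left_diff_distrib)
    then have "ys K - (\<Sum>l<e. acomp absv (S l - (\<Sum>k<K. zs k l)) g * newton \<alpha> l)
        = y - (\<Sum>l<e. acomp absv (S l) g * newton \<alpha> l)"
      using partial[of K] by (simp add: algebra_simps)
    ultimately show "gauss_le r (y - (\<Sum>l<e. acomp absv (S l) g * newton \<alpha> l)) \<epsilon>"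
      using gauss_le_mono K by simp
  qed (rule r)
  then have "y = (\<Sum>l<e. acomp absv (S l) g * newton \<alpha> l)" by simp
  moreover have "gauss_le \<phi> (S l) (B / r ^ l)" if "l < e" for l
    using S(2)[OF that, of 0] by simp
  ultimately show ?thesis using that S(1) by blast
qed

end

end

section \<open>Linear systems over a field\<close>

lemma homogeneous_nontrivial:
  fixes A :: "nat \<Rightarrow> nat \<Rightarrow> 'k::field"
  assumes "m < n"
  shows "\<exists>x. (\<exists>j<n. x j \<noteq> 0) \<and> (\<forall>i<m. (\<Sum>j<n. A i j * x j) = 0)"
  using assms
proof (induction m arbitrary: n A)
  case 0
  then show ?case by (intro exI[of _ "\<lambda>_. 1"]) auto
next
  case (Suc m)
  show ?case
  proof (cases "\<forall>j<n. A m j = 0")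
    case True
    obtain x where "\<exists>j<n. x j \<noteq> 0" "\<forall>i<m. (\<Sum>j<n. A i j * x j) = 0"
      using Suc.IH[of n A] Suc.prems by auto
    with True show ?thesis by (intro exI[of _ x]) (auto simp: less_Suc_eq)
  next
    case False
    then obtain p where p: "p < n" "A m p \<noteq> 0" by auto
    obtain n' where n': "n = Suc n'" "m < n'" using Suc.prems by (cases n) auto
    define \<sigma> where "\<sigma> j = (if j < p then j else Suc j)" for j
    have \<sigma>: "bij_betw \<sigma> {..<n'} ({..<n} - {p})"
      unfolding \<sigma>_def using p n'
      by (intro bij_betwI[where g = "\<lambda>j. if j < p then j else j - 1"]) (auto simp: not_less split: if_splits)
    \<comment> \<open>Gaussian elimination: the last equation is solved for unknown
      \<open>p\<close>, and the other equations are rewritten in the remaining unknowns, listed by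
      \<sigma>.\<close>
    define B where "B i j = A i (\<sigma> j) - A i p * A m (\<sigma> j) / A m p" for i j
    obtain y where y: "\<exists>j<n'. y j \<noteq> 0" "\<forall>i<m. (\<Sum>j<n'. B i j * y j) = 0"
      using Suc.IH[OF n'(2), of B] by auto
    define \<tau> where "\<tau> = inv_into {..<n'} \<sigma>"
    have \<tau>: "\<tau> (\<sigma> j) = j" if "j < n'" for j
      using that \<sigma> by (simp add: \<tau>_def bij_betw_inv_into_left)
    define x where "x j = (if j = p then - (\<Sum>j<n'. A m (\<sigma> j) * y j) / A m p else y (\<tau> j))" for j
    have \<sigma>p: "\<sigma> j \<noteq> p" for j by (simp add: \<sigma>_def)
    have x\<sigma>: "x (\<sigma> j) = y j" if "j < n'" for j
      using that \<sigma>p by (simp add: x_def \<tau>)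
    have split: "(\<Sum>j<n. C j * x j) = C p * x p + (\<Sum>j<n'. C (\<sigma> j) * y j)" for C
    proof -
      have "(\<Sum>j<n. C j * x j) = C p * x p + (\<Sum>j\<in>{..<n} - {p}. C j * x j)"
        using p by (subst sum.remove[of _ p]) auto
      also have "(\<Sum>j\<in>{..<n} - {p}. C j * x j) = (\<Sum>j<n'. C (\<sigma> j) * x (\<sigma> j))"
        by (rule sum.reindex_bij_betw[OF \<sigma>, symmetric])
      also have "\<dots> = (\<Sum>j<n'. C (\<sigma> j) * y j)"
        by (intro sum.cong) (auto simp: x\<sigma>)
      finally show ?thesis .
    qed
    have xp: "x p = - (\<Sum>j<n'. A m (\<sigma> j) * y j) / A m p"
      by (simp add: x_def)
    have "(\<Sum>j<n. A i j * x j) = 0" if "i < m" for i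
    proof -
      have "0 = (\<Sum>j<n'. B i j * y j)" using y that by simp
      also have "\<dots> = (\<Sum>j<n'. A i (\<sigma> j) * y j - A i p / A m p * (A m (\<sigma> j) * y j))"
        by (intro sum.cong) (auto simp: B_def field_simps)
      also have "\<dots> = (\<Sum>j<n'. A i (\<sigma> j) * y j) + A i p * x p"
        by (simp add: sum_subtractf xp sum_divide_distrib sum_distrib_left)
      finally show ?thesis unfolding split by (simp add: add.commute)
    qed
    moreover have "(\<Sum>j<n. A m j * x j) = 0"
      unfolding split using p by (simp add: xp)
    moreover have "\<exists>j<n. x j \<noteq> 0"
    proof -
      obtain j where "j < n'" "y j \<noteq> 0" using y by auto
      then show ?thesis
        using x\<sigma>[of j] bij_betwE[OF \<sigma>] by (intro exI[of _ "\<sigma> j"]) auto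
    qed
    ultimately show ?thesis by (intro exI[of _ x]) (auto simp: less_Suc_eq)
  qed
qed

text \<open>Surjectivity provides \<open>d\<close> vectors mapped to the unit vectors; together with
  \<open>x\<close> they are \<open>d + 1\<close> vectors in dimension \<open>d\<close>. Applying
  \<open>W\<close> to a dependence kills the coefficients of the former, so \<open>x\<close>
  vanishes.\<close>

lemma square_inj_if_surj:
  fixes W :: "nat \<Rightarrow> nat \<Rightarrow> 'k::field"
  assumes surj: "\<And>i0. i0 < d \<Longrightarrow> \<exists>x. \<forall>i<d. (\<Sum>l<d. W i l * x l) = (if i = i0 then 1 else 0)"
    and x: "\<And>i. i < d \<Longrightarrow> (\<Sum>l<d. W i l * x l) = 0" and l: "l < d"
  shows "x l = 0"
proof -
  obtain B where B: "\<And>i0 i. i0 < d \<Longrightarrow> i < d \<Longrightarrow> (\<Sum>l<d. W i l * B i0 l) = (if i = i0 then 1 else 0)"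
    using surj by metis
  define A where "A l j = (if j < d then B j l else x l)" for l j
  obtain y where y: "\<exists>j<Suc d. y j \<noteq> 0" "\<And>l. l < d \<Longrightarrow> (\<Sum>j<Suc d. A l j * y j) = 0"
    using homogeneous_nontrivial[of d "Suc d" A] by auto
  have comb: "(\<Sum>j<d. B j l * y j) + x l * y d = 0" if "l < d" for l
    using y(2)[OF that] by (simp add: A_def)
  have yi: "y i = 0" if i: "i < d" for i
  proof -
    have "0 = (\<Sum>l<d. W i l * ((\<Sum>j<d. B j l * y j) + x l * y d))"
      using comb by simp
    also have "\<dots> = (\<Sum>l<d. \<Sum>j<d. W i l * B j l * y j) + (\<Sum>l<d. W i l * x l) * y d"
      by (simp add: distrib_left sum.distrib sum_distrib_left sum_distrib_right mult.assoc)
    also have "(\<Sum>l<d. \<Sum>j<d. W i l * B j l * y j) = (\<Sum>j<d. (\<Sum>l<d. W i l * B j l) * y j)"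
      by (subst sum.swap) (simp add: sum_distrib_right)
    also have "\<dots> = (\<Sum>j<d. if i = j then y j else 0)"
      using B i by (intro sum.cong) auto
    finally show ?thesis using x[OF i] i by simp
  qed
  then have "y d \<noteq> 0" using y(1) by (auto simp: less_Suc_eq)
  then show ?thesis using comb[OF l] yi by simp
qed

context nonarch
begin

subsection \<open>Analytic functions on the unit disc\<close>

text \<open>For \<open>n > 0\<close> every \<open>z\<close> in (0, 1) is the \<open>n\<close>-th
  power of an admissible radius, and letting \<open>z\<close> tend to 1 gives the bound.\<close>

lemma gauss_le_limit:
  assumes "\<And>r. 0 < r \<Longrightarrow> r < 1 \<Longrightarrow> gauss_le r f B"
  shows "gauss_le 1 f B"
  unfolding gauss_le_def
proof
  fix n
  have "z * absv (f $ n) \<le> B" if z: "0 < z" "z < 1" for z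
  proof (cases "n = 0")
    case True
    have "absv (f $ 0) \<le> B" using gauss_leD[OF assms[of "1/2"], of 0] by simp
    moreover have "z * absv (f $ 0) \<le> 1 * absv (f $ 0)" using z by (intro mult_right_mono) auto
    ultimately show ?thesis using True by simp
  next
    case False
    then have "root n z ^ n = z" "0 < root n z" "root n z < 1" using z by auto
    then show ?thesis
      using gauss_leD[OF assms[of "root n z"], of n] by (simp add: mult.commute)
  qed
  then have "absv (f $ n) \<le> B" by (rule field_le_mult_one_interval)
  then show "absv (f $ n) * 1 ^ n \<le> B" by simp
qed

text \<open>At all but finitely many radii slightly above \<open>r\<close> a single term of
  \<open>f\<close> is strictly largest, and the values at points of that absolute value then have
  the size of the Gauss norm. This turns pointwise bounds into bounds on Gauss norms.\<close>

lemma generic_point: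
  assumes f: "f \<in> Oring absv cl" and r: "0 < r" "r < 1"
  obtains x where "r < absv x" "absv x < 1" "\<And>n. absv (f $ n) * absv x ^ n \<le> absv (evalk absv f x)"
proof (cases "f = 0")
  case True
  obtain x where "r < absv x" "absv x < 1" using ex_absv_between[of r 1] r by auto
  then show ?thesis using that True by (simp add: evalk_eq_expand)
next
  case False
  then obtain m where m: "f $ m \<noteq> 0" by (auto simp: fps_eq_iff)
  define r2 where "r2 = (1 + r) / 2"
  have r2: "r < r2" "r2 < 1" "0 < r2" using r by (auto simp: r2_def)
  have fr2: "tate r2 f" using f r2 by (auto simp: Oring_iff good_def)
  define w where "w = absv (f $ m) * r ^ m"
  have w: "w > 0" using m r by (simp add: w_def)
  have "eventually (\<lambda>n. absv (f $ n) * r2 ^ n < w) sequentially"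
    using fr2 w order_tendstoD(2)[of _ 0 sequentially w] unfolding tate_def by simp
  then obtain N0 where N0: "\<And>n. n \<ge> N0 \<Longrightarrow> absv (f $ n) * r2 ^ n < w"
    unfolding eventually_sequentially by blast
  \<comment> \<open>Terms from index \<open>N0\<close> on stay below \<open>w\<close> up to radius
    \<open>r2\<close>, so only ties among the first \<open>N0\<close> terms can spoil strict
    dominance, and two given terms tie at one radius at most.\<close>
  define bad where "bad = {\<xi>. 0 < \<xi> \<and> (\<exists>n<N0. \<exists>m<N0. n < m \<and> f $ m \<noteq> 0 \<and> absv (f $ n) * \<xi> ^ n = absv (f $ m) * \<xi> ^ m)}"
  have "bad \<subseteq> (\<lambda>(n, m). root (m - n) (absv (f $ n) / absv (f $ m))) ` ({..<N0} \<times> {..<N0})"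
  proof
    fix \<xi> assume "\<xi> \<in> bad"
    then obtain n m where nm: "0 < \<xi>" "n < N0" "m < N0" "n < m" "f $ m \<noteq> 0" "absv (f $ n) * \<xi> ^ n = absv (f $ m) * \<xi> ^ m"
      by (auto simp: bad_def)
    have "\<xi> ^ m = \<xi> ^ (m - n) * \<xi> ^ n" using nm by (simp flip: power_add)
    then have "absv (f $ n) / absv (f $ m) = \<xi> ^ (m - n)"
      using nm by (simp add: field_simps)
    then have "\<xi> = root (m - n) (absv (f $ n) / absv (f $ m))"
      using nm by (simp add: real_root_power_cancel)
    then show "\<xi> \<in> (\<lambda>(n, m). root (m - n) (absv (f $ n) / absv (f $ m))) ` ({..<N0} \<times> {..<N0})"
      using nm by force
  qed
  then have finbad: "finite bad" by (rule finite_subset) simp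
  define r3 where "r3 = Min (insert r2 {\<xi> \<in> bad. \<xi> > r})"
  have r3: "r < r3" "r3 \<le> r2"
    unfolding r3_def using finbad r2 by auto
  have nobad: "\<xi> \<notin> bad" if "r < \<xi>" "\<xi> < r3" for \<xi>
  proof
    assume "\<xi> \<in> bad"
    then have "r3 \<le> \<xi>" unfolding r3_def using finbad that by (intro Min_le) auto
    then show False using that by simp
  qed
  obtain x where x: "r < absv x" "absv x < r3"
    using ex_absv_between[of r r3] r r2 r3 by auto
  define \<rho> where "\<rho> = absv x"
  have \<rho>: "0 < \<rho>" "r < \<rho>" "\<rho> < r2" "\<rho> \<notin> bad"
    using x r r3 nobad by (auto simp: \<rho>_def)
  have tf: "tate \<rho> f" using fr2 \<rho> by (auto intro: tate_radius)
  obtain N where N: "f $ N \<noteq> 0" "\<And>n. absv (f $ n) * \<rho> ^ n \<le> absv (f $ N) * \<rho> ^ N"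
    "\<And>n. n > N \<Longrightarrow> absv (f $ n) * \<rho> ^ n < absv (f $ N) * \<rho> ^ N"
    using last_max_index[OF tf \<rho>(1) False] by blast
  have NN0: "N < N0"
  proof (rule ccontr)
    assume "\<not> N < N0"
    then have "absv (f $ N) * r2 ^ N < w" using N0 by simp
    moreover have "absv (f $ N) * \<rho> ^ N \<le> absv (f $ N) * r2 ^ N"
      using \<rho> by (intro mult_left_mono power_mono) auto
    moreover have "w \<le> absv (f $ m) * \<rho> ^ m"
      unfolding w_def using \<rho> r by (intro mult_left_mono power_mono) auto
    ultimately show False using N(2)[of m] by linarith
  qed
  have strict: "absv (f $ n) * \<rho> ^ n < absv (f $ N) * \<rho> ^ N" if "n \<noteq> N" for n
  proof (cases "n > N")
    case False
    then have "n < N" using that by simp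
    have "absv (f $ n) * \<rho> ^ n \<noteq> absv (f $ N) * \<rho> ^ N"
    proof
      assume "absv (f $ n) * \<rho> ^ n = absv (f $ N) * \<rho> ^ N"
      then have "\<rho> \<in> bad"
        unfolding bad_def using \<open>n < N\<close> NN0 N(1) \<rho>(1) by (intro CollectI conjI exI[of _ n] exI[of _ N]) auto
      then show False using \<rho>(4) by simp
    qed
    then show ?thesis using N(2)[of n] by simp
  qed (rule N(3))
  define f' where "f' = f - fps_const (f $ N) * fps_X ^ N"
  have f'n: "f' $ n = (if n = N then 0 else f $ n)" for n
    by (simp add: f'_def fps_X_power_nth)
  have tm: "tate \<rho> (fps_const (f $ N) * fps_X ^ N)"
    using \<rho> by (intro tate_cmult tate_power) auto
  have tf': "tate \<rho> f'" unfolding f'_def using tf tm \<rho> by (intro tate_diff) auto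
  have small: "absv (expand absv f' x $ 0) < absv (f $ N) * \<rho> ^ N"
  proof (cases "f' = 0")
    case True
    then show ?thesis using N(1) \<rho> by simp
  next
    case False
    obtain M where M: "f' $ M \<noteq> 0" "\<And>n. absv (f' $ n) * \<rho> ^ n \<le> absv (f' $ M) * \<rho> ^ M"
      using last_max_index[OF tf' \<rho>(1) False] by blast
    have "M \<noteq> N" using M(1) f'n by auto
    have "gauss_le \<rho> (expand absv f' x) (absv (f' $ M) * \<rho> ^ M)"
      using M(2) \<rho> tf' by (intro expand_gauss) (auto simp: \<rho>_def gauss_le_def)
    then have "absv (expand absv f' x $ 0) \<le> absv (f' $ M) * \<rho> ^ M"
      using gauss_leD[of _ _ _ 0] by fastforce
    also have "\<dots> < absv (f $ N) * \<rho> ^ N"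
      using strict[OF \<open>M \<noteq> N\<close>] f'n[of M] \<open>M \<noteq> N\<close> by simp
    finally show ?thesis .
  qed
  have f: "f = f' + fps_const (f $ N) * fps_X ^ N" by (simp add: f'_def)
  have "expand absv f x = expand absv f' x + expand absv (fps_const (f $ N) * fps_X ^ N) x"
    by (subst f) (rule expand_add[of \<rho>], use \<rho> tf' tm in \<open>auto simp: \<rho>_def\<close>)
  also have "expand absv (fps_const (f $ N) * fps_X ^ N) x = fps_const (f $ N) * (fps_X + fps_const x) ^ N"
    by (simp add: expand_def)
  finally have "evalk absv f x = expand absv f' x $ 0 + f $ N * x ^ N"
    by (simp add: evalk_eq_expand fps_power_zeroth)
  moreover have "absv (expand absv f' x $ 0) < absv (f $ N * x ^ N)"
    using small by (simp add: absv_mult absv_power \<rho>_def)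
  ultimately have "absv (evalk absv f x) = absv (f $ N) * \<rho> ^ N"
    using absv_add_eq by (simp add: absv_mult absv_power \<rho>_def)
  then show ?thesis
    using that[of x] x r2 r3 N(2) by (simp add: \<rho>_def)
qed

lemma udisc_good:
  assumes "finite S" "S \<subseteq> udisc absv cl"
  obtains r where "good cl r" "\<And>x. x \<in> S \<Longrightarrow> absv x \<le> r"
proof (cases cl)
  case True
  then show ?thesis using assms that[of 1] by (auto simp: good_def udisc_def)
next
  case False
  define r where "r = Max (insert (1/2) (absv ` S))"
  have "r < 1" "\<And>x. x \<in> S \<Longrightarrow> absv x \<le> r"
    using assms False by (auto simp: r_def udisc_def)
  moreover have "r \<ge> 1/2"
    unfolding r_def using assms by (intro Max_ge) auto
  ultimately show ?thesis using that[of r] False by (auto simp: good_def)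
qed

lemma good_le: "good cl r \<Longrightarrow> r \<le> 1" "good cl r \<Longrightarrow> 0 < r"
  by (auto simp: good_def split: if_splits)

lemma good_max: "good cl r \<Longrightarrow> good cl r' \<Longrightarrow> good cl (max r r')"
  by (auto simp: good_def max_def)

lemma good_less_1: "0 < r \<Longrightarrow> r < 1 \<Longrightarrow> good cl r"
  by (auto simp: good_def)

lemma Oring_tate: "f \<in> Oring absv cl \<Longrightarrow> good cl r \<Longrightarrow> tate r f"
  by (simp add: Oring_iff)

lemma Oring_if_eventually:
  assumes "\<And>r. good cl r \<Longrightarrow> r0 \<le> r \<Longrightarrow> tate r f" "good cl r0"
  shows "f \<in> Oring absv cl"
  unfolding Oring_iff
proof (intro allI impI)
  fix r assume r: "good cl r"
  have "tate (max r r0) f" using assms good_max[OF r assms(2)] by simp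
  then show "tate r f" using good_le[OF r] by (auto intro: tate_radius)
qed

lemma Oring_const [simp]: "fps_const c \<in> Oring absv cl"
  and Oring_X [simp]: "fps_X \<in> Oring absv cl"
  and Oring_0 [simp]: "0 \<in> Oring absv cl"
  and Oring_1 [simp]: "1 \<in> Oring absv cl"
  by (auto simp: Oring_iff)

lemma Oring_add: "f \<in> Oring absv cl \<Longrightarrow> g \<in> Oring absv cl \<Longrightarrow> f + g \<in> Oring absv cl"
  and Oring_diff: "f \<in> Oring absv cl \<Longrightarrow> g \<in> Oring absv cl \<Longrightarrow> f - g \<in> Oring absv cl"
  and Oring_mult: "f \<in> Oring absv cl \<Longrightarrow> g \<in> Oring absv cl \<Longrightarrow> f * g \<in> Oring absv cl"
  by (auto simp: Oring_iff good_def intro!: tate_add tate_diff tate_mult)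

lemma Oring_power: "f \<in> Oring absv cl \<Longrightarrow> f ^ n \<in> Oring absv cl"
  by (induction n) (auto intro: Oring_mult)

lemma Oring_sum: "(\<And>i. i \<in> I \<Longrightarrow> f i \<in> Oring absv cl) \<Longrightarrow> (\<Sum>i\<in>I. f i) \<in> Oring absv cl"
  by (induction I rule: infinite_finite_induct) (auto intro: Oring_add)

lemma Oring_prod: "(\<And>i. i \<in> I \<Longrightarrow> f i \<in> Oring absv cl) \<Longrightarrow> (\<Prod>i\<in>I. f i) \<in> Oring absv cl"
  by (induction I rule: infinite_finite_induct) (auto intro: Oring_mult)

lemma Oring_dom_inverse: "(\<And>r. good cl r \<Longrightarrow> dominated r f) \<Longrightarrow> inverse f \<in> Oring absv cl"
  by (simp add: Oring_iff dominated_inverse(2) dominated_tate good_le)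

lemma
  assumes r: "good cl r" "absv c \<le> r"
  shows evalk_diff_aux: "f \<in> Oring absv cl \<Longrightarrow> g \<in> Oring absv cl \<Longrightarrow> evalk absv (f - g) c = evalk absv f c - evalk absv g c"
    and evalk_mult_aux: "f \<in> Oring absv cl \<Longrightarrow> g \<in> Oring absv cl \<Longrightarrow> evalk absv (f * g) c = evalk absv f c * evalk absv g c"
    and evalk_sum_aux: "(\<And>i. i \<in> I \<Longrightarrow> h i \<in> Oring absv cl) \<Longrightarrow> evalk absv (\<Sum>i\<in>I. h i) c = (\<Sum>i\<in>I. evalk absv (h i) c)"
proof -
  assume "\<And>i. i \<in> I \<Longrightarrow> h i \<in> Oring absv cl"
  then have "expand absv (\<Sum>i\<in>I. h i) c = (\<Sum>i\<in>I. expand absv (h i) c)"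
    using r by (intro expand_sum[OF good_le(2)[OF r(1)] r(2)] Oring_tate)
  then show "evalk absv (\<Sum>i\<in>I. h i) c = (\<Sum>i\<in>I. evalk absv (h i) c)"
    by (simp add: evalk_eq_expand fps_sum_nth)
qed (use r in \<open>simp_all add: evalk_eq_expand
    expand_diff[OF good_le(2)[OF r(1)] r(2)] expand_mult[OF good_le(2)[OF r(1)] r(2)] Oring_tate\<close>)

context
  fixes cl c assumes c: "c \<in> udisc absv cl"
begin

lemma udisc_goodE:
  obtains r where "good cl r" "absv c \<le> r"
  using udisc_good[of "{c}" cl] c by auto

lemma evalk_diff: "f \<in> Oring absv cl \<Longrightarrow> g \<in> Oring absv cl \<Longrightarrow> evalk absv (f - g) c = evalk absv f c - evalk absv g c"
  by (rule udisc_goodE, rule evalk_diff_aux)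

lemma evalk_linear: "evalk absv (fps_X - fps_const x) c = c - x"
  using evalk_diff[OF Oring_X Oring_const] by (simp add: evalk_eq_expand)

lemma evalk_mult: "f \<in> Oring absv cl \<Longrightarrow> g \<in> Oring absv cl \<Longrightarrow> evalk absv (f * g) c = evalk absv f c * evalk absv g c"
  by (rule udisc_goodE, rule evalk_mult_aux)

lemma evalk_sum: "(\<And>i. i \<in> I \<Longrightarrow> f i \<in> Oring absv cl) \<Longrightarrow> evalk absv (\<Sum>i\<in>I. f i) c = (\<Sum>i\<in>I. evalk absv (f i) c)"
  by (rule udisc_goodE, rule evalk_sum_aux)

lemma evalk_prod: "(\<And>i. i \<in> I \<Longrightarrow> f i \<in> Oring absv cl) \<Longrightarrow> evalk absv (\<Prod>i\<in>I. f i) c = (\<Prod>i\<in>I. evalk absv (f i) c)"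
  by (induction I rule: infinite_finite_induct)
    (auto simp: evalk_eq_expand[of 1] evalk_mult Oring_prod)

lemma Oring_expand: "f \<in> Oring absv cl \<Longrightarrow> expand absv f c \<in> Oring absv cl"
  by (rule udisc_goodE, rule Oring_if_eventually) (auto intro!: expand_tate dest: good_le Oring_tate)

text \<open>Division is carried out at each radius separately; the quotients coincide because
  \<open>F\<close> can be cancelled, so one series serves all radii.\<close>

lemma Oring_linear_division:
  assumes "h \<in> Oring absv cl"
  obtains h' where "h' \<in> Oring absv cl" "h = fps_const (evalk absv h c) + (fps_X - fps_const c) * h'"
proof -
  define F where "F = (fps_X - fps_const c)"
  have "F $ 1 \<noteq> 0" by (simp add: F_def)
  then have F: "F \<noteq> 0" by auto
  have ev: "evalk absv F c = 0" by (simp add: evalk_eq_expand F_def expand_diff[of "max 1 (absv c)"])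
  have ex: "\<exists>h'. tate r h' \<and> h = fps_const (evalk absv h c) + F * h'" if r: "good cl r" "absv c \<le> r" for r
  proof -
    have th: "tate r h" using assms r by (simp add: Oring_tate)
    obtain B where B: "gauss_le r h B" using tate_bound[OF th] by blast
    obtain x h' where h': "h = fps_const x + F * h'" "tate r h'"
      using linear_division[OF th B r(2) good_le(2)[OF r(1)]] unfolding F_def by metis
    have "evalk absv h c = x + evalk absv F c * evalk absv h' c"
      unfolding evalk_eq_expand F_def using r(2) h'(2) good_le(2)[OF r(1)]
      by (subst h'(1)) (simp add: F_def expand_add[of r c] expand_mult[of r c] tate_mult)
    then show ?thesis using h' ev by auto
  qed
  obtain r0 where r0: "good cl r0" "absv c \<le> r0" by (rule udisc_goodE)
  obtain h' where h': "tate r0 h'" "h = fps_const (evalk absv h c) + F * h'" using ex r0 by blast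
  have "h' \<in> Oring absv cl"
  proof (rule Oring_if_eventually[OF _ r0(1)])
    fix r assume r: "good cl r" "r0 \<le> r"
    then obtain h2 where h2: "tate r h2" "h = fps_const (evalk absv h c) + F * h2"
      using ex[of r] r0(2) by fastforce
    have "F * h' = F * h2" using h2(2) h'(2) by (metis add_left_cancel)
    then show "tate r h'" using F h2(1) by simp
  qed
  then show ?thesis using that h'(2) by (simp add: F_def)
qed

end

end

section \<open>The fibre over \<open>b\<close> and the factorisation of \<open>f - b\<close>\<close>

locale etale_fibre = nonarch absv for absv :: "'k::field_char_0 \<Rightarrow> real" +
  fixes cl :: bool and d :: nat and f :: "'k fps" and b :: 'k and a :: "nat \<Rightarrow> 'k"
  assumes phi: "fin_etale absv cl d f"
    and b_disc: "b \<in> udisc absv cl"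
    and a_inj: "inj_on a {..<d}"
    and a_fibre: "a ` {..<d} = {x \<in> udisc absv cl. evalk absv f x = b}"
begin

abbreviation "\<O> \<equiv> Oring absv cl"

lemma f_Oring: "f \<in> \<O>"
  and f_disc: "x \<in> udisc absv cl \<Longrightarrow> evalk absv f x \<in> udisc absv cl"
  using phi by (auto simp: fin_etale_def)

lemma a_disc: "i < d \<Longrightarrow> a i \<in> udisc absv cl"
  and f_a: "i < d \<Longrightarrow> evalk absv f (a i) = b"
  using a_fibre by blast+

text \<open>Generic points convert the pointwise inclusion of the image in the disc into a norm
  bound, so composition with \<open>f\<close> is defined on the analytic ring. The open case needs a
  bound below 1 and takes it from one generic point; the closed case passes to the limit of radii
  below 1.\<close>

lemma f_gauss:
  assumes "good cl r"
  obtains \<rho> where "good cl \<rho>" "gauss_le r f \<rho>"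
proof -
  have *: "\<exists>x. r < absv x \<and> absv x < 1 \<and> gauss_le r f (absv (evalk absv f x)) \<and> x \<in> udisc absv cl" if r: "0 < r" "r < 1" for r
  proof -
    obtain x where x: "r < absv x" "absv x < 1" "\<And>n. absv (f $ n) * absv x ^ n \<le> absv (evalk absv f x)"
      using generic_point[OF f_Oring r] by blast
    have "gauss_le (absv x) f (absv (evalk absv f x))" using x(3) by (simp add: gauss_le_def)
    then have "gauss_le r f (absv (evalk absv f x))" using x(1) r by (auto intro: gauss_le_radius)
    then show ?thesis using x by (auto simp: udisc_def)
  qed
  show ?thesis
  proof (cases cl)
    case True
    have "gauss_le 1 f 1"
    proof (rule gauss_le_limit)
      fix r :: real assume "0 < r" "r < 1"
      then obtain x where "gauss_le r f (absv (evalk absv f x))" "x \<in> udisc absv cl" using * by blast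
      then show "gauss_le r f 1" using f_disc[of x] True by (auto simp: udisc_def intro: gauss_le_mono)
    qed
    then have "gauss_le r f 1" using assms by (auto simp: good_def split: if_splits intro: gauss_le_radius)
    then show ?thesis using that[of 1] True by (auto simp: good_def)
  next
    case False
    then obtain x where "gauss_le r f (absv (evalk absv f x))" "x \<in> udisc absv cl"
      using * assms by (auto simp: good_def)
    then show ?thesis
      using f_disc[of x] False by (intro that[of "max (1/2) (absv (evalk absv f x))"])
        (auto simp: udisc_def good_def intro: gauss_le_mono)
  qed
qed

lemma acomp_f_Oring: "h \<in> \<O> \<Longrightarrow> acomp absv h f \<in> \<O>"
  unfolding Oring_iff[of "acomp absv h f"]
proof (intro allI impI)
  fix r assume h: "h \<in> \<O>" and r: "good cl r"
  obtain \<rho> where "good cl \<rho>" "gauss_le r f \<rho>" using f_gauss[OF r] .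
  then show "tate r (acomp absv h f)"
    using h r f_Oring by (intro acomp_tate[of \<rho>]) (auto simp: Oring_tate good_le)
qed

lemma acomp_f_mult: "h \<in> \<O> \<Longrightarrow> h' \<in> \<O> \<Longrightarrow> acomp absv (h * h') f = acomp absv h f * acomp absv h' f"
  and acomp_f_diff: "h \<in> \<O> \<Longrightarrow> h' \<in> \<O> \<Longrightarrow> acomp absv (h - h') f = acomp absv h f - acomp absv h' f"
proof -
  have r: "good cl (1/2)" by (simp add: good_def)
  obtain \<rho> where "good cl \<rho>" "gauss_le (1/2) f \<rho>" using f_gauss[OF r] .
  then show "h \<in> \<O> \<Longrightarrow> h' \<in> \<O> \<Longrightarrow> acomp absv (h * h') f = acomp absv h f * acomp absv h' f"
    "h \<in> \<O> \<Longrightarrow> h' \<in> \<O> \<Longrightarrow> acomp absv (h - h') f = acomp absv h f - acomp absv h' f"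
    by (auto intro!: acomp_mult[of \<rho> _ _ "1/2"] acomp_diff[of \<rho> _ _ "1/2"] simp: Oring_tate)
qed

text \<open>Removing the constant term of the expansion of \<open>f\<close> at \<open>x\<close>
  makes the inner series start at 0; compensating by re-expanding \<open>h\<close> at the image
  point turns analytic into formal composition.\<close>

lemma expand_acomp_f:
  assumes "h \<in> \<O>" "x \<in> udisc absv cl"
  shows "expand absv (acomp absv h f) x
     = fps_compose (expand absv h (evalk absv f x)) (expand absv f x - fps_const (evalk absv f x))"
proof -
  obtain r where r: "good cl r" "absv x \<le> r" using udisc_goodE[OF assms(2)] .
  obtain \<rho>1 where \<rho>1: "good cl \<rho>1" "gauss_le r f \<rho>1" using f_gauss[OF r(1)] .
  obtain \<rho>2 where \<rho>2: "good cl \<rho>2" "absv (evalk absv f x) \<le> \<rho>2" using udisc_goodE[OF f_disc[OF assms(2)]] .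
  define \<rho> where "\<rho> = max \<rho>1 \<rho>2"
  have \<rho>: "good cl \<rho>" "gauss_le r f \<rho>" "absv (evalk absv f x) \<le> \<rho>"
    using \<rho>1 \<rho>2 by (auto simp: \<rho>_def good_max intro: gauss_le_mono)
  define G where "G = expand absv f x - fps_const (evalk absv f x)"
  have G0: "G $ 0 = 0" by (simp add: G_def evalk_eq_expand)
  have tf: "tate r f" using f_Oring r by (simp add: Oring_tate)
  have G: "gauss_le r G \<rho>"
    unfolding G_def using \<rho> r tf good_le(2)[OF r(1)] by (intro gauss_le_diff' expand_gauss gauss_le_const) auto
  have "expand absv (acomp absv h f) x = acomp absv h (expand absv f x)"
    using assms r \<rho> tf by (intro expand_acomp[of r x \<rho>]) (auto simp: Oring_tate good_le)
  also have "\<dots> = acomp absv h (G + fps_const (evalk absv f x))"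
    by (simp add: G_def)
  also have "\<dots> = acomp absv (expand absv h (evalk absv f x)) G"
    using assms r \<rho> G by (intro acomp_expand[of \<rho> _ h r, symmetric]) (auto simp: Oring_tate good_le)
  also have "\<dots> = fps_compose (expand absv h (evalk absv f x)) G"
    using G0 by (rule acomp_eq_compose)
  finally show ?thesis by (simp add: G_def)
qed

lemma evalk_acomp_f: "h \<in> \<O> \<Longrightarrow> x \<in> udisc absv cl \<Longrightarrow> evalk absv (acomp absv h f) x = evalk absv h (evalk absv f x)"
  by (simp add: evalk_eq_expand[of "acomp absv h f"] expand_acomp_f) (simp add: evalk_eq_expand)

text \<open>Some basis of the source ring over the target ring, fixed by choice; its relation to the
  powers of \<open>t\<close> is not known at this stage.\<close>

definition "module_basis = (SOME module_basis. (\<forall>l<d. module_basis l \<in> \<O>) \<and>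
        (\<forall>g\<in>\<O>. \<exists>!h. (\<forall>l<d. h l \<in> \<O>) \<and> (\<forall>l\<ge>d. h l = 0) \<and> g = (\<Sum>l<d. acomp absv (h l) f * module_basis l)))"

lemma module_basis: "\<And>l. l < d \<Longrightarrow> module_basis l \<in> \<O>"
  "\<And>g. g \<in> \<O> \<Longrightarrow> \<exists>!h. (\<forall>l<d. h l \<in> \<O>) \<and> (\<forall>l\<ge>d. h l = 0) \<and> g = (\<Sum>l<d. acomp absv (h l) f * module_basis l)"
proof -
  have *: "(\<forall>l<d. module_basis l \<in> \<O>) \<and>
        (\<forall>g\<in>\<O>. \<exists>!h. (\<forall>l<d. h l \<in> \<O>) \<and> (\<forall>l\<ge>d. h l = 0) \<and> g = (\<Sum>l<d. acomp absv (h l) f * module_basis l))"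
    unfolding module_basis_def using phi by (intro someI_ex[of "\<lambda>module_basis. (\<forall>l<d. module_basis l \<in> \<O>) \<and>
        (\<forall>g\<in>\<O>. \<exists>!h. (\<forall>l<d. h l \<in> \<O>) \<and> (\<forall>l\<ge>d. h l = 0) \<and> g = (\<Sum>l<d. acomp absv (h l) f * module_basis l))"])
      (simp add: fin_etale_def)
  show "\<And>l. l < d \<Longrightarrow> module_basis l \<in> \<O>"
    by (rule conjunct1[OF *, rule_format])
  show "\<And>g. g \<in> \<O> \<Longrightarrow> \<exists>!h. (\<forall>l<d. h l \<in> \<O>) \<and> (\<forall>l\<ge>d. h l = 0) \<and> g = (\<Sum>l<d. acomp absv (h l) f * module_basis l)"
    by (rule bspec[OF conjunct2[OF *]])
qed

lemma d_pos: "d > 0"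
proof (rule ccontr)
  assume "\<not> d > 0"
  moreover obtain h where "1 = (\<Sum>l<d. acomp absv (h l) f * module_basis l)"
    using module_basis(2)[OF Oring_1] by blast
  ultimately show False by simp
qed

text \<open>\<open>\<O>/(f - b)\<close> has dimension \<open>d\<close> because \<open>\<O>\<close> is free of rank \<open>d\<close>, and evaluation at the
  \<open>d\<close> points of the fibre maps it onto a space of dimension \<open>d\<close>.\<close>

lemma vanishing_divisible:
  assumes y: "y \<in> \<O>" "\<And>i. i < d \<Longrightarrow> evalk absv y (a i) = 0"
  obtains y' where "y' \<in> \<O>" "y = (f - fps_const b) * y'"
proof -
  define W where "W i l = evalk absv (module_basis l) (a i)" for i l
  have evsum: "evalk absv (\<Sum>l<d. acomp absv (h l) f * module_basis l) (a i) = (\<Sum>l<d. W i l * evalk absv (h l) b)"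
    if h: "\<forall>l<d. h l \<in> \<O>" and i: "i < d" for h i
  proof -
    have "evalk absv (\<Sum>l<d. acomp absv (h l) f * module_basis l) (a i) = (\<Sum>l<d. evalk absv (acomp absv (h l) f * module_basis l) (a i))"
      using h module_basis by (intro evalk_sum[OF a_disc[OF i]] Oring_mult acomp_f_Oring) auto
    also have "\<dots> = (\<Sum>l<d. W i l * evalk absv (h l) b)"
      using h module_basis i by (intro sum.cong refl)
        (simp add: evalk_mult[OF a_disc[OF i]] acomp_f_Oring evalk_acomp_f a_disc f_a W_def)
    finally show ?thesis .
  qed
  have surj: "\<exists>x. \<forall>i<d. (\<Sum>l<d. W i l * x l) = (if i = i0 then 1 else 0)" if i0: "i0 < d" for i0
  proof -
    \<comment> \<open>Lagrange interpolation: the polynomial \<open>g\<close> takes the value 1 at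
      \<open>a i0\<close> and 0 at the other fibre points.\<close>
    define c where "c = (\<Prod>j\<in>{..<d} - {i0}. a i0 - a j)"
    have c: "c \<noteq> 0" using a_inj i0 by (auto simp: c_def inj_on_def)
    define g where "g = fps_const (inverse c) * (\<Prod>j\<in>{..<d} - {i0}. fps_X - fps_const (a j))"
    have g: "g \<in> \<O>" unfolding g_def by (intro Oring_mult Oring_prod Oring_diff) auto
    have gi: "evalk absv g (a i) = (if i = i0 then 1 else 0)" if i: "i < d" for i
    proof -
      have "evalk absv g (a i) = inverse c * (\<Prod>j\<in>{..<d} - {i0}. a i - a j)"
        unfolding g_def by (subst evalk_mult[OF a_disc[OF i]], simp, intro Oring_prod Oring_diff, simp, simp)
          (simp add: evalk_prod[OF a_disc[OF i]] Oring_diff evalk_linear[OF a_disc[OF i]], simp add: evalk_eq_expand)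
      also have "\<dots> = (if i = i0 then 1 else 0)"
        using c i by (auto simp: c_def)
      finally show ?thesis .
    qed
    obtain h where h: "\<forall>l<d. h l \<in> \<O>" "g = (\<Sum>l<d. acomp absv (h l) f * module_basis l)"
      using module_basis(2)[OF g] by blast
    show ?thesis
      using evsum[OF h(1)] gi h(2) by (intro exI[of _ "\<lambda>l. evalk absv (h l) b"]) auto
  qed
  obtain h where h: "\<forall>l<d. h l \<in> \<O>" "y = (\<Sum>l<d. acomp absv (h l) f * module_basis l)"
    using module_basis(2)[OF y(1)] by blast
  \<comment> \<open>The matrix \<open>W\<close> of basis values is surjective, hence injective, so
    the coordinates of \<open>y\<close> vanish at \<open>b\<close> and are divisible by
    \<open>X - b\<close>; substituting \<open>f\<close> makes \<open>y\<close> divisible by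
    \<open>f - b\<close>.\<close>
  have "evalk absv (h l) b = 0" if "l < d" for l
    using square_inj_if_surj[OF surj, of "\<lambda>l. evalk absv (h l) b"] evsum[OF h(1)] y(2) h(2) that by auto
  then have "\<exists>h'. h' \<in> \<O> \<and> h l = (fps_X - fps_const b) * h'" if "l < d" for l
    using Oring_linear_division[OF b_disc, of "h l"] h(1) that by (metis add_0 fps_const_0_eq_0)
  then obtain h' where h': "\<And>l. l < d \<Longrightarrow> h' l \<in> \<O>" "\<And>l. l < d \<Longrightarrow> h l = (fps_X - fps_const b) * h' l"
    by metis
  have "acomp absv (h l) f = (f - fps_const b) * acomp absv (h' l) f" if "l < d" for l
    using h'[OF that] by (simp add: acomp_f_mult Oring_diff acomp_f_diff)
  then have "y = (f - fps_const b) * (\<Sum>l<d. acomp absv (h' l) f * module_basis l)"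
    unfolding h(2) sum_distrib_left by (intro sum.cong) (auto simp: mult.assoc)
  moreover have "(\<Sum>l<d. acomp absv (h' l) f * module_basis l) \<in> \<O>"
    using h' module_basis by (intro Oring_sum Oring_mult acomp_f_Oring) auto
  ultimately show ?thesis using that by blast
qed

definition "Q = (\<Prod>j<d. fps_X - fps_const (a j))"

text \<open>One root is split off at a time: the fibre points are distinct, so the factors already
  removed do not vanish at \<open>a k\<close>, and the cofactor must.\<close>

lemma f_factor_aux:
  assumes "k \<le> d"
  shows "\<exists>h\<in>\<O>. f - fps_const b = (\<Prod>j<k. fps_X - fps_const (a j)) * h"
  using assms
proof (induction k)
  case 0
  then show ?case using f_Oring by (intro bexI[of _ "f - fps_const b"]) (auto intro: Oring_diff)
next
  case (Suc k)
  then obtain h where h: "h \<in> \<O>" "f - fps_const b = (\<Prod>j<k. fps_X - fps_const (a j)) * h" by auto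
  have k: "k < d" using Suc.prems by simp
  note ak = a_disc[OF k]
  have "evalk absv (f - fps_const b) (a k) = 0"
    using evalk_diff[OF ak f_Oring Oring_const] f_a[OF k] by (simp add: evalk_eq_expand[of "fps_const _"])
  moreover have "evalk absv (f - fps_const b) (a k) = (\<Prod>j<k. a k - a j) * evalk absv h (a k)"
    unfolding h(2) using h(1) by (simp add: evalk_mult[OF ak] Oring_prod Oring_diff evalk_prod[OF ak] evalk_linear[OF ak])
  moreover have "a k - a j \<noteq> 0" if "j < k" for j
    using inj_onD[OF a_inj, of k j] that k by auto
  then have "(\<Prod>j<k. a k - a j) \<noteq> 0" by simp
  ultimately have "evalk absv h (a k) = 0" by simp
  then obtain h' where h': "h' \<in> \<O>" "h = (fps_X - fps_const (a k)) * h'"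
    using Oring_linear_division[OF ak h(1)] by (metis add_0 fps_const_0_eq_0)
  then show ?case using h(2) by (intro bexI[of _ h']) (auto simp: mult.assoc)
qed

definition "unit_part = (SOME h. h \<in> \<O> \<and> f - fps_const b = Q * h)"

lemma unit_part: "unit_part \<in> \<O>" "f - fps_const b = Q * unit_part"
proof -
  have "unit_part \<in> \<O> \<and> f - fps_const b = Q * unit_part"
    unfolding unit_part_def Q_def by (rule someI_ex) (use f_factor_aux[of d] in auto)
  then show "unit_part \<in> \<O>" "f - fps_const b = Q * unit_part" by auto
qed

lemma Q_Oring: "Q \<in> \<O>"
  unfolding Q_def by (intro Oring_prod Oring_diff) auto

lemma Q_nth_d: "Q $ d = 1" and Q_nz: "Q \<noteq> 0"
proof -
  have "(\<Prod>j<k. fps_X - fps_const (a j)) $ k = 1 \<and> (\<forall>n>k. (\<Prod>j<k. fps_X - fps_const (a j)) $ n = 0)" for k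
  proof (induction k)
    case (Suc k)
    have "((\<Prod>j<k. fps_X - fps_const (a j)) * (fps_X - fps_const (a k))) $ Suc n
      = (\<Prod>j<k. fps_X - fps_const (a j)) $ n - (\<Prod>j<k. fps_X - fps_const (a j)) $ Suc n * a k" for n
      by (simp add: right_diff_distrib)
    then show ?case using Suc by (auto simp: gr0_conv_Suc Suc_less_eq2)
  qed auto
  then show "Q $ d = 1" by (simp add: Q_def)
  then show "Q \<noteq> 0" by auto
qed

lemma Q_gauss: "gauss_le 1 Q 1"
proof -
  have "gauss_le 1 (fps_X - fps_const (a j)) 1" if "j < d" for j
    using a_disc[OF that] by (intro gauss_le_shift') (auto simp: udisc_def split: if_splits)
  then show ?thesis
    unfolding Q_def using gauss_le_prod[of "{..<d}" 1 "\<lambda>j. fps_X - fps_const (a j)" "\<lambda>_. 1"] by simp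
qed

text \<open>\<open>Q\<close> vanishes on the fibre and is therefore a multiple of
  \<open>f - b\<close>, which is itself a multiple of \<open>Q\<close>; cancelling \<open>Q\<close>
  exhibits the inverse.\<close>

lemma unit_part_inverse: "inverse unit_part \<in> \<O>" "unit_part * inverse unit_part = 1"
  and unit_part_dom: "good cl r \<Longrightarrow> dominated r unit_part"
proof -
  have "evalk absv Q (a i) = 0" if i: "i < d" for i
  proof -
    have "evalk absv (fps_X - fps_const (a i)) (a i) = 0"
      using evalk_linear[OF a_disc[OF i]] by simp
    then show ?thesis
      unfolding Q_def using i by (subst evalk_prod[OF a_disc[OF i]]) (auto intro!: Oring_diff)
  qed
  then obtain q where q: "q \<in> \<O>" "Q = (f - fps_const b) * q"
    using vanishing_divisible[OF Q_Oring] by blast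
  then have "Q * (unit_part * q) = Q * 1" using unit_part(2) by (simp add: mult.assoc)
  then have hq: "unit_part * q = 1" using Q_nz by (simp only: mult_cancel_left) simp
  have "unit_part $ 0 * q $ 0 = 1" using arg_cong[OF hq, of "\<lambda>g. g $ 0"] by simp
  then have "unit_part $ 0 \<noteq> 0" by auto
  then show "unit_part * inverse unit_part = 1" using inverse_mult_eq_1[of unit_part] by (simp add: mult.commute)
  have "inverse unit_part = q" using hq by (rule fps_inverse_unique)
  then show "inverse unit_part \<in> \<O>" using q by simp
  show "dominated r unit_part" if "good cl r"
    using unit_imp_dom[OF Oring_tate[OF unit_part(1) that] Oring_tate[OF q(1) that] hq] good_le[OF that] by simp
qed

lemma b_le_1: "absv b \<le> 1" and a_le_1: "i < d \<Longrightarrow> absv (a i) \<le> 1"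
  using b_disc a_disc[of i] by (auto simp: udisc_def split: if_splits)

text \<open>Upper bound: \<open>Q\<close> has leading coefficient 1 and is the quotient of
  \<open>f - b\<close>, of norm at most 1, by the unit. Lower bound: otherwise some
  \<open>f - s\<close> with \<open>s\<close> in the disc would be a unit, which freeness
  forbids.\<close>

lemma unit_part_0: "absv (unit_part $ 0) = 1"
proof (rule antisym)
  have nz: "unit_part $ 0 \<noteq> 0" using unit_part_dom[of "1/2"] by (auto simp: dominated_def good_def)
  have "gauss_le 1 Q (1 / absv (unit_part $ 0))"
  proof (rule gauss_le_limit)
    fix r :: real assume "0 < r" "r < 1"
    then have r: "good cl r" "0 < r" by (auto simp: good_def)
    obtain \<rho> where "good cl \<rho>" "gauss_le r f \<rho>" using f_gauss[OF r(1)] .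
    then have "gauss_le r f 1" using good_le gauss_le_mono by blast
    then have "gauss_le r (f - fps_const b) 1"
      using b_le_1 r by (intro gauss_le_diff' gauss_le_const) auto
    moreover have "gauss_le r (inverse unit_part) (absv (inverse unit_part $ 0))"
      using r by (intro dominated_gauss dominated_inverse(2) unit_part_dom) auto
    ultimately have "gauss_le r ((f - fps_const b) * inverse unit_part) (1 * absv (inverse unit_part $ 0))"
      using r by (intro gauss_le_mult) auto
    moreover have "(f - fps_const b) * inverse unit_part = Q"
      using unit_part(2) unit_part_inverse(2) by (simp add: mult.assoc)
    ultimately show "gauss_le r Q (1 / absv (unit_part $ 0))"
      by (simp add: absv_inverse divide_inverse)
  qed
  then have "1 \<le> 1 / absv (unit_part $ 0)"
    using gauss_leD[of 1 Q _ d] Q_nth_d by fastforce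
  then show "absv (unit_part $ 0) \<le> 1" using nz by (simp add: field_simps)
  show "1 \<le> absv (unit_part $ 0)"
  proof (rule ccontr)
    assume "\<not> 1 \<le> absv (unit_part $ 0)"
    \<comment> \<open>The norm of \<open>f - b\<close> is at most the size of the unit's constant
      term, so moving \<open>b\<close> by a larger \<open>x\<close> makes \<open>f - s\<close>
      dominated by its constant term.\<close>
    then obtain x where x: "absv (unit_part $ 0) < absv x" "absv x < 1"
      using ex_absv_between[of "absv (unit_part $ 0)" 1] nz by auto
    have "x \<noteq> 0" using order_le_less_trans[OF absv_nonneg x(1)] by simp
    define s where "s = b + x"
    have s: "s \<in> udisc absv cl"
      using b_disc x absv_add_le[of b x] by (auto simp: udisc_def s_def split: if_splits)
    define F where "F = f - fps_const s"
    have F: "F = fps_const (- x) + (f - fps_const b)"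
      by (simp add: F_def s_def flip: fps_const_add fps_const_neg)
    have domF: "dominated r F" if r: "good cl r" for r
    proof -
      have "gauss_le r ((f - fps_const b)) (1 * absv (unit_part $ 0))"
        unfolding unit_part(2) using r good_le[OF r] Q_gauss unit_part_dom[OF r]
        by (intro gauss_le_mult dominated_gauss gauss_le_radius[OF Q_gauss]) auto
      then have "gauss_le r ((f - fps_const b)) (absv (unit_part $ 0) / absv x * absv (fps_const (- x) $ 0))"
        using \<open>x \<noteq> 0\<close> by simp
      then show ?thesis
        unfolding F using x r good_le[OF r] \<open>x \<noteq> 0\<close> f_Oring
        by (intro dominated_add(1)[OF dominated_const, where \<epsilon> = "absv (unit_part $ 0) / absv x"])
           (auto intro!: tate_diff simp: Oring_tate divide_less_eq)
    qed
    have iF: "inverse F \<in> \<O>" "F * inverse F = 1"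
      using domF Oring_dom_inverse dominated_inverse(1)[of "1/2"] by (auto simp: good_def)
    have "module_basis 0 * inverse F \<in> \<O>" using iF module_basis d_pos by (intro Oring_mult) auto
    then obtain h where h: "\<forall>l<d. h l \<in> \<O>" "\<forall>l\<ge>d. h l = 0" "module_basis 0 * inverse F = (\<Sum>l<d. acomp absv (h l) f * module_basis l)"
      using module_basis(2) by blast
    \<comment> \<open>Two coordinate vectors of the same element: multiplying by
      \<open>f - s\<close> multiplies coordinates by \<open>X - s\<close>, and uniqueness forces
      \<open>(X - s) * h 0 = 1\<close>.\<close>
    define h1 where "h1 l = (fps_X - fps_const s) * h l" for l
    define h2 where "h2 l = (if l = 0 then 1 else 0 :: 'k fps)" for l :: nat
    have "module_basis 0 = F * (module_basis 0 * inverse F)" using iF(2) by (simp add: mult_ac)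
    also have "\<dots> = (\<Sum>l<d. acomp absv (h1 l) f * module_basis l)"
      unfolding h(3) sum_distrib_left h1_def using h(1)
      by (intro sum.cong) (auto simp: F_def acomp_f_mult acomp_f_diff Oring_diff mult.assoc)
    finally have "module_basis 0 = (\<Sum>l<d. acomp absv (h1 l) f * module_basis l)" .
    moreover have "module_basis 0 = (\<Sum>l<d. acomp absv (h2 l) f * module_basis l)"
      using d_pos by (simp add: h2_def if_distrib[of "\<lambda>h. acomp absv h f"] if_distrib[of "\<lambda>x. x * _"] cong: if_cong)
    moreover have "\<forall>l<d. h1 l \<in> \<O>" "\<forall>l\<ge>d. h1 l = 0" "\<forall>l<d. h2 l \<in> \<O>" "\<forall>l\<ge>d. h2 l = 0"
      using h d_pos by (auto simp: h1_def h2_def intro!: Oring_mult Oring_diff)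
    ultimately have "h1 = h2"
      using module_basis(2)[OF module_basis(1)[OF d_pos]] by blast
    then have "h1 0 = h2 0" by simp
    then have 1: "(fps_X - fps_const s) * h 0 = 1"
      by (simp add: h1_def h2_def)
    have "evalk absv ((fps_X - fps_const s) * h 0) s = 0"
      using h(1) d_pos by (subst evalk_mult[OF s]) (auto simp: evalk_linear[OF s] Oring_diff)
    then show False unfolding 1 by (simp add: evalk_eq_expand)
  qed
qed

text \<open>Dominance keeps the deviation from the constant term below the size of that term at
  every point of the disc.\<close>

lemma evalk_hh: "x \<in> udisc absv cl \<Longrightarrow> absv (evalk absv unit_part x) = 1"
proof -
  assume x: "x \<in> udisc absv cl"
  obtain r where r: "good cl r" "absv x \<le> r" using udisc_goodE[OF x] .
  have rpos: "0 < r" using good_le r by simp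
  have t: "tate r unit_part" using unit_part(1) r by (auto intro: Oring_tate)
  obtain \<delta> where \<delta>: "\<delta> < 1" "gauss_le r (unit_part - fps_const (unit_part $ 0)) (\<delta> * absv (unit_part $ 0))"
    using unit_part_dom[OF r(1)] by (auto simp: dominated_def)
  have "gauss_le r (expand absv (unit_part - fps_const (unit_part $ 0)) x) \<delta>"
    using \<delta> rpos r t unit_part_0 by (intro expand_gauss tate_diff) auto
  then have "absv (expand absv (unit_part - fps_const (unit_part $ 0)) x $ 0) \<le> \<delta>"
    using gauss_leD[of r _ \<delta> 0] by simp
  also have "expand absv (unit_part - fps_const (unit_part $ 0)) x = expand absv unit_part x - fps_const (unit_part $ 0)"
    using expand_diff[OF rpos r(2) t tate_const] by simp
  finally have "absv (evalk absv unit_part x - unit_part $ 0) < absv (unit_part $ 0)"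
    using \<delta> unit_part_0 by (simp add: evalk_eq_expand)
  from absv_add_eq[OF this] show ?thesis using unit_part_0 by simp
qed

end

locale etale_cover = etale_fibre absv cl d f b a for absv :: "'k::field_char_0 \<Rightarrow> real" and cl d f b a +
  fixes P :: "'k fps poly" and u :: "nat \<Rightarrow> 'k fps" and V :: "nat \<Rightarrow> nat \<Rightarrow> 'k fps"
  assumes P_deg: "degree P = d" and P_monic: "lead_coeff P = 1"
    and P_coeffs: "\<And>j. coeff P j \<in> Oring absv cl"
    and P_root: "(\<Sum>j\<le>d. acomp absv (coeff P j) f * fps_X ^ j) = 0"
    and u_def: "\<And>i. i < d \<Longrightarrow> fps_nth (u i) 0 = a i \<and>
                   (\<Sum>j\<le>d. expand absv (coeff P j) b * (u i) ^ j) = 0"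
    and V_right: "\<And>i j. i < d \<Longrightarrow> j < d \<Longrightarrow> (\<Sum>l<d. (u i) ^ l * V l j) = (if i = j then 1 else 0)"
    and V_left: "\<And>i j. i < d \<Longrightarrow> j < d \<Longrightarrow> (\<Sum>l<d. V i l * (u l) ^ j) = (if i = j then 1 else 0)"
begin

subsection \<open>Local inverses\<close>

text \<open>\<open>F i\<close> is \<open>s - b\<close> written in the local coordinate
  \<open>t - a i\<close>, and \<open>D i\<close> is \<open>t - a i\<close> written in
  \<open>s - b\<close> along the branch \<open>u i\<close>; \<open>D_eq_inv\<close> shows that they
  are inverse to each other.\<close>

definition F :: "nat \<Rightarrow> 'k fps" where
  "F i = expand absv f (a i) - fps_const b"

definition D :: "nat \<Rightarrow> 'k fps" where
  "D i = u i - fps_const (a i)"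

lemma D_0 [simp]: "i < d \<Longrightarrow> D i $ 0 = 0"
  using u_def by (simp add: D_def)

lemma F_0 [simp]: "i < d \<Longrightarrow> F i $ 0 = 0"
  using f_a[of i] by (simp add: F_def evalk_eq_expand)

lemma F_deriv_nz: "i < d \<Longrightarrow> fps_deriv (F i) $ 0 \<noteq> 0"
  and F_deriv: "i < d \<Longrightarrow> fps_deriv (F i) = expand absv (fps_deriv f) (a i)"
proof -
  assume i: "i < d"
  obtain r where r: "good cl r" "absv (a i) \<le> r" using udisc_goodE[OF a_disc[OF i]] .
  obtain g where g: "g \<in> \<O>" "fps_deriv f * g = 1" using phi by (auto simp: fin_etale_def)
  have t: "tate r f" "tate r g" "tate r (fps_deriv f)" "0 < r"
    using f_Oring g r by (auto simp: Oring_tate good_le intro!: tate_deriv)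
  show eq: "fps_deriv (F i) = expand absv (fps_deriv f) (a i)"
    using expand_deriv[of r f "a i"] t r by (simp add: F_def)
  have "expand absv (fps_deriv f) (a i) * expand absv g (a i) = 1"
    using expand_mult[of r "a i" "fps_deriv f" g] t r g(2) by simp
  then have "expand absv (fps_deriv f) (a i) $ 0 * expand absv g (a i) $ 0 = 1"
    by (metis fps_mult_nth_0 fps_one_nth)
  then show "fps_deriv (F i) $ 0 \<noteq> 0" using eq by auto
qed

text \<open>The \<open>u i\<close> are \<open>d\<close> distinct roots of a nonzero polynomial of
  degree at most \<open>d\<close> over an integral domain, hence all its roots, and their constant
  terms tell them apart.\<close>

lemma u_roots:
  assumes "i < d" "y $ 0 = a i" "(\<Sum>j\<le>d. expand absv (coeff P j) b * y ^ j) = 0"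
  shows "y = u i"
proof -
  define R where "R = (\<Sum>j\<le>d. monom (expand absv (coeff P j) b) j)"
  have cR: "coeff R n = (if n \<le> d then expand absv (coeff P n) b else 0)" for n
    by (simp add: R_def coeff_sum)
  have "coeff P d = 1" using P_deg P_monic by simp
  then have "coeff R d = 1" by (simp add: cR)
  then have "R \<noteq> 0" by (metis coeff_0 zero_neq_one)
  then have R: "R \<noteq> 0" "degree R \<le> d"
    by (auto simp: cR intro!: degree_le)
  have root: "poly R z = 0 \<longleftrightarrow> (\<Sum>j\<le>d. expand absv (coeff P j) b * z ^ j) = 0" for z
    by (simp add: R_def poly_sum poly_monom)
  have inj: "inj_on u {..<d}"
  proof (rule inj_onI)
    fix i j assume "i \<in> {..<d}" "j \<in> {..<d}" "u i = u j"
    then have "a i = a j" using u_def[of i] u_def[of j] by simp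
    then show "i = j" using a_inj \<open>i \<in> {..<d}\<close> \<open>j \<in> {..<d}\<close> by (auto dest: inj_onD)
  qed
  have "y \<in> u ` {..<d}"
  proof (rule ccontr)
    assume "y \<notin> u ` {..<d}"
    then have "card (insert y (u ` {..<d})) = Suc d"
      using card_image[OF inj] by simp
    moreover have "insert y (u ` {..<d}) \<subseteq> {z. poly R z = 0}"
      using u_def assms by (auto simp: root)
    then have "card (insert y (u ` {..<d})) \<le> card {z. poly R z = 0}"
      using poly_roots_finite[OF R(1)] by (intro card_mono)
    moreover have "card {z. poly R z = 0} \<le> degree R"
      using R(1) by (rule card_poly_roots_bound)
    ultimately show False using R by simp
  qed
  then obtain j where j: "j < d" "y = u j" by auto
  then have "a j = a i" using assms u_def[of j] by simp
  then have "j = i" using a_inj j assms by (auto dest: inj_onD)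
  then show ?thesis using j by simp
qed

text \<open>The compositional inverse of \<open>F i\<close>, moved by \<open>a i\<close>, is a root
  of \<open>P\<close> with constant term \<open>a i\<close>, and \<open>u_roots\<close> leaves only
  \<open>u i\<close>. Thus the algebraic branches are the local inverses of
  \<open>f\<close>.\<close>

lemma D_eq_inv: "i < d \<Longrightarrow> D i = fps_inv (F i)"
proof -
  assume i: "i < d"
  have F1: "F i $ 1 \<noteq> 0" using F_deriv_nz[OF i] by simp
  define W where "W = fps_inv (F i)"
  have W0: "W $ 0 = 0" by (simp add: W_def fps_inv_def)
  have FW: "fps_compose (F i) W = fps_X"
    unfolding W_def using F1 i by (intro fps_inv_right) auto
  note ai = a_disc[OF i]
  obtain r where r: "good cl r" "absv (a i) \<le> r" using udisc_goodE[OF ai] .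
  have "0 = fps_compose (expand absv (\<Sum>j\<le>d. acomp absv (coeff P j) f * fps_X ^ j) (a i)) W"
    unfolding P_root by simp
  also have "expand absv (\<Sum>j\<le>d. acomp absv (coeff P j) f * fps_X ^ j) (a i)
     = (\<Sum>j\<le>d. expand absv (acomp absv (coeff P j) f) (a i) * (fps_X + fps_const (a i)) ^ j)"
  proof -
    have t: "tate r (acomp absv (coeff P j) f)" "tate r (fps_X ^ j)" for j
      using acomp_f_Oring[OF P_coeffs] r good_le[OF r(1)] by (auto intro!: Oring_tate tate_power)
    then have "expand absv (\<Sum>j\<le>d. acomp absv (coeff P j) f * fps_X ^ j) (a i)
      = (\<Sum>j\<le>d. expand absv (acomp absv (coeff P j) f * fps_X ^ j) (a i))"
      using r good_le[OF r(1)] by (intro expand_sum[of r] tate_mult) auto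
    also have "\<dots> = (\<Sum>j\<le>d. expand absv (acomp absv (coeff P j) f) (a i) * (fps_X + fps_const (a i)) ^ j)"
      using t r good_le[OF r(1)] by (intro sum.cong refl) (simp add: expand_mult[of r])
    finally show ?thesis .
  qed
  also have "\<dots> = (\<Sum>j\<le>d. fps_compose (expand absv (coeff P j) b) (F i) * (fps_X + fps_const (a i)) ^ j)"
    using ai i by (intro sum.cong refl) (simp add: expand_acomp_f P_coeffs f_a F_def)
  also have "fps_compose \<dots> W = (\<Sum>j\<le>d. expand absv (coeff P j) b * (W + fps_const (a i)) ^ j)"
  proof -
    have "fps_compose (fps_compose y (F i)) W = y" for y
      using fps_compose_assoc[OF W0 F_0[OF i], of y] FW by simp
    then show ?thesis
      by (simp add: fps_compose_sum_distrib fps_compose_mult_distrib[OF W0] fps_compose_power[OF W0, symmetric]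
          fps_compose_add_distrib fps_X_fps_compose_startby0[OF W0])
  qed
  finally have "W + fps_const (a i) = u i"
    using W0 by (intro u_roots[OF i]) auto
  then show ?thesis by (simp add: D_def W_def flip: \<open>W + _ = _\<close>)
qed

lemma F_D: "i < d \<Longrightarrow> fps_compose (F i) (D i) = fps_X"
  unfolding D_eq_inv using F_deriv_nz[of i] by (intro fps_inv_right) auto

lemma D_F: "i < d \<Longrightarrow> fps_compose (D i) (F i) = fps_X"
  unfolding D_eq_inv using F_deriv_nz[of i] by (intro fps_inv) auto

lemma compose_F_D: "i < d \<Longrightarrow> fps_compose (fps_compose y (F i)) (D i) = y"
  using fps_compose_assoc[of "D i" "F i" y] F_D by simp

lemma compose_D_F: "i < d \<Longrightarrow> fps_compose (fps_compose y (D i)) (F i) = y"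
  using fps_compose_assoc[of "F i" "D i" y] D_F by simp

subsection \<open>Restriction to the points of the fibre\<close>

text \<open>Takes a function given in the coordinate \<open>t - c\<close> to its germ at
  \<open>a j\<close>, rewritten in \<open>s - b\<close>. With \<open>c\<close> the centre of a disc,
  one series \<open>y\<close> yields the germs at all fibre points of that disc.\<close>

definition pull :: "'k \<Rightarrow> nat \<Rightarrow> 'k fps \<Rightarrow> 'k fps" where
  "pull c j y = fps_compose (expand absv y (a j - c)) (D j)"

lemma pull_const [simp]: "j < d \<Longrightarrow> pull c j (fps_const x) = fps_const x"
  and pull_X [simp]: "j < d \<Longrightarrow> pull c j fps_X = u j - fps_const c"
  by (simp_all add: pull_def fps_compose_add_distrib fps_X_fps_compose_startby0)
    (simp add: D_def flip: fps_const_sub)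

context
  fixes r c j assumes r: "0 < r" and c: "absv (a j - c) \<le> r" and j: "j < d"
begin

lemma pull_add: "tate r y \<Longrightarrow> tate r z \<Longrightarrow> pull c j (y + z) = pull c j y + pull c j z"
  by (simp add: pull_def expand_add[OF r c] fps_compose_add_distrib)

lemma pull_diff: "tate r y \<Longrightarrow> tate r z \<Longrightarrow> pull c j (y - z) = pull c j y - pull c j z"
  by (simp add: pull_def expand_diff[OF r c] fps_compose_sub_distrib)

lemma pull_mult: "tate r y \<Longrightarrow> tate r z \<Longrightarrow> pull c j (y * z) = pull c j y * pull c j z"
  by (simp add: pull_def expand_mult[OF r c] fps_compose_mult_distrib j)

lemma pull_sum: "(\<And>i. i \<in> I \<Longrightarrow> tate r (y i)) \<Longrightarrow> pull c j (\<Sum>i\<in>I. y i) = (\<Sum>i\<in>I. pull c j (y i))"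
  by (simp add: pull_def expand_sum[OF r c] fps_compose_sum_distrib)

lemma pull_prod: "(\<And>i. i \<in> I \<Longrightarrow> tate r (y i)) \<Longrightarrow> pull c j (\<Prod>i\<in>I. y i) = (\<Prod>i\<in>I. pull c j (y i))"
  by (simp add: pull_def expand_prod[OF r c] fps_compose_prod_distrib j)

lemma pull_power: "tate r y \<Longrightarrow> pull c j (y ^ n) = pull c j y ^ n"
  by (simp add: pull_def expand_power[OF r c] fps_compose_power[of "D j"] j)

text \<open>Re-expansion and composition with \<open>D j\<close> are both invertible, so one germ
  determines the function.\<close>

lemma pull_inj: "tate r y \<Longrightarrow> pull c j y = 0 \<Longrightarrow> y = 0"
proof -
  assume y: "tate r y" and "pull c j y = 0"
  then have "expand absv y (a j - c) = 0"
    using compose_D_F[OF j, of "expand absv y (a j - c)"] by (simp add: pull_def)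
  then show "y = 0"
    using expand_inverse[OF y r c] by simp
qed

text \<open>A function of \<open>s\<close> alone looks the same in \<open>s - b\<close> at every
  fibre point; this is why Weierstrass coefficients come out independent of
  \<open>j\<close>.\<close>

lemma pull_acomp:
  assumes "tate \<phi> z" "gauss_le r g \<phi>" "tate r g" "expand absv g (a j - c) = F j"
  shows "pull c j (acomp absv z g) = z"
  using expand_acomp[OF r c assms(1-3)] assms(4) j
  by (simp add: pull_def acomp_eq_compose compose_F_D)

end

subsection \<open>Coordinates\<close>

definition coord :: "nat \<Rightarrow> (nat \<Rightarrow> 'k fps) \<Rightarrow> 'k fps" where
  "coord m v = (\<Sum>i<d. V m i * v i)"

lemma coord_unique:
  assumes "\<And>i. i < d \<Longrightarrow> v i = (\<Sum>m<d. z m * u i ^ m)" "m < d"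
  shows "coord m v = z m"
proof -
  have "coord m v = (\<Sum>i<d. \<Sum>m'<d. z m' * (V m i * u i ^ m'))"
    unfolding coord_def using assms(1) by (intro sum.cong refl) (simp add: sum_distrib_left mult_ac)
  also have "\<dots> = (\<Sum>m'<d. z m' * (\<Sum>i<d. V m i * u i ^ m'))"
    by (subst sum.swap) (simp add: sum_distrib_left)
  also have "\<dots> = (\<Sum>m'<d. if m = m' then z m' else 0)"
    using assms(2) by (intro sum.cong refl) (simp add: V_left)
  finally show ?thesis using assms(2) by simp
qed

lemma coord_expansion: "i < d \<Longrightarrow> (\<Sum>m<d. coord m v * u i ^ m) = v i"
proof -
  assume i: "i < d"
  have "(\<Sum>m<d. coord m v * u i ^ m) = (\<Sum>m<d. \<Sum>j<d. v j * (u i ^ m * V m j))"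
    unfolding coord_def by (intro sum.cong refl) (simp add: sum_distrib_left sum_distrib_right mult_ac)
  also have "\<dots> = (\<Sum>j<d. v j * (\<Sum>m<d. u i ^ m * V m j))"
    by (subst sum.swap) (simp add: sum_distrib_left)
  also have "\<dots> = (\<Sum>j<d. if i = j then v j else 0)"
    using i by (intro sum.cong refl) (simp add: V_right)
  finally show ?thesis using i by simp
qed

text \<open>Families of germs, one per fibre point, that come from a polynomial in \<open>t\<close>
  with coefficients converging on the closed disc of radius \<rho> around \<open>b\<close>. The
  coefficients are unique, so membership means convergence of the coordinates computed by
  \<open>V\<close>.\<close>

definition in_span :: "real \<Rightarrow> (nat \<Rightarrow> 'k fps) \<Rightarrow> bool" where
  "in_span \<rho> v \<longleftrightarrow> (\<exists>z. (\<forall>m<d. tate \<rho> (z m)) \<and> (\<forall>i<d. v i = (\<Sum>m<d. z m * u i ^ m)))"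

lemma in_span_coord: "in_span \<rho> v \<Longrightarrow> m < d \<Longrightarrow> tate \<rho> (coord m v)"
  unfolding in_span_def using coord_unique by metis

lemma in_span_cong: "in_span \<rho> v \<Longrightarrow> (\<And>i. i < d \<Longrightarrow> v i = w i) \<Longrightarrow> in_span \<rho> w"
  unfolding in_span_def by metis

context
  fixes \<rho> assumes \<rho>: "good cl \<rho>"
begin

lemma in_span_series: "tate \<rho> y \<Longrightarrow> in_span \<rho> (\<lambda>i. y)"
  unfolding in_span_def using d_pos
  by (intro exI[of _ "\<lambda>m. if m = 0 then y else 0"])
     (auto simp: if_distrib[of "\<lambda>x. x * _"] cong: if_cong)

lemma in_span_add: "in_span \<rho> v \<Longrightarrow> in_span \<rho> w \<Longrightarrow> in_span \<rho> (\<lambda>i. v i + w i)"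
  unfolding in_span_def
proof (elim exE conjE)
  fix z z' assume "\<forall>m<d. tate \<rho> (z m)" "\<forall>i<d. v i = (\<Sum>m<d. z m * u i ^ m)"
    "\<forall>m<d. tate \<rho> (z' m)" "\<forall>i<d. w i = (\<Sum>m<d. z' m * u i ^ m)"
  then show "\<exists>z. (\<forall>m<d. tate \<rho> (z m)) \<and> (\<forall>i<d. v i + w i = (\<Sum>m<d. z m * u i ^ m))"
    using good_le(2)[OF \<rho>]
    by (intro exI[of _ "\<lambda>m. z m + z' m"]) (auto simp: distrib_right sum.distrib intro!: tate_add)
qed

lemma in_span_cmult: "tate \<rho> y \<Longrightarrow> in_span \<rho> w \<Longrightarrow> in_span \<rho> (\<lambda>i. y * w i)"
  unfolding in_span_def
proof (elim exE conjE)
  fix z assume "tate \<rho> y" "\<forall>m<d. tate \<rho> (z m)" "\<forall>i<d. w i = (\<Sum>m<d. z m * u i ^ m)"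
  then show "\<exists>z. (\<forall>m<d. tate \<rho> (z m)) \<and> (\<forall>i<d. y * w i = (\<Sum>m<d. z m * u i ^ m))"
    using good_le(2)[OF \<rho>]
    by (intro exI[of _ "\<lambda>m. y * z m"]) (auto simp: sum_distrib_left mult.assoc intro!: tate_mult)
qed

lemma in_span_sum: "(\<And>k. k \<in> I \<Longrightarrow> in_span \<rho> (v k)) \<Longrightarrow> in_span \<rho> (\<lambda>i. \<Sum>k\<in>I. v k i)"
proof (induction I rule: infinite_finite_induct)
  case (insert x F)
  then show ?case
    using in_span_add[of "v x" "\<lambda>i. \<Sum>k\<in>F. v k i"] by simp
qed (use in_span_series[OF tate_0] in simp_all)

lemma P_tate: "tate \<rho> (expand absv (coeff P j) b)"
proof -
  obtain r where r: "good cl r" "absv b \<le> r" using udisc_goodE[OF b_disc] .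
  have "good cl (max r \<rho>)" "absv b \<le> max r \<rho>" using r \<rho> by (auto simp: good_max)
  then have "tate (max r \<rho>) (expand absv (coeff P j) b)"
    using P_coeffs good_le(2) by (intro expand_tate Oring_tate) blast+
  then show ?thesis using good_le[OF \<rho>] by (auto intro: tate_radius)
qed

text \<open>Closure under multiplication by \<open>t\<close>: the power \<open>u i ^ d\<close> is
  reduced through the monic equation \<open>P\<close>, with the same coefficients for every
  \<open>i\<close>. This makes the span a ring.\<close>

lemma in_span_u_mult: "in_span \<rho> w \<Longrightarrow> in_span \<rho> (\<lambda>i. u i * w i)"
  unfolding in_span_def
proof (elim exE conjE)
  fix z assume z: "\<forall>m<d. tate \<rho> (z m)" "\<forall>i<d. w i = (\<Sum>m<d. z m * u i ^ m)"
  obtain d' where d': "d = Suc d'" using d_pos by (cases d) auto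
  define p where "p m = expand absv (coeff P m) b" for m
  define z' where "z' m = (if m = 0 then 0 else z (m - 1)) - z d' * p m" for m
  have top: "u i ^ d = - (\<Sum>m<d. p m * u i ^ m)" if "i < d" for i
  proof -
    have "coeff P d = 1" using P_deg P_monic by simp
    then have "p d = 1" by (simp add: p_def)
    moreover have "(\<Sum>m<d. p m * u i ^ m) + p d * u i ^ d = 0"
      using u_def[OF that] by (simp add: p_def atMost_Suc_eq_insert_0 flip: lessThan_Suc_atMost)
    ultimately show ?thesis by (simp add: eq_neg_iff_add_eq_0 add.commute)
  qed
  have "u i * w i = (\<Sum>m<d. z' m * u i ^ m)" if i: "i < d" for i
  proof -
    have "u i * w i = (\<Sum>m<d. z m * u i ^ Suc m)"
      using z(2) i by (simp add: sum_distrib_left mult_ac)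
    also have "\<dots> = (\<Sum>m<d'. z m * u i ^ Suc m) + z d' * u i ^ d"
      by (simp add: d')
    also have "(\<Sum>m<d'. z m * u i ^ Suc m) = (\<Sum>m<d. (if m = 0 then 0 else z (m - 1)) * u i ^ m)"
      unfolding d' sum.lessThan_Suc_shift by simp
    also have "z d' * u i ^ d = (\<Sum>m<d. - (z d' * p m) * u i ^ m)"
      unfolding top[OF i] by (simp add: sum_distrib_left mult.assoc sum_negf)
    finally show ?thesis
      unfolding z'_def left_diff_distrib sum_subtractf by (simp add: sum_negf)
  qed
  moreover have "tate \<rho> (z' m)" if "m < d" for m
    unfolding z'_def using z(1) that P_tate good_le(2)[OF \<rho>]
    by (intro tate_diff tate_mult) (auto simp: p_def d')
  ultimately show "\<exists>z. (\<forall>m<d. tate \<rho> (z m)) \<and> (\<forall>i<d. u i * w i = (\<Sum>m<d. z m * u i ^ m))"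
    by blast
qed

lemma in_span_mult: "in_span \<rho> v \<Longrightarrow> in_span \<rho> w \<Longrightarrow> in_span \<rho> (\<lambda>i. v i * w i)"
proof -
  assume "in_span \<rho> v" and w: "in_span \<rho> w"
  then obtain z where z: "\<forall>m<d. tate \<rho> (z m)" "\<And>i. i < d \<Longrightarrow> v i = (\<Sum>m<d. z m * u i ^ m)"
    by (auto simp: in_span_def)
  have "in_span \<rho> (\<lambda>i. u i ^ m * w i)" for m
  proof (induction m)
    case (Suc m)
    then show ?case using in_span_u_mult[of "\<lambda>i. u i ^ m * w i"] by (simp add: mult.assoc)
  qed (simp add: w)
  then have "in_span \<rho> (\<lambda>i. \<Sum>m<d. z m * (u i ^ m * w i))"
    using z(1) by (intro in_span_sum in_span_cmult) auto
  then show ?thesis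
    by (rule in_span_cong) (simp add: z(2) sum_distrib_right mult.assoc)
qed

lemma in_span_prod: "(\<And>k. k \<in> I \<Longrightarrow> in_span \<rho> (v k)) \<Longrightarrow> in_span \<rho> (\<lambda>i. \<Prod>k\<in>I. v k i)"
proof (induction I rule: infinite_finite_induct)
  case (insert x F)
  then show ?case
    using in_span_mult[of "v x" "\<lambda>i. \<Prod>k\<in>F. v k i"] by simp
qed (use in_span_series[OF tate_1] in simp_all)

lemma in_span_u: "in_span \<rho> (\<lambda>i. u i - fps_const x)"
proof -
  have "in_span \<rho> (\<lambda>i. u i * 1 + fps_const (- x))"
    by (rule in_span_add[OF in_span_u_mult[OF in_span_series[OF tate_1]] in_span_series[OF tate_const]])
  then show ?thesis by (rule in_span_cong) simp
qed

end

lemma good_powerI: "good cl r \<Longrightarrow> good cl (r ^ d)"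
  using d_pos by (auto simp: good_def power_le_one power_less_one_iff split: if_splits)

text \<open>Coordinates in the powers of \<open>t\<close> are analytic: Weierstrass division by
  \<open>f - b\<close> on a disc containing the whole fibre gives analytic coefficients for Newton
  polynomials in \<open>t\<close>, and these lie in the span of the powers.\<close>

lemma coord_Oring:
  assumes y: "y \<in> \<O>" and m: "m < d"
  shows "coord m (\<lambda>j. pull 0 j y) \<in> \<O>"
  unfolding Oring_iff
proof (intro allI impI)
  fix \<rho> assume \<rho>: "good cl \<rho>"
  obtain r0 where r0: "good cl r0" "\<And>x. x \<in> insert b (a ` {..<d}) \<Longrightarrow> absv x \<le> r0"
    using udisc_good[of "insert b (a ` {..<d})" cl] b_disc a_disc by auto
  \<comment> \<open>All fibre points lie in the disc of radius \<open>r\<close>, on which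
    \<open>f - b\<close> has norm \<open>r ^ d\<close>; the root makes this at least \<rho>.\<close>
  define r where "r = max r0 (root d \<rho>)"
  have root: "good cl (root d \<rho>)" "root d \<rho> ^ d = \<rho>"
    using \<rho> d_pos by (auto simp: good_def split: if_splits)
  have r: "good cl r" unfolding r_def using r0(1) root(1) by (rule good_max)
  have rpos: "0 < r" using good_le[OF r] by simp
  have ar: "absv (a j) \<le> r" if "j < d" for j using r0(2)[of "a j"] that by (auto simp: r_def)
  have "root d \<rho> ^ d \<le> r ^ d"
    using good_le[OF root(1)] by (intro power_mono) (auto simp: r_def)
  then have le: "\<rho> \<le> r ^ d" using root by simp
  have ty: "tate r y" using y r by (rule Oring_tate)
  obtain B where "gauss_le r y B" using tate_bound[OF ty] by blast
  then have B: "gauss_le r y (max B 1)" "0 < max B 1" by (auto intro: gauss_le_mono)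
  have new: "newton a d * unit_part = f - fps_const b" by (simp add: newton_def Q_def unit_part(2))
  have K: "dominated r unit_part" using r by (rule unit_part_dom)
  obtain z where z: "\<And>l. l < d \<Longrightarrow> tate (r ^ d) (z l)"
    "y = (\<Sum>l<d. acomp absv (z l) (f - fps_const b) * newton a l)"
    using weierstrass_basis[of r d a unit_part y "max B 1", OF rpos d_pos ar K ty B] unit_part_0 new by auto
  have g: "gauss_le r (f - fps_const b) (r ^ d)" "tate r (f - fps_const b)"
    using weierstrass_gauss[of r d a unit_part, OF rpos d_pos ar K] weierstrass_tate[of r d a unit_part, OF rpos d_pos ar K] unit_part_0 new by auto
  have gd: "good cl (r ^ d)" using r by (rule good_powerI)
  have "in_span (r ^ d) (\<lambda>j. \<Sum>l<d. z l * (\<Prod>m<l. u j - fps_const (a m)))"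
  proof (rule in_span_sum[OF gd])
    fix l assume "l \<in> {..<d}"
    moreover have "in_span (r ^ d) (\<lambda>j. \<Prod>m<l. u j - fps_const (a m))"
      by (intro in_span_prod[OF gd] in_span_u[OF gd])
    ultimately show "in_span (r ^ d) (\<lambda>j. z l * (\<Prod>m<l. u j - fps_const (a m)))"
      using z(1) by (intro in_span_cmult[OF gd]) auto
  qed
  moreover have "(\<Sum>l<d. z l * (\<Prod>m<l. u j - fps_const (a m))) = pull 0 j y" if j: "j < d" for j
  proof -
    have aj: "absv (a j - 0) \<le> r" using ar[OF j] by simp
    have ex: "expand absv (f - fps_const b) (a j - 0) = F j"
      using expand_diff[of r "a j" f "fps_const b"] rpos ar[OF j] Oring_tate[OF f_Oring r] by (simp add: F_def)
    have "pull 0 j (acomp absv (z l) (f - fps_const b) * newton a l) = z l * (\<Prod>m<l. u j - fps_const (a m))" if l: "l < d" for l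
    proof -
      have "pull 0 j (newton a l) = (\<Prod>m<l. u j - fps_const (a m))"
        unfolding newton_def using rpos aj j
        by (subst pull_prod[of r]) (auto simp: pull_diff[of r])
      then show ?thesis
        using rpos aj j z(1)[OF l] g ex acomp_tate[OF z(1)[OF l] g(1) rpos g(2)]
        by (subst pull_mult[of r]) (auto simp: pull_acomp[of r _ _ "r ^ d"] newton_tate)
    qed
    then have "(\<Sum>l<d. z l * (\<Prod>m<l. u j - fps_const (a m)))
       = (\<Sum>l<d. pull 0 j (acomp absv (z l) (f - fps_const b) * newton a l))" by simp
    also have "\<dots> = pull 0 j y"
      unfolding z(2) using rpos aj j z(1) g
      by (intro pull_sum[of r, symmetric] tate_mult newton_tate acomp_tate[of "r ^ d"]) auto
    finally show ?thesis .
  qed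
  ultimately have "in_span (r ^ d) (\<lambda>j. pull 0 j y)"
    by (rule in_span_cong)
  then have "tate (r ^ d) (coord m (\<lambda>j. pull 0 j y))" using m by (rule in_span_coord)
  then show "tate \<rho> (coord m (\<lambda>j. pull 0 j y))"
    using le good_le[OF \<rho>] by (auto intro: tate_radius)
qed

lemma pull_acomp_f: "h \<in> \<O> \<Longrightarrow> j < d \<Longrightarrow> pull 0 j (acomp absv h f) = expand absv h b"
  by (simp add: pull_def expand_acomp_f a_disc f_a compose_F_D flip: F_def)

lemma uminus_b: "- b \<in> udisc absv cl"
  using b_disc by (simp add: udisc_def)

lemma expand_b_inverse:
  "h \<in> \<O> \<Longrightarrow> expand absv (expand absv h b) (- b) = h"
  "h \<in> \<O> \<Longrightarrow> expand absv (expand absv h (- b)) b = h"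
proof -
  assume h: "h \<in> \<O>"
  obtain r where r: "good cl r" "absv b \<le> r" using udisc_goodE[OF b_disc] .
  show "expand absv (expand absv h b) (- b) = h"
    using h r by (intro expand_inverse[of r]) (auto simp: Oring_tate good_le)
  show "expand absv (expand absv h (- b)) b = h"
    using expand_inverse[of r h "- b"] h r by (auto simp: Oring_tate good_le)
qed

lemma pull_power_sum:
  assumes h: "\<And>l. l < d \<Longrightarrow> h l \<in> \<O>" and j: "j < d"
  shows "pull 0 j (\<Sum>l<d. acomp absv (h l) f * fps_X ^ l) = (\<Sum>l<d. expand absv (h l) b * u j ^ l)"
proof -
  obtain r where r: "good cl r" "absv (a j) \<le> r" using udisc_goodE[OF a_disc[OF j]] .
  have rpos: "0 < r" "absv (a j - 0) \<le> r" using r good_le by auto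
  have t: "tate r (acomp absv (h l) f)" "tate r (fps_X ^ l)" if "l < d" for l
    using acomp_f_Oring[OF h[OF that]] r rpos by (auto intro!: Oring_tate tate_power)
  have "pull 0 j (\<Sum>l<d. acomp absv (h l) f * fps_X ^ l) = (\<Sum>l<d. pull 0 j (acomp absv (h l) f * fps_X ^ l))"
    using t rpos j by (intro pull_sum[of r] tate_mult) auto
  also have "\<dots> = (\<Sum>l<d. expand absv (h l) b * u j ^ l)"
    using t rpos j h by (intro sum.cong refl) (auto simp: pull_mult[of r] pull_power[of r] pull_acomp_f)
  finally show ?thesis .
qed

text \<open>\<open>coordO\<close> uses series in \<open>s\<close> and \<open>coord\<close> series in
  \<open>s - b\<close>, hence the shift by \<open>- b\<close>. The candidate reproduces
  \<open>g\<close> at one fibre point, which suffices by \<open>pull_inj\<close>; uniqueness uses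
  all fibre points.\<close>

lemma coordO_eq:
  assumes g: "g \<in> \<O>"
  shows "coordO absv cl d f g = (\<lambda>l. if l < d then expand absv (coord l (\<lambda>j. pull 0 j g)) (- b) else 0)"
proof -
  define H where "H l = (if l < d then expand absv (coord l (\<lambda>j. pull 0 j g)) (- b) else 0)" for l
  have HO: "H l \<in> \<O>" if "l < d" for l
    using coord_Oring[OF g that] Oring_expand[OF uminus_b] that by (simp add: H_def)
  have HB: "expand absv (H l) b = coord l (\<lambda>j. pull 0 j g)" if "l < d" for l
    using coord_Oring[OF g that] expand_b_inverse(2) that by (simp add: H_def)
  define g' where "g' = (\<Sum>l<d. acomp absv (H l) f * fps_X ^ l)"
  have g': "g' \<in> \<O>"
    unfolding g'_def using HO by (intro Oring_sum Oring_mult acomp_f_Oring Oring_power) auto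
  have eq0: "pull 0 0 g' = pull 0 0 g"
    unfolding g'_def using pull_power_sum[of H 0] HO HB coord_expansion[of 0 "\<lambda>j. pull 0 j g"] d_pos by simp
  obtain r where r: "good cl r" "absv (a 0) \<le> r" using udisc_goodE[OF a_disc[OF d_pos]] .
  have rpos: "0 < r" "absv (a 0 - 0) \<le> r" using r good_le(2)[OF r(1)] by auto
  have t: "tate r g" "tate r g'" using g g' r(1) by (auto intro: Oring_tate)
  have eq0': "pull 0 0 (g - g') = 0"
    using pull_diff[OF rpos d_pos t] eq0 by simp
  have "g - g' = 0"
    by (rule pull_inj[OF rpos d_pos tate_diff[OF t less_imp_le[OF rpos(1)]] eq0'])
  then have eq: "g = (\<Sum>l<d. acomp absv (H l) f * fps_X ^ l)"
    by (simp add: g'_def)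
  have uniq: "h = H" if h: "\<forall>l<d. h l \<in> \<O>" "\<forall>l\<ge>d. h l = 0" "g = (\<Sum>l<d. acomp absv (h l) f * fps_X ^ l)" for h
  proof
    fix l
    show "h l = H l"
    proof (cases "l < d")
      case True
      have "pull 0 j g = (\<Sum>l<d. expand absv (h l) b * u j ^ l)" if "j < d" for j
        using pull_power_sum[of h j] h that by simp
      then have "coord l (\<lambda>j. pull 0 j g) = expand absv (h l) b"
        using True by (intro coord_unique)
      then show ?thesis using h(1) expand_b_inverse(1) True by (simp add: H_def)
    qed (use h(2) in \<open>simp add: H_def\<close>)
  qed
  show ?thesis
    unfolding coordO_def H_def[symmetric]
  proof (rule the_equality)
    show "(\<forall>l<d. H l \<in> \<O>) \<and> (\<forall>l\<ge>d. H l = 0) \<and> g = (\<Sum>l<d. acomp absv (H l) f * fps_X ^ l)"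
      by (intro conjI allI impI HO eq) (simp_all add: H_def)
  qed (elim conjE, rule uniq)
qed

lemma expand_coordO: "g \<in> \<O> \<Longrightarrow> m < d \<Longrightarrow> expand absv (coordO absv cl d f g m) b = coord m (\<lambda>j. pull 0 j g)"
  using coord_Oring by (simp add: coordO_eq expand_b_inverse(2))

end

lemma prod_nth_0:
  fixes g :: "'i \<Rightarrow> 'a::comm_ring_1 fps"
  shows "(\<Prod>i\<in>I. g i) $ 0 = (\<Prod>i\<in>I. g i $ 0)"
  by (induction I rule: infinite_finite_induct) auto

context etale_cover
begin

subsection \<open>Images of discs\<close>

text \<open>The Gauss norm of \<open>f - b\<close> on the disc of radius \<open>r\<close> around
  \<open>a i\<close>, and hence the radius of the image disc (\<open>Sup_image\<close>). It is
  strictly increasing, so radii upstairs and downstairs correspond.\<close>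

definition prof :: "nat \<Rightarrow> real \<Rightarrow> real" where
  "prof i r = (\<Prod>j<d. max r (absv (a i - a j)))"

lemma a_dist_le_1: "i < d \<Longrightarrow> j < d \<Longrightarrow> absv (a i - a j) \<le> 1"
  using absv_diff_le[of "a i" "a j"] a_le_1[of i] a_le_1[of j] by simp

lemma prof_0: "i < d \<Longrightarrow> prof i 0 = 0"
  unfolding prof_def by (rule prod_zero) (auto intro!: bexI[of _ i])

lemma prof_1: "i < d \<Longrightarrow> prof i 1 = 1"
  unfolding prof_def using a_dist_le_1 by (simp add: max_absorb1)

lemma prof_split: "i < d \<Longrightarrow> 0 \<le> r \<Longrightarrow> prof i r = r * (\<Prod>j\<in>{..<d} - {i}. max r (absv (a i - a j)))"
  unfolding prof_def by (subst prod.remove[of _ i]) auto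

lemma prof_less: "i < d \<Longrightarrow> 0 \<le> r \<Longrightarrow> r < r' \<Longrightarrow> prof i r < prof i r'"
proof -
  assume i: "i < d" and r: "0 \<le> r" "r < r'"
  let ?A = "\<lambda>r. \<Prod>j\<in>{..<d} - {i}. max r (absv (a i - a j))"
  have le: "?A r \<le> ?A r'" using r by (intro prod_mono) auto
  have pos: "0 < ?A r'" using r by (intro prod_pos) auto
  have "r * ?A r \<le> r * ?A r'" using le r by (intro mult_left_mono)
  also have "\<dots> < r' * ?A r'" using r pos by simp
  finally show ?thesis using i r by (simp add: prof_split)
qed

lemma prof_le: "i < d \<Longrightarrow> 0 \<le> r \<Longrightarrow> r \<le> r' \<Longrightarrow> prof i r \<le> prof i r'"
  using prof_less[of i r r'] by (cases "r = r'") auto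

lemma prof_less_iff: "i < d \<Longrightarrow> 0 \<le> r \<Longrightarrow> 0 \<le> r' \<Longrightarrow> prof i r < prof i r' \<longleftrightarrow> r < r'"
  using prof_less[of i r r'] prof_le[of i r' r] by linarith

lemma prof_pos: "i < d \<Longrightarrow> 0 < r \<Longrightarrow> 0 < prof i r"
  using prof_less[of i 0 r] prof_0 by simp

lemma prof_le_1: "i < d \<Longrightarrow> 0 \<le> r \<Longrightarrow> r \<le> 1 \<Longrightarrow> prof i r \<le> 1"
  using prof_le[of i r 1] prof_1 by simp

lemma prof_less_1: "i < d \<Longrightarrow> 0 \<le> r \<Longrightarrow> r < 1 \<Longrightarrow> prof i r < 1"
  using prof_less[of i r 1] prof_1 by simp

lemma prof_surj:
  assumes "i < d" "0 < \<rho>" "\<rho> \<le> 1"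
  obtains r where "0 < r" "r \<le> 1" "prof i r = \<rho>"
proof -
  have "continuous_on {0..1} (prof i)"
    unfolding prof_def by (intro continuous_intros)
  then obtain r where "0 \<le> r" "r \<le> 1" "prof i r = \<rho>"
    using IVT'[of "prof i" 0 \<rho> 1] assms prof_0 prof_1 by auto
  then show ?thesis using that[of r] assms prof_0[of i] by (cases "r = 0") auto
qed

text \<open>Moving the centre by at most \<open>r\<close> can change only distances up to
  \<open>r\<close>, and these are hidden by the maximum.\<close>

lemma prof_cong: "i < d \<Longrightarrow> j < d \<Longrightarrow> absv (a i - a j) \<le> r \<Longrightarrow> prof i r = prof j r"
proof -
  assume *: "i < d" "j < d" "absv (a i - a j) \<le> r"
  have "max r (absv (a i - a k)) = max r (absv (a j - a k))" for k
    using *(3) absv_ultra[of "a i" "a k" "a j"] absv_ultra[of "a j" "a k" "a i"] absv_minus_commute[of "a i" "a j"]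
    by (auto simp: max_def split: if_splits)
  then show "prof i r = prof j r" by (simp add: prof_def)
qed

definition H :: "nat \<Rightarrow> 'k fps" where
  "H i = expand absv unit_part (a i)"

lemma F_factor: "i < d \<Longrightarrow> F i = (\<Prod>j<d. fps_X + fps_const (a i - a j)) * H i"
proof -
  assume i: "i < d"
  obtain r where r: "good cl r" "absv (a i) \<le> r" using udisc_goodE[OF a_disc[OF i]] .
  have rpos: "0 < r" using good_le[OF r(1)] by simp
  have t: "tate r f" "tate r Q" "tate r unit_part"
    using f_Oring Q_Oring unit_part r by (auto intro: Oring_tate)
  have "F i = expand absv (f - fps_const b) (a i)"
    using expand_diff[of r "a i" f "fps_const b"] rpos r t by (simp add: F_def)
  also have "\<dots> = expand absv Q (a i) * H i"
    unfolding unit_part(2) H_def using rpos r t by (intro expand_mult)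
  also have "expand absv Q (a i) = (\<Prod>j<d. expand absv (fps_X - fps_const (a j)) (a i))"
    unfolding Q_def using rpos r by (intro expand_prod[of r]) auto
  also have "\<dots> = (\<Prod>j<d. fps_X + fps_const (a i - a j))"
    using rpos r by (intro prod.cong refl) (simp add: expand_diff[of r "a i"] add_diff_eq flip: fps_const_sub)
  finally show ?thesis .
qed

lemma H_gauss: "i < d \<Longrightarrow> gauss_le 1 (H i) 1"
  and H_0: "i < d \<Longrightarrow> absv (H i $ 0) = 1"
proof -
  assume i: "i < d"
  obtain r0 where r0: "good cl r0" "absv (a i) \<le> r0" using udisc_goodE[OF a_disc[OF i]] .
  have hg: "gauss_le r unit_part 1" if "good cl r" for r
    using dominated_gauss[OF unit_part_dom[OF that]] unit_part_0 good_le(2)[OF that] by simp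
  show "gauss_le 1 (H i) 1"
  proof (rule gauss_le_limit)
    fix r :: real assume "0 < r" "r < 1"
    then have r: "good cl (max r r0)" using r0 good_less_1 by (intro good_max) auto
    have "gauss_le (max r r0) (H i) 1"
      unfolding H_def using r r0 hg[OF r] good_le(2)[OF r] Oring_tate[OF unit_part(1) r]
      by (intro expand_gauss) auto
    then show "gauss_le r (H i) 1" using \<open>0 < r\<close> by (auto intro: gauss_le_radius)
  qed
  show "absv (H i $ 0) = 1"
    using evalk_hh[OF a_disc[OF i]] by (simp add: H_def evalk_eq_expand)
qed

text \<open>All coefficients have size at most 1 and the constant term has size 1, so every later
  weight is smaller by the factor \<open>r\<close>.\<close>

lemma H_dom: "i < d \<Longrightarrow> 0 < r \<Longrightarrow> r < 1 \<Longrightarrow> dominated r (H i)"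
proof -
  assume i: "i < d" and r: "0 < r" "r < 1"
  have "gauss_le r (H i - fps_const (H i $ 0)) (r * absv (H i $ 0))"
    unfolding gauss_le_def
  proof
    fix n
    show "absv ((H i - fps_const (H i $ 0)) $ n) * r ^ n \<le> r * absv (H i $ 0)"
    proof (cases n)
      case (Suc n')
      have "absv (H i $ n) \<le> 1" using gauss_leD[OF H_gauss[OF i], of n] by simp
      then have "absv (H i $ n) * r ^ n \<le> 1 * r ^ n" using r by (intro mult_right_mono) auto
      also have "\<dots> \<le> r" using r Suc by (simp add: power_le_one mult_left_le)
      finally show ?thesis using Suc H_0[OF i] by simp
    qed (use r H_0[OF i] in auto)
  qed
  moreover have "tate r (H i)" using tate_if_gauss_le[OF H_gauss[OF i]] r by simp
  moreover have "H i $ 0 \<noteq> 0" using H_0[OF i] by auto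
  ultimately show ?thesis using r by (intro dominatedI[where \<delta> = r])
qed

lemma F_gauss: "i < d \<Longrightarrow> 0 < r \<Longrightarrow> r \<le> 1 \<Longrightarrow> gauss_le r (F i) (prof i r)"
proof -
  assume i: "i < d" and r: "0 < r" "r \<le> 1"
  have "gauss_le r (\<Prod>j<d. fps_X + fps_const (a i - a j)) (prof i r)"
    unfolding prof_def using r by (intro gauss_le_prod gauss_le_X_plus) auto
  moreover have "gauss_le r (H i) 1" using r by (intro gauss_le_radius[OF H_gauss[OF i]]) auto
  ultimately have "gauss_le r (F i) (prof i r * 1)"
    unfolding F_factor[OF i] using r by (intro gauss_le_mult) auto
  then show ?thesis by simp
qed

lemma F_tate: "i < d \<Longrightarrow> 0 < r \<Longrightarrow> r < 1 \<Longrightarrow> tate r (F i)"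
  using tate_if_gauss_le[OF F_gauss[of i 1]] by simp

lemma expand_F:
  assumes "i < d" "j < d"
  shows "expand absv (F i) (a j - a i) = F j"
proof -
  obtain r where r: "good cl r" "\<And>x. x \<in> {a i, a j} \<Longrightarrow> absv x \<le> r"
    using udisc_good[of "{a i, a j}" cl] assms a_disc by auto
  then have rr: "0 < r" "absv (a i) \<le> r" "absv (a j) \<le> r" using good_le by auto
  then have ji: "absv (a j - a i) \<le> r" using absv_diff_le[of "a j" "a i"] by linarith
  have t: "tate r f" "tate r (expand absv f (a i))"
    using f_Oring r rr by (auto intro: Oring_tate expand_tate)
  show ?thesis
    using expand_diff[OF rr(1) ji t(2) tate_const] expand_expand[OF t(1) rr(1) rr(2) ji]
    by (simp add: F_def)
qed

subsection \<open>Push-forward of functions on discs\<close>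

lemma pull_linear:
  assumes "0 < r" "absv (a k - c) \<le> r" "k < d"
  shows "pull c k (fps_X - fps_const (x - c)) = u k - fps_const x"
proof -
  have "pull c k (fps_X - fps_const (x - c)) = u k - fps_const c - fps_const (x - c)"
    using pull_diff[OF assms tate_X tate_const, of "x - c"] assms(3) by (simp only: pull_X pull_const)
  then show ?thesis by (simp flip: fps_const_sub)
qed

text \<open>Division by \<open>F i\<close> on a disc around \<open>a i\<close>: the \<open>e\<close>
  fibre points in the disc form the Newton polynomial, and all other factors are units there. The
  coefficients \<open>z\<close> are functions of \<open>s\<close> that serve every fibre point of
  the disc at once.\<close>

lemma disc_basis:
  assumes i: "i < d" and r: "0 < r" "r < 1" and y: "tate r y" "gauss_le r y B" "0 < B"
  obtains h e z where "bij_betw h {..<e} {j. j < d \<and> absv (a j - a i) \<le> r}" "0 < e"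
    "\<And>l. l < e \<Longrightarrow> tate (prof i r) (z l)" "\<And>l. l < e \<Longrightarrow> gauss_le (prof i r) (z l) (B / r ^ l)"
    "\<And>k. k < d \<Longrightarrow> absv (a k - a i) \<le> r \<Longrightarrow> pull (a i) k y = (\<Sum>l<e. z l * (\<Prod>m<l. u k - fps_const (a (h m))))"
proof -
  define L where "L = {j. j < d \<and> absv (a j - a i) \<le> r}"
  have L: "finite L" "L \<subseteq> {..<d}" "i \<in> L" using i r by (auto simp: L_def)
  define e where "e = card L"
  have e: "0 < e" using L by (auto simp: e_def card_gt_0_iff)
  obtain h where h: "bij_betw h {..<e} L"
    using ex_bij_betw_nat_finite[OF L(1)] by (auto simp: e_def lessThan_atLeast0)
  define \<alpha> where "\<alpha> m = a (h m) - a i" for m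
  have hL: "h m \<in> L" if "m < e" for m using h that by (auto simp: bij_betw_def)
  have \<alpha>: "absv (\<alpha> m) \<le> r" if "m < e" for m using hL[OF that] by (simp add: \<alpha>_def L_def)
  define K where "K = (\<Prod>j\<in>{..<d} - L. fps_X + fps_const (a i - a j)) * H i"
  have out: "r < absv (a i - a j)" if "j \<in> {..<d} - L" for j
    using that absv_minus_commute[of "a i" "a j"] by (auto simp: L_def)
  have K: "dominated r K"
    unfolding K_def using r out by (intro dominated_mult dominated_prod dominated_linear H_dom i) auto
  have nw: "newton \<alpha> e = (\<Prod>j\<in>L. fps_X + fps_const (a i - a j))"
  proof -
    have "newton \<alpha> e = (\<Prod>m<e. fps_X + fps_const (a i - a (h m)))"
      unfolding newton_def \<alpha>_def by (intro prod.cong refl) (simp flip: fps_const_sub)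
    also have "\<dots> = (\<Prod>j\<in>L. fps_X + fps_const (a i - a j))"
      by (rule prod.reindex_bij_betw[OF h])
    finally show ?thesis .
  qed
  have split: "{..<d} = ({..<d} - L) \<union> L" using L by auto
  have FK: "newton \<alpha> e * K = F i"
  proof -
    have "(\<Prod>j<d. fps_X + fps_const (a i - a j))
       = (\<Prod>j\<in>{..<d} - L. fps_X + fps_const (a i - a j)) * (\<Prod>j\<in>L. fps_X + fps_const (a i - a j))"
      by (subst split, rule prod.union_disjoint) (use L in auto)
    then show ?thesis by (simp add: F_factor[OF i] nw K_def mult_ac)
  qed
  \<comment> \<open>Each fibre point inside contributes \<open>r\<close> to \<open>prof i r\<close>;
    one outside contributes its distance, which is the size of its factor in
    \<open>K\<close>.\<close>
  have K0: "r ^ e * absv (K $ 0) = prof i r"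
  proof -
    have "prof i r = (\<Prod>j\<in>{..<d} - L. max r (absv (a i - a j))) * (\<Prod>j\<in>L. max r (absv (a i - a j)))"
      unfolding prof_def by (subst split, rule prod.union_disjoint) (use L in auto)
    also have "(\<Prod>j\<in>L. max r (absv (a i - a j))) = (\<Prod>j\<in>L. r)"
      using absv_minus_commute by (intro prod.cong refl) (auto simp: L_def max_def)
    also have "(\<Prod>j\<in>{..<d} - L. max r (absv (a i - a j))) = (\<Prod>j\<in>{..<d} - L. absv (a i - a j))"
      using out by (intro prod.cong refl) (force simp: max_def)
    also have "absv (K $ 0) = (\<Prod>j\<in>{..<d} - L. absv (a i - a j))"
      using H_0[OF i] by (simp add: K_def absv_mult prod_nth_0 absv_prod)
    ultimately show ?thesis by (simp add: e_def mult.commute)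
  qed
  obtain z where z: "\<And>l. l < e \<Longrightarrow> tate (prof i r) (z l)" "\<And>l. l < e \<Longrightarrow> gauss_le (prof i r) (z l) (B / r ^ l)"
    "y = (\<Sum>l<e. acomp absv (z l) (F i) * newton \<alpha> l)"
    using weierstrass_basis[of r e \<alpha> K y B, OF r(1) e \<alpha> K y] unfolding FK K0 by blast
  note Fg = F_gauss[OF i r(1) less_imp_le[OF r(2)]] F_tate[OF i r]
  have "pull (a i) k y = (\<Sum>l<e. z l * (\<Prod>m<l. u k - fps_const (a (h m))))" if k: "k < d" "absv (a k - a i) \<le> r" for k
  proof -
    have "pull (a i) k (acomp absv (z l) (F i) * newton \<alpha> l) = z l * (\<Prod>m<l. u k - fps_const (a (h m)))" if l: "l < e" for l
    proof -
      have lin: "pull (a i) k (fps_X - fps_const (\<alpha> m)) = u k - fps_const (a (h m))" for m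
        unfolding \<alpha>_def by (rule pull_linear[OF r(1) k(2,1)])
      have "pull (a i) k (newton \<alpha> l) = (\<Prod>m<l. pull (a i) k (fps_X - fps_const (\<alpha> m)))"
        unfolding newton_def by (rule pull_prod[OF r(1) k(2,1)]) simp
      then have nl: "pull (a i) k (newton \<alpha> l) = (\<Prod>m<l. u k - fps_const (a (h m)))"
        by (simp only: lin)
      have "pull (a i) k (acomp absv (z l) (F i) * newton \<alpha> l) = pull (a i) k (acomp absv (z l) (F i)) * pull (a i) k (newton \<alpha> l)"
        using r by (intro pull_mult[OF r(1) k(2,1)] acomp_tate[OF z(1)[OF l] Fg(1) r(1) Fg(2)] newton_tate) auto
      also have "pull (a i) k (acomp absv (z l) (F i)) = z l"
        by (rule pull_acomp[OF r(1) k(2,1) z(1)[OF l] Fg expand_F[OF i k(1)]])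
      finally show ?thesis by (simp only: nl)
    qed
    moreover have "pull (a i) k y = (\<Sum>l<e. pull (a i) k (acomp absv (z l) (F i) * newton \<alpha> l))"
      unfolding z(3) using r by (intro pull_sum[OF r(1) k(2,1)] tate_mult newton_tate acomp_tate[OF z(1) Fg(1) r(1) Fg(2)]) auto
    ultimately show ?thesis by simp
  qed
  then show ?thesis using that[of h e z] h e z(1,2) by (auto simp: L_def)
qed

text \<open>A polynomial in \<open>u\<close> with analytic coefficients that vanishes on the disc around \<open>a j\<close> and
  is invertible on a disjoint disc around \<open>a i\<close> with the same image.\<close>

lemma separating_element:
  assumes j: "j < d" and r: "0 < r" "r < 1"
    and i: "i < d" "r < absv (a i - a j)" and ri: "0 < ri" "ri < absv (a i - a j)" "prof i ri = prof j r"
  obtains q C where "in_span (prof j r) q" "\<And>k. k < d \<Longrightarrow> absv (a k - a j) \<le> r \<Longrightarrow> q k = 0"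
    "dominated ri C" "\<And>k. k < d \<Longrightarrow> absv (a k - a i) \<le> ri \<Longrightarrow> pull (a i) k C = q k"
proof -
  define N where "N = {k. k < d \<and> absv (a k - a j) \<le> r}"
  define \<rho> where "\<rho> = prof j r"
  define \<Delta> where "\<Delta> = absv (a i - a j)"
  have \<rho>: "0 < \<rho>" "\<rho> < 1" "good cl \<rho>"
    using prof_pos[OF j] prof_less_1[OF j] r by (auto simp: \<rho>_def intro!: good_less_1)
  have ri1: "ri < 1" using ri a_dist_le_1[OF i(1) j] by linarith
  define y where "y = (\<Prod>k\<in>N. fps_X - fps_const (a k - a j))"
  have ty: "tate r y" unfolding y_def using r by (intro tate_prod) auto
  have "gauss_le r y (\<Prod>k\<in>N. r)"
    unfolding y_def using r by (intro gauss_le_prod gauss_le_shift') (auto simp: N_def)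
  then have gy: "gauss_le r y (r ^ card N)" by simp
  obtain h e z where h: "bij_betw h {..<e} N" "0 < e"
    and z: "\<And>l. l < e \<Longrightarrow> tate \<rho> (z l)" "\<And>l. l < e \<Longrightarrow> gauss_le \<rho> (z l) (r ^ card N / r ^ l)"
    and py: "\<And>k. k < d \<Longrightarrow> absv (a k - a j) \<le> r \<Longrightarrow> pull (a j) k y = (\<Sum>l<e. z l * (\<Prod>m<l. u k - fps_const (a (h m))))"
    using disc_basis[OF j r ty gy] r unfolding N_def[symmetric] \<rho>_def[symmetric] by auto
  have cN: "card N = e" using bij_betw_same_card[OF h(1)] by simp
  have hN: "h m \<in> N" if "m < e" for m using h that by (auto simp: bij_betw_def)
  \<comment> \<open>The monic polynomial of degree \<open>e\<close> satisfied by \<open>t\<close> on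
    the disc around \<open>a j\<close>: the product over all its fibre points minus the expansion of
    that same product in lower degrees. As an element of the span it makes sense at every fibre
    point.\<close>
  define q where "q k = (\<Prod>m<e. u k - fps_const (a (h m))) - (\<Sum>l<e. z l * (\<Prod>m<l. u k - fps_const (a (h m))))" for k
  have spanl: "in_span \<rho> (\<lambda>k. \<Prod>m<l. u k - fps_const (a (h m)))" for l
    by (intro in_span_prod[OF \<rho>(3)] in_span_u[OF \<rho>(3)])
  have span: "in_span \<rho> q"
  proof -
    have "in_span \<rho> (\<lambda>k. \<Sum>l<e. - z l * (\<Prod>m<l. u k - fps_const (a (h m))))"
    proof (rule in_span_sum[OF \<rho>(3)])
      fix l assume "l \<in> {..<e}"
      then show "in_span \<rho> (\<lambda>k. - z l * (\<Prod>m<l. u k - fps_const (a (h m))))"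
        using z(1) by (intro in_span_cmult[OF \<rho>(3) _ spanl]) auto
    qed
    from in_span_add[OF \<rho>(3) spanl[of e] this] show ?thesis
      by (rule in_span_cong) (simp add: q_def sum_negf)
  qed
  have van: "q k = 0" if k: "k < d" "absv (a k - a j) \<le> r" for k
  proof -
    have "pull (a j) k y = (\<Prod>k'\<in>N. pull (a j) k (fps_X - fps_const (a k' - a j)))"
      unfolding y_def by (rule pull_prod[OF r(1) k(2,1)]) simp
    also have "\<dots> = (\<Prod>k'\<in>N. u k - fps_const (a k'))"
      by (intro prod.cong refl pull_linear[OF r(1) k(2,1)])
    also have "\<dots> = (\<Prod>m<e. u k - fps_const (a (h m)))"
      by (rule prod.reindex_bij_betw[OF h(1), symmetric])
    finally show ?thesis using py[OF k] by (simp add: q_def)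
  qed
  define lin where "lin m = fps_X - fps_const (a (h m) - a i)" for m
  have dist: "absv (a (h m) - a i) = \<Delta>" if "m < e" for m
  proof -
    have "absv (a (h m) - a j) < absv (a j - a i)"
      using hN[OF that] i(2) absv_minus_commute[of "a i" "a j"] by (simp add: N_def)
    then show ?thesis
      using absv_ultra_eq[of "a (h m)" "a j" "a i"] absv_minus_commute[of "a i" "a j"] by (simp add: \<Delta>_def)
  qed
  have lin_alt: "lin m = fps_X + fps_const (a i - a (h m))" for m
    by (simp add: lin_def flip: fps_const_sub)
  have linK: "dominated ri (lin m)" "gauss_le ri (lin m) \<Delta>" "absv (lin m $ 0) = \<Delta>" if "m < e" for m
  proof -
    have di: "absv (a i - a (h m)) = \<Delta>" using dist[OF that] absv_minus_commute by simp
    show "dominated ri (lin m)" unfolding lin_alt using di ri by (intro dominated_linear) (auto simp: \<Delta>_def)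
    show "absv (lin m $ 0) = \<Delta>" unfolding lin_alt using di by simp
    show "gauss_le ri (lin m) \<Delta>"
      unfolding lin_alt using gauss_le_X_plus[of ri "a i - a (h m)"] di ri by (simp add: max_def \<Delta>_def)
  qed
  have \<Delta>: "0 < \<Delta>" "r < \<Delta>" using i r by (auto simp: \<Delta>_def)
  note Fg = F_gauss[OF i(1) ri(1) less_imp_le[OF ri1], unfolded ri(3), folded \<rho>_def] F_tate[OF i(1) ri(1) ri1]
  define \<eta> where "\<eta> = - (\<Sum>l<e. acomp absv (z l) (F i) * (\<Prod>m<l. lin m))"
  define C where "C = (\<Prod>m<e. lin m) + \<eta>"
  have tl: "tate ri (lin m)" for m by (simp add: lin_def)
  have tate_summand: "tate ri (acomp absv (z l) (F i) * (\<Prod>m<l. lin m))" if "l < e" for l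
    using ri tl by (intro tate_mult tate_prod acomp_tate[OF z(1)[OF that] Fg(1) ri(1) Fg(2)]) auto
  have tn: "tate ri \<eta>"
    unfolding \<eta>_def tate_minus using ri tate_summand by (intro tate_sum) auto
  \<comment> \<open>Around \<open>a i\<close> every linear factor has size \<Delta>, and the term of
    degree \<open>l\<close> is bounded by \<open>r ^ (e - l) * \<Delta> ^ l\<close>; as
    \<open>r < \<Delta>\<close>, the top term wins by the factor
    \<open>r / \<Delta>\<close>.\<close>
  have g\<eta>: "gauss_le ri \<eta> (r / \<Delta> * \<Delta> ^ e)"
    unfolding \<eta>_def gauss_le_minus
  proof (rule gauss_le_sum)
    fix l assume "l \<in> {..<e}"
    then have l: "l < e" by simp
    have "gauss_le ri (\<Prod>m<l. lin m) (\<Prod>m<l. \<Delta>)"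
      using l ri linK(2) by (intro gauss_le_prod) auto
    then have "gauss_le ri (acomp absv (z l) (F i) * (\<Prod>m<l. lin m)) (r ^ card N / r ^ l * \<Delta> ^ l)"
      using ri by (intro gauss_le_mult acomp_gauss[OF z(1)[OF l] z(2)[OF l] Fg(1) ri(1)]) auto
    moreover have "r ^ card N / r ^ l * \<Delta> ^ l \<le> r / \<Delta> * \<Delta> ^ e"
    proof -
      obtain t where t: "e = l + Suc t" using l less_iff_Suc_add by auto
      have "r ^ t \<le> \<Delta> ^ t" using \<Delta> r by (intro power_mono) auto
      then have "r * r ^ t * \<Delta> ^ l \<le> r * \<Delta> ^ t * \<Delta> ^ l" using r \<Delta> by (intro mult_right_mono mult_left_mono) auto
      then show ?thesis using r \<Delta> by (simp add: cN t power_add mult_ac)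
    qed
    ultimately show "gauss_le ri (acomp absv (z l) (F i) * (\<Prod>m<l. lin m)) (r / \<Delta> * \<Delta> ^ e)"
      by (rule gauss_le_mono)
  qed (use r \<Delta> ri in auto)
  have p0: "absv ((\<Prod>m<e. lin m) $ 0) = \<Delta> ^ e"
    using linK(3) by (simp add: prod_nth_0 absv_prod)
  have "dominated ri (\<Prod>m<e. lin m)" using linK(1) ri by (intro dominated_prod) auto
  then have domC: "dominated ri C"
    unfolding C_def using tn g\<eta> p0 \<Delta> ri
    by (intro dominated_add(1)[where \<epsilon> = "r / \<Delta>"]) (auto simp: divide_less_eq)
  have "pull (a i) k C = q k" if k: "k < d" "absv (a k - a i) \<le> ri" for k
  proof -
    have pl: "pull (a i) k (\<Prod>m<l. lin m) = (\<Prod>m<l. u k - fps_const (a (h m)))" for l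
    proof -
      have "pull (a i) k (\<Prod>m<l. lin m) = (\<Prod>m<l. pull (a i) k (lin m))"
        using tl by (intro pull_prod[OF ri(1) k(2,1)])
      also have "\<dots> = (\<Prod>m<l. u k - fps_const (a (h m)))"
        unfolding lin_def by (intro prod.cong refl pull_linear[OF ri(1) k(2,1)])
      finally show ?thesis .
    qed
    have "pull (a i) k (acomp absv (z l) (F i) * (\<Prod>m<l. lin m)) = z l * (\<Prod>m<l. u k - fps_const (a (h m)))" if l: "l < e" for l
    proof -
      have "pull (a i) k (acomp absv (z l) (F i) * (\<Prod>m<l. lin m))
         = pull (a i) k (acomp absv (z l) (F i)) * pull (a i) k (\<Prod>m<l. lin m)"
        using ri tl by (intro pull_mult[OF ri(1) k(2,1)] tate_prod acomp_tate[OF z(1)[OF l] Fg(1) ri(1) Fg(2)]) auto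
      also have "pull (a i) k (acomp absv (z l) (F i)) = z l"
        by (rule pull_acomp[OF ri(1) k(2,1) z(1)[OF l] Fg expand_F[OF i(1) k(1)]])
      finally show ?thesis by (simp only: pl)
    qed
    moreover have "C = (\<Prod>m<e. lin m) - (\<Sum>l<e. acomp absv (z l) (F i) * (\<Prod>m<l. lin m))"
      by (simp add: C_def \<eta>_def)
    then have "pull (a i) k C = pull (a i) k (\<Prod>m<e. lin m) - pull (a i) k (\<Sum>l<e. acomp absv (z l) (F i) * (\<Prod>m<l. lin m))"
      using ri tl tate_summand by (simp only:) (intro pull_diff[OF ri(1) k(2,1)] tate_prod tate_sum, auto)
    moreover have "pull (a i) k (\<Sum>l<e. acomp absv (z l) (F i) * (\<Prod>m<l. lin m))
       = (\<Sum>l<e. pull (a i) k (acomp absv (z l) (F i) * (\<Prod>m<l. lin m)))"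
      using tate_summand by (intro pull_sum[OF ri(1) k(2,1)]) auto
    ultimately show ?thesis by (simp add: pl q_def)
  qed
  then show ?thesis using that[of q C] span van domC by (simp add: \<rho>_def)
qed

text \<open>Extension by zero from one disc to the whole preimage of its image. Multiplying by
  separating elements for all outside fibre points kills the germs there; dividing \<open>y\<close>
  by their product beforehand restores \<open>y\<close> on the disc itself.\<close>

theorem pushforward:
  assumes i: "i < d" and r: "0 < r" "r \<le> 1" and y: "conv_open absv y r" and m: "m < d"
  defines "v \<equiv> \<lambda>j. if absv (a j - a i) < r then pull (a i) j y else 0"
  shows "conv_open absv (coord m v) (prof i r)"
proof -
  have "tate \<rho> (coord m v)" if \<rho>: "0 < \<rho>" "\<rho> < prof i r" for \<rho>
  proof -
    define W where "W = {j. j < d \<and> absv (a j - a i) < r}"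
    define r0 where "r0 = Max (insert 0 ((\<lambda>j. absv (a j - a i)) ` W))"
    have r0: "r0 < r" "0 \<le> r0" "\<And>j. j \<in> W \<Longrightarrow> absv (a j - a i) \<le> r0"
      using r by (auto simp: r0_def W_def)
    have "\<rho> \<le> 1" using \<rho> prof_le_1[OF i, of r] r by linarith
    then obtain r1 where r1: "0 < r1" "r1 \<le> 1" "prof i r1 = \<rho>" using prof_surj[OF i \<rho>(1)] by blast
    have r1r: "r1 < r" using \<rho> r1 r prof_less_iff[OF i, of r1 r] by simp
    \<comment> \<open>So close to \<open>r\<close> that the closed disc of radius \<open>r'\<close>
      contains the same fibre points, and its image still has radius above \<rho>.\<close>
    define r' where "r' = (max r0 r1 + r) / 2"
    have r': "r0 < r'" "r1 < r'" "r' < r" "0 < r'" "r' < 1"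
      using r0 r1 r1r r by (auto simp: r'_def max_def)
    define \<rho>' where "\<rho>' = prof i r'"
    have \<rho>': "\<rho> < \<rho>'" "0 < \<rho>'" "\<rho>' < 1" "good cl \<rho>'"
      using prof_less[OF i, of r1 r'] prof_pos[OF i, of r'] prof_less_1[OF i, of r'] r1 r'
      by (auto simp: \<rho>'_def intro!: good_less_1)
    have W: "j \<in> W \<longleftrightarrow> absv (a j - a i) \<le> r'" if "j < d" for j
      using r0(3)[of j] r' that by (auto simp: W_def)
    have ty: "tate r' y" using y r' r by (simp add: conv_open_iff)
    define J where "J = {..<d} - W"
    have "\<exists>q C. in_span \<rho>' q \<and> q j = 0 \<and> dominated r' C \<and> (\<forall>k\<in>W. pull (a i) k C = q k)" if "j \<in> J" for j
    proof -
      have j: "j < d" "j \<notin> W" using that by (auto simp: J_def)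
      then have far: "r \<le> absv (a i - a j)" using absv_minus_commute[of "a i" "a j"] by (simp add: W_def)
      obtain s where s: "0 < s" "s \<le> 1" "prof j s = \<rho>'" using prof_surj[OF j(1) \<rho>'(2)] \<rho>' by auto
      have s1: "s < 1" using s prof_1[OF j(1)] \<rho>' by (cases "s = 1") auto
      \<comment> \<open>If the disc around \<open>a j\<close> with the same image reached
        \<open>a i\<close>, both would have radius \<open>r'\<close>, but \<open>a j\<close> is at
        distance at least \<open>r\<close>.\<close>
      have "s < absv (a i - a j)"
      proof (rule ccontr)
        assume c: "\<not> s < absv (a i - a j)"
        then have "prof i s = prof i r'" using prof_cong[OF i j(1), of s] s by (simp add: \<rho>'_def)
        then have "s = r'" using prof_less_iff[OF i, of s r'] prof_less_iff[OF i, of r' s] s r' by auto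
        then show False using c far r' by simp
      qed
      then obtain q C where "in_span (prof j s) q" "\<And>k. k < d \<Longrightarrow> absv (a k - a j) \<le> s \<Longrightarrow> q k = 0"
        "dominated r' C" "\<And>k. k < d \<Longrightarrow> absv (a k - a i) \<le> r' \<Longrightarrow> pull (a i) k C = q k"
        using separating_element[OF j(1) s(1) s1 i _ r'(4)] far r' s \<rho>'_def by auto
      then show ?thesis using s j W by (intro exI[of _ q] exI[of _ C]) (auto simp: W_def)
    qed
    then obtain q C where q: "\<And>j. j \<in> J \<Longrightarrow> in_span \<rho>' (q j)" "\<And>j. j \<in> J \<Longrightarrow> q j j = 0"
      and C: "\<And>j. j \<in> J \<Longrightarrow> dominated r' (C j)" "\<And>j k. j \<in> J \<Longrightarrow> k \<in> W \<Longrightarrow> pull (a i) k (C j) = q j k"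
      by metis
    define Cp where "Cp = (\<Prod>j\<in>J. C j)"
    have Cp: "dominated r' Cp" unfolding Cp_def using C r' by (intro dominated_prod) auto
    define y2 where "y2 = y * inverse Cp"
    have t: "tate r' Cp" "tate r' y2"
      unfolding y2_def using ty r' dominated_tate[OF Cp] dominated_tate[OF dominated_inverse(2)[OF Cp]] by (auto intro!: tate_mult)
    have yy: "y = y2 * Cp"
      using dominated_inverse(1)[OF Cp] r' by (simp add: y2_def mult.assoc mult.commute[of Cp])
    obtain B where "gauss_le r' y2 B" using tate_bound[OF t(2)] by blast
    then have B: "gauss_le r' y2 (max B 1)" "0 < max B 1" by (auto intro: gauss_le_mono)
    obtain h :: "nat \<Rightarrow> nat" and e :: nat and z where z: "\<And>l. l < e \<Longrightarrow> tate \<rho>' (z l)"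
      and py: "\<And>k. k < d \<Longrightarrow> absv (a k - a i) \<le> r' \<Longrightarrow> pull (a i) k y2 = (\<Sum>l<e. z l * (\<Prod>m<l. u k - fps_const (a (h m))))"
      by (rule disc_basis[OF i r'(4,5) t(2) B, folded \<rho>'_def]) (rule that; assumption)
    define \<beta> where "\<beta> k = (\<Sum>l<e. z l * (\<Prod>m<l. u k - fps_const (a (h m))))" for k
    have "in_span \<rho>' \<beta>"
      unfolding \<beta>_def
    proof (rule in_span_sum[OF \<rho>'(4)])
      fix l assume "l \<in> {..<e}"
      moreover have "in_span \<rho>' (\<lambda>k. \<Prod>m<l. u k - fps_const (a (h m)))"
        by (intro in_span_prod[OF \<rho>'(4)] in_span_u[OF \<rho>'(4)])
      ultimately show "in_span \<rho>' (\<lambda>k. z l * (\<Prod>m<l. u k - fps_const (a (h m))))"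
        using z by (intro in_span_cmult[OF \<rho>'(4)]) auto
    qed
    from in_span_mult[OF \<rho>'(4) this in_span_prod[OF \<rho>'(4), of J q, OF q(1)]]
    have "in_span \<rho>' (\<lambda>k. \<beta> k * (\<Prod>j\<in>J. q j k))" by simp
    then have "in_span \<rho>' v"
    proof (rule in_span_cong)
      fix k assume k: "k < d"
      show "\<beta> k * (\<Prod>j\<in>J. q j k) = v k"
      proof (cases "k \<in> W")
        case True
        then have kr: "absv (a k - a i) \<le> r'" using W[OF k] by simp
        have "(\<Prod>j\<in>J. q j k) = (\<Prod>j\<in>J. pull (a i) k (C j))"
          using C(2) True by (intro prod.cong) auto
        also have "\<dots> = pull (a i) k Cp"
          unfolding Cp_def using C(1) by (intro pull_prod[OF r'(4) kr k, symmetric]) (auto intro: dominated_tate)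
        finally have "\<beta> k * (\<Prod>j\<in>J. q j k) = pull (a i) k (y2 * Cp)"
          using py[OF k kr] pull_mult[OF r'(4) kr k t(2,1)] by (simp add: \<beta>_def)
        then show ?thesis using True by (simp add: v_def W_def flip: yy)
      next
        case False
        then have "k \<in> J" using k by (simp add: J_def)
        then have "(\<Prod>j\<in>J. q j k) = 0" using q(2) by (intro prod_zero) (auto simp: J_def)
        then show ?thesis using False k by (simp add: v_def W_def)
      qed
    qed
    then have "tate \<rho>' (coord m v)" using m by (rule in_span_coord)
    then show ?thesis using \<rho> \<rho>' by (auto intro: tate_radius)
  qed
  then show ?thesis
    using prof_pos[OF i r(1)] prof_le_1[OF i _ r(2)] r by (simp add: conv_open_iff)
qed

subsection \<open>Pull-back to the fibre\<close>

lemma u_F: "i < d \<Longrightarrow> fps_compose (u i) (F i) = fps_X + fps_const (a i)"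
proof -
  assume i: "i < d"
  have "u i = D i + fps_const (a i)" by (simp add: D_def)
  then show ?thesis using D_F[OF i] by (simp add: fps_compose_add_distrib)
qed

lemma back_eq:
  assumes i: "i < d"
  shows "fps_compose (\<Sum>m<d. Z m * u i ^ m) (F i) = (\<Sum>m<d. acomp absv (Z m) (F i) * (fps_X + fps_const (a i)) ^ m)"
  using i by (simp add: fps_compose_sum_distrib fps_compose_mult_distrib fps_compose_power[of "F i", symmetric]
      u_F acomp_eq_compose)

text \<open>In the coordinate \<open>t - a i\<close> the sum is a polynomial in \<open>t\<close>
  whose coefficients are the \<open>Z m\<close> composed with \<open>F i\<close>, hence analytic on
  the disc. The same formula results at another fibre point because \<open>F i\<close> re-expands to
  \<open>F k\<close>.\<close>

theorem pullback:
  assumes i: "i < d" and r: "0 < r" "r \<le> 1" and Z: "\<And>m. m < d \<Longrightarrow> conv_open absv (Z m) (prof i r)"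
  shows "conv_open absv (fps_compose (\<Sum>m<d. Z m * u i ^ m) (F i)) r"
    and "k < d \<Longrightarrow> absv (a k - a i) < r \<Longrightarrow>
      expand absv (fps_compose (\<Sum>m<d. Z m * u i ^ m) (F i)) (a k - a i) = fps_compose (\<Sum>m<d. Z m * u k ^ m) (F k)"
proof -
  have Zt: "tate (prof i r') (Z m)" if "m < d" "0 < r'" "r' < r" for r' m
    using Z[OF that(1)] prof_pos[OF i that(2)] prof_less[OF i _ that(3)] that(2) prof_pos[OF i r(1)] prof_le_1[OF i _ r(2)] r
    by (simp add: conv_open_iff)
  have At: "tate r' (acomp absv (Z m) (F i))" if "m < d" "0 < r'" "r' < r" for r' m
    using that r by (intro acomp_tate[OF Zt[OF that]] F_gauss F_tate i) auto
  show "conv_open absv (fps_compose (\<Sum>m<d. Z m * u i ^ m) (F i)) r"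
    unfolding back_eq[OF i] conv_open_iff[OF r] using At
    by (auto intro!: tate_sum tate_mult tate_power)
  show "expand absv (fps_compose (\<Sum>m<d. Z m * u i ^ m) (F i)) (a k - a i) = fps_compose (\<Sum>m<d. Z m * u k ^ m) (F k)"
    if k: "k < d" "absv (a k - a i) < r"
  proof -
    define r' where "r' = (absv (a k - a i) + r) / 2"
    have r': "absv (a k - a i) \<le> r'" "0 < r'" "r' < r" "r' < 1"
      using k r add_nonneg_pos[OF absv_nonneg[of "a k - a i"] r(1)] by (auto simp: r'_def)
    have "expand absv (\<Sum>m<d. acomp absv (Z m) (F i) * (fps_X + fps_const (a i)) ^ m) (a k - a i)
      = (\<Sum>m<d. expand absv (acomp absv (Z m) (F i) * (fps_X + fps_const (a i)) ^ m) (a k - a i))"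
      using r' At by (intro expand_sum[OF r'(2,1)] tate_mult tate_power) auto
    also have "\<dots> = (\<Sum>m<d. acomp absv (Z m) (F k) * (fps_X + fps_const (a k)) ^ m)"
    proof (intro sum.cong refl)
      fix m assume "m \<in> {..<d}"
      then have m: "m < d" by simp
      have "expand absv (acomp absv (Z m) (F i)) (a k - a i) = acomp absv (Z m) (expand absv (F i) (a k - a i))"
        using r' i Zt[OF m r'(2,3)] F_gauss[OF i r'(2)] F_tate[OF i r'(2,4)]
        by (intro expand_acomp[OF r'(2,1)]) auto
      moreover have "expand absv ((fps_X + fps_const (a i)) ^ m) (a k - a i) = (fps_X + fps_const (a k)) ^ m"
        using expand_power[OF r'(2,1), of "fps_X + fps_const (a i)" m] expand_add[OF r'(2,1) tate_X tate_const, of "a i"]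
        by (simp add: add.assoc)
      ultimately show "expand absv (acomp absv (Z m) (F i) * (fps_X + fps_const (a i)) ^ m) (a k - a i)
        = acomp absv (Z m) (F k) * (fps_X + fps_const (a k)) ^ m"
        using r' At[OF m r'(2,3)] by (simp add: expand_mult[OF r'(2,1)] tate_power expand_F[OF i k(1)])
    qed
    finally show ?thesis
      by (simp add: back_eq[OF i] back_eq[OF k(1)])
  qed
qed

end

lemma sum_nat_prod: "(\<Sum>q<n * d. h q) = (\<Sum>j<n. \<Sum>l<d. h (j * d + l :: nat) :: 'a::comm_monoid_add)"
proof (induction n)
  case (Suc n)
  have "(\<Sum>q<Suc n * d. h q) = (\<Sum>q<n * d. h q) + (\<Sum>q\<in>{n * d..<n * d + d}. h q)"
    by (subst sum.union_disjoint[symmetric]) (auto intro!: sum.cong)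
  also have "(\<Sum>q\<in>{n * d..<n * d + d}. h q) = (\<Sum>l<d. h (n * d + l))"
    by (rule sum.reindex_bij_witness[of _ "\<lambda>l. n * d + l" "\<lambda>q. q - n * d"]) auto
  finally show ?case using Suc by simp
qed simp

locale diff_module = etale_cover absv cl d f b a P u V
  for absv :: "'k::field_char_0 \<Rightarrow> real" and cl d f b a P u V +
  fixes rk :: nat and G :: "nat \<Rightarrow> nat \<Rightarrow> 'k fps"
  assumes G_an: "\<And>i j. i < rk \<Longrightarrow> j < rk \<Longrightarrow> G i j \<in> Oring absv cl"
begin

subsection \<open>Horizontal elements of the direct image\<close>

abbreviation "DM \<equiv> dimg_mat absv cl d f G"

lemma index_div_mod [simp]: "m < d \<Longrightarrow> (c * d + m) div d = c" "m < d \<Longrightarrow> (c * d + m) mod d = m"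
  by simp_all

lemma index_less: "c < n \<Longrightarrow> m < d \<Longrightarrow> c * d + m < n * d"
  by (metis add.commute less_mult_imp_div_less div_less_iff_less_mult d_pos index_div_mod(1))

lemma index_split:
  assumes "p < n * d"
  obtains c m where "c < n" "m < d" "p = c * d + m"
  using assms d_pos that[of "p div d" "p mod d"] by (simp add: less_mult_imp_div_less)

lemma inverse_deriv_f: "inverse (fps_deriv f) \<in> \<O>" "fps_deriv f * inverse (fps_deriv f) = 1"
proof -
  obtain g where g: "g \<in> \<O>" "fps_deriv f * g = 1" using phi by (auto simp: fin_etale_def)
  have "inverse (fps_deriv f) = g" by (rule fps_inverse_unique) (rule g(2))
  then show "inverse (fps_deriv f) \<in> \<O>" "fps_deriv f * inverse (fps_deriv f) = 1" using g by auto
qed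

lemma D_deriv: "i < d \<Longrightarrow> (fps_compose (fps_deriv (F i)) (D i)) * fps_deriv (D i) = 1"
  using fps_compose_deriv[of "D i" "F i"] F_D[of i] by simp

lemma u_deriv: "fps_deriv (u i) = fps_deriv (D i)"
  by (simp add: D_def)

lemma deriv_f_Oring: "fps_deriv f \<in> \<O>"
  using f_Oring unfolding Oring_iff by (auto simp: good_def intro: tate_deriv)

context
  fixes i assumes i: "i < d"
begin

lemma pull0_mult: "g \<in> \<O> \<Longrightarrow> h \<in> \<O> \<Longrightarrow> pull 0 i (g * h) = pull 0 i g * pull 0 i h"
  and pull0_add: "g \<in> \<O> \<Longrightarrow> h \<in> \<O> \<Longrightarrow> pull 0 i (g + h) = pull 0 i g + pull 0 i h"
proof -
  obtain r where r: "good cl r" "absv (a i) \<le> r" using udisc_goodE[OF a_disc[OF i]] .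
  then have rr: "0 < r" "absv (a i - 0) \<le> r" using good_le(2)[OF r(1)] by auto
  show "g \<in> \<O> \<Longrightarrow> h \<in> \<O> \<Longrightarrow> pull 0 i (g * h) = pull 0 i g * pull 0 i h"
    "g \<in> \<O> \<Longrightarrow> h \<in> \<O> \<Longrightarrow> pull 0 i (g + h) = pull 0 i g + pull 0 i h"
    using r by (auto intro!: pull_mult[OF rr i] pull_add[OF rr i] Oring_tate)
qed

lemma pull0_X_power: "pull 0 i (fps_X ^ l) = u i ^ l"
  using i by (induction l) (simp_all add: pull0_mult Oring_power pull_def[of _ _ 1])

lemma pull0_inverse_deriv: "pull 0 i (inverse (fps_deriv f)) = fps_deriv (D i)"
proof -
  have "pull 0 i (fps_deriv f) = fps_compose (fps_deriv (F i)) (D i)"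
    using F_deriv[OF i] by (simp add: pull_def)
  moreover have "pull 0 i (fps_deriv f) * pull 0 i (inverse (fps_deriv f)) = 1"
    using pull0_mult[OF deriv_f_Oring inverse_deriv_f(1)] inverse_deriv_f(2) by (simp add: pull_def[of _ _ 1])
  ultimately have "fps_compose (fps_deriv (F i)) (D i) * pull 0 i (inverse (fps_deriv f))
    = fps_compose (fps_deriv (F i)) (D i) * fps_deriv (D i)"
    using D_deriv[OF i] by simp
  moreover have "fps_compose (fps_deriv (F i)) (D i) \<noteq> 0" using D_deriv[OF i] by auto
  ultimately show ?thesis by simp
qed

text \<open>Column \<open>(j, l)\<close> of the connection matrix is \<open>D_s(t^l e_j)\<close>,
  the derivative of \<open>t^l e_j\<close> divided by \<open>f'\<close>. On the branch
  \<open>u i\<close> the factor \<open>1 / f'\<close> becomes the derivative of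
  \<open>D i\<close>.\<close>

lemma DM_expansion:
  assumes "c < rk" "j < rk" "l < d"
  shows "(\<Sum>m<d. expand absv (DM (c * d + m) (j * d + l)) b * u i ^ m)
    = fps_deriv (D i) * ((if c = j then of_nat l * u i ^ (l - 1) else 0) + u i ^ l * pull 0 i (G c j))"
proof -
  define h where "h = (if c = j then fps_const (of_nat l) * fps_X ^ (l - 1) else 0) + fps_X ^ l * G c j"
  define g where "g = inverse (fps_deriv f) * h"
  have hO: "fps_const (of_nat l) * fps_X ^ (l - 1) \<in> \<O>" "fps_X ^ l * G c j \<in> \<O>" "h \<in> \<O>"
    using G_an[OF assms(1,2)] by (auto simp: h_def intro!: Oring_add Oring_mult Oring_power)
  then have g: "g \<in> \<O>" unfolding g_def by (intro Oring_mult inverse_deriv_f)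
  have "(\<Sum>m<d. expand absv (DM (c * d + m) (j * d + l)) b * u i ^ m) = (\<Sum>m<d. expand absv (coordO absv cl d f g m) b * u i ^ m)"
    using assms by (intro sum.cong refl) (simp add: dimg_mat_def Let_def g_def h_def fps_of_nat)
  also have "\<dots> = (\<Sum>m<d. coord m (\<lambda>j. pull 0 j g) * u i ^ m)"
    using g by (intro sum.cong refl) (simp add: expand_coordO)
  also have "\<dots> = pull 0 i g" using i by (simp add: coord_expansion)
  also have "\<dots> = fps_deriv (D i) * pull 0 i h"
    unfolding g_def using pull0_mult[OF inverse_deriv_f(1) hO(3)] pull0_inverse_deriv by simp
  also have "pull 0 i h = (if c = j then of_nat l * u i ^ (l - 1) else 0) + u i ^ l * pull 0 i (G c j)"
  proof -
    have "pull 0 i (fps_const (of_nat l) * fps_X ^ (l - 1)) = fps_const (of_nat l) * u i ^ (l - 1)"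
      using pull0_mult[OF Oring_const Oring_power[OF Oring_X]] i by (simp add: pull0_X_power)
    moreover have "pull 0 i (fps_X ^ l * G c j) = u i ^ l * pull 0 i (G c j)"
      using pull0_mult[OF Oring_power[OF Oring_X] G_an[OF assms(1,2)]] by (simp add: pull0_X_power)
    moreover have "pull 0 i h = (if c = j then pull 0 i (fps_const (of_nat l) * fps_X ^ (l - 1)) else 0) + pull 0 i (fps_X ^ l * G c j)"
      unfolding h_def using pull0_add[OF hO(1,2)] by (cases "c = j") simp_all
    ultimately show ?thesis by (simp add: fps_of_nat)
  qed
  finally show ?thesis .
qed

text \<open>The \<open>c\<close>-th component at \<open>t = u i\<close>: multiplication by a row of
  the Vandermonde matrix.\<close>

definition vals :: "(nat \<Rightarrow> 'k fps) \<Rightarrow> nat \<Rightarrow> 'k fps" where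
  "vals Z c = (\<Sum>m<d. Z (c * d + m) * u i ^ m)"

text \<open>Substituting \<open>t = u i\<close> turns the residual of the equation downstairs into
  that upstairs: the terms \<open>l * t^(l-1)\<close> of the connection supply the derivatives of
  the powers \<open>u i ^ l\<close>.\<close>

lemma residual_expansion:
  assumes c: "c < rk"
  shows "(\<Sum>m<d. (fps_deriv (Z (c * d + m)) + (\<Sum>q<rk * d. expand absv (DM (c * d + m) q) b * Z q)) * u i ^ m)
    = fps_deriv (vals Z c) + fps_deriv (D i) * (\<Sum>j<rk. pull 0 i (G c j) * vals Z j)"
proof -
  let ?e = "\<lambda>m j l. expand absv (DM (c * d + m) (j * d + l)) b"
  let ?D = "fps_deriv (D i)"
  have "(\<Sum>m<d. (\<Sum>q<rk * d. expand absv (DM (c * d + m) q) b * Z q) * u i ^ m)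
     = (\<Sum>m<d. \<Sum>j<rk. \<Sum>l<d. Z (j * d + l) * (?e m j l * u i ^ m))"
    unfolding sum_nat_prod sum_distrib_right by (simp only: mult_ac)
  also have "\<dots> = (\<Sum>j<rk. \<Sum>m<d. \<Sum>l<d. Z (j * d + l) * (?e m j l * u i ^ m))"
    by (rule sum.swap)
  also have "\<dots> = (\<Sum>j<rk. \<Sum>l<d. \<Sum>m<d. Z (j * d + l) * (?e m j l * u i ^ m))"
    by (intro sum.cong refl sum.swap)
  also have "\<dots> = (\<Sum>j<rk. \<Sum>l<d. Z (j * d + l) * (?D * ((if c = j then of_nat l * u i ^ (l - 1) else 0) + u i ^ l * pull 0 i (G c j))))"
    using c by (intro sum.cong refl) (simp add: DM_expansion flip: sum_distrib_left)
  also have "\<dots> = (\<Sum>j<rk. (if c = j then \<Sum>l<d. Z (j * d + l) * (?D * (of_nat l * u i ^ (l - 1))) else 0)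
        + ?D * (pull 0 i (G c j) * vals Z j))"
    unfolding vals_def by (intro sum.cong refl) (auto simp: distrib_left sum.distrib sum_distrib_left mult_ac)
  also have "\<dots> = (\<Sum>l<d. Z (c * d + l) * (?D * (of_nat l * u i ^ (l - 1)))) + ?D * (\<Sum>j<rk. pull 0 i (G c j) * vals Z j)"
    using c by (simp add: sum.distrib sum_distrib_left)
  finally have 1: "(\<Sum>m<d. (\<Sum>q<rk * d. expand absv (DM (c * d + m) q) b * Z q) * u i ^ m)
    = (\<Sum>l<d. Z (c * d + l) * (?D * (of_nat l * u i ^ (l - 1)))) + ?D * (\<Sum>j<rk. pull 0 i (G c j) * vals Z j)" .
  have "fps_deriv (vals Z c) = (\<Sum>m<d. fps_deriv (Z (c * d + m)) * u i ^ m + Z (c * d + m) * (?D * (of_nat m * u i ^ (m - 1))))"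
    unfolding vals_def fps_deriv_sum
    by (intro sum.cong refl) (simp add: fps_deriv_power' u_deriv mult_ac)
  with 1 show ?thesis
    by (simp add: distrib_right sum.distrib)
qed

text \<open>The same values in the coordinate \<open>t - a i\<close>, to be compared with horizontal
  elements of \<open>M\<close> at \<open>a i\<close>.\<close>

definition fpart :: "(nat \<Rightarrow> 'k fps) \<Rightarrow> nat \<Rightarrow> 'k fps" where
  "fpart Z c = (if c < rk then fps_compose (vals Z c) (F i) else 0)"

lemma fpart_D: "c < rk \<Longrightarrow> fps_compose (fpart Z c) (D i) = vals Z c"
  using i by (simp add: fpart_def compose_F_D)

lemma residual_fpart:
  assumes c: "c < rk"
  shows "fps_deriv (vals Z c) + fps_deriv (D i) * (\<Sum>j<rk. pull 0 i (G c j) * vals Z j)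
    = fps_deriv (D i) * fps_compose (fps_deriv (fpart Z c) + (\<Sum>j<rk. expand absv (G c j) (a i) * fpart Z j)) (D i)"
proof -
  have "fps_deriv (vals Z c) = fps_compose (fps_deriv (fpart Z c)) (D i) * fps_deriv (D i)"
    using fpart_D[OF c, of Z] fps_compose_deriv[of "D i" "fpart Z c"] i by simp
  moreover have "fps_compose (\<Sum>j<rk. expand absv (G c j) (a i) * fpart Z j) (D i)
     = (\<Sum>j<rk. pull 0 i (G c j) * vals Z j)"
    using i by (simp add: fps_compose_sum_distrib fps_compose_mult_distrib fpart_D pull_def)
  ultimately show ?thesis
    by (simp add: fps_compose_add_distrib distrib_left mult.commute)
qed

lemma D_deriv_nz: "fps_deriv (D i) \<noteq> 0"
  using D_deriv[OF i] by (metis mult_zero_right zero_neq_one)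

lemma compose_D_eq_0: "fps_compose y (D i) = 0 \<longleftrightarrow> y = 0"
  using compose_D_F[OF i, of y] by auto

end

text \<open>For fixed \<open>c\<close> the residuals on the \<open>d\<close> branches and those in
  the basis of powers determine each other through the invertible Vandermonde matrix; on each branch
  a nonzero derivative factor is cancelled.\<close>

lemma horizontal_equation_iff:
  "(\<forall>p<rk * d. fps_deriv (Z p) + (\<Sum>q<rk * d. expand absv (DM p q) b * Z q) = 0) \<longleftrightarrow>
   (\<forall>i<d. \<forall>c<rk. fps_deriv (fpart i Z c) + (\<Sum>j<rk. expand absv (G c j) (a i) * fpart i Z j) = 0)"
  (is "(\<forall>p<rk * d. ?R p = 0) \<longleftrightarrow> (\<forall>i<d. \<forall>c<rk. ?S i c = 0)")
proof -
  have key: "(\<Sum>m<d. ?R (c * d + m) * u i ^ m) = fps_deriv (D i) * fps_compose (?S i c) (D i)" if "i < d" "c < rk" for i c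
    using residual_expansion[OF that, of Z] residual_fpart[OF that, of Z] by simp
  show ?thesis
  proof (intro iffI allI impI)
    fix i c assume R: "\<forall>p<rk * d. ?R p = 0" and ic: "i < d" "c < rk"
    have "(\<Sum>m<d. ?R (c * d + m) * u i ^ m) = 0"
      using R index_less[OF ic(2)] by (intro sum.neutral) auto
    then show "?S i c = 0" using key[OF ic] D_deriv_nz[OF ic(1)] compose_D_eq_0[OF ic(1)] by simp
  next
    fix p assume S: "\<forall>i<d. \<forall>c<rk. ?S i c = 0" and p: "p < rk * d"
    obtain c m where cm: "c < rk" "m < d" "p = c * d + m" using index_split[OF p] .
    have "coord m (\<lambda>i. 0) = ?R (c * d + m)"
      using key[OF _ cm(1)] S cm(1,2) by (intro coord_unique[where z = "\<lambda>m. ?R (c * d + m)"]) simp_all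
    then show "?R p = 0" by (simp add: coord_def cm(3))
  qed
qed

lemma hor_on_fpart:
  assumes Z: "hor_on absv (rk * d) DM b (prof i r) Z" and i: "i < d" and r: "0 < r" "r \<le> 1"
  shows "hor_on absv rk G (a i) r (fpart i Z)"
  unfolding hor_on_def
proof (intro conjI allI impI)
  fix c assume "rk \<le> c"
  then show "fpart i Z c = 0" by (simp add: fpart_def[OF i])
next
  fix c assume c: "c < rk"
  show "conv_open absv (fpart i Z c) r"
    unfolding fpart_def[OF i] vals_def[OF i] using c Z index_less[OF c]
    by (simp only: if_True) (intro pullback(1)[OF i r], simp add: hor_on_def)
  show "fps_deriv (fpart i Z c) + (\<Sum>q<rk. expand absv (G c q) (a i) * fpart i Z q) = 0"
    using Z i c horizontal_equation_iff[of Z] by (simp add: hor_on_def)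
qed

text \<open>Analytic continuation inside one component: convergence downstairs ties together the
  local parts at different fibre points.\<close>

lemma reexp_fpart:
  assumes Z: "hor_on absv (rk * d) DM b (prof i r) Z" and i: "i < d" and r: "0 < r" "r \<le> 1"
    and k: "k < d" "absv (a k - a i) < r"
  shows "reexp absv rk (fpart i Z) (a k - a i) = fpart k Z"
proof
  fix c
  show "reexp absv rk (fpart i Z) (a k - a i) c = fpart k Z c"
  proof (cases "c < rk")
    case True
    have "conv_open absv (Z (c * d + m)) (prof i r)" if "m < d" for m
      using Z index_less[OF True that] by (simp add: hor_on_def)
    from pullback(2)[OF i r this k] show ?thesis
      using True by (simp add: reexp_def fpart_def[OF i] fpart_def[OF k(1)] vals_def[OF i] vals_def[OF k(1)])
  qed (simp add: reexp_def fpart_def[OF k(1)])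
qed

text \<open>Evaluation on the branches undoes \<open>V\<close>, so a vector prescribed branch by
  branch is recovered.\<close>

lemma fpart_Vr:
  assumes "i < d" "c < rk"
  shows "fpart i (Vr d rk V v) c = fps_compose (v (c * d + i)) (F i)"
proof -
  have "vals i (Vr d rk V v) c = (\<Sum>m<d. coord m (\<lambda>i. v (c * d + i)) * u i ^ m)"
    unfolding vals_def[OF assms(1)] using index_less[OF assms(2)]
    by (intro sum.cong refl) (simp add: Vr_def coord_def)
  then show ?thesis using assms by (simp add: fpart_def coord_expansion)
qed

end

section \<open>Multisets of radii and linear independence of families\<close>

lemma image_mset_eqI_card_ge:
  fixes f :: "'i \<Rightarrow> real" and g :: "'j \<Rightarrow> real"
  assumes fin: "finite A" "finite B"
    and f: "\<And>x. x \<in> A \<Longrightarrow> 0 < f x \<and> f x \<le> 1" and g: "\<And>x. x \<in> B \<Longrightarrow> 0 < g x \<and> g x \<le> 1"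
    and eq: "\<And>r. 0 < r \<Longrightarrow> r \<le> 1 \<Longrightarrow> card {x \<in> A. r \<le> f x} = card {x \<in> B. r \<le> g x}"
  shows "image_mset f (mset_set A) = image_mset g (mset_set B)"
proof (rule multiset_eqI)
  fix v
  have cnt: "count (image_mset h (mset_set C)) v = card {x \<in> C. h x = v}" if "finite C" for h :: "'c \<Rightarrow> real" and C
  proof -
    have "h -` {v} \<inter> C = {x \<in> C. h x = v}" by auto
    then show ?thesis using that by (simp add: count_image_mset)
  qed
  have split: "card {x \<in> C. h x = v} = card {x \<in> C. v \<le> h x} - card {x \<in> C. v < h x}" if "finite C" for h :: "'c \<Rightarrow> real" and C
  proof -
    have "{x \<in> C. h x = v} = {x \<in> C. v \<le> h x} - {x \<in> C. v < h x}" by auto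
    then show ?thesis using that by (simp add: card_Diff_subset Collect_mono_iff subset_iff)
  qed
  show "count (image_mset f (mset_set A)) v = count (image_mset g (mset_set B)) v"
  proof (cases "0 < v \<and> v \<le> 1")
    case True
    \<comment> \<open>The values strictly above \<open>v\<close> are those at least the next
      occurring value, so the strict count is again covered by \<open>eq\<close>.\<close>
    define W where "W = {w \<in> f ` A \<union> g ` B. v < w}"
    have W: "finite W" using fin by (simp add: W_def)
    have "card {x \<in> A. v < f x} = card {x \<in> B. v < g x}"
    proof (cases "W = {}")
      case True
      then have "{x \<in> A. v < f x} = {}" "{x \<in> B. v < g x} = {}" by (auto simp: W_def)
      then show ?thesis by (simp only:) simp
    next
      case False
      define w where "w = Min W"
      have w: "w \<in> W" "\<And>x. x \<in> W \<Longrightarrow> w \<le> x" using W False by (auto simp: w_def)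
      have "{x \<in> A. v < f x} = {x \<in> A. w \<le> f x}" "{x \<in> B. v < g x} = {x \<in> B. w \<le> g x}"
        using w by (fastforce simp: W_def)+
      moreover have "0 < w" "w \<le> 1" using w(1) f g by (auto simp: W_def)
      ultimately show ?thesis using eq by simp
    qed
    then show ?thesis using True eq fin by (simp add: cnt split)
  next
    case False
    then have "{x \<in> A. f x = v} = {}" "{x \<in> B. g x = v} = {}" using f g by auto
    then show ?thesis using fin by (simp only: cnt) simp
  qed
qed

lemma card_ge_image_mset:
  assumes "finite A" "finite B" "image_mset f (mset_set A) = image_mset g (mset_set B)"
  shows "card {x \<in> A. r \<le> f x} = card {x \<in> B. (r::real) \<le> g x}"
proof -
  have *: "size (filter_mset (\<lambda>v. r \<le> v) (image_mset h (mset_set C))) = card {x \<in> C. r \<le> h x}" if "finite C" for h :: "'c \<Rightarrow> real" and C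
    using that by (simp add: filter_mset_image_mset)
  show ?thesis using *[OF assms(1), of f] *[OF assms(2), of g] assms(3) by simp
qed

lemma fps_const_sum: "fps_const (\<Sum>i\<in>I. f i) = (\<Sum>i\<in>I. fps_const (f i))"
  by (induction I rule: infinite_finite_induct) (auto simp flip: fps_const_add)

lemma klin_indep_subset:
  assumes "klin_indep n J F" "J' \<subseteq> J" "finite J"
  shows "klin_indep n J' F"
  unfolding klin_indep_def
proof (intro allI impI ballI)
  fix cf :: "'a \<Rightarrow> 'b" and j
  assume z: "\<forall>p<n. (\<Sum>j\<in>J'. fps_const (cf j) * F j p) = 0" and j: "j \<in> J'"
  define cf' where "cf' j = (if j \<in> J' then cf j else 0)" for j
  have "(\<Sum>j\<in>J. fps_const (cf' j) * F j p) = (\<Sum>j\<in>J'. fps_const (cf j) * F j p)" for p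
    using assms by (intro sum.mono_neutral_cong_right) (auto simp: cf'_def)
  then have "\<forall>j\<in>J. cf' j = 0" using assms(1) z by (simp add: klin_indep_def)
  then have "cf' j = 0" using j assms(2) by blast
  then show "cf j = 0" using j by (simp add: cf'_def)
qed

lemma klin_indep_reindex:
  assumes "klin_indep n J F" "bij_betw h I J"
  shows "klin_indep n I (\<lambda>i. F (h i))"
  unfolding klin_indep_def
proof (intro allI impI ballI)
  fix cf :: "_ \<Rightarrow> _" and i
  assume z: "\<forall>p<n. (\<Sum>i\<in>I. fps_const (cf i) * F (h i) p) = 0" and i: "i \<in> I"
  have inv: "inv_into I h (h i) = i" if "i \<in> I" for i using that assms(2) by (simp add: bij_betw_inv_into_left)
  have "(\<Sum>j\<in>J. fps_const (cf (inv_into I h j)) * F j p) = (\<Sum>i\<in>I. fps_const (cf i) * F (h i) p)" for p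
    unfolding sum.reindex_bij_betw[OF assms(2), symmetric] by (intro sum.cong refl) (simp add: inv)
  then have "\<forall>p<n. (\<Sum>j\<in>J. fps_const (cf (inv_into I h j)) * F j p) = 0"
    using z by simp
  then have "\<forall>j\<in>J. cf (inv_into I h j) = 0"
    using assms(1)[unfolded klin_indep_def, THEN spec, of "\<lambda>j. cf (inv_into I h j)"] by simp
  then show "cf i = 0" using i inv assms(2) by (metis bij_betwE)
qed

context nonarch
begin

subsection \<open>Optimal bases\<close>

lemma conv_open_sum:
  assumes "0 < r" "r \<le> 1" "\<And>j. j \<in> J \<Longrightarrow> conv_open absv (F j) r"
  shows "conv_open absv (\<Sum>j\<in>J. fps_const (x j) * F j) r"
  using assms by (auto simp: conv_open_iff intro!: tate_sum tate_cmult)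

lemma horizontal_hor_on:
  assumes "horizontal absv n A c Z" "0 < r" "r \<le> 1" "\<And>p. p < n \<Longrightarrow> conv_open absv (Z p) r"
  shows "hor_on absv n A c r Z"
  using assms by (auto simp: horizontal_def hor_on_def)

lemma hor_on_horizontal: "hor_on absv n A c r Z \<Longrightarrow> 0 < r \<Longrightarrow> horizontal absv n A c Z"
  by (auto simp: horizontal_def)

lemma hor_on_mono: "hor_on absv n A c r Z \<Longrightarrow> r' \<le> r \<Longrightarrow> hor_on absv n A c r' Z"
  by (auto simp: hor_on_def intro: conv_open_mono)

lemma horizontal_small:
  assumes "horizontal absv n A c Z"
  obtains r where "0 < r" "r \<le> 1" "hor_on absv n A c r Z"
proof -
  obtain r where "0 < r" "hor_on absv n A c r Z" using assms by (auto simp: horizontal_def)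
  then show ?thesis using that[of "min r 1"] hor_on_mono[of n A c r Z "min r 1"] by simp
qed

lemma hor_on_Radv_iff:
  assumes "horizontal absv n A c Z" "0 < r" "r \<le> 1"
  shows "hor_on absv n A c r Z \<longleftrightarrow> r \<le> Radv absv n Z"
  using horizontal_hor_on[OF assms] Radv_ge_iff[OF assms(2,3), of n Z] by (auto simp: hor_on_def)

lemma horizontal_Radv_pos: "horizontal absv n A c Z \<Longrightarrow> 0 < Radv absv n Z"
proof (erule horizontal_small)
  fix r assume "0 < r" "r \<le> 1" "hor_on absv n A c r Z"
  then have "r \<le> Radv absv n Z" by (simp add: Radv_ge_iff hor_on_def)
  then show ?thesis using \<open>0 < r\<close> by simp
qed

lemma hor_on_sum:
  assumes r: "0 < r" "r \<le> 1" and F: "\<And>j. j \<in> J \<Longrightarrow> hor_on absv n A c r (F j)"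
  shows "hor_on absv n A c r (\<lambda>p. \<Sum>j\<in>J. fps_const (x j) * F j p)"
  unfolding hor_on_def
proof (intro conjI allI impI)
  fix p assume "n \<le> p"
  then show "(\<Sum>j\<in>J. fps_const (x j) * F j p) = 0" using F by (simp add: hor_on_def)
next
  fix p assume p: "p < n"
  then show "conv_open absv (\<Sum>j\<in>J. fps_const (x j) * F j p) r"
    using F r by (intro conv_open_sum) (auto simp: hor_on_def)
  have "fps_deriv (\<Sum>j\<in>J. fps_const (x j) * F j p) + (\<Sum>q<n. expand absv (A p q) c * (\<Sum>j\<in>J. fps_const (x j) * F j q))
     = (\<Sum>j\<in>J. fps_const (x j) * fps_deriv (F j p)) + (\<Sum>j\<in>J. \<Sum>q<n. fps_const (x j) * (expand absv (A p q) c * F j q))"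
    by (subst sum.swap[of _ _ J]) (simp add: fps_deriv_sum sum_distrib_left mult_ac)
  also have "\<dots> = (\<Sum>j\<in>J. fps_const (x j) * (fps_deriv (F j p) + (\<Sum>q<n. expand absv (A p q) c * F j q)))"
    by (simp add: distrib_left sum.distrib sum_distrib_left)
  also have "\<dots> = 0" using F p by (intro sum.neutral) (auto simp: hor_on_def)
  finally show "fps_deriv (\<Sum>j\<in>J. fps_const (x j) * F j p) + (\<Sum>q<n. expand absv (A p q) c * (\<Sum>j\<in>J. fps_const (x j) * F j q)) = 0" .
qed

text \<open>No cancellation of singularities: a combination converges no further than its members
  with nonzero coefficients. For a basis of horizontal elements this amounts to optimality, by
  \<open>opt_basis_adapted\<close> and \<open>opt_basisI\<close>.\<close>

definition adapted :: "nat \<Rightarrow> 'j set \<Rightarrow> ('j \<Rightarrow> nat \<Rightarrow> 'k fps) \<Rightarrow> bool" where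
  "adapted n J F \<longleftrightarrow> (\<forall>x r. 0 < r \<and> r \<le> 1 \<and> (\<forall>p<n. conv_open absv (\<Sum>j\<in>J. fps_const (x j) * F j p) r) \<longrightarrow>
     (\<forall>j\<in>J. x j \<noteq> 0 \<longrightarrow> r \<le> Radv absv n (F j)))"

lemma multiradius_ge:
  assumes r: "0 < r" "r \<le> 1" and F: "\<And>j. j < m \<Longrightarrow> hor_on absv n A c r (F j)" "klin_indep n {..<m} F"
    and i: "n - i + 1 \<le> m"
  shows "r \<le> multiradius absv n A c i"
  unfolding multiradius_def
proof (rule cSup_upper)
  have "klin_indep n {..<n - i + 1} F"
    using F(2) i by (rule_tac klin_indep_subset) auto
  then show "r \<in> {r. 0 < r \<and> r \<le> 1 \<and>
      (\<exists>F. (\<forall>j<n - i + 1. hor_on absv n A c r (F j)) \<and> klin_indep n {..<n - i + 1} F)}"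
    using r F(1) i by (intro CollectI conjI exI[of _ F]) auto
qed (auto intro: bdd_aboveI[of _ 1])

text \<open>If a member of too small radius occurred, the combination together with the members of
  radius at least \<open>r\<close> would be independent on that disc, giving more entries of the
  multiradius that are at least \<open>r\<close> than there are such members.\<close>

lemma opt_basis_adapted:
  assumes opt: "opt_basis absv n A c J F"
  shows "adapted n J F"
  unfolding adapted_def
proof (intro allI impI ballI, elim conjE)
  fix x r j0 assume r: "0 < r" "r \<le> 1" and conv: "\<forall>p<n. conv_open absv (\<Sum>j\<in>J. fps_const (x j) * F j p) r"
    and j0: "j0 \<in> J" "x j0 \<noteq> 0"
  have fin: "finite J" and hor: "\<And>j. j \<in> J \<Longrightarrow> horizontal absv n A c (F j)" and ind: "klin_indep n J F"
    and mset: "image_mset (\<lambda>j. Radv absv n (F j)) (mset_set J) = image_mset (multiradius absv n A c) (mset_set {1..n})"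
    using opt by (auto simp: opt_basis_def)
  show "r \<le> Radv absv n (F j0)"
  proof (rule ccontr)
    assume small: "\<not> r \<le> Radv absv n (F j0)"
    define Jr where "Jr = {j \<in> J. r \<le> Radv absv n (F j)}"
    define N where "N = card Jr"
    have Jr: "finite Jr" "Jr \<subseteq> J" "j0 \<notin> Jr" using fin small by (auto simp: Jr_def)
    have cJ: "card J = n" using arg_cong[OF mset, of size] by simp
    have "N < n"
      using psubset_card_mono[of J Jr] fin Jr j0 cJ by (auto simp: N_def)
    obtain h where h: "bij_betw h {..<N} Jr"
      using ex_bij_betw_nat_finite[OF Jr(1)] by (auto simp: N_def lessThan_atLeast0)
    define Z where "Z p = (\<Sum>j\<in>J. fps_const (x j) * F j p)" for p
    have Zhor: "hor_on absv n A c r Z"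
    proof -
      have "\<exists>s. 0 < s \<and> s \<le> 1 \<and> (\<forall>j\<in>J. hor_on absv n A c s (F j))"
      proof -
        define s where "s = Min (insert 1 ((\<lambda>j. Radv absv n (F j)) ` J))"
        have "0 < s" "s \<le> 1" "\<And>j. j \<in> J \<Longrightarrow> s \<le> Radv absv n (F j)"
          using fin horizontal_Radv_pos[OF hor] by (auto simp: s_def)
        then show ?thesis using hor hor_on_Radv_iff by blast
      qed
      then obtain s where "0 < s" "s \<le> 1" "\<And>j. j \<in> J \<Longrightarrow> hor_on absv n A c s (F j)" by blast
      then have "hor_on absv n A c s Z" unfolding Z_def by (intro hor_on_sum)
      then show ?thesis
        using \<open>0 < s\<close> conv r by (intro horizontal_hor_on) (auto simp: Z_def intro: hor_on_horizontal)
    qed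
    define F' where "F' t = (if t < N then F (h t) else Z)" for t
    have hJ: "h t \<in> Jr" if "t < N" for t using h that by (auto simp: bij_betw_def)
    have hor': "hor_on absv n A c r (F' t)" for t
      using Zhor hJ[of t] hor r by (auto simp: F'_def Jr_def hor_on_Radv_iff)
    have ind': "klin_indep n {..<Suc N} F'"
      unfolding klin_indep_def
    proof (intro allI impI ballI)
      fix y :: "nat \<Rightarrow> 'k" and t
      assume z: "\<forall>p<n. (\<Sum>j<Suc N. fps_const (y j) * F' j p) = 0" and t: "t \<in> {..<Suc N}"
      \<comment> \<open>The relation rewritten in the original family: at \<open>j0\<close>, outside
        \<open>Jr\<close>, only the contribution of the combination remains, so its coefficient
        vanishes.\<close>
      define w where "w j = (if j \<in> Jr then y (inv_into {..<N} h j) else 0) + y N * x j" for j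
      have inv: "inv_into {..<N} h (h t) = t" if "t < N" for t using that h by (simp add: bij_betw_inv_into_left)
      have "(\<Sum>j\<in>J. fps_const (w j) * F j p) = (\<Sum>j<Suc N. fps_const (y j) * F' j p)" for p
      proof -
        have "(\<Sum>j\<in>J. fps_const (w j) * F j p)
          = (\<Sum>j\<in>J. fps_const (if j \<in> Jr then y (inv_into {..<N} h j) else 0) * F j p) + fps_const (y N) * Z p"
          by (simp add: w_def Z_def distrib_right sum.distrib sum_distrib_left mult.assoc flip: fps_const_add fps_const_mult)
        also have "(\<Sum>j\<in>J. fps_const (if j \<in> Jr then y (inv_into {..<N} h j) else 0) * F j p)
          = (\<Sum>j\<in>Jr. fps_const (y (inv_into {..<N} h j)) * F j p)"
          using fin Jr by (intro sum.mono_neutral_cong_right) auto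
        also have "\<dots> = (\<Sum>t<N. fps_const (y t) * F (h t) p)"
          unfolding sum.reindex_bij_betw[OF h, symmetric] by (intro sum.cong refl) (simp add: inv)
        finally show ?thesis by (simp add: F'_def)
      qed
      then have w: "w j = 0" if "j \<in> J" for j using ind z that by (simp add: klin_indep_def)
      have "y N = 0" using w[OF j0(1)] Jr(3) j0(2) by (simp add: w_def)
      moreover have "y t = 0" if "t < N" for t
        using w[of "h t"] hJ[OF that] Jr(2) inv[OF that] \<open>y N = 0\<close> by (auto simp: w_def)
      ultimately show "y t = 0" using t by (auto simp: less_Suc_eq)
    qed
    have "r \<le> multiradius absv n A c i" if "i \<in> {n - N..n}" for i
      using that \<open>N < n\<close> by (intro multiradius_ge[OF r hor' ind']) auto
    then have "{n - N..n} \<subseteq> {i \<in> {1..n}. r \<le> multiradius absv n A c i}" using \<open>N < n\<close> by auto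
    then have "card {n - N..n} \<le> card {i \<in> {1..n}. r \<le> multiradius absv n A c i}" by (intro card_mono) auto
    also have "\<dots> = card Jr" unfolding Jr_def using card_ge_image_mset[OF fin _ mset, of r] by simp
    finally show False using \<open>N < n\<close> by (simp add: N_def)
  qed
qed

text \<open>By adaptedness the solutions on radius \<open>r\<close> are spanned by the members of
  radius at least \<open>r\<close>, so their dimension is \<open>N r\<close>; the multiradius is
  read off from these counts.\<close>

lemma opt_basisI:
  assumes fin: "finite J" and cJ: "card J = n" and hor: "\<And>j. j \<in> J \<Longrightarrow> horizontal absv n A c (F j)"
    and ind: "klin_indep n J F" and ad: "adapted n J F"
    and span: "\<And>Z. horizontal absv n A c Z \<Longrightarrow> \<exists>x. \<forall>p<n. Z p = (\<Sum>j\<in>J. fps_const (x j) * F j p)"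
  shows "opt_basis absv n A c J F"
proof -
  define N where "N r = card {j \<in> J. r \<le> Radv absv n (F j)}" for r
  have N_le: "N r \<le> n" for r unfolding N_def cJ[symmetric] using fin by (intro card_mono) auto
  have N_anti: "N r \<le> N r'" if "r' \<le> r" for r r'
    unfolding N_def using fin that by (intro card_mono) auto
  have upper: "m \<le> N r" if r: "0 < r" "r \<le> 1" and F': "\<And>t. t < m \<Longrightarrow> hor_on absv n A c r (F' t)" "klin_indep n {..<m} F'" for m r F'
  proof (rule ccontr)
    assume m: "\<not> m \<le> N r"
    define Jr where "Jr = {j \<in> J. r \<le> Radv absv n (F j)}"
    have "\<exists>x. \<forall>p<n. F' t p = (\<Sum>j\<in>J. fps_const (x j) * F j p)" if "t < m" for t
      using span hor_on_horizontal[OF F'(1)[OF that] r(1)] by blast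
    then obtain x where x: "\<And>t p. t < m \<Longrightarrow> p < n \<Longrightarrow> F' t p = (\<Sum>j\<in>J. fps_const (x t j) * F j p)"
      by metis
    have x0: "x t j = 0" if "t < m" "j \<in> J" "j \<notin> Jr" for t j
    proof (rule ccontr)
      assume "x t j \<noteq> 0"
      moreover have "\<forall>p<n. conv_open absv (\<Sum>j\<in>J. fps_const (x t j) * F j p) r"
        using F'(1)[OF that(1)] x[OF that(1)] by (simp add: hor_on_def)
      ultimately have "r \<le> Radv absv n (F j)"
        using ad r that(2) unfolding adapted_def by blast
      then show False using that by (simp add: Jr_def)
    qed
    have "finite Jr" using fin by (simp add: Jr_def)
    then obtain h where h: "bij_betw h {..<N r} Jr"
      using ex_bij_betw_nat_finite[of Jr] by (auto simp: N_def Jr_def lessThan_atLeast0)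
    obtain y where y: "\<exists>t<m. y t \<noteq> 0" "\<And>s. s < N r \<Longrightarrow> (\<Sum>t<m. x t (h s) * y t) = 0"
      using homogeneous_nontrivial[of "N r" m "\<lambda>s t. x t (h s)"] m by auto
    have y0: "(\<Sum>t<m. x t j * y t) = 0" if "j \<in> J" for j
    proof (cases "j \<in> Jr")
      case True
      then obtain s where "s < N r" "j = h s" using h by (auto simp: bij_betw_def)
      then show ?thesis using y(2) by simp
    qed (use x0 that in simp)
    have "(\<Sum>t<m. fps_const (y t) * F' t p) = 0" if "p < n" for p
    proof -
      have "(\<Sum>t<m. fps_const (y t) * F' t p) = (\<Sum>t<m. \<Sum>j\<in>J. fps_const (x t j * y t) * F j p)"
        using that x by (intro sum.cong refl) (simp add: sum_distrib_left mult_ac flip: fps_const_mult)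
      also have "\<dots> = (\<Sum>j\<in>J. fps_const (\<Sum>t<m. x t j * y t) * F j p)"
        by (subst sum.swap) (simp add: sum_distrib_right fps_const_sum)
      also have "\<dots> = 0" using y0 by simp
      finally show ?thesis .
    qed
    then have "\<forall>t\<in>{..<m}. y t = 0" using F'(2) unfolding klin_indep_def by simp
    then show False using y(1) by auto
  qed
  have lower: "\<exists>F'. (\<forall>t<m. hor_on absv n A c r (F' t)) \<and> klin_indep n {..<m} F'" if r: "0 < r" "r \<le> 1" and m: "m \<le> N r" for m r
  proof -
    define Jr where "Jr = {j \<in> J. r \<le> Radv absv n (F j)}"
    have Jr: "finite Jr" "Jr \<subseteq> J" using fin by (auto simp: Jr_def)
    then obtain h where h: "bij_betw h {..<N r} Jr"
      using ex_bij_betw_nat_finite[of Jr] by (auto simp: N_def Jr_def lessThan_atLeast0)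
    have "klin_indep n {..<N r} (\<lambda>t. F (h t))"
      using klin_indep_reindex[OF klin_indep_subset[OF ind Jr(2) fin] h] .
    then have "klin_indep n {..<m} (\<lambda>t. F (h t))"
      using m by (rule_tac klin_indep_subset) auto
    moreover have "hor_on absv n A c r (F (h t))" if "t < m" for t
    proof -
      have "h t \<in> Jr" using h that m by (auto simp: bij_betw_def)
      then show ?thesis using hor r by (simp add: Jr_def hor_on_Radv_iff)
    qed
    ultimately show ?thesis by (intro exI[of _ "\<lambda>t. F (h t)"] conjI allI impI)
  qed
  define S where "S i = {r. 0 < r \<and> r \<le> 1 \<and> (\<exists>F. (\<forall>j<n - i + 1. hor_on absv n A c r (F j)) \<and> klin_indep n {..<n - i + 1} F)}" for i
  have S_iff: "r \<in> S i \<longleftrightarrow> 0 < r \<and> r \<le> 1 \<and> n - i + 1 \<le> N r" for r i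
    unfolding S_def using upper[of r "n - i + 1"] lower[of r "n - i + 1"] by blast
  have mult: "multiradius absv n A c i = Sup (S i)" for i
    by (simp add: multiradius_def S_def)
  have bdd: "bdd_above (S i)" for i by (auto simp: S_iff intro: bdd_aboveI[of _ 1])
  define s0 where "s0 = Min (insert 1 ((\<lambda>j. Radv absv n (F j)) ` J))"
  have s0: "0 < s0" "s0 \<le> 1" "\<And>j. j \<in> J \<Longrightarrow> s0 \<le> Radv absv n (F j)"
    using fin horizontal_Radv_pos[OF hor] by (auto simp: s0_def)
  have "{j \<in> J. s0 \<le> Radv absv n (F j)} = J" using s0(3) by auto
  then have "N s0 = n" by (simp add: N_def cJ)
  then have s0S: "s0 \<in> S i" if "i \<in> {1..n}" for i using s0 that by (auto simp: S_iff)
  have ge_iff: "r \<le> multiradius absv n A c i \<longleftrightarrow> n - i + 1 \<le> N r" if r: "0 < r" "r \<le> 1" and i: "i \<in> {1..n}" for r i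
  proof
    assume "n - i + 1 \<le> N r"
    then have "r \<in> S i" using r by (simp add: S_iff)
    then show "r \<le> multiradius absv n A c i" unfolding mult using bdd by (rule cSup_upper)
  next
    assume le: "r \<le> multiradius absv n A c i"
    \<comment> \<open>\<open>N\<close> is constant between the largest member radius below
      \<open>r\<close> and \<open>r\<close> itself, so a radius close to the supremum gives the
      count at \<open>r\<close>; 0 keeps the set nonempty.\<close>
    define T where "T = insert 0 {\<rho> \<in> (\<lambda>j. Radv absv n (F j)) ` J. \<rho> < r}"
    have T: "finite T" "T \<noteq> {}" using fin by (auto simp: T_def)
    have "Max T < r" using T r by (auto simp: T_def)
    then have "Max T < Sup (S i)" using le by (simp add: mult)
    then obtain s where s: "s \<in> S i" "Max T < s"
      using less_cSup_iff[OF _ bdd] s0S[OF i] by blast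
    have "N s \<le> N r"
    proof (cases "r \<le> s")
      case True
      then show ?thesis by (rule N_anti)
    next
      case False
      have "{j \<in> J. s \<le> Radv absv n (F j)} \<subseteq> {j \<in> J. r \<le> Radv absv n (F j)}"
      proof safe
        fix j assume j: "j \<in> J" "s \<le> Radv absv n (F j)"
        show "r \<le> Radv absv n (F j)"
        proof (rule ccontr)
          assume "\<not> r \<le> Radv absv n (F j)"
          then have "Radv absv n (F j) \<le> Max T" using T j by (intro Max_ge) (auto simp: T_def)
          then show False using s j by simp
        qed
      qed
      then show ?thesis unfolding N_def using fin by (intro card_mono) auto
    qed
    then show "n - i + 1 \<le> N r" using s by (simp add: S_iff)
  qed
  have "image_mset (\<lambda>j. Radv absv n (F j)) (mset_set J) = image_mset (multiradius absv n A c) (mset_set {1..n})"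
  proof (rule image_mset_eqI_card_ge)
    fix j assume "j \<in> J"
    then show "0 < Radv absv n (F j) \<and> Radv absv n (F j) \<le> 1"
      using hor horizontal_Radv_pos Radv_bounds by blast
  next
    fix i assume i: "i \<in> {1..n}"
    have "s0 \<le> multiradius absv n A c i" unfolding mult using s0S[OF i] bdd by (rule cSup_upper)
    moreover have "multiradius absv n A c i \<le> 1"
      unfolding mult using s0S[OF i] by (intro cSup_least) (auto simp: S_iff)
    ultimately show "0 < multiradius absv n A c i \<and> multiradius absv n A c i \<le> 1" using s0 by simp
  next
    fix r :: real assume r: "0 < r" "r \<le> 1"
    have "{i \<in> {1..n}. r \<le> multiradius absv n A c i} = {i \<in> {1..n}. n - i + 1 \<le> N r}"
      using ge_iff[OF r] by auto
    also have "\<dots> = {n + 1 - N r..n}" using N_le[of r] by auto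
    finally show "card {j \<in> J. r \<le> Radv absv n (F j)} = card {i \<in> {1..n}. r \<le> multiradius absv n A c i}"
      using N_le[of r] by (simp add: N_def)
  qed (use fin in auto)
  then show ?thesis
    unfolding opt_basis_def using fin hor ind span by blast
qed

text \<open>Comparing coefficients determines each one from lower ones after division by its index,
  which is possible in characteristic zero.\<close>

lemma horizontal_unique:
  assumes eq: "\<And>p. p < n \<Longrightarrow> fps_deriv (Z p) + (\<Sum>q<n. B p q * Z q) = 0"
    and init: "\<And>p. p < n \<Longrightarrow> Z p $ 0 = (0::'k)" and p: "p < n"
  shows "Z p = 0"
proof -
  have "\<forall>p<n. Z p $ k = 0" for k
  proof (induction k rule: less_induct)
    case (less k)
    show ?case
    proof (intro allI impI)
      fix p assume p: "p < n"
      show "Z p $ k = 0"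
      proof (cases k)
        case (Suc k')
        have "(B p q * Z q) $ k' = 0" if "q < n" for q
          unfolding fps_mult_nth using less.IH that Suc by (intro sum.neutral) auto
        then have "(\<Sum>q<n. B p q * Z q) $ k' = 0" by (simp add: fps_sum_nth)
        moreover have "fps_deriv (Z p) = - (\<Sum>q<n. B p q * Z q)"
          using eq[OF p] by (simp add: eq_neg_iff_add_eq_0)
        ultimately have "of_nat (k' + 1) * Z p $ (k' + 1) = 0"
          by (metis fps_deriv_nth fps_neg_nth neg_equal_0_iff_equal)
        moreover have "(of_nat (k' + 1) :: 'k) \<noteq> 0" by (simp only: of_nat_eq_0_iff)
        ultimately show ?thesis using Suc by simp
      qed (use init p in simp)
    qed
  qed
  then show ?thesis using p by (intro fps_ext) simp
qed

text \<open>\<open>n + 1\<close> solutions have linearly dependent initial values, and a solution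
  with zero initial values vanishes; independence of the family prevents the coefficient of
  \<open>Z\<close> from being zero.\<close>

lemma horizontal_span_if_card:
  assumes fin: "finite J" and cJ: "card J = n" and hor: "\<And>j. j \<in> J \<Longrightarrow> horizontal absv n A c (F j)"
    and ind: "klin_indep n J F" and Z: "horizontal absv n A c Z"
  shows "\<exists>x. \<forall>p<n. Z p = (\<Sum>j\<in>J. fps_const (x j) * F j p)"
proof -
  obtain h where h: "bij_betw h {..<n} J"
    using ex_bij_betw_nat_finite[OF fin] cJ by (auto simp: lessThan_atLeast0)
  define E where "E t = (if t < n then F (h t) else Z)" for t
  obtain y where y: "\<exists>t<Suc n. y t \<noteq> 0" "\<And>p. p < n \<Longrightarrow> (\<Sum>t<Suc n. E t p $ 0 * y t) = 0"
    using homogeneous_nontrivial[of n "Suc n" "\<lambda>p t. E t p $ 0"] by auto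
  have horE: "horizontal absv n A c (E t)" for t
    using Z hor h by (auto simp: E_def bij_betw_def)
  define S where "S p = (\<Sum>t<Suc n. fps_const (y t) * E t p)" for p
  have S0: "S p = 0" if "p < n" for p
  proof (rule horizontal_unique[OF _ _ that])
    fix p assume p: "p < n"
    have "fps_deriv (S p) + (\<Sum>q<n. expand absv (A p q) c * S q)
      = (\<Sum>t<Suc n. fps_const (y t) * fps_deriv (E t p)) + (\<Sum>t<Suc n. \<Sum>q<n. fps_const (y t) * (expand absv (A p q) c * E t q))"
      unfolding S_def by (subst sum.swap[of _ _ "{..<Suc n}"]) (simp add: fps_deriv_sum sum_distrib_left distrib_left sum.distrib mult_ac del: sum.lessThan_Suc)
    also have "\<dots> = (\<Sum>t<Suc n. fps_const (y t) * (fps_deriv (E t p) + (\<Sum>q<n. expand absv (A p q) c * E t q)))"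
      by (simp add: distrib_left sum.distrib sum_distrib_left del: sum.lessThan_Suc)
    also have "\<dots> = 0"
    proof (intro sum.neutral ballI)
      fix t
      have "fps_deriv (E t p) + (\<Sum>q<n. expand absv (A p q) c * E t q) = 0"
        using horE[of t] p by (auto simp: horizontal_def hor_on_def)
      then show "fps_const (y t) * (fps_deriv (E t p) + (\<Sum>q<n. expand absv (A p q) c * E t q)) = 0" by simp
    qed
    finally show "fps_deriv (S p) + (\<Sum>q<n. expand absv (A p q) c * S q) = 0" .
    show "S p $ 0 = 0" using y(2)[OF p] by (simp add: S_def fps_sum_nth mult.commute)
  qed
  have split: "(\<Sum>t<n. fps_const (y t) * F (h t) p) + fps_const (y n) * Z p = 0" if "p < n" for p
    using S0[OF that] by (simp add: S_def E_def)
  have yn: "y n \<noteq> 0"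
  proof
    assume yn: "y n = 0"
    then have "\<forall>p<n. (\<Sum>t<n. fps_const (y t) * F (h t) p) = 0" using split by simp
    then have "\<forall>t\<in>{..<n}. y t = 0" using klin_indep_reindex[OF ind h] by (simp add: klin_indep_def)
    then show False using y(1) yn by (auto simp: less_Suc_eq)
  qed
  define x where "x j = - y (inv_into {..<n} h j) / y n" for j
  have "Z p = (\<Sum>j\<in>J. fps_const (x j) * F j p)" if "p < n" for p
  proof -
    have "(\<Sum>j\<in>J. fps_const (x j) * F j p) = (\<Sum>t<n. fps_const (- y t / y n) * F (h t) p)"
      unfolding sum.reindex_bij_betw[OF h, symmetric]
      using h by (intro sum.cong refl) (simp add: x_def bij_betw_inv_into_left)
    also have "\<dots> = fps_const (- 1 / y n) * (\<Sum>t<n. fps_const (y t) * F (h t) p)"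
      by (simp add: sum_distrib_left mult.assoc[symmetric])
    also have "(\<Sum>t<n. fps_const (y t) * F (h t) p) = fps_const (- y n) * Z p"
      using split[OF that] by (simp add: add_eq_0_iff flip: fps_const_neg)
    also have "fps_const (- 1 / y n) * (fps_const (- y n) * Z p) = Z p"
      using yn by (simp flip: mult.assoc)
    finally show ?thesis by simp
  qed
  then show ?thesis by blast
qed

subsection \<open>The tree of a fibre\<close>

lemma odisc_center: "x \<in> odisc absv c r \<Longrightarrow> odisc absv x r = odisc absv c r"
  and cdisc_center: "x \<in> cdisc absv c r \<Longrightarrow> cdisc absv x r = cdisc absv c r"
proof -
  have *: "absv (y - c) \<le> max (absv (y - x)) (absv (x - c))" "absv (y - x) \<le> max (absv (y - c)) (absv (x - c))" for y
    using absv_ultra[of y c x] absv_ultra[of y x c] absv_minus_commute[of c x] by auto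
  show "x \<in> odisc absv c r \<Longrightarrow> odisc absv x r = odisc absv c r"
  proof (rule set_eqI)
    fix y assume "x \<in> odisc absv c r"
    then show "y \<in> odisc absv x r \<longleftrightarrow> y \<in> odisc absv c r" using *(1)[of y] *(2)[of y] by (auto simp: odisc_def)
  qed
  show "x \<in> cdisc absv c r \<Longrightarrow> cdisc absv x r = cdisc absv c r"
  proof (rule set_eqI)
    fix y assume "x \<in> cdisc absv c r"
    then show "y \<in> cdisc absv x r \<longleftrightarrow> y \<in> cdisc absv c r" using *(1)[of y] *(2)[of y] by (auto simp: cdisc_def)
  qed
qed

text \<open>Discs are identified with their sets of points; density of the value group ensures that
  such a set determines its radius.\<close>

lemma odisc_radius_le: "0 < r \<Longrightarrow> r' \<le> 1 \<Longrightarrow> odisc absv c r' \<subseteq> odisc absv c r \<Longrightarrow> r' \<le> r"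
proof (rule ccontr)
  assume *: "0 < r" "r' \<le> 1" "odisc absv c r' \<subseteq> odisc absv c r" and "\<not> r' \<le> r"
  then obtain x where "r < absv x" "absv x < r'" using ex_absv_between[of r r'] by auto
  then have "c + x \<in> odisc absv c r'" "c + x \<notin> odisc absv c r" by (auto simp: odisc_def)
  then show False using * by blast
qed

lemma odisc_mono: "r \<le> r' \<Longrightarrow> odisc absv c r \<subseteq> odisc absv c r'"
  by (auto simp: odisc_def)

lemma odisc_self: "0 < r \<Longrightarrow> c \<in> odisc absv c r"
  by (simp add: odisc_def)

context
  fixes cl :: bool and d :: nat and a :: "nat \<Rightarrow> 'k" and i0 :: nat and R :: real
    and P :: "'k set \<times> real \<times> (nat \<Rightarrow> nat \<Rightarrow> 'k fps)"
    and Ch :: "('k set \<times> real \<times> (nat \<Rightarrow> nat \<Rightarrow> 'k fps)) \<Rightarrow> ('k set \<times> real) \<Rightarrow> 'k set set"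
  assumes a_inj: "inj_on a {..<d}" and i0: "i0 < d" and R: "0 < R" "R \<le> 1"
    and P: "fst P = odisc absv (a i0) R" "fst (snd P) = R"
    and choice: "\<And>\<eta>. \<eta> \<in> BP absv cl d a P \<Longrightarrow> Ch P \<eta> \<subseteq> brs absv d a (fst \<eta>) (snd \<eta>) \<and>
                   card (Ch P \<eta>) = card (brs absv d a (fst \<eta>) (snd \<eta>)) - 1"
begin

abbreviation (input) "U0 \<equiv> odisc absv (a i0) R"
abbreviation (input) "UPs \<equiv> UP absv cl d a Ch P"
abbreviation (input) "vert i \<rho> \<equiv> (cdisc absv (a i) \<rho>, \<rho>)"

lemma U0_center: "a i \<in> U0 \<Longrightarrow> odisc absv (a i) R = U0"
  by (rule odisc_center)

lemma finite_brs: "finite (brs absv d a S \<rho>)"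
proof -
  have "brs absv d a S \<rho> \<subseteq> (\<lambda>i. odisc absv (a i) \<rho>) ` {..<d}" by (auto simp: brs_def)
  then show ?thesis by (rule finite_subset) simp
qed

text \<open>Below \<open>R \<le> 1\<close> one component always lies outside the disc of the vertex,
  so branching means at least two downward branches, that is, a fibre point at distance exactly
  \<rho>.\<close>

lemma BP_iff:
  assumes i: "i < d" "a i \<in> U0" and \<rho>: "0 < \<rho>"
  shows "vert i \<rho> \<in> BP absv cl d a P \<longleftrightarrow> \<rho> < R \<and> (\<exists>k<d. absv (a k - a i) = \<rho>)"
proof
  assume "vert i \<rho> \<in> BP absv cl d a P"
  then have *: "\<rho> < R" "2 < card (brs absv d a (cdisc absv (a i) \<rho>) \<rho>) + (if \<rho> < 1 then 1 else 0)"
    by (auto simp: BP_def branching_pts_def P)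
  have "\<exists>k<d. absv (a k - a i) = \<rho>"
  proof (rule ccontr)
    assume c: "\<not> (\<exists>k<d. absv (a k - a i) = \<rho>)"
    have "brs absv d a (cdisc absv (a i) \<rho>) \<rho> \<subseteq> {odisc absv (a i) \<rho>}"
    proof
      fix B assume "B \<in> brs absv d a (cdisc absv (a i) \<rho>) \<rho>"
      then obtain k where k: "k < d" "absv (a k - a i) \<le> \<rho>" "B = odisc absv (a k) \<rho>"
        by (auto simp: brs_def cdisc_def)
      then have "a k \<in> odisc absv (a i) \<rho>" using c by (auto simp: odisc_def less_le)
      then show "B \<in> {odisc absv (a i) \<rho>}" using k odisc_center by simp
    qed
    then have "card (brs absv d a (cdisc absv (a i) \<rho>) \<rho>) \<le> card {odisc absv (a i) \<rho>}"
      by (intro card_mono) auto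
    then show False using * by (auto split: if_splits)
  qed
  then show "\<rho> < R \<and> (\<exists>k<d. absv (a k - a i) = \<rho>)" using * by blast
next
  assume *: "\<rho> < R \<and> (\<exists>k<d. absv (a k - a i) = \<rho>)"
  then obtain k where k: "k < d" "absv (a k - a i) = \<rho>" by blast
  have "cdisc absv (a i) \<rho> \<subseteq> odisc absv (a i) R" using * by (auto simp: odisc_def cdisc_def)
  then have sub: "cdisc absv (a i) \<rho> \<subseteq> U0" using U0_center[OF i(2)] by simp
  have "a k \<notin> odisc absv (a i) \<rho>" using k by (simp add: odisc_def)
  then have ne: "odisc absv (a k) \<rho> \<noteq> odisc absv (a i) \<rho>" using odisc_self[OF \<rho>] by blast
  have "{odisc absv (a k) \<rho>, odisc absv (a i) \<rho>} \<subseteq> brs absv d a (cdisc absv (a i) \<rho>) \<rho>"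
    using i k \<rho> by (auto simp: brs_def cdisc_def)
  then have "card {odisc absv (a k) \<rho>, odisc absv (a i) \<rho>} \<le> card (brs absv d a (cdisc absv (a i) \<rho>) \<rho>)"
    by (intro card_mono finite_brs)
  then have "2 \<le> card (brs absv d a (cdisc absv (a i) \<rho>) \<rho>)" using ne by simp
  then show "vert i \<rho> \<in> BP absv cl d a P"
    using * \<rho> R sub i unfolding BP_def branching_pts_def P
    by (intro CollectI conjI exI[of _ "a i"] exI[of _ \<rho>] exI[of _ i]) auto
qed

lemma BP_cases:
  assumes "\<eta> \<in> BP absv cl d a P"
  obtains i where "i < d" "a i \<in> U0" "\<eta> = vert i (snd \<eta>)" "0 < snd \<eta>" "snd \<eta> < R"
proof -
  obtain c i where i: "\<eta> = (cdisc absv c (snd \<eta>), snd \<eta>)" "0 < snd \<eta>" "snd \<eta> < R" "fst \<eta> \<subseteq> U0" "i < d" "absv (a i - c) \<le> snd \<eta>"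
    using assms by (auto simp: BP_def branching_pts_def P)
  then have "a i \<in> cdisc absv c (snd \<eta>)" by (simp add: cdisc_def)
  then show ?thesis using that[of i] i cdisc_center[of "a i" c "snd \<eta>"] by (metis fst_conv subsetD)
qed

text \<open>The choice of discs seen from a fibre point: the branch towards \<open>a i\<close> at
  radius \<rho> is among the selected ones.\<close>

definition chosen :: "nat \<Rightarrow> real \<Rightarrow> bool" where
  "chosen i \<rho> \<longleftrightarrow> vert i \<rho> \<in> BP absv cl d a P \<and> odisc absv (a i) \<rho> \<in> Ch P (vert i \<rho>)"

lemma UPs_cases:
  assumes "U \<in> UPs"
  obtains "U = U0" | i \<rho> where "i < d" "a i \<in> U0" "0 < \<rho>" "\<rho> < R" "U = odisc absv (a i) \<rho>" "chosen i \<rho>"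
proof -
  from assms consider "U = U0" | \<eta> where "\<eta> \<in> BP absv cl d a P" "U \<in> Ch P \<eta>"
    by (auto simp: UP_def P)
  then show ?thesis
  proof cases
    case 2
    obtain j where j: "j < d" "a j \<in> U0" "\<eta> = vert j (snd \<eta>)" "0 < snd \<eta>" "snd \<eta> < R"
      using BP_cases[OF 2(1)] .
    have "U \<in> brs absv d a (fst \<eta>) (snd \<eta>)" using choice[OF 2(1)] 2(2) by blast
    then obtain i where i: "i < d" "a i \<in> fst \<eta>" "U = odisc absv (a i) (snd \<eta>)"
      by (auto simp: brs_def)
    have "fst \<eta> \<subseteq> U0" using 2(1) by (simp add: BP_def P)
    then have "a i \<in> U0" using i by blast
    moreover have "a i \<in> cdisc absv (a j) (snd \<eta>)" using i(2) j(3) by (metis fst_conv)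
    then have "\<eta> = vert i (snd \<eta>)" using j(3) cdisc_center by metis
    then have "chosen i (snd \<eta>)" using 2 i unfolding chosen_def by simp
    ultimately show ?thesis using that(2) i j by blast
  qed (use that in blast)
qed

lemma chosen_UPs: "chosen i \<rho> \<Longrightarrow> odisc absv (a i) \<rho> \<in> UPs"
  by (auto simp: chosen_def UP_def)

lemma U0_UPs: "U0 \<in> UPs"
  by (simp add: UP_def P)

lemma chosen_cong:
  assumes "a k \<in> odisc absv (a i) \<rho>" "0 < \<rho>"
  shows "chosen k \<rho> \<longleftrightarrow> chosen i \<rho>"
proof -
  have "a k \<in> cdisc absv (a i) \<rho>" using assms by (simp add: odisc_def cdisc_def)
  then show ?thesis
    using odisc_center[OF assms(1)] cdisc_center by (simp add: chosen_def)
qed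

lemma chosen_less: "chosen i \<rho> \<Longrightarrow> i < d \<Longrightarrow> a i \<in> U0 \<Longrightarrow> 0 < \<rho> \<Longrightarrow> \<rho> < R \<and> (\<exists>k<d. absv (a k - a i) = \<rho>)"
  using BP_iff by (simp add: chosen_def)

lemma UPs_at_leaf:
  assumes "U \<in> UPs" "k < d" "a k \<in> U"
  obtains "U = U0" | \<rho> where "0 < \<rho>" "\<rho> < R" "U = odisc absv (a k) \<rho>" "chosen k \<rho>"
  using assms(1)
proof (cases rule: UPs_cases)
  case (2 i \<rho>)
  then show ?thesis
    using that(2)[of \<rho>] assms odisc_center[of "a k" "a i" \<rho>] chosen_cong[of k i \<rho>] by auto
qed (use that in blast)

text \<open>The count \<open>card - 1\<close> leaves exactly one branch at the vertex;
  \<open>k\<close> lies in it.\<close>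

lemma unchosen:
  assumes "i < d" "a i \<in> U0" "0 < \<rho>" "vert i \<rho> \<in> BP absv cl d a P"
  obtains k where "k < d" "absv (a k - a i) \<le> \<rho>" "\<not> chosen k \<rho>"
    "\<And>j. j < d \<Longrightarrow> absv (a j - a i) \<le> \<rho> \<Longrightarrow> \<not> chosen j \<rho> \<Longrightarrow> a j \<in> odisc absv (a k) \<rho>"
proof -
  let ?B = "brs absv d a (cdisc absv (a i) \<rho>) \<rho>"
  have Ch: "Ch P (vert i \<rho>) \<subseteq> ?B" "card (Ch P (vert i \<rho>)) = card ?B - 1"
    using choice[OF assms(4)] by auto
  have "odisc absv (a i) \<rho> \<in> ?B" using assms by (auto simp: brs_def cdisc_def)
  then have "card ?B \<ge> 1" using finite_brs by (metis One_nat_def Suc_leI card_gt_0_iff empty_iff)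
  then have "card (?B - Ch P (vert i \<rho>)) = 1"
    using Ch finite_brs by (subst card_Diff_subset) (auto intro: finite_subset)
  then obtain B where B: "?B - Ch P (vert i \<rho>) = {B}" by (auto simp: card_1_singleton_iff)
  then have "B \<in> ?B" by blast
  then obtain k where k: "k < d" "a k \<in> cdisc absv (a i) \<rho>" "B = odisc absv (a k) \<rho>"
    by (auto simp: brs_def)
  have vert: "vert j \<rho> = vert i \<rho>" if "absv (a j - a i) \<le> \<rho>" for j
    using that cdisc_center[of "a j" "a i" \<rho>] by (simp add: cdisc_def)
  have ch: "chosen j \<rho> \<longleftrightarrow> odisc absv (a j) \<rho> \<noteq> B" if "j < d" "absv (a j - a i) \<le> \<rho>" for j
  proof -
    have "odisc absv (a j) \<rho> \<in> ?B" using that by (auto simp: brs_def cdisc_def)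
    then show ?thesis
      using B assms(4) vert[OF that(2)] unfolding chosen_def by auto
  qed
  show ?thesis
  proof (rule that[of k])
    show "absv (a k - a i) \<le> \<rho>" using k by (simp add: cdisc_def)
    then show "\<not> chosen k \<rho>" using ch k by simp
    show "a j \<in> odisc absv (a k) \<rho>" if "j < d" "absv (a j - a i) \<le> \<rho>" "\<not> chosen j \<rho>" for j
      using ch[OF that(1,2)] that(3) k odisc_self[OF assms(3), of "a j"] by simp
  qed (rule k(1))
qed

text \<open>Descend along the branches that were not chosen.\<close>

lemma descend:
  assumes "i < d" "a i \<in> U0" "0 < r" "r \<le> R"
  shows "\<exists>k<d. a k \<in> odisc absv (a i) r \<and> (\<forall>\<rho>. 0 < \<rho> \<and> \<rho> < r \<longrightarrow> \<not> chosen k \<rho>)"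
  using assms
proof (induction "card {k. k < d \<and> a k \<in> odisc absv (a i) r}" arbitrary: i r rule: less_induct)
  case less
  define L where "L = {k. k < d \<and> a k \<in> odisc absv (a i) r}"
  have L: "finite L" "i \<in> L" using less.prems odisc_self by (auto simp: L_def)
  have LU: "a k \<in> U0" if "k \<in> L" for k
    using that odisc_mono[OF less.prems(4), of "a i"] U0_center[OF less.prems(2)] by (auto simp: L_def)
  have in_L: "k \<in> L" if "k < d" "j \<in> L" "absv (a k - a j) < r" for j k
    using that absv_ultra[of "a k" "a i" "a j"] by (auto simp: L_def odisc_def)
  have near: "absv (a k - a j) < r" if "j \<in> L" "k \<in> L" for j k
    using that absv_ultra[of "a k" "a j" "a i"] absv_minus_commute[of "a i" "a j"] by (auto simp: L_def odisc_def)
  show ?case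
  proof (cases "L = {i}")
    case True
    have "\<not> chosen i \<rho>" if \<rho>: "0 < \<rho>" "\<rho> < r" for \<rho>
    proof
      assume ch: "chosen i \<rho>"
      obtain k where k: "k < d" "absv (a k - a i) = \<rho>"
        using chosen_less[OF ch less.prems(1,2) \<rho>(1)] by blast
      then have "k \<in> L" using \<rho> in_L[OF k(1) L(2)] by simp
      then show False using True k \<rho> by simp
    qed
    then show ?thesis using less.prems odisc_self by blast
  next
    case False
    define \<delta> where "\<delta> = Max ((\<lambda>(j, k). absv (a k - a j)) ` (L \<times> L))"
    have fin: "finite ((\<lambda>(j, k). absv (a k - a j)) ` (L \<times> L))" using L by simp
    have le\<delta>: "absv (a k - a j) \<le> \<delta>" if "j \<in> L" "k \<in> L" for j k
      unfolding \<delta>_def using that by (intro Max_ge[OF fin]) force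
    have "\<delta> \<in> (\<lambda>(j, k). absv (a k - a j)) ` (L \<times> L)"
      unfolding \<delta>_def using L by (intro Max_in[OF fin]) auto
    then obtain j k where jk: "j \<in> L" "k \<in> L" "absv (a k - a j) = \<delta>" by auto
    obtain k' where k': "k' \<in> L" "k' \<noteq> i" using False L by blast
    then have "a k' \<noteq> a i" using a_inj L by (auto simp: L_def dest: inj_onD)
    then have "0 < absv (a k' - a i)" by simp
    then have \<delta>pos: "0 < \<delta>" using le\<delta>[OF L(2) k'(1)] by (rule less_le_trans)
    have \<delta>r: "\<delta> < r" using near[OF jk(1,2)] jk(3) by simp
    have jd: "j < d" "k < d" using jk by (auto simp: L_def)
    have BP: "vert j \<delta> \<in> BP absv cl d a P"
      using BP_iff[OF jd(1) LU[OF jk(1)] \<delta>pos] jk jd \<delta>r less.prems by auto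
    obtain k0 where k0: "k0 < d" "absv (a k0 - a j) \<le> \<delta>" "\<not> chosen k0 \<delta>"
      using unchosen[OF jd(1) LU[OF jk(1)] \<delta>pos BP] by metis
    have k0L: "k0 \<in> L" using in_L[OF k0(1) jk(1)] k0 \<delta>r by simp
    let ?L' = "{k. k < d \<and> a k \<in> odisc absv (a k0) \<delta>}"
    have sub: "?L' \<subseteq> L"
      using in_L[OF _ k0L] \<delta>r by (auto simp: odisc_def)
    have "\<not> (j \<in> ?L' \<and> k \<in> ?L')"
      using jk(3) absv_ultra[of "a k" "a j" "a k0"] absv_minus_commute[of "a k0" "a j"] by (auto simp: odisc_def)
    then have "?L' \<subset> L" using sub jk by blast
    then have "card ?L' < card L" using L by (intro psubset_card_mono)
    then obtain k1 where k1: "k1 < d" "a k1 \<in> odisc absv (a k0) \<delta>" "\<And>\<rho>. 0 < \<rho> \<Longrightarrow> \<rho> < \<delta> \<Longrightarrow> \<not> chosen k1 \<rho>"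
      using less.hyps[of k0 \<delta>] k0(1) LU[OF k0L] \<delta>pos \<delta>r less.prems(4) unfolding L_def by auto
    have k1L: "k1 \<in> L" using k1 sub by auto
    have "\<not> chosen k1 \<rho>" if \<rho>: "0 < \<rho>" "\<rho> < r" for \<rho>
    proof
      assume ch: "chosen k1 \<rho>"
      consider "\<rho> < \<delta>" | "\<rho> = \<delta>" | "\<delta> < \<rho>" by linarith
      then show False
      proof cases
        case 2
        then show ?thesis using ch chosen_cong[OF k1(2) \<delta>pos] k0(3) by simp
      next
        case 3
        obtain k2 where k2: "k2 < d" "absv (a k2 - a k1) = \<rho>"
          using chosen_less[OF ch k1(1) LU[OF k1L] \<rho>(1)] by blast
        then have "k2 \<in> L" using in_L[OF k2(1) k1L] \<rho> by simp
        then show ?thesis using le\<delta>[OF k1L] k2 3 by fastforce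
      qed (use ch k1(3) \<rho> in blast)
    qed
    then show ?thesis using k1L by (auto simp: L_def)
  qed
qed

text \<open>The point reached by descending inside \<open>U\<close> along omitted branches avoids
  all smaller chosen discs.\<close>

lemma tree_min:
  assumes "U \<in> UPs"
  obtains k where "k < d" "a k \<in> U" "\<And>U'. U' \<in> UPs \<Longrightarrow> a k \<in> U' \<longleftrightarrow> U \<subseteq> U'"
proof -
  obtain i r where ir: "i < d" "a i \<in> U0" "0 < r" "r \<le> R" "U = odisc absv (a i) r"
    using assms
  proof (cases rule: UPs_cases)
    case 1
    then show ?thesis using that[of i0 R] i0 R odisc_self by blast
  qed (use that in auto)
  obtain k where k: "k < d" "a k \<in> odisc absv (a i) r" "\<And>\<rho>. 0 < \<rho> \<Longrightarrow> \<rho> < r \<Longrightarrow> \<not> chosen k \<rho>"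
    using descend[OF ir(1-4)] by blast
  have Uk: "U = odisc absv (a k) r" using odisc_center[OF k(2)] ir by simp
  have "U \<subseteq> U'" if U': "U' \<in> UPs" "a k \<in> U'" for U'
    using U'(1) k(1) U'(2)
  proof (cases rule: UPs_at_leaf)
    case 1
    then show ?thesis using ir odisc_mono[OF ir(4), of "a i"] U0_center[OF ir(2)] by simp
  next
    case (2 \<rho>)
    then have "r \<le> \<rho>" using k(3) by (meson not_le)
    then show ?thesis unfolding Uk 2 by (rule odisc_mono)
  qed
  then show ?thesis using that[of k] k ir by blast
qed

text \<open>Companion of \<open>tree_min\<close>: at the vertex of \<open>U\<close> one enters the
  omitted branch and descends there. Comparing the two points isolates the coefficient of
  \<open>U\<close>.\<close>

lemma tree_next:
  assumes "U \<in> UPs" "U \<noteq> U0"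
  obtains i \<rho> k where "i < d" "a i \<in> U0" "0 < \<rho>" "\<rho> < R" "U = odisc absv (a i) \<rho>" "k < d" "absv (a k - a i) = \<rho>"
    "\<And>U'. U' \<in> UPs \<Longrightarrow> a k \<in> U' \<longleftrightarrow> U \<subset> U'"
  using assms(1)
proof (cases rule: UPs_cases)
  case (2 i \<rho>)
  then have BP: "vert i \<rho> \<in> BP absv cl d a P" by (simp add: chosen_def)
  obtain k0 where k0: "k0 < d" "absv (a k0 - a i) \<le> \<rho>" "\<not> chosen k0 \<rho>"
    using unchosen[OF 2(1-3) BP] by metis
  have k0U: "a k0 \<in> U0"
    using k0 2(4) U0_center[OF 2(2)] by (auto simp: odisc_def)
  obtain k where k: "k < d" "a k \<in> odisc absv (a k0) \<rho>" "\<And>s. 0 < s \<Longrightarrow> s < \<rho> \<Longrightarrow> \<not> chosen k s"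
    using descend[OF k0(1) k0U 2(3)] 2(4) by (meson less_imp_le)
  have unch: "\<not> chosen k \<rho>" using chosen_cong[OF k(2) 2(3)] k0 by simp
  have "absv (a k - a i) \<le> \<rho>"
    using absv_ultra[of "a k" "a i" "a k0"] k(2) k0(2) by (auto simp: odisc_def)
  moreover have "\<not> absv (a k - a i) < \<rho>"
    using chosen_cong[of k i \<rho>] 2 unch by (auto simp: odisc_def)
  ultimately have ki: "absv (a k - a i) = \<rho>" by simp
  have "a k \<in> U' \<longleftrightarrow> U \<subset> U'" if U': "U' \<in> UPs" for U'
  proof
    assume kU: "a k \<in> U'"
    have "a i \<in> U' \<and> U \<subseteq> U'"
      using U' k(1) kU
    proof (cases rule: UPs_at_leaf)
      case 1
      then show ?thesis using 2 odisc_mono[of \<rho> R "a i"] U0_center[OF 2(2)] by auto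
    next
      case (2 s)
      then have "\<rho> < s" using k(3)[of s] unch by (cases s \<rho> rule: linorder_cases) auto
      then have "a i \<in> odisc absv (a k) s" using ki absv_minus_commute[of "a i" "a k"] by (simp add: odisc_def)
      then have "U' = odisc absv (a i) s" using odisc_center 2 by simp
      then show ?thesis
        using \<open>\<rho> < s\<close> odisc_mono[of \<rho> s "a i"] odisc_self[of s "a i"] \<open>U = odisc absv (a i) \<rho>\<close> \<open>0 < s\<close> by auto
    qed
    moreover have "a k \<notin> U" using ki 2 by (simp add: odisc_def)
    ultimately show "U \<subset> U'" using kU by blast
  next
    assume sub: "U \<subset> U'"
    have iU: "a i \<in> U'" using sub 2 odisc_self by blast
    show "a k \<in> U'"
      using U' 2(1) iU
    proof (cases rule: UPs_at_leaf)
      case 1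
      then show ?thesis using ki 2 U0_center[OF 2(2)] by (auto simp: odisc_def)
    next
      case (2 s)
      have "\<rho> < s"
      proof (rule ccontr)
        assume "\<not> \<rho> < s"
        then have "U' \<subseteq> U" using 2 \<open>U = odisc absv (a i) \<rho>\<close> odisc_mono[of s \<rho> "a i"] by simp
        then show False using sub by blast
      qed
      then show ?thesis using ki 2 by (simp add: odisc_def)
    qed
  qed
  then show ?thesis using that[of i \<rho> k] 2 k(1) ki by blast
qed (use assms in blast)

text \<open>At the vertex where the paths to the two points part they lie in different branches, and
  only one branch is omitted.\<close>

lemma tree_sep:
  assumes "i < d" "k < d" "i \<noteq> k" "a i \<in> U0" "a k \<in> U0"
  obtains U where "U \<in> UPs" "a i \<in> U \<longleftrightarrow> a k \<notin> U"
proof -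
  define \<rho> where "\<rho> = absv (a k - a i)"
  have "a k \<noteq> a i" using a_inj assms by (auto dest: inj_onD)
  then have \<rho>: "0 < \<rho>" using absv_pos_iff[of "a k - a i"] by (simp add: \<rho>_def)
  have \<rho>R: "\<rho> < R" using assms(5) U0_center[OF assms(4)] by (auto simp: \<rho>_def odisc_def)
  have BP: "vert i \<rho> \<in> BP absv cl d a P"
    using BP_iff[OF assms(1,4) \<rho>] \<rho>R assms(2) by (auto simp: \<rho>_def)
  have nk: "a k \<notin> odisc absv (a i) \<rho>" "a i \<notin> odisc absv (a k) \<rho>"
    using absv_minus_commute[of "a i" "a k"] by (auto simp: odisc_def \<rho>_def)
  obtain k0 where k0: "\<And>j. j < d \<Longrightarrow> absv (a j - a i) \<le> \<rho> \<Longrightarrow> \<not> chosen j \<rho> \<Longrightarrow> a j \<in> odisc absv (a k0) \<rho>"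
    using unchosen[OF assms(1,4) \<rho> BP] by metis
  have "chosen i \<rho> \<or> chosen k \<rho>"
  proof (rule ccontr)
    assume "\<not> (chosen i \<rho> \<or> chosen k \<rho>)"
    then have "a i \<in> odisc absv (a k0) \<rho>" "a k \<in> odisc absv (a k0) \<rho>"
      using k0[of i] k0[of k] assms \<rho> by (auto simp: \<rho>_def)
    then show False using nk odisc_center by metis
  qed
  then show ?thesis
    using that[of "odisc absv (a i) \<rho>"] that[of "odisc absv (a k) \<rho>"] chosen_UPs nk odisc_self[OF \<rho>] by blast
qed

lemma finite_UPs: "finite UPs"
proof -
  have "UPs \<subseteq> insert U0 ((\<lambda>(i, k). odisc absv (a i) (absv (a k - a i))) ` ({..<d} \<times> {..<d}))"
  proof
    fix U assume "U \<in> UPs"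
    then show "U \<in> insert U0 ((\<lambda>(i, k). odisc absv (a i) (absv (a k - a i))) ` ({..<d} \<times> {..<d}))"
    proof (cases rule: UPs_cases)
      case (2 i \<rho>)
      then obtain k where "k < d" "absv (a k - a i) = \<rho>" using chosen_less by blast
      then show ?thesis using 2 by force
    qed simp
  qed
  then show ?thesis by (rule finite_subset) simp
qed

lemma UPs_nested: "U \<in> UPs \<Longrightarrow> U' \<in> UPs \<Longrightarrow> k < d \<Longrightarrow> a k \<in> U \<Longrightarrow> a k \<in> U' \<Longrightarrow> U \<subseteq> U' \<or> U' \<subseteq> U"
proof -
  assume *: "U \<in> UPs" "U' \<in> UPs" "k < d" "a k \<in> U" "a k \<in> U'"
  have "\<exists>r. V = odisc absv (a k) r" if "V \<in> UPs" "a k \<in> V" for V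
    using that(1) *(3) that(2)
    by (cases rule: UPs_at_leaf) (use that U0_center[of k] in auto)
  then obtain r r' where "U = odisc absv (a k) r" "U' = odisc absv (a k) r'" using * by metis
  then show ?thesis using odisc_mono[of r r'] odisc_mono[of r' r] by (cases "r \<le> r'") auto
qed

lemma UPs_sub: "U \<in> UPs \<Longrightarrow> U \<subseteq> U0"
  by (erule UPs_cases) (use odisc_mono U0_center less_imp_le in \<open>blast\<close>)+

text \<open>The point of \<open>tree_min\<close> gives a bijection: \<open>U\<close> is the smallest
  disc containing it, and every fibre point arises from the smallest disc around it because the
  discs separate points.\<close>

lemma card_UPs: "card UPs = card {k. k < d \<and> a k \<in> U0}"
proof -
  have "\<exists>k. k < d \<and> a k \<in> U \<and> (\<forall>U'\<in>UPs. a k \<in> U' \<longleftrightarrow> U \<subseteq> U')" if "U \<in> UPs" for U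
    using tree_min[OF that] by metis
  then obtain kf where kf: "\<And>U. U \<in> UPs \<Longrightarrow> kf U < d \<and> a (kf U) \<in> U \<and> (\<forall>U'\<in>UPs. a (kf U) \<in> U' \<longleftrightarrow> U \<subseteq> U')"
    by metis
  have "bij_betw kf UPs {k. k < d \<and> a k \<in> U0}"
    unfolding bij_betw_def
  proof
    show "inj_on kf UPs"
    proof (rule inj_onI)
      fix U U' assume UU': "U \<in> UPs" "U' \<in> UPs" "kf U = kf U'"
      have "U \<subseteq> U'" using kf[OF UU'(1)] kf[OF UU'(2)] UU' by auto
      moreover have "U' \<subseteq> U" using kf[OF UU'(1)] kf[OF UU'(2)] UU' by auto
      ultimately show "U = U'" by blast
    qed
    show "kf ` UPs = {k. k < d \<and> a k \<in> U0}"
    proof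
      show "kf ` UPs \<subseteq> {k. k < d \<and> a k \<in> U0}" using kf UPs_sub by blast
      show "{k. k < d \<and> a k \<in> U0} \<subseteq> kf ` UPs"
      proof
        fix k assume "k \<in> {k. k < d \<and> a k \<in> U0}"
        then have k: "k < d" "a k \<in> U0" by auto
        define W where "W = {U \<in> UPs. a k \<in> U}"
        have "finite W" "W \<noteq> {}" using finite_UPs U0_UPs k by (auto simp: W_def)
        then obtain U where U: "U \<in> W" "\<And>U'. U' \<in> W \<Longrightarrow> U' \<subseteq> U \<Longrightarrow> U' = U"
          using finite_has_minimal[of W] by metis
        have UP: "U \<in> UPs" "a k \<in> U" using U(1) by (auto simp: W_def)
        have least: "U \<subseteq> U'" if "U' \<in> W" for U'
          using U(2)[OF that] UPs_nested[OF UP(1) _ k(1) UP(2), of U'] that by (auto simp: W_def)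
        have "kf U = k"
        proof (rule ccontr)
          assume ne: "kf U \<noteq> k"
          have kfU: "kf U < d" "a (kf U) \<in> U0" using kf[OF UP(1)] UPs_sub[OF UP(1)] by auto
          obtain U' where U': "U' \<in> UPs" "a (kf U) \<in> U' \<longleftrightarrow> a k \<notin> U'"
            using tree_sep[OF kfU(1) k(1) ne kfU(2) k(2)] by metis
          show False
          proof (cases "a k \<in> U'")
            case True
            then have "U \<subseteq> U'" using U' least by (simp add: W_def)
            then show False using U' True kf[OF UP(1)] by blast
          next
            case False
            then have "U \<subseteq> U'" using U' kf[OF UP(1)] by blast
            then show False using UP(2) False by blast
          qed
        qed
        then show "k \<in> kf ` UPs" using UP(1) by blast
      qed
    qed
  qed
  then show ?thesis by (rule bij_betw_same_card)
qed

end

section \<open>Re-expansion on open discs\<close>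

lemma conv_open_expand:
  assumes "conv_open absv h r" "0 < r" "r \<le> 1" "absv c < r"
  shows "conv_open absv (expand absv h c) r"
proof -
  have "tate r' (expand absv h c)" if r': "0 < r'" "r' < r" for r'
  proof -
    have s: "0 < max r' (absv c)" "max r' (absv c) < r" using assms r' by auto
    then have "tate (max r' (absv c)) h" using assms by (simp add: conv_open_iff)
    then have "tate (max r' (absv c)) (expand absv h c)" using s by (intro expand_tate) auto
    then show ?thesis using r' by (auto intro: tate_radius)
  qed
  then show ?thesis using assms by (simp add: conv_open_iff)
qed

lemma conv_open_expand_expand:
  assumes "conv_open absv h r" "0 < r" "r \<le> 1" "absv c < r" "absv c' < r"
  shows "expand absv (expand absv h c) c' = expand absv h (c + c')"
proof -
  define s where "s = (max (absv c) (absv c') + r) / 2"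
  have s: "absv c \<le> s" "absv c' \<le> s" "0 < s" "s < r"
    using assms add_nonneg_pos[OF absv_nonneg[of c] assms(2)] add_nonneg_pos[OF absv_nonneg[of c'] assms(2)]
    by (auto simp: s_def max_def)
  then have "tate s h" using assms by (simp add: conv_open_iff)
  then show ?thesis using s by (intro expand_expand[of s]) auto
qed

lemma reexp_reexp:
  assumes "\<And>l. l < n \<Longrightarrow> conv_open absv (Z l) r" "0 < r" "r \<le> 1" "absv c < r" "absv c' < r"
  shows "reexp absv n (reexp absv n Z c) c' = reexp absv n Z (c + c')"
  using conv_open_expand_expand[OF assms(1) assms(2-)] by (auto simp: reexp_def fun_eq_iff)

lemma reexp_0: "(\<And>l. l \<ge> n \<Longrightarrow> Z l = 0) \<Longrightarrow> reexp absv n Z 0 = Z"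
  by (auto simp: reexp_def fun_eq_iff)

lemma odisc_eq_radius:
  assumes "odisc absv c r = odisc absv c' r'" "0 < r" "r \<le> 1" "0 < r'" "r' \<le> 1"
  shows "r = r'" "absv (c - c') < r"
proof -
  have "c \<in> odisc absv c' r'" using assms odisc_self[of r c] by simp
  then have "odisc absv c r = odisc absv c r'" using odisc_center[of c c' r'] assms by simp
  then show "r = r'" using odisc_radius_le[of r r' c] odisc_radius_le[of r' r c] assms by force
  then show "absv (c - c') < r" using \<open>c \<in> odisc absv c' r'\<close> by (simp add: odisc_def)
qed

end

section \<open>The radius of the image of a disc\<close>

context etale_cover
begin

lemma evalk_f: "x \<in> udisc absv cl \<Longrightarrow> absv (evalk absv f x - b) = (\<Prod>j<d. absv (x - a j))"
proof -
  assume x: "x \<in> udisc absv cl"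
  have "evalk absv f x - b = evalk absv (f - fps_const b) x"
    using evalk_diff[OF x f_Oring Oring_const] by (simp add: evalk_eq_expand[of "fps_const _"])
  also have "\<dots> = evalk absv Q x * evalk absv unit_part x"
    unfolding unit_part(2) using Q_Oring unit_part(1) by (intro evalk_mult[OF x])
  also have "evalk absv Q x = (\<Prod>j<d. evalk absv (fps_X - fps_const (a j)) x)"
    unfolding Q_def by (intro evalk_prod[OF x] Oring_diff) auto
  also have "\<dots> = (\<Prod>j<d. x - a j)" by (simp add: evalk_linear[OF x])
  finally show ?thesis using evalk_hh[OF x] by (simp add: absv_mult absv_prod)
qed

text \<open>The values of \<open>f - b\<close> factor over the fibre. At points near the boundary,
  farther from \<open>a i\<close> than all other fibre points inside, they have the size of the
  Gauss norm at that distance.\<close>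

lemma Sup_image:
  assumes i: "i < d" and r: "0 < r" "r \<le> 1"
  shows "Sup ((\<lambda>x. absv (evalk absv f x - b)) ` odisc absv (a i) r) = prof i r"
proof (rule cSup_eq)
  have disc: "x \<in> udisc absv cl" if "absv (x - a i) < r" for x
    using that a_disc[OF i] r absv_add_le[of "x - a i" "a i"] by (auto simp: udisc_def split: if_splits)
  {
    fix v assume "v \<in> (\<lambda>x. absv (evalk absv f x - b)) ` odisc absv (a i) r"
    then obtain x where x: "absv (x - a i) < r" "v = absv (evalk absv f x - b)" by (auto simp: odisc_def)
    have "absv (x - a j) \<le> max r (absv (a i - a j))" for j
      using absv_ultra[of x "a j" "a i"] x(1) by auto
    then have "(\<Prod>j<d. absv (x - a j)) \<le> (\<Prod>j<d. max r (absv (a i - a j)))"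
      by (intro prod_mono) auto
    then show "v \<le> prof i r"
      using x evalk_f[OF disc[OF x(1)]] by (simp add: prof_def)
  }
  fix y assume y: "\<And>v. v \<in> (\<lambda>x. absv (evalk absv f x - b)) ` odisc absv (a i) r \<Longrightarrow> v \<le> y"
  show "prof i r \<le> y"
  proof (rule ccontr)
    assume less: "\<not> prof i r \<le> y"
    \<comment> \<open>The largest distance below \<open>r\<close> of a fibre point from
      \<open>a i\<close>, or \<open>r / 2\<close>; strictly between it and \<open>r\<close> no ties
      occur.\<close>
    define r0 where "r0 = Max (insert (r / 2) {s \<in> (\<lambda>j. absv (a j - a i)) ` {..<d}. s < r})"
    have r0: "0 < r0" "r0 < r" "\<And>j. j < d \<Longrightarrow> absv (a j - a i) < r \<Longrightarrow> absv (a j - a i) \<le> r0"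
      using r by (auto simp: r0_def Max_gr_iff)
    define y' where "y' = max y (prof i r0)"
    have y': "0 < y'" "y' < prof i r"
      using less prof_pos[OF i r0(1)] prof_less[OF i _ r0(2)] r0 by (auto simp: y'_def)
    then have "y' \<le> 1" using prof_le_1[OF i, of r] r by linarith
    then obtain r1 where r1: "0 < r1" "r1 \<le> 1" "prof i r1 = y'" using prof_surj[OF i y'(1)] by blast
    have "r1 < r" using prof_less_iff[OF i, of r1 r] r1 r y' by simp
    moreover have "r0 \<le> r1" using prof_less_iff[OF i, of r1 r0] r1 r0 by (auto simp: y'_def not_less[symmetric])
    ultimately obtain z where z: "r1 < absv z" "absv z < r" using ex_absv_between[of r1 r] r1 r by blast
    define x where "x = a i + z"
    have xi: "absv (x - a i) = absv z" by (simp add: x_def)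
    have "absv (x - a j) = max (absv z) (absv (a i - a j))" if j: "j < d" for j
    proof (cases "absv (a j - a i) < r")
      case True
      then have "absv (a i - a j) < absv (x - a i)"
        using r0(3)[OF j] \<open>r0 \<le> r1\<close> z xi absv_minus_commute[of "a i" "a j"] by simp
      then show ?thesis
        using absv_add_eq[of "a i - a j" "x - a i"] xi by (simp add: max_def algebra_simps)
    next
      case False
      then have "absv (x - a i) < absv (a i - a j)"
        using z xi absv_minus_commute[of "a i" "a j"] by simp
      then show ?thesis
        using absv_ultra_eq[of x "a i" "a j"] xi by simp
    qed
    then have "absv (evalk absv f x - b) = prof i (absv z)"
      using evalk_f[OF disc[of x]] xi z by (simp add: prof_def)
    moreover have "absv (evalk absv f x - b) \<le> y"
      using xi z by (intro y) (auto simp: odisc_def)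
    moreover have "y' < prof i (absv z)" using prof_less[OF i _ z(1)] r1 by simp
    ultimately show False by (simp add: y'_def)
  qed
qed

end

locale linked_bases = diff_module absv cl d f b a P u V rk G
  for absv :: "'k::field_char_0 \<Rightarrow> real" and cl d f b a P u V rk G +
  fixes Y :: "nat \<Rightarrow> nat \<Rightarrow> nat \<Rightarrow> 'k fps"
    and Ch :: "('k set \<times> real \<times> (nat \<Rightarrow> nat \<Rightarrow> 'k fps)) \<Rightarrow> ('k set \<times> real) \<Rightarrow> 'k set set"
  assumes opt: "\<And>i. i < d \<Longrightarrow> opt_basis absv rk G (a i) {..<rk} (Y i)"
    and linked: "\<And>i j k. i < d \<Longrightarrow> j < rk \<Longrightarrow> k < d \<Longrightarrow> absv (a k - a i) < Radv absv rk (Y i j) \<Longrightarrow>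
                   \<exists>m<rk. reexp absv rk (Y i j) (a k - a i) = Y k m"
    and choice: "\<And>Pp \<eta>. Pp \<in> fund_pairs absv d rk a Y \<Longrightarrow> \<eta> \<in> BP absv cl d a Pp \<Longrightarrow>
                   Ch Pp \<eta> \<subseteq> brs absv d a (fst \<eta>) (snd \<eta>) \<and>
                   card (Ch Pp \<eta>) = card (brs absv d a (fst \<eta>) (snd \<eta>)) - 1"
begin

subsection \<open>Fundamental pairs\<close>

abbreviation "rad i j \<equiv> Radv absv rk (Y i j)"
abbreviation "FP \<equiv> fund_pairs absv d rk a Y"

lemma Y_horizontal: "i < d \<Longrightarrow> j < rk \<Longrightarrow> horizontal absv rk G (a i) (Y i j)"
  using opt[of i] by (simp add: opt_basis_def)

lemma Y_indep: "i < d \<Longrightarrow> klin_indep rk {..<rk} (Y i)"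
  using opt[of i] by (simp add: opt_basis_def)

lemma Y_0: "i < d \<Longrightarrow> j < rk \<Longrightarrow> rk \<le> l \<Longrightarrow> Y i j l = 0"
  using Y_horizontal[of i j] by (auto simp: horizontal_def hor_on_def)

lemma rad_pos: "i < d \<Longrightarrow> j < rk \<Longrightarrow> 0 < rad i j"
  using Y_horizontal horizontal_Radv_pos by blast

lemma rad_le_1: "rad i j \<le> 1"
  by (rule Radv_bounds)

lemma Y_hor_on: "i < d \<Longrightarrow> j < rk \<Longrightarrow> hor_on absv rk G (a i) (rad i j) (Y i j)"
  using hor_on_Radv_iff[OF Y_horizontal rad_pos rad_le_1] by simp

lemma Y_conv: "i < d \<Longrightarrow> j < rk \<Longrightarrow> l < rk \<Longrightarrow> conv_open absv (Y i j l) (rad i j)"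
  using Y_hor_on by (simp add: hor_on_def)

lemma Y_inj: "k < d \<Longrightarrow> m < rk \<Longrightarrow> m' < rk \<Longrightarrow> Y k m = Y k m' \<Longrightarrow> m = m'"
proof (rule ccontr)
  assume *: "k < d" "m < rk" "m' < rk" "Y k m = Y k m'" "m \<noteq> m'"
  define x where "x j = (if j = m then 1 else if j = m' then - 1 else 0 :: 'k)" for j
  have "(\<Sum>j<rk. fps_const (x j) * Y k j p) = 0" for p
  proof -
    have "(\<Sum>j<rk. fps_const (x j) * Y k j p) = (\<Sum>j\<in>{m, m'}. fps_const (x j) * Y k j p)"
      using * by (intro sum.mono_neutral_right) (auto simp: x_def)
    also have "\<dots> = 0" using * by (simp add: x_def flip: fps_const_neg)
    finally show ?thesis .
  qed
  then have "\<forall>j\<in>{..<rk}. x j = 0" using Y_indep[OF *(1)] unfolding klin_indep_def by blast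
  then have "x m = 0" using *(2) by blast
  then show False by (simp add: x_def)
qed

text \<open>Linkedness only says that the re-expansion is a basis element at \<open>a k\<close>; the
  radii agree because re-expanding back returns the original element.\<close>

lemma linked_rad:
  assumes "i < d" "j < rk" "k < d" "absv (a k - a i) < rad i j"
  obtains m where "m < rk" "reexp absv rk (Y i j) (a k - a i) = Y k m" "rad k m = rad i j"
proof -
  obtain m where m: "m < rk" "reexp absv rk (Y i j) (a k - a i) = Y k m" using linked[OF assms] by blast
  have conv: "conv_open absv (Y k m l) (rad i j)" if "l < rk" for l
    using conv_open_expand[OF Y_conv[OF assms(1,2) that] rad_pos[OF assms(1,2)] rad_le_1 assms(4)]
    using fun_cong[OF m(2), of l] that by (simp add: reexp_def)
  have ge: "rad i j \<le> rad k m"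
    using conv rad_pos[OF assms(1,2)] rad_le_1 by (simp add: Radv_ge_iff)
  have ki: "absv (a i - a k) < rad i j" using assms(4) absv_minus_commute[of "a i" "a k"] by simp
  have "reexp absv rk (Y k m) (a i - a k) = reexp absv rk (Y i j) ((a k - a i) + (a i - a k))"
    unfolding m(2)[symmetric]
    using reexp_reexp[OF Y_conv[OF assms(1,2)] rad_pos[OF assms(1,2)] rad_le_1 assms(4) ki] .
  also have "\<dots> = Y i j" using reexp_0[OF Y_0[OF assms(1,2)]] by simp
  finally have rev: "reexp absv rk (Y k m) (a i - a k) = Y i j" .
  have "conv_open absv (Y i j l) (rad k m)" if "l < rk" for l
    using conv_open_expand[OF Y_conv[OF assms(3) m(1) that] rad_pos[OF assms(3) m(1)] rad_le_1, of "a i - a k"]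
    using fun_cong[OF rev, of l] that ki ge by (simp add: reexp_def)
  then have "rad k m \<le> rad i j" using rad_pos[OF assms(3) m(1)] rad_le_1 by (simp add: Radv_ge_iff)
  then show ?thesis using that m ge by simp
qed

text \<open>The pair attached to the index \<open>(i, j)\<close>. Linked indices produce equal
  pairs, so pairs rather than indices label the discs.\<close>

definition mkP :: "nat \<Rightarrow> nat \<Rightarrow> 'k set \<times> real \<times> (nat \<Rightarrow> nat \<Rightarrow> 'k fps)" where
  "mkP i j = (odisc absv (a i) (rad i j), rad i j,
       \<lambda>k. if k < d \<and> a k \<in> odisc absv (a i) (rad i j)
           then reexp absv rk (Y i j) (a k - a i) else (\<lambda>l. 0))"

lemma mkP_simps [simp]: "fst (mkP i j) = odisc absv (a i) (rad i j)" "fst (snd (mkP i j)) = rad i j"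
  by (simp_all add: mkP_def)

lemma FP_eq: "FP = {mkP i j | i j. i < d \<and> j < rk}"
  by (simp add: fund_pairs_def mkP_def)

lemma mkP_self: "i < d \<Longrightarrow> j < rk \<Longrightarrow> snd (snd (mkP i j)) i = Y i j"
  using odisc_self[OF rad_pos] reexp_0[OF Y_0] by (simp add: mkP_def)

lemma mkP_eq:
  assumes "i < d" "j < rk" "k < d" "m < rk" "absv (a k - a i) < rad i j"
    "reexp absv rk (Y i j) (a k - a i) = Y k m" "rad k m = rad i j"
  shows "mkP k m = mkP i j"
proof -
  have disc: "odisc absv (a k) (rad k m) = odisc absv (a i) (rad i j)"
    using odisc_center[of "a k" "a i" "rad i j"] assms by (simp add: odisc_def)
  have "reexp absv rk (Y k m) (a l - a k) = reexp absv rk (Y i j) (a l - a i)"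
    if "a l \<in> odisc absv (a i) (rad i j)" for l
  proof -
    have "a l \<in> odisc absv (a k) (rad i j)" using that disc assms(7) by simp
    then have lk: "absv (a l - a k) < rad i j" by (simp add: odisc_def)
    show ?thesis
      unfolding assms(6)[symmetric]
      using reexp_reexp[OF Y_conv[OF assms(1,2)] rad_pos[OF assms(1,2)] rad_le_1 assms(5) lk] by simp
  qed
  then show ?thesis
    using disc assms(7) by (auto simp: mkP_def fun_eq_iff)
qed

lemma mkP_center:
  assumes "Pp \<in> FP" "k < d" "a k \<in> fst Pp"
  obtains m where "m < rk" "Pp = mkP k m"
proof -
  obtain i j where ij: "i < d" "j < rk" "Pp = mkP i j" using assms by (auto simp: FP_eq)
  then have "absv (a k - a i) < rad i j" using assms by (simp add: odisc_def)
  then show ?thesis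
    using linked_rad[OF ij(1,2) assms(2)] mkP_eq[OF ij(1,2) assms(2)] ij(3) that by metis
qed

lemma finite_FP: "finite FP"
proof -
  have "FP = (\<lambda>(i, j). mkP i j) ` ({..<d} \<times> {..<rk})" by (auto simp: FP_eq)
  then show ?thesis by simp
qed

definition FPk :: "nat \<Rightarrow> ('k set \<times> real \<times> (nat \<Rightarrow> nat \<Rightarrow> 'k fps)) set" where
  "FPk k = {Pp \<in> FP. a k \<in> fst Pp}"

text \<open>Linked elements have been identified, and elements of one basis stay distinct.
  Independence and adaptedness of the basis at \<open>a k\<close> thus pass to the pairs whose disc
  contains \<open>a k\<close>.\<close>

lemma FPk_bij: "k < d \<Longrightarrow> bij_betw (mkP k) {..<rk} (FPk k)"
proof -
  assume k: "k < d"
  have "inj_on (mkP k) {..<rk}"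
  proof (rule inj_onI)
    fix m m' assume m: "m \<in> {..<rk}" "m' \<in> {..<rk}" "mkP k m = mkP k m'"
    then have "Y k m = Y k m'" using mkP_self[OF k, of m] mkP_self[OF k, of m'] by simp
    then show "m = m'" using Y_inj[OF k] m by simp
  qed
  moreover have "mkP k ` {..<rk} = FPk k"
  proof
    show "mkP k ` {..<rk} \<subseteq> FPk k"
      using k odisc_self[OF rad_pos[OF k]] by (auto simp: FPk_def FP_eq)
    show "FPk k \<subseteq> mkP k ` {..<rk}"
      using mkP_center[OF _ k] by (auto simp: FPk_def) (metis imageI lessThan_iff)
  qed
  ultimately show ?thesis by (simp add: bij_betw_def)
qed

lemma sum_FPk: "k < d \<Longrightarrow> (\<Sum>Pp\<in>FPk k. x Pp (snd (snd Pp) k)) = (\<Sum>m<rk. x (mkP k m) (Y k m))"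
  by (subst sum.reindex_bij_betw[OF FPk_bij, symmetric]) (auto intro!: sum.cong simp: mkP_self)

lemma FPk_indep: "k < d \<Longrightarrow> klin_indep rk (FPk k) (\<lambda>Pp. snd (snd Pp) k)"
  unfolding klin_indep_def
proof (intro allI impI ballI)
  fix x :: "_ \<Rightarrow> 'k" and Pp
  assume k: "k < d" and z: "\<forall>p<rk. (\<Sum>Pp\<in>FPk k. fps_const (x Pp) * snd (snd Pp) k p) = 0" and Pp: "Pp \<in> FPk k"
  have "(\<Sum>m<rk. fps_const (x (mkP k m)) * Y k m p) = 0" if "p < rk" for p
    using z that sum_FPk[OF k, of "\<lambda>Pp y. fps_const (x Pp) * y p"] by simp
  then have "\<forall>m\<in>{..<rk}. x (mkP k m) = 0"
    using Y_indep[OF k, unfolded klin_indep_def, THEN spec, of "\<lambda>m. x (mkP k m)"] by simp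
  moreover obtain m where "m < rk" "Pp = mkP k m" using FPk_bij[OF k] Pp unfolding bij_betw_def by blast
  ultimately show "x Pp = 0" by simp
qed

lemma FPk_adapted:
  assumes k: "k < d" and r: "0 < r" "r \<le> 1"
    and conv: "\<And>p. p < rk \<Longrightarrow> conv_open absv (\<Sum>Pp\<in>FPk k. fps_const (x Pp) * snd (snd Pp) k p) r"
    and Pp: "Pp \<in> FPk k" "x Pp \<noteq> 0"
  shows "r \<le> fst (snd Pp)"
proof -
  have "\<forall>p<rk. conv_open absv (\<Sum>m<rk. fps_const (x (mkP k m)) * Y k m p) r"
    using conv sum_FPk[OF k, of "\<lambda>Pp y. fps_const (x Pp) * y _"] by simp
  then have *: "\<forall>m\<in>{..<rk}. x (mkP k m) \<noteq> 0 \<longrightarrow> r \<le> rad k m"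
    using opt_basis_adapted[OF opt[OF k], unfolded adapted_def, THEN spec, of "\<lambda>m. x (mkP k m)"] r by blast
  obtain m where "m < rk" "Pp = mkP k m" using FPk_bij[OF k] Pp by (auto simp: bij_betw_def)
  then show ?thesis using * Pp by simp
qed

lemma FPk_reexp:
  assumes "Pp \<in> FPk k" "k < d" "k' < d" "absv (a k' - a k) < fst (snd Pp)"
  shows "Pp \<in> FPk k'" "snd (snd Pp) k' = reexp absv rk (snd (snd Pp) k) (a k' - a k)"
proof -
  obtain m where m: "m < rk" "Pp = mkP k m" using FPk_bij[OF assms(2)] assms(1) by (auto simp: bij_betw_def)
  then show "Pp \<in> FPk k'" using assms by (simp add: FPk_def odisc_def)
  show "snd (snd Pp) k' = reexp absv rk (snd (snd Pp) k) (a k' - a k)"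
    using m assms mkP_self[OF assms(2) m(1)] by (simp add: mkP_def odisc_def)
qed

lemma FPk_D:
  assumes "Pp \<in> FPk k" "k < d"
  shows "hor_on absv rk G (a k) (fst (snd Pp)) (snd (snd Pp) k)"
    "0 < fst (snd Pp)" "fst (snd Pp) \<le> 1" "fst Pp = odisc absv (a k) (fst (snd Pp))"
    "\<And>l. l \<ge> rk \<Longrightarrow> snd (snd Pp) k l = 0"
proof -
  obtain m where m: "m < rk" "Pp = mkP k m" using FPk_bij[OF assms(2)] assms(1) by (auto simp: bij_betw_def)
  show "hor_on absv rk G (a k) (fst (snd Pp)) (snd (snd Pp) k)" "0 < fst (snd Pp)" "fst (snd Pp) \<le> 1"
    "fst Pp = odisc absv (a k) (fst (snd Pp))" "\<And>l. l \<ge> rk \<Longrightarrow> snd (snd Pp) k l = 0"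
    using m assms Y_hor_on rad_pos rad_le_1 mkP_self Y_0 by simp_all
qed

subsection \<open>The horizontal elements attached to discs\<close>

abbreviation "UU \<equiv> UP absv cl d a Ch"

definition HB :: "('k set \<times> real \<times> (nat \<Rightarrow> nat \<Rightarrow> 'k fps)) \<Rightarrow> 'k set \<Rightarrow> nat \<Rightarrow> 'k fps" where
  "HB Pp U = Vr d rk V (vvec d rk a u Pp U)"

definition II :: "(('k set \<times> real \<times> (nat \<Rightarrow> nat \<Rightarrow> 'k fps)) \<times> 'k set) set" where
  "II = Sigma FP UU"

lemma FP_disc:
  assumes "Pp \<in> FP"
  obtains i where "i < d" "Pp \<in> FPk i" "fst Pp = odisc absv (a i) (fst (snd Pp))" "0 < fst (snd Pp)" "fst (snd Pp) \<le> 1"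
proof -
  obtain i j where ij: "i < d" "j < rk" "Pp = mkP i j" using assms by (auto simp: FP_eq)
  then have "Pp \<in> FPk i" using FPk_bij[OF ij(1)] by (auto simp: bij_betw_def)
  then show ?thesis using that[of i] ij(1) FPk_D by blast
qed

context
  fixes Pp assumes Pp: "Pp \<in> FP"
begin

lemma choice_Pp: "\<eta> \<in> BP absv cl d a Pp \<Longrightarrow> Ch Pp \<eta> \<subseteq> brs absv d a (fst \<eta>) (snd \<eta>) \<and>
    card (Ch Pp \<eta>) = card (brs absv d a (fst \<eta>) (snd \<eta>)) - 1"
  by (rule choice[OF Pp])

lemma UU_finite: "finite (UU Pp)"
  by (rule FP_disc[OF Pp]) (rule finite_UPs[where P = Pp and Ch = Ch, OF a_inj _ _ _ _ refl choice_Pp])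

lemma UU_card: "card (UU Pp) = card {k. k < d \<and> a k \<in> fst Pp}"
proof (rule FP_disc[OF Pp])
  fix i assume *: "i < d" "fst Pp = odisc absv (a i) (fst (snd Pp))" "0 < fst (snd Pp)" "fst (snd Pp) \<le> 1"
  from card_UPs[where P = Pp and Ch = Ch, OF a_inj *(1,3,4,2) refl choice_Pp] show ?thesis using *(2) by simp
qed

lemma UU_sub: "U \<in> UU Pp \<Longrightarrow> U \<subseteq> fst Pp"
proof (rule FP_disc[OF Pp])
  fix i assume U: "U \<in> UU Pp" and *: "i < d" "fst Pp = odisc absv (a i) (fst (snd Pp))" "0 < fst (snd Pp)" "fst (snd Pp) \<le> 1"
  from UPs_sub[where P = Pp and Ch = Ch, OF a_inj *(1,3,4,2) refl choice_Pp U] show ?thesis using *(2) by simp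
qed

lemma UU_min:
  assumes "U \<in> UU Pp"
  obtains k where "k < d" "a k \<in> U" "\<And>U'. U' \<in> UU Pp \<Longrightarrow> a k \<in> U' \<longleftrightarrow> U \<subseteq> U'"
proof (rule FP_disc[OF Pp])
  fix i assume *: "i < d" "fst Pp = odisc absv (a i) (fst (snd Pp))" "0 < fst (snd Pp)" "fst (snd Pp) \<le> 1"
  from tree_min[where P = Pp and Ch = Ch, OF a_inj *(1,3,4,2) refl choice_Pp assms] that show thesis by blast
qed

lemma UU_next:
  assumes "U \<in> UU Pp" "U \<noteq> fst Pp"
  obtains i \<rho> k where "i < d" "a i \<in> fst Pp" "0 < \<rho>" "\<rho> < fst (snd Pp)" "U = odisc absv (a i) \<rho>"
    "k < d" "absv (a k - a i) = \<rho>" "\<And>U'. U' \<in> UU Pp \<Longrightarrow> a k \<in> U' \<longleftrightarrow> U \<subset> U'"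
proof (rule FP_disc[OF Pp])
  fix i assume *: "i < d" "fst Pp = odisc absv (a i) (fst (snd Pp))" "0 < fst (snd Pp)" "fst (snd Pp) \<le> 1"
  have ne: "U \<noteq> odisc absv (a i) (fst (snd Pp))" using assms(2) *(2) by simp
  from tree_next[where P = Pp and Ch = Ch, OF a_inj *(1,3,4,2) refl choice_Pp assms(1) ne, folded *(2)] that
  show thesis by blast
qed

end

lemma UU_disc:
  assumes "Pp \<in> FP" "U \<in> UU Pp"
  obtains i r where "i < d" "Pp \<in> FPk i" "0 < r" "r \<le> fst (snd Pp)" "U = odisc absv (a i) r"
proof (cases "U = fst Pp")
  case True
  then show ?thesis using FP_disc[OF assms(1)] that by (metis order_refl)
next
  case False
  then obtain i \<rho> where "i < d" "a i \<in> fst Pp" "0 < \<rho>" "\<rho> < fst (snd Pp)" "U = odisc absv (a i) \<rho>"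
    using UU_next[OF assms False] by metis
  then show ?thesis using that[of i \<rho>] assms by (simp add: FPk_def)
qed

lemma II_finite: "finite II"
  unfolding II_def using finite_FP UU_finite by blast

text \<open>Both sides count incidences between pairs and fibre points: a pair has as many discs as
  fibre points, and each fibre point lies in the discs of \<open>rk\<close> pairs.\<close>

lemma II_card: "card II = rk * d"
proof -
  have "card II = (\<Sum>Pp\<in>FP. card {k. k < d \<and> a k \<in> fst Pp})"
    unfolding II_def using finite_FP UU_finite UU_card by (simp add: card_SigmaI)
  also have "\<dots> = (\<Sum>Pp\<in>FP. \<Sum>k<d. if a k \<in> fst Pp then 1 else 0)"
    by (intro sum.cong refl) (simp add: Collect_conj_eq lessThan_def[symmetric] flip: sum.inter_filter sum.inter_restrict)
  also have "\<dots> = (\<Sum>k<d. \<Sum>Pp\<in>FP. if a k \<in> fst Pp then 1 else 0)"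
    by (rule sum.swap)
  also have "\<dots> = (\<Sum>k<d. card (FPk k))"
    using finite_FP by (intro sum.cong refl) (simp add: FPk_def flip: sum.inter_filter)
  also have "\<dots> = (\<Sum>k<d. rk)"
    using bij_betw_same_card[OF FPk_bij] by (intro sum.cong refl) force
  finally show ?thesis by simp
qed

text \<open>Locally the constructed element is \<open>Y\<close> at the fibre points of
  \<open>U\<close> and zero elsewhere; independence and radii are studied through this
  description.\<close>

lemma fpart_HB:
  assumes k: "k < d"
  shows "fpart k (HB Pp U) c = (if c < rk \<and> a k \<in> U then snd (snd Pp) k c else 0)"
proof (cases "c < rk")
  case True
  have "fpart k (HB Pp U) c = fps_compose (vvec d rk a u Pp U (c * d + k)) (F k)"
    unfolding HB_def by (rule fpart_Vr[OF k True])
  then show ?thesis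
    using True k index_less[OF True k] compose_D_F[OF k] by (simp add: vvec_def flip: D_def)
qed (simp add: fpart_def[OF k])

text \<open>Convergence is the push-forward of \<open>Y\<close> from the disc, extended by zero; the
  equation holds because it holds at each fibre point separately.\<close>

lemma HB_hor_on:
  assumes Pp: "Pp \<in> FPk i" and i: "i < d" and r: "0 < r" "r \<le> fst (snd Pp)"
  shows "hor_on absv (rk * d) DM b (prof i r) (HB Pp (odisc absv (a i) r))"
  unfolding hor_on_def
proof (intro conjI allI impI)
  let ?U = "odisc absv (a i) r"
  fix p assume p: "p \<ge> rk * d"
  then show "HB Pp ?U p = 0" by (simp add: HB_def Vr_def)
next
  let ?U = "odisc absv (a i) r"
  note PD = FPk_D[OF Pp i]
  have r1: "r \<le> 1" using r PD by simp
  fix p assume p: "p < rk * d"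
  obtain c m where cm: "c < rk" "m < d" "p = c * d + m" using index_split[OF p] .
  have "HB Pp ?U p = coord m (\<lambda>j. vvec d rk a u Pp ?U (c * d + j))"
    using cm p by (simp add: HB_def Vr_def coord_def)
  also have "\<dots> = coord m (\<lambda>j. if absv (a j - a i) < r then pull (a i) j (snd (snd Pp) i c) else 0)"
    unfolding coord_def
  proof (intro sum.cong refl)
    fix j assume "j \<in> {..<d}"
    then have j: "j < d" by simp
    have "snd (snd Pp) j c = expand absv (snd (snd Pp) i c) (a j - a i)" if "absv (a j - a i) < r"
      using FPk_reexp(2)[OF Pp i j] that r cm by (simp add: reexp_def)
    then show "V m j * vvec d rk a u Pp ?U (c * d + j)
      = V m j * (if absv (a j - a i) < r then pull (a i) j (snd (snd Pp) i c) else 0)"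
      using j index_less[OF cm(1) j] by (simp add: vvec_def odisc_def pull_def flip: D_def)
  qed
  finally have eq: "HB Pp ?U p = coord m (\<lambda>j. if absv (a j - a i) < r then pull (a i) j (snd (snd Pp) i c) else 0)" .
  have "conv_open absv (snd (snd Pp) i c) r"
    using PD(1) cm r by (auto simp: hor_on_def intro: conv_open_mono)
  then show "conv_open absv (HB Pp ?U p) (prof i r)"
    unfolding eq using i r r1 cm by (intro pushforward)
  have "\<forall>k<d. \<forall>c<rk. fps_deriv (fpart k (HB Pp ?U) c) + (\<Sum>j<rk. expand absv (G c j) (a k) * fpart k (HB Pp ?U) j) = 0"
  proof (intro allI impI)
    fix k c assume k: "k < d" and c: "c < rk"
    show "fps_deriv (fpart k (HB Pp ?U) c) + (\<Sum>j<rk. expand absv (G c j) (a k) * fpart k (HB Pp ?U) j) = 0"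
    proof (cases "a k \<in> ?U")
      case True
      then have "Pp \<in> FPk k" using FPk_reexp(1)[OF Pp i k] r by (simp add: odisc_def)
      from FPk_D(1)[OF this k] show ?thesis using True c k by (simp add: hor_on_def fpart_HB)
    qed (use k in \<open>simp add: fpart_HB\<close>)
  qed
  then show "fps_deriv (HB Pp ?U p) + (\<Sum>q<rk * d. expand absv (DM p q) b * HB Pp ?U q) = 0"
    using horizontal_equation_iff[of "HB Pp ?U"] p by blast
qed

lemma HB_horizontal:
  assumes "Pp \<in> FP" "U \<in> UU Pp"
  shows "horizontal absv (rk * d) DM b (HB Pp U)"
proof -
  obtain i r where ir: "i < d" "Pp \<in> FPk i" "0 < r" "r \<le> fst (snd Pp)" "U = odisc absv (a i) r"
    using UU_disc[OF assms] .
  show ?thesis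
    unfolding ir(5) by (rule hor_on_horizontal[OF HB_hor_on[OF ir(2,1,3,4)] prof_pos[OF ir(1,3)]])
qed

text \<open>The coefficient with which the pair contributes at the fibre point \<open>a k\<close> to
  the combination with coefficients \<open>x\<close>.\<close>

definition gsum :: "(('k set \<times> real \<times> (nat \<Rightarrow> nat \<Rightarrow> 'k fps)) \<times> 'k set \<Rightarrow> 'k) \<Rightarrow>
    ('k set \<times> real \<times> (nat \<Rightarrow> nat \<Rightarrow> 'k fps)) \<Rightarrow> nat \<Rightarrow> 'k" where
  "gsum x Pp k = (\<Sum>U\<in>{U \<in> UU Pp. a k \<in> U}. x (Pp, U))"

definition comb :: "(('k set \<times> real \<times> (nat \<Rightarrow> nat \<Rightarrow> 'k fps)) \<times> 'k set \<Rightarrow> 'k) \<Rightarrow> nat \<Rightarrow> 'k fps" where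
  "comb x p = (\<Sum>j\<in>II. fps_const (x j) * HB (fst j) (snd j) p)"

lemma fpart_comb:
  assumes k: "k < d" and c: "c < rk"
  shows "fpart k (comb x) c = (\<Sum>Pp\<in>FPk k. fps_const (gsum x Pp k) * snd (snd Pp) k c)"
proof -
  have "vals k (comb x) c = (\<Sum>j\<in>II. fps_const (x j) * vals k (HB (fst j) (snd j)) c)"
    unfolding vals_def[OF k] comb_def sum_distrib_right sum_distrib_left
    by (subst sum.swap) (simp add: mult.assoc)
  then have "fpart k (comb x) c = (\<Sum>j\<in>II. fps_const (x j) * fpart k (HB (fst j) (snd j)) c)"
    using k c by (simp add: fpart_def fps_compose_sum_distrib fps_compose_mult_distrib)
  also have "\<dots> = (\<Sum>Pp\<in>FP. \<Sum>U\<in>UU Pp. fps_const (x (Pp, U)) * fpart k (HB Pp U) c)"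
    unfolding II_def using finite_FP UU_finite by (subst sum.Sigma) (auto simp: split_def)
  also have "\<dots> = (\<Sum>Pp\<in>FP. fps_const (gsum x Pp k) * snd (snd Pp) k c)"
  proof (intro sum.cong refl)
    fix Pp assume Pp: "Pp \<in> FP"
    have "(\<Sum>U\<in>UU Pp. fps_const (x (Pp, U)) * fpart k (HB Pp U) c)
       = (\<Sum>U\<in>{U \<in> UU Pp. a k \<in> U}. fps_const (x (Pp, U)) * snd (snd Pp) k c)"
      using UU_finite[OF Pp] c k by (intro sum.mono_neutral_cong_right) (auto simp: fpart_HB)
    then show "(\<Sum>U\<in>UU Pp. fps_const (x (Pp, U)) * fpart k (HB Pp U) c) = fps_const (gsum x Pp k) * snd (snd Pp) k c"
      by (simp add: gsum_def fps_const_sum sum_distrib_right)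
  qed
  also have "\<dots> = (\<Sum>Pp\<in>FPk k. fps_const (gsum x Pp k) * snd (snd Pp) k c)"
  proof (rule sum.mono_neutral_right[OF finite_FP])
    show "\<forall>Pp\<in>FP - FPk k. fps_const (gsum x Pp k) * snd (snd Pp) k c = 0"
    proof
      fix Pp assume Pp: "Pp \<in> FP - FPk k"
      then have "{U \<in> UU Pp. a k \<in> U} = {}" using UU_sub[of Pp] unfolding FPk_def by blast
      then have "gsum x Pp k = 0" unfolding gsum_def by (simp only: sum.empty)
      then show "fps_const (gsum x Pp k) * snd (snd Pp) k c = 0" by simp
    qed
  qed (auto simp: FPk_def)
  finally show ?thesis .
qed

lemma gsum_min:
  assumes "Pp \<in> FP" "U \<in> UU Pp"
  obtains k where "k < d" "a k \<in> U" "gsum x Pp k = (\<Sum>U'\<in>{U' \<in> UU Pp. U \<subseteq> U'}. x (Pp, U'))"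
proof -
  obtain k where k: "k < d" "a k \<in> U" "\<And>U'. U' \<in> UU Pp \<Longrightarrow> a k \<in> U' \<longleftrightarrow> U \<subseteq> U'"
    using UU_min[OF assms] by metis
  have "{U' \<in> UU Pp. a k \<in> U'} = {U' \<in> UU Pp. U \<subseteq> U'}" using k(3) by auto
  then show ?thesis using that[of k] k by (simp add: gsum_def)
qed

lemma sum_supersets:
  assumes "Pp \<in> FP" "U \<in> UU Pp"
  shows "(\<Sum>U'\<in>{U' \<in> UU Pp. U \<subseteq> U'}. x (Pp, U')) = x (Pp, U) + (\<Sum>U'\<in>{U' \<in> UU Pp. U \<subset> U'}. x (Pp, U'))"
proof -
  have "{U' \<in> UU Pp. U \<subseteq> U'} = insert U {U' \<in> UU Pp. U \<subset> U'}" using assms by auto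
  then show ?thesis using UU_finite[OF assms(1)] by simp
qed

text \<open>The coefficient of \<open>U\<close> is the difference of \<open>gsum\<close> at the
  points of \<open>UU_min\<close> and \<open>UU_next\<close>: the first lies in \<open>U\<close> and
  its strict supersets, the second only in the strict supersets. For the full disc the second sum is
  empty.\<close>

lemma gsum_zero:
  assumes Pp: "Pp \<in> FP" and U: "U \<in> UU Pp" and z: "\<And>k. k < d \<Longrightarrow> a k \<in> fst Pp \<Longrightarrow> gsum x Pp k = 0"
  shows "x (Pp, U) = 0"
proof -
  obtain k where k: "k < d" "a k \<in> U" "gsum x Pp k = (\<Sum>U'\<in>{U' \<in> UU Pp. U \<subseteq> U'}. x (Pp, U'))"
    using gsum_min[OF Pp U] .
  have "a k \<in> fst Pp" using k UU_sub[OF Pp U] by blast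
  then have s: "x (Pp, U) + (\<Sum>U'\<in>{U' \<in> UU Pp. U \<subset> U'}. x (Pp, U')) = 0"
    using z[OF k(1)] k(3) sum_supersets[OF Pp U, of x] by simp
  show ?thesis
  proof (cases "U = fst Pp")
    case True
    then have "{U' \<in> UU Pp. U \<subset> U'} = {}" using UU_sub[OF Pp] by blast
    then show ?thesis using s by (simp only: sum.empty) simp
  next
    case False
    obtain i \<rho> k1 where k1: "a i \<in> fst Pp" "i < d" "\<rho> < fst (snd Pp)" "k1 < d" "absv (a k1 - a i) = \<rho>"
      "\<And>U'. U' \<in> UU Pp \<Longrightarrow> a k1 \<in> U' \<longleftrightarrow> U \<subset> U'"
      using UU_next[OF Pp U False] by metis
    have "Pp \<in> FPk i" using Pp k1 by (simp add: FPk_def)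
    then have "a k1 \<in> fst Pp" using FPk_reexp(1)[of Pp i k1] k1 by (simp add: FPk_def)
    then have "gsum x Pp k1 = 0" using z k1 by simp
    moreover have "{U' \<in> UU Pp. a k1 \<in> U'} = {U' \<in> UU Pp. U \<subset> U'}" using k1(6) by auto
    ultimately show ?thesis using s by (simp add: gsum_def)
  qed
qed

lemma HB_indep: "klin_indep (rk * d) II (\<lambda>j. HB (fst j) (snd j))"
  unfolding klin_indep_def
proof (intro allI impI ballI)
  fix x j assume z: "\<forall>p<rk * d. (\<Sum>j\<in>II. fps_const (x j) * HB (fst j) (snd j) p) = 0" and j: "j \<in> II"
  obtain Pp U where PU: "j = (Pp, U)" "Pp \<in> FP" "U \<in> UU Pp" using j by (auto simp: II_def)
  have "gsum x Pp k = 0" if k: "k < d" "a k \<in> fst Pp" for k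
  proof -
    have "(\<Sum>Pp\<in>FPk k. fps_const (gsum x Pp k) * snd (snd Pp) k c) = 0" if c: "c < rk" for c
    proof -
      have "vals k (comb x) c = 0"
        unfolding vals_def[OF k(1)] comb_def using z index_less[OF c] by (intro sum.neutral) auto
      then have "fpart k (comb x) c = 0" using k c by (simp add: fpart_def)
      then show ?thesis using fpart_comb[OF k(1) c] by simp
    qed
    then have "\<forall>Pp\<in>FPk k. gsum x Pp k = 0"
      using FPk_indep[OF k(1), unfolded klin_indep_def, THEN spec, of "\<lambda>Pp. gsum x Pp k"] by simp
    moreover have "Pp \<in> FPk k" using PU k by (simp add: FPk_def)
    ultimately show ?thesis by blast
  qed
  then show "x j = 0" using gsum_zero[OF PU(2,3)] PU(1) by simp
qed

lemma comb_hor_on: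
  assumes \<rho>: "0 < \<rho>" "\<rho> \<le> 1" and conv: "\<And>p. p < rk * d \<Longrightarrow> conv_open absv (comb x p) \<rho>"
  shows "hor_on absv (rk * d) DM b \<rho> (comb x)"
proof -
  define s where "s = Min (insert 1 ((\<lambda>j. Radv absv (rk * d) (HB (fst j) (snd j))) ` II))"
  have hor: "horizontal absv (rk * d) DM b (HB (fst j) (snd j))" if "j \<in> II" for j
    using that HB_horizontal by (auto simp: II_def)
  have s: "0 < s" "s \<le> 1" "\<And>j. j \<in> II \<Longrightarrow> s \<le> Radv absv (rk * d) (HB (fst j) (snd j))"
    using II_finite horizontal_Radv_pos[OF hor] by (auto simp: s_def)
  have "hor_on absv (rk * d) DM b s (comb x)"
    unfolding comb_def using s hor by (intro hor_on_sum) (simp_all add: hor_on_Radv_iff)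
  then show ?thesis
    using s(1) \<rho> conv by (intro horizontal_hor_on) (auto intro: hor_on_horizontal)
qed

text \<open>The coefficient at \<open>U\<close> is the difference of the sums \<open>gsum\<close> at two fibre points lying in
  the same component of the preimage of the disc on which the combination converges; analytic
  continuation from one point to the other shows that these sums agree.\<close>

lemma gsum_constant:
  assumes \<rho>: "0 < \<rho>" "\<rho> \<le> 1" and conv: "\<And>p. p < rk * d \<Longrightarrow> conv_open absv (comb x p) \<rho>"
    and k: "k < d" and k1: "k1 < d" and s: "0 < s" "s \<le> 1" "prof k s = \<rho>" "absv (a k1 - a k) < s"
    and Pp: "Pp \<in> FPk k" "s \<le> fst (snd Pp)"
  shows "gsum x Pp k = gsum x Pp k1"
proof -
  have hor: "hor_on absv (rk * d) DM b (prof k s) (comb x)"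
    using comb_hor_on[OF \<rho> conv] s(3) by simp
  have "prof k1 s = \<rho>" using prof_cong[OF k1 k, of s] s by simp
  then have hor1: "hor_on absv (rk * d) DM b (prof k1 s) (comb x)" using hor s(3) by simp
  define S where "S = {Pp \<in> FPk k. s \<le> fst (snd Pp)}"
  \<comment> \<open>Adaptedness at a fibre point forces every pair with nonzero coefficient to
    converge on the disc of radius \<open>s\<close>, so only pairs in \<open>S\<close>
    contribute.\<close>
  have big: "s \<le> fst (snd Pp)" if i: "i < d" "prof i s = \<rho>" and Q: "Pp \<in> FPk i" "gsum x Pp i \<noteq> 0" for i Pp
  proof (rule FPk_adapted[OF i(1) s(1,2) _ Q(1), of "\<lambda>Pp. gsum x Pp i"])
    fix p assume p: "p < rk"
    note p
    moreover have "hor_on absv rk G (a i) s (fpart i (comb x))"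
      using hor s(3) i by (intro hor_on_fpart[OF _ i(1) s(1,2)]) simp
    ultimately have "conv_open absv (fpart i (comb x) p) s" by (simp add: hor_on_def)
    then show "conv_open absv (\<Sum>Pp\<in>FPk i. fps_const (gsum x Pp i) * snd (snd Pp) i p) s"
      by (simp only: fpart_comb[OF i(1) p])
  qed (rule Q(2))
  have S1: "S = {Pp \<in> FPk k1. s \<le> fst (snd Pp)}"
    using FPk_reexp(1)[of _ k k1] FPk_reexp(1)[of _ k1 k] k k1 s(4) absv_minus_commute[of "a k" "a k1"]
    by (fastforce simp: S_def)
  have finS: "finite S" "finite (FPk k)" "finite (FPk k1)" using finite_FP by (auto simp: S_def FPk_def)
  have at: "fpart i (comb x) c = (\<Sum>Pp\<in>S. fps_const (gsum x Pp i) * snd (snd Pp) i c)"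
    if "c < rk" "i = k \<or> i = k1" for i c
  proof -
    have i: "i < d" "prof i s = \<rho>" "S = {Pp \<in> FPk i. s \<le> fst (snd Pp)}" "finite (FPk i)"
      using that k k1 s(3) \<open>prof k1 s = \<rho>\<close> S1 finS by (auto simp: S_def)
    show ?thesis
      unfolding fpart_comb[OF i(1) that(1)]
      using big[OF i(1,2)] i(4) by (intro sum.mono_neutral_right) (auto simp: i(3))
  qed
  \<comment> \<open>Continuation from \<open>k\<close> to \<open>k1\<close> expresses the local part
    at \<open>k1\<close> with the coefficients of \<open>k\<close>; independence at
    \<open>k1\<close> then compares coefficients.\<close>
  have "(\<Sum>Pp\<in>S. fps_const (gsum x Pp k - gsum x Pp k1) * snd (snd Pp) k1 c) = 0" if c: "c < rk" for c
  proof -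
    have "fpart k1 (comb x) c = expand absv (fpart k (comb x) c) (a k1 - a k)"
      using fun_cong[OF reexp_fpart[OF hor k s(1,2) k1 s(4)], of c] c by (simp add: reexp_def)
    also have "fpart k (comb x) c = (\<Sum>Pp\<in>S. fps_const (gsum x Pp k) * snd (snd Pp) k c)"
      using at[OF c] by simp
    also have "expand absv \<dots> (a k1 - a k) = (\<Sum>Pp\<in>S. fps_const (gsum x Pp k) * snd (snd Pp) k1 c)"
    proof -
      define r where "r = (absv (a k1 - a k) + s) / 2"
      have r: "0 < r" "absv (a k1 - a k) \<le> r" "r < s"
        using s add_nonneg_pos[OF absv_nonneg[of "a k1 - a k"] s(1)] by (auto simp: r_def)
      have t: "tate r (snd (snd Pp) k c)" if "Pp \<in> S" for Pp
      proof -
        have "conv_open absv (snd (snd Pp) k c) s"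
          using FPk_D(1)[of Pp k] that k c by (auto simp: S_def hor_on_def intro: conv_open_mono)
        then show ?thesis using r s by (simp add: conv_open_iff)
      qed
      have "expand absv (\<Sum>Pp\<in>S. fps_const (gsum x Pp k) * snd (snd Pp) k c) (a k1 - a k)
        = (\<Sum>Pp\<in>S. expand absv (fps_const (gsum x Pp k) * snd (snd Pp) k c) (a k1 - a k))"
        using t by (intro expand_sum[OF r(1,2)] tate_cmult)
      also have "\<dots> = (\<Sum>Pp\<in>S. fps_const (gsum x Pp k) * snd (snd Pp) k1 c)"
      proof (intro sum.cong refl)
        fix Pp assume Pp: "Pp \<in> S"
        have "snd (snd Pp) k1 c = expand absv (snd (snd Pp) k c) (a k1 - a k)"
          using FPk_reexp(2)[of Pp k k1] Pp k k1 s(4) c by (auto simp: S_def reexp_def)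
        then show "expand absv (fps_const (gsum x Pp k) * snd (snd Pp) k c) (a k1 - a k) = fps_const (gsum x Pp k) * snd (snd Pp) k1 c"
          using expand_cmult[OF r(1,2) t[OF Pp]] by simp
      qed
      finally show ?thesis .
    qed
    finally have "(\<Sum>Pp\<in>S. fps_const (gsum x Pp k1) * snd (snd Pp) k1 c) = (\<Sum>Pp\<in>S. fps_const (gsum x Pp k) * snd (snd Pp) k1 c)"
      using at[OF c, of k1] by simp
    then show ?thesis by (simp add: left_diff_distrib sum_subtractf flip: fps_const_sub)
  qed
  then have zero: "\<forall>p<rk. (\<Sum>Pp\<in>S. fps_const (gsum x Pp k - gsum x Pp k1) * snd (snd Pp) k1 p) = 0"
    by (intro allI impI)
  have "klin_indep rk S (\<lambda>Pp. snd (snd Pp) k1)"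
    using klin_indep_subset[OF FPk_indep[OF k1] _ finS(3), of S] S1 by blast
  then have "\<forall>Pp\<in>S. gsum x Pp k - gsum x Pp k1 = 0"
    using zero unfolding klin_indep_def
    by (elim allE[of _ "\<lambda>Pp. gsum x Pp k - gsum x Pp k1"] mp)
  moreover have "Pp \<in> S" using Pp by (simp add: S_def)
  ultimately have "gsum x Pp k - gsum x Pp k1 = 0" by (rule bspec)
  then show ?thesis by simp
qed

text \<open>Let \<open>s\<close> be the radius of the disc around \<open>a i\<close> with image
  radius \<rho>. If the pair has radius below \<open>s\<close>, adaptedness at the fibre points
  annihilates it; otherwise the two points isolating the coefficient of \<open>U\<close> are closer
  than \<open>s\<close>, and \<open>gsum_constant\<close> makes it zero.\<close>

lemma comb_adapted:
  assumes \<rho>: "0 < \<rho>" "\<rho> \<le> 1" and conv: "\<And>p. p < rk * d \<Longrightarrow> conv_open absv (comb x p) \<rho>"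
    and PU: "Pp \<in> FP" "U \<in> UU Pp" "x (Pp, U) \<noteq> 0"
    and ir: "i < d" "0 < r" "r \<le> 1" "U = odisc absv (a i) r"
  shows "\<rho> \<le> prof i r"
proof (rule ccontr)
  assume less: "\<not> \<rho> \<le> prof i r"
  obtain s where s: "0 < s" "s \<le> 1" "prof i s = \<rho>" using prof_surj[OF ir(1) \<rho>] by blast
  have rs: "r < s" using less s ir prof_less_iff[OF ir(1), of r s] by simp
  have iP: "Pp \<in> FPk i" using UU_sub[OF PU(1,2)] odisc_self[OF ir(2), of "a i"] ir(4) PU(1) by (auto simp: FPk_def)
  have fP: "fst Pp = odisc absv (a i) (fst (snd Pp))" "0 < fst (snd Pp)" "fst (snd Pp) \<le> 1"
    using FPk_D[OF iP ir(1)] by auto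
  have sk: "prof k s = \<rho>" if "k < d" "absv (a k - a i) < s" for k
    using prof_cong[OF that(1) ir(1), of s] that s by simp
  show False
  proof (cases "s \<le> fst (snd Pp)")
    case False
    have "gsum x Pp k = 0" if k: "k < d" "a k \<in> fst Pp" for k
    proof (rule ccontr)
      assume nz: "gsum x Pp k \<noteq> 0"
      have "absv (a k - a i) < s" using k(2) fP(1) False by (auto simp: odisc_def)
      then have pk: "prof k s = \<rho>" using sk k by simp
      have kP: "Pp \<in> FPk k" using PU k by (simp add: FPk_def)
      have "hor_on absv rk G (a k) s (fpart k (comb x))"
        using comb_hor_on[OF \<rho> conv] pk by (intro hor_on_fpart[OF _ k(1) s(1,2)]) simp
      then have "conv_open absv (fpart k (comb x) p) s" if "p < rk" for p
        using that by (simp add: hor_on_def)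
      then have "conv_open absv (\<Sum>Pp\<in>FPk k. fps_const (gsum x Pp k) * snd (snd Pp) k p) s" if "p < rk" for p
        using that by (simp only: fpart_comb[OF k(1) that, symmetric])
      then have "s \<le> fst (snd Pp)" using FPk_adapted[OF k(1) s(1,2) _ kP, of "\<lambda>Pp. gsum x Pp k"] nz by blast
      then show False using False by simp
    qed
    then show False using gsum_zero[OF PU(1,2)] PU(3) by blast
  next
    case True
    \<comment> \<open>The full disc of the pair has radius at least \<open>s\<close>, whereas
      \<open>r < s\<close>; hence \<open>U\<close> is a chosen branch and \<open>UU_next\<close>
      applies.\<close>
    have "U \<noteq> fst Pp"
    proof
      assume "U = fst Pp"
      then have "r = fst (snd Pp)" using odisc_eq_radius(1)[of "a i" r "a i" "fst (snd Pp)"] ir fP by simp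
      then show False using rs True by simp
    qed
    then obtain i' \<rho>' k1 where n: "i' < d" "0 < \<rho>'" "\<rho>' < fst (snd Pp)" "U = odisc absv (a i') \<rho>'"
      "k1 < d" "absv (a k1 - a i') = \<rho>'" "\<And>U'. U' \<in> UU Pp \<Longrightarrow> a k1 \<in> U' \<longleftrightarrow> U \<subset> U'"
      using UU_next[OF PU(1,2)] by metis
    have "\<rho>' = r" "absv (a i' - a i) < r"
      using odisc_eq_radius[of "a i'" \<rho>' "a i" r] n ir fP(3) by auto
    obtain k where k: "k < d" "a k \<in> U" "gsum x Pp k = (\<Sum>U'\<in>{U' \<in> UU Pp. U \<subseteq> U'}. x (Pp, U'))"
      using gsum_min[OF PU(1,2)] .
    have ki: "absv (a k - a i) < r" using k ir by (simp add: odisc_def)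
    have k1i: "absv (a k1 - a i) \<le> r"
      using absv_ultra[of "a k1" "a i" "a i'"] n \<open>\<rho>' = r\<close> \<open>absv (a i' - a i) < r\<close> by auto
    have kk1: "absv (a k1 - a k) < s"
      using absv_ultra[of "a k1" "a k" "a i"] ki k1i rs absv_minus_commute[of "a k" "a i"] by auto
    have kP: "Pp \<in> FPk k" using UU_sub[OF PU(1,2)] k PU by (auto simp: FPk_def)
    have "gsum x Pp k = gsum x Pp k1"
      using gsum_constant[OF \<rho> conv k(1) n(5) s(1,2) _ kk1 kP True] sk[OF k(1)] ki rs by simp
    moreover have "{U' \<in> UU Pp. a k1 \<in> U'} = {U' \<in> UU Pp. U \<subset> U'}" using n(7) by auto
    ultimately have "(\<Sum>U'\<in>{U' \<in> UU Pp. U \<subseteq> U'}. x (Pp, U')) = (\<Sum>U'\<in>{U' \<in> UU Pp. U \<subset> U'}. x (Pp, U'))"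
      using k(3) by (simp add: gsum_def)
    then show False using sum_supersets[OF PU(1,2), of x] PU(3) by simp
  qed
qed

text \<open>Convergence on the image disc comes from the construction; that it stops there is
  \<open>comb_adapted\<close> for the combination with the single coefficient 1.\<close>

lemma HB_Radv:
  assumes PU: "Pp \<in> FP" "U \<in> UU Pp" and i: "i < d" and r: "0 < r" "r \<le> 1" and U: "U = odisc absv (a i) r"
  shows "Radv absv (rk * d) (HB Pp U) = prof i r"
proof (rule antisym)
  obtain i' r' where ir: "i' < d" "Pp \<in> FPk i'" "0 < r'" "r' \<le> fst (snd Pp)" "U = odisc absv (a i') r'"
    using UU_disc[OF PU] .
  have r'1: "r' \<le> 1" using ir(4) FPk_D(3)[OF ir(2,1)] by simp
  have "r' = r" "absv (a i' - a i) < r'" using odisc_eq_radius[of "a i'" r' "a i" r] ir r U r'1 by auto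
  then have pr: "prof i' r' = prof i r" using prof_cong[OF ir(1) i, of r] by simp
  have hor: "horizontal absv (rk * d) DM b (HB Pp U)" using HB_horizontal PU by simp
  have "hor_on absv (rk * d) DM b (prof i r) (HB Pp U)"
    using HB_hor_on[OF ir(2,1,3,4)] ir(5) pr by simp
  then show "prof i r \<le> Radv absv (rk * d) (HB Pp U)"
    using hor_on_Radv_iff[OF hor prof_pos[OF i r(1)]] prof_le_1[OF i _ r(2)] r(1) by simp
  define \<rho> where "\<rho> = Radv absv (rk * d) (HB Pp U)"
  have \<rho>: "0 < \<rho>" "\<rho> \<le> 1" using horizontal_Radv_pos[OF hor] Radv_bounds by (auto simp: \<rho>_def)
  define x where "x j = (if j = (Pp, U) then 1 else 0 :: 'k)" for j
  have "comb x p = HB Pp U p" for p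
  proof -
    have "comb x p = (\<Sum>j\<in>{(Pp, U)}. fps_const (x j) * HB (fst j) (snd j) p)"
      unfolding comb_def using II_finite PU by (intro sum.mono_neutral_right) (auto simp: II_def x_def)
    then show ?thesis by (simp add: x_def)
  qed
  then have "conv_open absv (comb x p) \<rho>" if "p < rk * d" for p
    using Radv_ge_iff[OF \<rho>, of "rk * d" "HB Pp U"] that by (simp add: \<rho>_def)
  from comb_adapted[OF \<rho> this PU _ i r U] show "Radv absv (rk * d) (HB Pp U) \<le> prof i r"
    by (simp add: x_def \<rho>_def)
qed

lemma HB_Radv_Sup:
  assumes "Pp \<in> FP" "U \<in> UU Pp"
  shows "Radv absv (rk * d) (HB Pp U) = Sup ((\<lambda>x. absv (evalk absv f x - b)) ` U)"
proof -
  obtain i r where ir: "i < d" "Pp \<in> FPk i" "0 < r" "r \<le> fst (snd Pp)" "U = odisc absv (a i) r"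
    using UU_disc[OF assms] .
  have r1: "r \<le> 1" using ir(4) FPk_D(3)[OF ir(2,1)] by simp
  show ?thesis
    unfolding HB_Radv[OF assms ir(1,3) r1 ir(5)] unfolding ir(5) by (rule Sup_image[OF ir(1,3) r1, symmetric])
qed

text \<open>The count \<open>rk * d\<close> and independence give spanning,
  \<open>comb_adapted\<close> gives adaptedness, and \<open>opt_basisI\<close> turns these into
  optimality.\<close>

theorem HB_opt_basis: "opt_basis absv (rk * d) DM b II (\<lambda>j. HB (fst j) (snd j))"
proof (rule opt_basisI[OF II_finite II_card _ HB_indep])
  show hor: "horizontal absv (rk * d) DM b (HB (fst j) (snd j))" if "j \<in> II" for j
    using that HB_horizontal by (auto simp: II_def)
  show "adapted (rk * d) II (\<lambda>j. HB (fst j) (snd j))"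
    unfolding adapted_def
  proof (intro allI impI ballI, elim conjE)
    fix x \<rho> j assume \<rho>: "0 < \<rho>" "\<rho> \<le> 1"
      and conv: "\<forall>p<rk * d. conv_open absv (\<Sum>j\<in>II. fps_const (x j) * HB (fst j) (snd j) p) \<rho>"
      and j: "j \<in> II" "x j \<noteq> 0"
    obtain Pp U where PU: "j = (Pp, U)" "Pp \<in> FP" "U \<in> UU Pp" using j by (auto simp: II_def)
    obtain i r where ir: "i < d" "Pp \<in> FPk i" "0 < r" "r \<le> fst (snd Pp)" "U = odisc absv (a i) r"
      using UU_disc[OF PU(2,3)] .
    have r1: "r \<le> 1" using ir(4) FPk_D(3)[OF ir(2,1)] by simp
    have "\<rho> \<le> prof i r"
      using comb_adapted[OF \<rho> _ PU(2,3) _ ir(1,3) r1 ir(5), of x] conv j(2) PU(1) by (simp add: comb_def)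
    then show "\<rho> \<le> Radv absv (rk * d) (HB (fst j) (snd j))"
      using HB_Radv[OF PU(2,3) ir(1,3) r1 ir(5)] PU(1) by simp
  qed
  show "\<exists>x. \<forall>p<rk * d. Z p = (\<Sum>j\<in>II. fps_const (x j) * HB (fst j) (snd j) p)"
    if "horizontal absv (rk * d) DM b Z" for Z
    by (rule horizontal_span_if_card[OF II_finite II_card hor HB_indep that])
qed

end

theorem theorem4p11:
  fixes absv :: "'k::field_char_0 \<Rightarrow> real" and cl :: bool and d rk :: nat
    and f :: "'k fps" and P :: "'k fps poly" and b :: 'k and a :: "nat \<Rightarrow> 'k"
    and u :: "nat \<Rightarrow> 'k fps" and V :: "nat \<Rightarrow> nat \<Rightarrow> 'k fps"
    and G :: "nat \<Rightarrow> nat \<Rightarrow> 'k fps" and Y :: "nat \<Rightarrow> nat \<Rightarrow> nat \<Rightarrow> 'k fps"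
    and Ch :: "('k set \<times> real \<times> (nat \<Rightarrow> nat \<Rightarrow> 'k fps)) \<Rightarrow> ('k set \<times> real) \<Rightarrow> 'k set set"
  assumes field: "nonarch_padic_field absv"
    and phi: "fin_etale absv cl d f"
    and P_deg: "degree P = d" and P_monic: "lead_coeff P = 1"
    and P_coeffs: "\<forall>j. coeff P j \<in> Oring absv cl"
    and P_root: "(\<Sum>j\<le>d. acomp absv (coeff P j) f * fps_X ^ j) = 0"
    and b: "b \<in> udisc absv cl"
    and a_inj: "inj_on a {..<d}"
    and a_fibre: "a ` {..<d} = {x \<in> udisc absv cl. evalk absv f x = b}"
    and u_def: "\<forall>i<d. fps_nth (u i) 0 = a i \<and>
                   (\<Sum>j\<le>d. expand absv (coeff P j) b * (u i) ^ j) = 0"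
    and V_right: "\<forall>i<d. \<forall>j<d. (\<Sum>l<d. (u i) ^ l * V l j) = (if i = j then 1 else 0)"
    and V_left: "\<forall>i<d. \<forall>j<d. (\<Sum>l<d. V i l * (u l) ^ j) = (if i = j then 1 else 0)"
    and G_an: "\<forall>i<rk. \<forall>j<rk. G i j \<in> Oring absv cl"
    and opt: "\<forall>i<d. opt_basis absv rk G (a i) {..<rk} (Y i)"
    and sorted: "\<forall>i<d. \<forall>j. Suc j < rk \<longrightarrow> Radv absv rk (Y i j) \<le> Radv absv rk (Y i (Suc j))"
    and linked: "\<forall>i<d. \<forall>j<rk. \<forall>k<d. absv (a k - a i) < Radv absv rk (Y i j) \<longrightarrow>
                   (\<exists>m<rk. reexp absv rk (Y i j) (a k - a i) = Y k m)"
    and choice: "\<forall>Pp\<in>fund_pairs absv d rk a Y. \<forall>\<eta>\<in>BP absv cl d a Pp.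
                   Ch Pp \<eta> \<subseteq> brs absv d a (fst \<eta>) (snd \<eta>) \<and>
                   card (Ch Pp \<eta>) = card (brs absv d a (fst \<eta>) (snd \<eta>)) - 1"
  shows "(\<forall>Pp\<in>fund_pairs absv d rk a Y. \<forall>U\<in>UP absv cl d a Ch Pp.
            horizontal absv (rk * d) (dimg_mat absv cl d f G) b (Vr d rk V (vvec d rk a u Pp U)) \<and>
            Radv absv (rk * d) (Vr d rk V (vvec d rk a u Pp U))
              = Sup ((\<lambda>x. absv (evalk absv f x - b)) ` U)) \<and>
         opt_basis absv (rk * d) (dimg_mat absv cl d f G) b
            (Sigma (fund_pairs absv d rk a Y) (UP absv cl d a Ch))
            (\<lambda>(Pp, U). Vr d rk V (vvec d rk a u Pp U))"
proof -
  interpret linked_bases absv cl d f b a P u V rk G Y Ch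
  proof unfold_locales
    show "nonarch_padic_field absv" "fin_etale absv cl d f" "b \<in> udisc absv cl" "inj_on a {..<d}"
      "a ` {..<d} = {x \<in> udisc absv cl. evalk absv f x = b}" "degree P = d" "lead_coeff P = 1"
      "(\<Sum>j\<le>d. acomp absv (coeff P j) f * fps_X ^ j) = 0"
      by (fact field phi b a_inj a_fibre P_deg P_monic P_root)+
    show "coeff P j \<in> Oring absv cl" for j
      by (rule P_coeffs[rule_format])
    show "u i $ 0 = a i \<and> (\<Sum>j\<le>d. expand absv (coeff P j) b * u i ^ j) = 0" if "i < d" for i
      by (rule u_def[rule_format, OF that])
    show "(\<Sum>l<d. u i ^ l * V l j) = (if i = j then 1 else 0)" if "i < d" "j < d" for i j
      by (rule V_right[rule_format, OF that])
    show "(\<Sum>l<d. V i l * u l ^ j) = (if i = j then 1 else 0)" if "i < d" "j < d" for i j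
      by (rule V_left[rule_format, OF that])
    show "G i j \<in> Oring absv cl" if "i < rk" "j < rk" for i j
      by (rule G_an[rule_format, OF that])
    show "opt_basis absv rk G (a i) {..<rk} (Y i)" if "i < d" for i
      by (rule opt[rule_format, OF that])
    show "\<exists>m<rk. reexp absv rk (Y i j) (a k - a i) = Y k m"
      if "i < d" "j < rk" "k < d" "absv (a k - a i) < Radv absv rk (Y i j)" for i j k
      by (rule linked[rule_format, OF that])
    show "Ch Pp \<eta> \<subseteq> brs absv d a (fst \<eta>) (snd \<eta>) \<and>
        card (Ch Pp \<eta>) = card (brs absv d a (fst \<eta>) (snd \<eta>)) - 1"
      if "Pp \<in> fund_pairs absv d rk a Y" "\<eta> \<in> BP absv cl d a Pp" for Pp \<eta>
      by (rule bspec[OF bspec[OF choice that(1)] that(2)])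
  qed
  have "(\<lambda>(Pp, U). Vr d rk V (vvec d rk a u Pp U)) = (\<lambda>j. HB (fst j) (snd j))"
    by (auto simp: HB_def)
  then show ?thesis
    using HB_horizontal HB_Radv_Sup HB_opt_basis unfolding HB_def II_def by simp
qed

end
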